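(* Let $n\ge1$. For each $1\le i\le n$, the open relativistic Toda Hamiltonian $H_i\in\mathbb{C}[x_1^{\pm1},\dots,x_{2n}^{\pm1}]$ is an element of the generic basis associated with the quiver with potential $(Q_n,W_n)$.
   Context: **The quiver with potential.** $Q_n$ has vertices $1,\dots,2n$ and arrows: two arrows $a_i,b_i:2i-1\to 2i$ for $1\le i\le n$; $\ell_i:2i\to 2i-3$ for $2\le i\le n$; $r_i:2i\to 2i+1$ for $1\le i\le n-1$. Paths are composed right to left. $W_n=\sum_{i=1}^{n-1}(a_i\ell_{i+1}b_{i+1}r_i-b_i\ell_{i+1}a_{i+1}r_i)$. The Jacobian algebra $J=J(Q_n,W_n)$ is the completed path algebra modulo the closed ideal generated by the cyclic derivatives of $W_n$ (it is finite-dimensional). Modules are finite-dimensional left $J$-modules; $I_v$ is the injective envelope of the simple module at $v$. Let $Q_{ij}$ be the number of arrows $i\to j$ minus the number of arrows $j\to i$, and $y_i=\prod_jx_j^{Q_{ij}}$. **Generic basis.** For $g\in\mathbb{Z}^{2n}$ consider the vector space $\mathrm{Hom}_J\big(\bigoplus_jI_j^{\oplus[g_j]_+},\bigoplus_jI_j^{\oplus[-g_j]_+}\big)$, where $[m]_+=\max(m,0)$. There is a dense open subset of this space on which the Laurent polynomial $$X_f=\prod_jx_j^{-g_j}\sum_{e\in\mathbb{N}^{2n}}\chi(\mathrm{Gr}_e(\ker f))\,y^e$$ does not depend on $f$; denote this common value by $X_g$. Here $\mathrm{Gr}_e$ is the quiver Grassmannian of subrepresentations of dimension vector $e$, and $\chi$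 is the topological Euler characteristic. The generic basis is the set $\{X_g:g\in\mathbb{Z}^{2n}\}$, i.e. the set of cluster characters of generic representations of each possible (co)index. **The Hamiltonians.** The open relativistic Toda Hamiltonians are the restrictions to $SL_{n+1}^{c,c}/\mathrm{Ad}\,H$ ($c=s_1\cdots s_n$) of the characters of $\bigwedge^k\mathbb{C}^{n+1}$, $1\le k\le n$. In cluster coordinates they are $$H_k=(x_{2n-1}x_{2n}^{-1})^k\,\mathrm{tr}\textstyle\bigwedge^k(g'),\qquad g'=E_1d_1(y_1)F_1d_1(y_2)E_2d_2(y_3)F_2d_2(y_4)\cdots E_nd_n(y_{2n-1})F_nd_n(y_{2n}),$$ where $E_i$ (resp. $F_i$) is the $(n+1)\times(n+1)$ identity matrix plus the matrix unit in position $(i,i+1)$ (resp. $(i+1,i)$), $d_i(y)=\mathrm{diag}(y,\dots,y,1,\dots,1)$ with $i$ entries $y$, and $y_i=\prod_jx_j^{Q_{ij}}$. *)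

theory Defs
  imports
    "HOL-Homology.Homology"
    "HOL-Algebra.QuotRing"
    "HOL-Library.Poly_Mapping"
    "Graph_Theory.Arc_Walk"
    "Jordan_Normal_Form.Matrix_Kernel"
    "Jordan_Normal_Form.DL_Submatrix"
begin

hide_const (open) Multiset.mult

section \<open>Completed path algebras and Jacobian algebras\<close>

text \<open>A quiver is a multi-digraph in the sense of \<open>Graph_Theory\<close>. A path is a pair of its source
  and its list of arrows, the arrow traversed first coming first in the list. Hence
  the path written \<open>a\<^sub>k \<dots> a\<^sub>1\<close> in right-to-left notation has the list \<open>[a\<^sub>1, \<dots>, a\<^sub>k]\<close>, and in a
  product \<open>x \<cdot> y\<close> the factor \<open>y\<close> is traversed first.\<close>

type_synonym ('v, 'e) path = "'v \<times> 'e list"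

definition paths :: "('v, 'e) pre_digraph \<Rightarrow> ('v, 'e) path set" where
  "paths G = {(u, p). \<exists>v. pre_digraph.awalk G u p v}"

definition path_end :: "('v, 'e) pre_digraph \<Rightarrow> ('v, 'e) path \<Rightarrow> 'v" where
  "path_end G = (\<lambda>(u, p). last (pre_digraph.awalk_verts G u p))"

text \<open>Elements are arbitrary families of coefficients indexed by the paths, i.e. infinite formal
  linear combinations of paths.\<close>

definition completed_path_algebra ::
  "('v, 'e) pre_digraph \<Rightarrow> (('v, 'e) path \<Rightarrow> complex) ring" where
  "completed_path_algebra G = \<lparr>
     carrier = {x. \<forall>w. w \<notin> paths G \<longrightarrow> x w = 0},
     mult = (\<lambda>x y (u, p). \<Sum>i\<le>length p.
       x (path_end G (u, take i p), drop i p) * y (u, take i p)),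
     one = (\<lambda>(u, p). if u \<in> verts G \<and> p = [] then 1 else 0),
     zero = (\<lambda>_. 0),
     add = (\<lambda>x y w. x w + y w) \<rparr>"

definition path_elem :: "('v, 'e) path \<Rightarrow> ('v, 'e) path \<Rightarrow> complex" where
  "path_elem w = (\<lambda>w'. if w' = w then 1 else 0)"

text \<open>The cyclic derivative sends a cycle \<open>a\<^sub>1 \<dots> a\<^sub>d\<close> to the sum over all \<open>j\<close> with \<open>a\<^sub>j = a\<close> of
  \<open>a\<^bsub>j+1\<^esub> \<dots> a\<^sub>d a\<^sub>1 \<dots> a\<^bsub>j-1\<^esub>\<close>. So the coefficient at a path \<open>p\<close> collects the
  coefficients of the cycles \<open>c\<^sub>1, a, c\<^sub>2\<close> for all decompositions of \<open>p\<close> as \<open>c\<^sub>2\<close> followed by \<open>c\<^sub>1\<close>.\<close>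

definition cyclic_derivative ::
  "('v, 'e) pre_digraph \<Rightarrow> 'e \<Rightarrow> (('v, 'e) path \<Rightarrow> complex) \<Rightarrow> ('v, 'e) path \<Rightarrow> complex" where
  "cyclic_derivative G a x = (\<lambda>(u, p). if u = head G a then
     (\<Sum>i\<le>length p. x (path_end G (u, take i p), drop i p @ a # take i p)) else 0)"

text \<open>The closure is taken in the adic topology of the arrow ideal.\<close>

definition closed_ideal ::
  "('v, 'e) pre_digraph \<Rightarrow> (('v, 'e) path \<Rightarrow> complex) set \<Rightarrow> (('v, 'e) path \<Rightarrow> complex) set" where
  "closed_ideal G S = {x \<in> carrier (completed_path_algebra G).
     \<forall>k. \<exists>y \<in> genideal (completed_path_algebra G) S. \<forall>u p. length p < k \<longrightarrow> x (u, p) = y (u, p)}"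

definition jacobian_ideal ::
  "('v, 'e) pre_digraph \<Rightarrow> (('v, 'e) path \<Rightarrow> complex) \<Rightarrow> (('v, 'e) path \<Rightarrow> complex) set" where
  "jacobian_ideal G W = closed_ideal G ((\<lambda>a. cyclic_derivative G a W) ` arcs G)"

definition jacobian_algebra ::
  "('v, 'e) pre_digraph \<Rightarrow> (('v, 'e) path \<Rightarrow> complex) \<Rightarrow> (('v, 'e) path \<Rightarrow> complex) set ring" where
  "jacobian_algebra G W = completed_path_algebra G Quot jacobian_ideal G W"

definition jacobian_class ::
  "('v, 'e) pre_digraph \<Rightarrow> (('v, 'e) path \<Rightarrow> complex) \<Rightarrow> (('v, 'e) path \<Rightarrow> complex)
    \<Rightarrow> (('v, 'e) path \<Rightarrow> complex) set" where
  "jacobian_class G W x = jacobian_ideal G W +>\<^bsub>completed_path_algebra G\<^esub> x"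


section \<open>Finite-dimensional modules\<close>

text \<open>A finite-dimensional left module is a vector space \<open>\<complex>\<^sup>d\<close> together with a homomorphism of unital
  \<open>\<complex>\<close>-algebras to the \<open>d \<times> d\<close> matrices, which act on column vectors from the left.\<close>

record 'a fd_module =
  mdim :: nat
  act :: "'a \<Rightarrow> complex mat"

type_synonym ('v, 'e) jmod = "(('v, 'e) path \<Rightarrow> complex) set fd_module"

locale quiver_with_potential =
  fixes G :: "('v, 'e) pre_digraph" and W :: "('v, 'e) path \<Rightarrow> complex"
begin

abbreviation J where "J \<equiv> jacobian_algebra G W"

abbreviation idem :: "'v \<Rightarrow> (('v, 'e) path \<Rightarrow> complex) set" where
  "idem v \<equiv> jacobian_class G W (path_elem (v, []))"

abbreviation arrow :: "'e \<Rightarrow> (('v, 'e) path \<Rightarrow> complex) set" where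
  "arrow a \<equiv> jacobian_class G W (path_elem (tail G a, [a]))"

definition is_module :: "('v, 'e) jmod \<Rightarrow> bool" where
  "is_module M \<longleftrightarrow> act M \<in> Ring.ring_hom J (ring_mat TYPE(complex) (mdim M) ()) \<and>
     (\<forall>c. act M (jacobian_class G W (\<lambda>w. c * \<one>\<^bsub>completed_path_algebra G\<^esub> w))
            = c \<cdot>\<^sub>m 1\<^sub>m (mdim M))"

definition Hom :: "('v, 'e) jmod \<Rightarrow> ('v, 'e) jmod \<Rightarrow> complex mat set" where
  "Hom M N = {f \<in> carrier_mat (mdim N) (mdim M). \<forall>x \<in> carrier J. f * act M x = act N x * f}"

definition is_mono :: "('v, 'e) jmod \<Rightarrow> ('v, 'e) jmod \<Rightarrow> complex mat \<Rightarrow> bool" where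
  "is_mono M N f \<longleftrightarrow> f \<in> Hom M N \<and> inj_on (\<lambda>v. f *\<^sub>v v) (carrier_vec (mdim M))"

definition is_submodule :: "('v, 'e) jmod \<Rightarrow> complex vec set \<Rightarrow> bool" where
  "is_submodule M N \<longleftrightarrow>
     VectorSpace.subspace class_ring N (module_vec TYPE(complex) (mdim M)) \<and>
     (\<forall>x \<in> carrier J. \<forall>v \<in> N. act M x *\<^sub>v v \<in> N)"

definition is_injective :: "('v, 'e) jmod \<Rightarrow> bool" where
  "is_injective E \<longleftrightarrow> is_module E \<and>
     (\<forall>M N f h. is_module M \<and> is_module N \<and> is_mono M N f \<and> h \<in> Hom M E
        \<longrightarrow> (\<exists>h' \<in> Hom N E. h' * f = h))"

definition is_simple_at :: "'v \<Rightarrow> ('v, 'e) jmod \<Rightarrow> bool" where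
  "is_simple_at v S \<longleftrightarrow> is_module S \<and> mdim S = 1 \<and> act S (idem v) = 1\<^sub>m 1 \<and>
     (\<forall>a \<in> arcs G. act S (arrow a) = 0\<^sub>m 1 1)"

definition is_injective_envelope :: "('v, 'e) jmod \<Rightarrow> ('v, 'e) jmod \<Rightarrow> bool" where
  "is_injective_envelope S E \<longleftrightarrow> is_injective E \<and>
     (\<exists>f. is_mono S E f \<and>
       (\<forall>N. is_submodule E N \<and> N \<noteq> {0\<^sub>v (mdim E)}
          \<longrightarrow> N \<inter> (\<lambda>v. f *\<^sub>v v) ` carrier_vec (mdim S) \<noteq> {0\<^sub>v (mdim E)}))"

definition dsum :: "('v, 'e) jmod list \<Rightarrow> ('v, 'e) jmod" where
  "dsum Ms = \<lparr> mdim = sum_list (map mdim Ms),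
               act = (\<lambda>x. diag_block_mat (map (\<lambda>M. act M x) Ms)) \<rparr>"

definition dimension_at :: "('v, 'e) jmod \<Rightarrow> complex vec set \<Rightarrow> 'v \<Rightarrow> nat" where
  "dimension_at M N v = vectorspace.dim class_ring
     ((module_vec TYPE(complex) (mdim M))
       \<lparr>carrier := (\<lambda>x. act M (idem v) *\<^sub>v x) ` N\<rparr>)"

end


section \<open>Grassmannians and Euler characteristics\<close>

definition quotient_topology :: "'a topology \<Rightarrow> ('a \<Rightarrow> 'b) \<Rightarrow> 'b topology" where
  "quotient_topology X q = topology (\<lambda>U. U \<subseteq> q ` topspace X \<and>
     openin X {x \<in> topspace X. q x \<in> U})"

definition frames :: "nat \<Rightarrow> nat \<Rightarrow> complex mat set" where
  "frames k d = {A \<in> carrier_mat d k. inj_on (\<lambda>v. A *\<^sub>v v) (carrier_vec k)}"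

definition frame_topology :: "nat \<Rightarrow> nat \<Rightarrow> complex mat topology" where
  "frame_topology k d = pullback_topology (frames k d)
     (\<lambda>A. \<lambda>ij \<in> {..<d} \<times> {..<k}. A $$ ij)
     (product_topology (\<lambda>_. euclidean) ({..<d} \<times> {..<k}))"

text \<open>The space of \<open>k\<close>-dimensional subspaces of \<open>\<complex>\<^sup>d\<close> in the analytic topology, as the quotient of the
  space of \<open>k\<close>-frames by the map taking a frame to its span.\<close>

definition grassmannian :: "nat \<Rightarrow> nat \<Rightarrow> complex vec set topology" where
  "grassmannian k d =
     quotient_topology (frame_topology k d) (\<lambda>A. (\<lambda>v. A *\<^sub>v v) ` carrier_vec k)"

text \<open>Linear independence over the integers in an abelian group, written multiplicatively.\<close>

definition int_independent :: "('a, 'b) monoid_scheme \<Rightarrow> 'a set \<Rightarrow> bool" where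
  "int_independent A B \<longleftrightarrow> finite B \<and> B \<subseteq> carrier A \<and>
     (\<forall>c :: 'a \<Rightarrow> int. finprod A (\<lambda>b. b [^]\<^bsub>A\<^esub> c b) B = \<one>\<^bsub>A\<^esub> \<longrightarrow> (\<forall>b \<in> B. c b = 0))"

definition abelian_rank :: "('a, 'b) monoid_scheme \<Rightarrow> nat" where
  "abelian_rank A = Sup {card B | B. int_independent A B}"

definition euler_characteristic :: "'a topology \<Rightarrow> int" where
  "euler_characteristic X =
     (\<Sum>p | abelian_rank (homology_group (int p) X) \<noteq> 0.
        (-1) ^ p * int (abelian_rank (homology_group (int p) X)))"

context quiver_with_potential
begin

text \<open>The Grassmannian of submodules of dimension vector \<open>e\<close> of a submodule \<open>K\<close> of \<open>M\<close>. A submodule is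
  the direct sum of its parts at the vertices, so this is a subspace of the Grassmannian of subspaces
  of dimension \<open>\<Sum>v. e v\<close>.\<close>

definition quiver_grassmannian ::
  "('v, 'e) jmod \<Rightarrow> complex vec set \<Rightarrow> ('v \<Rightarrow> nat) \<Rightarrow> complex vec set topology" where
  "quiver_grassmannian M K e = subtopology (grassmannian (\<Sum>v \<in> verts G. e v) (mdim M))
     {N. is_submodule M N \<and> N \<subseteq> K \<and> (\<forall>v \<in> verts G. dimension_at M N v = e v)}"

end


section \<open>Zariski topology\<close>

inductive_set polynomial_functions :: "nat \<Rightarrow> nat \<Rightarrow> (complex mat \<Rightarrow> complex) set"
  for r c :: nat where
  const: "(\<lambda>_. z) \<in> polynomial_functions r c"
| coord: "i < r \<Longrightarrow> j < c \<Longrightarrow> (\<lambda>A. A $$ (i, j)) \<in> polynomial_functions r c"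
| add: "p \<in> polynomial_functions r c \<Longrightarrow> q \<in> polynomial_functions r c
    \<Longrightarrow> (\<lambda>A. p A + q A) \<in> polynomial_functions r c"
| mult: "p \<in> polynomial_functions r c \<Longrightarrow> q \<in> polynomial_functions r c
    \<Longrightarrow> (\<lambda>A. p A * q A) \<in> polynomial_functions r c"

text \<open>The Zariski topology on a linear subspace \<open>V\<close> of the space of \<open>r \<times> c\<close> matrices.\<close>

definition zariski_topology :: "nat \<Rightarrow> nat \<Rightarrow> complex mat set \<Rightarrow> complex mat topology" where
  "zariski_topology r c V = topology (\<lambda>U. \<exists>P \<subseteq> polynomial_functions r c.
     U = {A \<in> V. \<exists>p \<in> P. p A \<noteq> 0})"


section \<open>Laurent polynomials\<close>

text \<open>Laurent polynomials over \<open>\<complex>\<close> in variables indexed by the natural numbers: finitely supported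
  functions on the exponents, with convolution as multiplication.\<close>

type_synonym laurent = "(nat \<Rightarrow>\<^sub>0 int) \<Rightarrow>\<^sub>0 complex"

definition xpow :: "nat \<Rightarrow> int \<Rightarrow> laurent" where
  "xpow j m = Poly_Mapping.single (Poly_Mapping.single j m) 1"


section \<open>The quiver with potential\<close>

datatype toda_arrow = A nat | B nat | L nat | R nat

fun toda_tail :: "toda_arrow \<Rightarrow> nat" where
  "toda_tail (A i) = 2 * i - 1"
| "toda_tail (B i) = 2 * i - 1"
| "toda_tail (L i) = 2 * i"
| "toda_tail (R i) = 2 * i"

fun toda_head :: "toda_arrow \<Rightarrow> nat" where
  "toda_head (A i) = 2 * i"
| "toda_head (B i) = 2 * i"
| "toda_head (L i) = 2 * i - 3"
| "toda_head (R i) = 2 * i + 1"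

definition toda_quiver :: "nat \<Rightarrow> (nat, toda_arrow) pre_digraph" where
  "toda_quiver n = \<lparr>
     verts = {1..2 * n},
     arcs = A ` {1..n} \<union> B ` {1..n} \<union> L ` {2..n} \<union> R ` {1..<n},
     tail = toda_tail,
     head = toda_head \<rparr>"

definition toda_potential :: "nat \<Rightarrow> (nat, toda_arrow) path \<Rightarrow> complex" where
  "toda_potential n = (\<lambda>w. \<Sum>i\<in>{1..<n}.
     path_elem (2 * i, [R i, B (i + 1), L (i + 1), A i]) w
     - path_elem (2 * i, [R i, A (i + 1), L (i + 1), B i]) w)"

definition exchange_entry :: "nat \<Rightarrow> nat \<Rightarrow> nat \<Rightarrow> int" where
  "exchange_entry n i j =
     int (card {a \<in> arcs (toda_quiver n). toda_tail a = i \<and> toda_head a = j})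
     - int (card {a \<in> arcs (toda_quiver n). toda_tail a = j \<and> toda_head a = i})"

definition yvar :: "nat \<Rightarrow> nat \<Rightarrow> laurent" where
  "yvar n i = (\<Prod>j\<in>{1..2 * n}. xpow j (exchange_entry n i j))"


section \<open>The generic basis\<close>

global_interpretation toda: quiver_with_potential "toda_quiver n" "toda_potential n" for n :: nat .

text \<open>The Laurent polynomial \<open>X\<^sub>f\<close> of a homomorphism \<open>f\<close> with domain \<open>M\<close>. The sum
  is restricted to the finitely many dimension vectors with a nonempty Grassmannian; the other
  summands vanish.\<close>

definition cluster_character ::
  "nat \<Rightarrow> (nat \<Rightarrow> int) \<Rightarrow> (nat, toda_arrow) jmod \<Rightarrow> complex mat \<Rightarrow> laurent" where
  "cluster_character n g M f =
     (\<Prod>j\<in>{1..2 * n}. xpow j (- g j)) *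
     (\<Sum>e \<in> {e \<in> {1..2 * n} \<rightarrow>\<^sub>E UNIV.
               topspace (toda.quiver_grassmannian n M (mat_kernel f) e) \<noteq> {}}.
        of_int (euler_characteristic (toda.quiver_grassmannian n M (mat_kernel f) e)) *
        (\<Prod>i\<in>{1..2 * n}. yvar n i ^ e i))"

text \<open>The coercion \<open>nat\<close> truncates negative integers, so \<open>nat m\<close> is \<open>[m]\<^sub>+\<close>.\<close>

definition injective_sum ::
  "nat \<Rightarrow> (nat \<Rightarrow> (nat, toda_arrow) jmod) \<Rightarrow> (nat \<Rightarrow> int) \<Rightarrow> (nat, toda_arrow) jmod" where
  "injective_sum n I g =
     toda.dsum (concat (map (\<lambda>j. replicate (nat (g j)) (I j)) [1..<2 * n + 1]))"

text \<open>\<open>X\<close> is the generic value of \<open>X\<^sub>f\<close> for \<open>g\<close>. Injective envelopes are unique up to isomorphism,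
  and any two dense open subsets of the space of homomorphisms meet, so neither the choice of the
  modules \<open>I v\<close> nor that of \<open>U\<close> affects \<open>X\<close>.\<close>

definition is_generic_character :: "nat \<Rightarrow> (nat \<Rightarrow> int) \<Rightarrow> laurent \<Rightarrow> bool" where
  "is_generic_character n g X \<longleftrightarrow>
     (\<exists>I. (\<forall>v \<in> {1..2 * n}. \<exists>S. toda.is_simple_at n v S \<and> toda.is_injective_envelope n S (I v)) \<and>
       (let M = injective_sum n I g; N = injective_sum n I (\<lambda>j. - g j);
            T = zariski_topology (mdim N) (mdim M) (toda.Hom n M N)
        in \<exists>U. openin T U \<and> T closure_of U = toda.Hom n M N \<and>
             (\<forall>f \<in> U. cluster_character n g M f = X)))"

definition generic_basis :: "nat \<Rightarrow> laurent set" where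
  "generic_basis n = {X. \<exists>g. is_generic_character n g X}"


section \<open>The relativistic Toda Hamiltonians\<close>

text \<open>Matrices are indexed from \<open>0\<close>, so position \<open>(i, i + 1)\<close> becomes \<open>(i - 1, i)\<close>.\<close>

definition E_mat :: "nat \<Rightarrow> nat \<Rightarrow> laurent mat" where
  "E_mat n i = mat (n + 1) (n + 1) (\<lambda>(r, c). if r = c \<or> (r = i - 1 \<and> c = i) then 1 else 0)"

definition F_mat :: "nat \<Rightarrow> nat \<Rightarrow> laurent mat" where
  "F_mat n i = mat (n + 1) (n + 1) (\<lambda>(r, c). if r = c \<or> (r = i \<and> c = i - 1) then 1 else 0)"

definition d_mat :: "nat \<Rightarrow> nat \<Rightarrow> laurent \<Rightarrow> laurent mat" where
  "d_mat n i y = mat (n + 1) (n + 1) (\<lambda>(r, c). if r = c then (if r < i then y else 1) else 0)"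

definition toda_matrix :: "nat \<Rightarrow> laurent mat" where
  "toda_matrix n = foldr (*)
     (map (\<lambda>i. E_mat n i * d_mat n i (yvar n (2 * i - 1)) * F_mat n i * d_mat n i (yvar n (2 * i)))
       [1..<n + 1])
     (1\<^sub>m (n + 1))"

text \<open>The matrix of \<open>\<And>\<^sup>k C\<close> in the basis \<open>e\<^bsub>s\<^sub>1\<^esub> \<and> \<dots> \<and> e\<^bsub>s\<^sub>k\<^esub>\<close>, \<open>s\<^sub>1 < \<dots> < s\<^sub>k\<close>, which is
  indexed by the sets with \<open>k\<close> elements: its entries are the minors of order \<open>k\<close> of \<open>C\<close>.\<close>

definition exterior_power_entry :: "'a :: comm_ring_1 mat \<Rightarrow> nat set \<Rightarrow> nat set \<Rightarrow> 'a" where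
  "exterior_power_entry C S T = det (submatrix C S T)"

definition trace_exterior_power :: "nat \<Rightarrow> 'a :: comm_ring_1 mat \<Rightarrow> 'a" where
  "trace_exterior_power k C =
     (\<Sum>S | S \<subseteq> {0..<dim_row C} \<and> card S = k. exterior_power_entry C S S)"

definition toda_hamiltonian :: "nat \<Rightarrow> nat \<Rightarrow> laurent" where
  "toda_hamiltonian n k =
     (xpow (2 * n - 1) 1 * xpow (2 * n) (- 1)) ^ k * trace_exterior_power k (toda_matrix n)"

end

theory Submission
  imports Defs
begin

text \<open>Let \<open>m = n + 1 - k\<close>. The Hamiltonian \<open>H\<^sub>k\<close> is the generic character whose only nonzero entries of \<open>g\<close>
  are \<open>1\<close> at \<open>2m\<close> and \<open>-1\<close> at \<open>2m - 1\<close>.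

  In the Jacobian algebra the letters \<open>a, b\<close> commute past each other at distance two, and so do \<open>l, r\<close>.
  Hence \<open>e\<^sub>v J\<close> has a basis of monomials indexed by the numbers of letters \<open>r, l, a, b\<close>, and \<open>I\<^sub>v\<close> is its dual.
  A homomorphism \<open>f : I\<^bsub>2m\<^esub> \<rightarrow> I\<^bsub>2m-1\<^esub>\<close> is generic if the coefficient of \<open>a\<^sub>m\<close> does not vanish; then the
  elements of the kernel are determined by their coefficients at monomials without \<open>a\<close>, and the
  cycles in the letters \<open>b, r, b, l\<close> act on each vertex space of the kernel as a single nilpotent Jordan
  block. A submodule of the kernel is thus determined by its dimension vector, so that every Grassmannian is empty
  or a point, and \<open>X\<^sub>f\<close> is a sum over dimension vectors given by linear inequalities.

  On the other side, the principal minors of the Toda matrix factor into contributions of the single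
  factors of the product, and expanding them gives the same sum.\<close>

text \<open>Call the vertices 2i - 1 and 2i column i. A generic \<open>f\<close> may have
  coefficients at many monomials besides a_m, and it is not brought to a normal form first. What
  replaces this is a triangularity: every other monomial in question contains r and l or is b_m, so
  the equations of the kernel can be solved for the values at monomials with a, by recursion on the
  pair of \<open>m\<close> minus the number of r and the number of a. The values at monomials
  without a are free coordinates.

  The bound on the monomials comes from idempotents: a word with too many r or l carries its
  idempotent beyond the first or last column, where it is zero.

  The truncated difference \<open>i - m\<close> has two roles. It is the number of letters l that a
  walk from column i to column m needs, and thereby the shift between the dimension vector at 2i and
  the number of elements of a subset below i. It also solves a second-difference equation with its
  source at m, by which the factor common to all monomials cancels the prefactor of the Hamiltonian
  up to x_(2m-1) / x_(2m). This cancellation at the last column forces m = n + 1 - k.\<close>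

section \<open>The completed path algebra as a ring\<close>

lemma path_end_Nil [simp]: "path_end G (u, []) = u"
  by (simp add: path_end_def pre_digraph.awalk_verts.simps)

lemma path_end_Cons [simp]: "path_end G (u, e # p) = path_end G (head G e, p)"
  by (simp add: path_end_def pre_digraph.awalk_verts.simps pre_digraph.awalk_verts_non_Nil)

lemma path_end_append: "path_end G (u, p @ q) = path_end G (path_end G (u, p), q)"
  by (induction p arbitrary: u) auto

lemma mult_cpa_Nil:
  "(x \<otimes>\<^bsub>completed_path_algebra G\<^esub> y) (u, []) = x (u, []) * y (u, [])"
  by (simp add: completed_path_algebra_def)

text \<open>The trivial initial segment gives the first summand. In every other splitting the right
  factor starts with \<open>e\<close>, so what remains is a product along \<open>p\<close> with
  \<open>y\<close> shifted by \<open>e\<close>. This turns statements about products into inductions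
  on the list of arrows.\<close>

lemma mult_cpa_Cons:
  "(x \<otimes>\<^bsub>completed_path_algebra G\<^esub> y) (u, e # p) = x (u, e # p) * y (u, []) +
     (x \<otimes>\<^bsub>completed_path_algebra G\<^esub> (\<lambda>(v, q). y (u, e # q))) (head G e, p)"
  by (simp add: completed_path_algebra_def sum.atMost_Suc_shift del: sum.atMost_Suc)

lemma add_cpa: "(x \<oplus>\<^bsub>completed_path_algebra G\<^esub> y) = (\<lambda>w. x w + y w)"
  and zero_cpa: "\<zero>\<^bsub>completed_path_algebra G\<^esub> = (\<lambda>_. 0)"
  and one_cpa: "\<one>\<^bsub>completed_path_algebra G\<^esub> = (\<lambda>(u, p). if u \<in> verts G \<and> p = [] then 1 else 0)"
  and carrier_cpa: "carrier (completed_path_algebra G) = {x. \<forall>w. w \<notin> paths G \<longrightarrow> x w = 0}"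
  by (simp_all add: completed_path_algebra_def)

lemma mult_cpa: "(x \<otimes>\<^bsub>completed_path_algebra G\<^esub> y) (u, p) =
    (\<Sum>i\<le>length p. x (path_end G (u, take i p), drop i p) * y (u, take i p))"
  by (simp add: completed_path_algebra_def)

text \<open>A coefficient of a product at \<open>p\<close> involves only coefficients at paths no
  longer than \<open>p\<close>: multiplication is continuous in the adic topology. Closed ideals
  rest on this.\<close>

lemma mult_cpa_cong:
  assumes "\<And>v q. length q \<le> length p \<Longrightarrow> x (v, q) = x' (v, q)"
    and "\<And>q. length q \<le> length p \<Longrightarrow> y (u, q) = y' (u, q)"
  shows "(x \<otimes>\<^bsub>completed_path_algebra G\<^esub> y) (u, p) = (x' \<otimes>\<^bsub>completed_path_algebra G\<^esub> y') (u, p)"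
  unfolding mult_cpa by (intro sum.cong refl) (simp add: assms)

lemma mult_cpa_add_right:
  "(x \<otimes>\<^bsub>completed_path_algebra G\<^esub> (\<lambda>w. y w + z w)) w =
     (x \<otimes>\<^bsub>completed_path_algebra G\<^esub> y) w + (x \<otimes>\<^bsub>completed_path_algebra G\<^esub> z) w"
  by (cases w) (simp add: mult_cpa sum.distrib algebra_simps)

lemma mult_cpa_add_left:
  "((\<lambda>w. y w + z w) \<otimes>\<^bsub>completed_path_algebra G\<^esub> x) w =
     (y \<otimes>\<^bsub>completed_path_algebra G\<^esub> x) w + (z \<otimes>\<^bsub>completed_path_algebra G\<^esub> x) w"
  by (cases w) (simp add: mult_cpa sum.distrib algebra_simps)

lemma mult_cpa_scale_right:
  "(x \<otimes>\<^bsub>completed_path_algebra G\<^esub> (\<lambda>w. y w * c)) w = (x \<otimes>\<^bsub>completed_path_algebra G\<^esub> y) w * c"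
  by (cases w) (simp add: mult_cpa sum_distrib_right mult.assoc)

lemma mult_cpa_assoc:
  "((x \<otimes>\<^bsub>completed_path_algebra G\<^esub> y) \<otimes>\<^bsub>completed_path_algebra G\<^esub> z) (u, p) =
     (x \<otimes>\<^bsub>completed_path_algebra G\<^esub> (y \<otimes>\<^bsub>completed_path_algebra G\<^esub> z)) (u, p)"
proof (induction p arbitrary: u z)
  case Nil
  then show ?case by (simp add: mult_cpa_Nil)
next
  case (Cons e p)
  let ?y = "\<lambda>(v, q). y (u, e # q)" and ?z = "\<lambda>(v, q). z (u, e # q)"
  \<comment> \<open>Shifting a product of \<open>y\<close> and \<open>z\<close> by \<open>e\<close>
    gives the product of \<open>y\<close> with the shifted \<open>z\<close>, plus the shifted
    \<open>y\<close> scaled by \<open>z (u, [])\<close>. This is why the induction hypothesis is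
    needed for all \<open>z\<close>.\<close>
  have "(x \<otimes>\<^bsub>completed_path_algebra G\<^esub> (\<lambda>(v, q). (y \<otimes>\<^bsub>completed_path_algebra G\<^esub> z) (u, e # q))) (head G e, p)
    = (x \<otimes>\<^bsub>completed_path_algebra G\<^esub> (\<lambda>w. ?y w * z (u, []) + (y \<otimes>\<^bsub>completed_path_algebra G\<^esub> ?z) w)) (head G e, p)"
    by (rule mult_cpa_cong) (auto simp: mult_cpa_Cons)
  then show ?case
    by (simp add: mult_cpa_Cons[of _ _ _ u e p] mult_cpa_Nil mult_cpa_add_right mult_cpa_scale_right
        Cons.IH[of ?z "head G e"] distrib_right add.assoc mult.assoc)
qed

context wf_digraph
begin

lemma path_Nil_iff [simp]: "(u, []) \<in> paths G \<longleftrightarrow> u \<in> verts G"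
  by (auto simp: paths_def awalk_Nil_iff)

lemma path_Cons_iff [simp]:
  "(u, e # p) \<in> paths G \<longleftrightarrow> e \<in> arcs G \<and> u = tail G e \<and> (head G e, p) \<in> paths G"
  by (auto simp: paths_def awalk_Cons_iff)

lemma path_end_in_verts: "(u, p) \<in> paths G \<Longrightarrow> path_end G (u, p) \<in> verts G"
  by (induction p arbitrary: u) auto

lemma path_append_iff:
  "(u, p @ q) \<in> paths G \<longleftrightarrow> (u, p) \<in> paths G \<and> (path_end G (u, p), q) \<in> paths G"
proof (induction p arbitrary: u)
  case Nil
  have "(u, q) \<in> paths G \<Longrightarrow> u \<in> verts G"
    by (cases q) auto
  then show ?case by auto
qed auto

lemma one_mult_cpa:
  assumes "x \<in> carrier (completed_path_algebra G)"
  shows "\<one>\<^bsub>completed_path_algebra G\<^esub> \<otimes>\<^bsub>completed_path_algebra G\<^esub> x = x"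
proof
  fix w show "(\<one>\<^bsub>completed_path_algebra G\<^esub> \<otimes>\<^bsub>completed_path_algebra G\<^esub> x) w = x w"
  proof (cases w)
    case (Pair u p)
    have "(\<one>\<^bsub>completed_path_algebra G\<^esub> \<otimes>\<^bsub>completed_path_algebra G\<^esub> x) (u, p) =
      (\<Sum>i\<le>length p. if i = length p then x (u, p) else 0)"
      unfolding mult_cpa
    proof (intro sum.cong refl)
      fix i assume "i \<in> {..length p}"
      then have "drop i p = [] \<longleftrightarrow> i = length p" by auto
      moreover have "x (u, p) \<noteq> 0 \<Longrightarrow> path_end G (u, p) \<in> verts G"
        using assms path_end_in_verts by (auto simp: carrier_cpa)
      ultimately show "\<one>\<^bsub>completed_path_algebra G\<^esub> (path_end G (u, take i p), drop i p) * x (u, take i p)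
          = (if i = length p then x (u, p) else 0)"
        by (auto simp: one_cpa)
    qed
    then show ?thesis using Pair by simp
  qed
qed

lemma mult_one_cpa:
  assumes "x \<in> carrier (completed_path_algebra G)"
  shows "x \<otimes>\<^bsub>completed_path_algebra G\<^esub> \<one>\<^bsub>completed_path_algebra G\<^esub> = x"
proof
  fix w show "(x \<otimes>\<^bsub>completed_path_algebra G\<^esub> \<one>\<^bsub>completed_path_algebra G\<^esub>) w = x w"
  proof (cases w)
    case (Pair u p)
    have "(x \<otimes>\<^bsub>completed_path_algebra G\<^esub> \<one>\<^bsub>completed_path_algebra G\<^esub>) (u, p) =
      (\<Sum>i\<le>length p. if i = 0 then x (u, p) else 0)"
      unfolding mult_cpa
    proof (intro sum.cong refl)
      fix i assume "i \<in> {..length p}"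
      then have "take i p = [] \<longleftrightarrow> i = 0" by auto
      moreover have "x (u, p) \<noteq> 0 \<Longrightarrow> u \<in> verts G"
        using assms path_append_iff[of u "[]" p] by (auto simp: carrier_cpa)
      ultimately show "x (path_end G (u, take i p), drop i p) * \<one>\<^bsub>completed_path_algebra G\<^esub> (u, take i p)
          = (if i = 0 then x (u, p) else 0)"
        by (auto simp: one_cpa)
    qed
    then show ?thesis using Pair by simp
  qed
qed

lemma mult_cpa_closed:
  assumes "x \<in> carrier (completed_path_algebra G)" "y \<in> carrier (completed_path_algebra G)"
  shows "x \<otimes>\<^bsub>completed_path_algebra G\<^esub> y \<in> carrier (completed_path_algebra G)"
  unfolding carrier_cpa
proof safe
  fix u p assume *: "(u, p) \<notin> paths G"
  have "x (path_end G (u, take i p), drop i p) * y (u, take i p) = 0" for i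
    using * path_append_iff[of u "take i p" "drop i p"] assms by (auto simp: carrier_cpa)
  then show "(x \<otimes>\<^bsub>completed_path_algebra G\<^esub> y) (u, p) = 0"
    unfolding mult_cpa by simp
qed

lemma ring_cpa: "ring (completed_path_algebra G)"
proof (rule ringI)
  show "abelian_group (completed_path_algebra G)"
  proof (rule abelian_groupI)
    fix x assume "x \<in> carrier (completed_path_algebra G)"
    then have "(\<lambda>w. - x w) \<in> carrier (completed_path_algebra G)" by (simp add: carrier_cpa)
    then show "\<exists>y\<in>carrier (completed_path_algebra G).
        y \<oplus>\<^bsub>completed_path_algebra G\<^esub> x = \<zero>\<^bsub>completed_path_algebra G\<^esub>"
      by (intro bexI[of _ "\<lambda>w. - x w"]) (auto simp: add_cpa zero_cpa)
  qed (auto simp: add_cpa zero_cpa carrier_cpa)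
  show "Group.monoid (completed_path_algebra G)"
  proof (rule monoidI)
    show "\<one>\<^bsub>completed_path_algebra G\<^esub> \<in> carrier (completed_path_algebra G)"
      by (auto simp: one_cpa carrier_cpa)
  qed (auto simp: mult_cpa_closed mult_one_cpa one_mult_cpa mult_cpa_assoc fun_eq_iff)
qed (auto simp: add_cpa mult_cpa_add_left mult_cpa_add_right)

lemma a_inv_cpa:
  assumes "x \<in> carrier (completed_path_algebra G)"
  shows "\<ominus>\<^bsub>completed_path_algebra G\<^esub> x = (\<lambda>w. - x w)"
proof -
  interpret R: ring "completed_path_algebra G" by (rule ring_cpa)
  show ?thesis
    using assms by (intro R.minus_equality) (auto simp: carrier_cpa add_cpa zero_cpa)
qed

lemma minus_cpa:
  assumes "x \<in> carrier (completed_path_algebra G)" "y \<in> carrier (completed_path_algebra G)"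
  shows "x \<ominus>\<^bsub>completed_path_algebra G\<^esub> y = (\<lambda>w. x w - y w)"
  using assms by (simp add: a_minus_def a_inv_cpa add_cpa)

lemma scale_cpa:
  assumes "x \<in> carrier (completed_path_algebra G)"
  shows "(\<lambda>w. c * \<one>\<^bsub>completed_path_algebra G\<^esub> w) \<otimes>\<^bsub>completed_path_algebra G\<^esub> x = (\<lambda>w. c * x w)"
proof
  fix w
  have "((\<lambda>w. c * \<one>\<^bsub>completed_path_algebra G\<^esub> w) \<otimes>\<^bsub>completed_path_algebra G\<^esub> x) w
      = c * (\<one>\<^bsub>completed_path_algebra G\<^esub> \<otimes>\<^bsub>completed_path_algebra G\<^esub> x) w"
    by (cases w) (simp add: mult_cpa sum_distrib_left algebra_simps)
  then show "((\<lambda>w. c * \<one>\<^bsub>completed_path_algebra G\<^esub> w) \<otimes>\<^bsub>completed_path_algebra G\<^esub> x) w = c * x w"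
    using assms by (simp add: one_mult_cpa)
qed

section \<open>Closed ideals in the adic topology\<close>

lemma closed_idealE:
  assumes "x \<in> closed_ideal G S"
  obtains y where "y \<in> genideal (completed_path_algebra G) S"
    and "\<And>u p. length p < k \<Longrightarrow> x (u, p) = y (u, p)"
  using assms unfolding closed_ideal_def by blast

text \<open>Approximants may be added and multiplied by a fixed element without loss of accuracy: by
  \<open>mult_cpa_cong\<close>, agreement in lengths below \<open>k\<close> survives multiplication
  from either side.\<close>

lemma ideal_closed_ideal:
  assumes "S \<subseteq> carrier (completed_path_algebra G)"
  shows "ideal (closed_ideal G S) (completed_path_algebra G)"
proof -
  let ?R = "completed_path_algebra G"
  interpret R: ring ?R by (rule ring_cpa)
  interpret I: ideal "genideal ?R S" ?R by (rule R.genideal_ideal[OF assms])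
  have sub: "genideal ?R S \<subseteq> carrier ?R" by auto
  show ?thesis
  proof (rule idealI[OF R.ring_axioms])
    show "subgroup (closed_ideal G S) (add_monoid ?R)"
    proof (rule R.add.subgroupI)
      show "closed_ideal G S \<subseteq> carrier ?R" by (auto simp: closed_ideal_def)
      have "\<zero>\<^bsub>?R\<^esub> \<in> closed_ideal G S" by (auto simp: closed_ideal_def)
      then show "closed_ideal G S \<noteq> {}" by auto
    next
      fix x assume x: "x \<in> closed_ideal G S"
      then have xc: "x \<in> carrier ?R" by (simp add: closed_ideal_def)
      show "\<ominus>\<^bsub>?R\<^esub> x \<in> closed_ideal G S"
        unfolding closed_ideal_def
      proof (intro CollectI conjI allI)
        fix k
        obtain y where y: "y \<in> genideal ?R S" "\<And>u p. length p < k \<Longrightarrow> x (u, p) = y (u, p)"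
          using closed_idealE[OF x, of k] by blast
        moreover from y(1) have "\<ominus>\<^bsub>?R\<^esub> y \<in> genideal ?R S"
          by (rule additive_subgroup.a_inv_closed[OF I.is_additive_subgroup])
        ultimately show "\<exists>y\<in>genideal ?R S. \<forall>u p. length p < k \<longrightarrow> (\<ominus>\<^bsub>?R\<^esub> x) (u, p) = y (u, p)"
          using xc sub by (intro bexI[of _ "\<ominus>\<^bsub>?R\<^esub> y"]) (simp_all add: a_inv_cpa subsetD)
      qed (use xc in auto)
    next
      fix x x' assume x: "x \<in> closed_ideal G S" and x': "x' \<in> closed_ideal G S"
      then have xc: "x \<in> carrier ?R" "x' \<in> carrier ?R" by (simp_all add: closed_ideal_def)
      show "x \<oplus>\<^bsub>?R\<^esub> x' \<in> closed_ideal G S"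
        unfolding closed_ideal_def
      proof (intro CollectI conjI allI)
        fix k
        obtain y y' where y: "y \<in> genideal ?R S" "\<And>u p. length p < k \<Longrightarrow> x (u, p) = y (u, p)"
            and y': "y' \<in> genideal ?R S" "\<And>u p. length p < k \<Longrightarrow> x' (u, p) = y' (u, p)"
          using closed_idealE[OF x, of k] closed_idealE[OF x', of k] by metis
        moreover from y(1) y'(1) have "y \<oplus>\<^bsub>?R\<^esub> y' \<in> genideal ?R S"
          by (rule additive_subgroup.a_closed[OF I.is_additive_subgroup])
        ultimately show "\<exists>y\<in>genideal ?R S. \<forall>u p. length p < k \<longrightarrow> (x \<oplus>\<^bsub>?R\<^esub> x') (u, p) = y (u, p)"
          by (intro bexI[of _ "y \<oplus>\<^bsub>?R\<^esub> y'"]) (simp_all add: add_cpa)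
      qed (use xc in auto)
    qed
  next
    fix x r assume x: "x \<in> closed_ideal G S" and r: "r \<in> carrier ?R"
    then have xc: "x \<in> carrier ?R" by (simp add: closed_ideal_def)
    show "r \<otimes>\<^bsub>?R\<^esub> x \<in> closed_ideal G S"
      unfolding closed_ideal_def
    proof (intro CollectI conjI allI)
      fix k
      obtain y where y: "y \<in> genideal ?R S" "\<And>u p. length p < k \<Longrightarrow> x (u, p) = y (u, p)"
        using closed_idealE[OF x, of k] by blast
      then show "\<exists>y\<in>genideal ?R S. \<forall>u p. length p < k \<longrightarrow> (r \<otimes>\<^bsub>?R\<^esub> x) (u, p) = y (u, p)"
        by (intro bexI[of _ "r \<otimes>\<^bsub>?R\<^esub> y"]) (auto intro!: mult_cpa_cong I.I_l_closed r)
    qed (use xc r in auto)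
    show "x \<otimes>\<^bsub>?R\<^esub> r \<in> closed_ideal G S"
      unfolding closed_ideal_def
    proof (intro CollectI conjI allI)
      fix k
      obtain y where y: "y \<in> genideal ?R S" "\<And>u p. length p < k \<Longrightarrow> x (u, p) = y (u, p)"
        using closed_idealE[OF x, of k] by blast
      then show "\<exists>y\<in>genideal ?R S. \<forall>u p. length p < k \<longrightarrow> (x \<otimes>\<^bsub>?R\<^esub> r) (u, p) = y (u, p)"
        by (intro bexI[of _ "y \<otimes>\<^bsub>?R\<^esub> r"]) (auto intro!: mult_cpa_cong I.I_r_closed r)
    qed (use xc r in auto)
  qed
qed

lemma subset_closed_ideal:
  assumes "S \<subseteq> carrier (completed_path_algebra G)"
  shows "S \<subseteq> closed_ideal G S"
proof -
  interpret R: ring "completed_path_algebra G" by (rule ring_cpa)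
  show ?thesis
    using R.genideal_self[OF assms] assms by (force simp: closed_ideal_def)
qed

text \<open>The closure is closed: an approximant from the closure is itself approximated to the
  same order by an element of the generated ideal.\<close>

lemma closed_idealI_approx:
  assumes S: "S \<subseteq> carrier (completed_path_algebra G)"
    and x: "x \<in> carrier (completed_path_algebra G)"
    and approx: "\<And>k. \<exists>y \<in> closed_ideal G S. \<forall>u p. length p < k \<longrightarrow> x (u, p) = y (u, p)"
  shows "x \<in> closed_ideal G S"
  unfolding closed_ideal_def
proof (intro CollectI conjI allI)
  fix k
  obtain y where y: "y \<in> closed_ideal G S" "\<forall>u p. length p < k \<longrightarrow> x (u, p) = y (u, p)"
    using approx by blast
  then obtain z where "z \<in> genideal (completed_path_algebra G) S" "\<And>u p. length p < k \<Longrightarrow> y (u, p) = z (u, p)"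
    using closed_idealE[of y S k] by blast
  with y show "\<exists>y\<in>genideal (completed_path_algebra G) S. \<forall>u p. length p < k \<longrightarrow> x (u, p) = y (u, p)"
    by (intro bexI[of _ z]) auto
qed (rule x)

text \<open>Scaling by \<open>c\<close> is left multiplication by \<open>c\<close> times the unit,
  so ideals are linear subspaces.\<close>

lemma ideal_cpa_sum:
  assumes "ideal I (completed_path_algebra G)" "finite F" "\<And>i. i \<in> F \<Longrightarrow> x i \<in> I"
  shows "(\<lambda>w. \<Sum>i\<in>F. c i * x i w) \<in> I"
proof -
  interpret I: ideal I "completed_path_algebra G" by fact
  have scale: "(\<lambda>w. c * y w) \<in> I" if "y \<in> I" for c y
    using I.I_l_closed[OF that, of "\<lambda>w. c * \<one>\<^bsub>completed_path_algebra G\<^esub> w"] that I.Icarr[OF that]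
    by (simp add: scale_cpa) (auto simp: carrier_cpa one_cpa)
  show ?thesis
    using assms(2,3)
  proof (induction F rule: finite_induct)
    case empty
    then show ?case using additive_subgroup.zero_closed[OF I.is_additive_subgroup] by (simp add: zero_cpa)
  next
    case (insert i F)
    then have "(\<lambda>w. c i * x i w) \<oplus>\<^bsub>completed_path_algebra G\<^esub> (\<lambda>w. \<Sum>i\<in>F. c i * x i w) \<in> I"
      by (intro additive_subgroup.a_closed[OF I.is_additive_subgroup] scale) auto
    then show ?case using insert by (simp add: add_cpa)
  qed
qed

end

context fin_digraph
begin

lemma finite_short_paths: "finite {(u, p). (u, p) \<in> paths G \<and> length p < k}"
proof (rule finite_subset)
  show "{(u, p). (u, p) \<in> paths G \<and> length p < k} \<subseteq> verts G \<times> {p. set p \<subseteq> arcs G \<and> length p \<le> k}"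
    by (auto simp: paths_def awalk_def)
  show "finite (verts G \<times> {p. set p \<subseteq> arcs G \<and> length p \<le> k})"
    by (intro finite_cartesian_product finite_verts finite_lists_length_le finite_arcs)
qed

text \<open>Truncated below length \<open>k\<close>, an element is a finite combination of paths,
  since a finite quiver has finitely many short paths. So it suffices that the paths of the support
  lie in the closed ideal.\<close>

lemma closed_idealI_paths:
  assumes S: "S \<subseteq> carrier (completed_path_algebra G)"
    and x: "x \<in> carrier (completed_path_algebra G)"
    and *: "\<And>w. w \<in> paths G \<Longrightarrow> x w \<noteq> 0 \<Longrightarrow> path_elem w \<in> closed_ideal G S"
  shows "x \<in> closed_ideal G S"
proof (rule closed_idealI_approx[OF S x])
  fix k
  let ?F = "{w \<in> {(u, p). (u, p) \<in> paths G \<and> length p < k}. x w \<noteq> 0}"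
  have "(\<lambda>v. \<Sum>w\<in>?F. x w * path_elem w v) \<in> closed_ideal G S"
    using * finite_short_paths[of k]
    by (intro ideal_cpa_sum ideal_closed_ideal[OF S]) auto
  moreover have "x (u, p) = (\<Sum>w\<in>?F. x w * path_elem w (u, p))" if "length p < k" for u p
  proof -
    have "(\<Sum>w\<in>?F. x w * path_elem w (u, p)) = (\<Sum>w\<in>?F. if w = (u, p) then x (u, p) else 0)"
      by (intro sum.cong) (auto simp: path_elem_def)
    also have "\<dots> = (if (u, p) \<in> ?F then x (u, p) else 0)"
      using finite_short_paths[of k] by (subst sum.delta) auto
    also have "\<dots> = x (u, p)"
      using that x by (auto simp: carrier_cpa)
    finally show ?thesis by simp
  qed
  ultimately show "\<exists>y\<in>closed_ideal G S. \<forall>u p. length p < k \<longrightarrow> x (u, p) = y (u, p)"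
    by (intro bexI[of _ "\<lambda>v. \<Sum>w\<in>?F. x w * path_elem w v"]) auto
qed

end

section \<open>Jacobian algebras and their modules\<close>

text \<open>\<open>W\<close> is an arbitrary function on pairs of a vertex and a list, so it has to
  be required that its derivatives are supported on paths.\<close>

locale jacobian_quiver = quiver_with_potential G W + fin_digraph G
  for G :: "('v, 'e) pre_digraph" and W :: "('v, 'e) path \<Rightarrow> complex" +
  assumes cyclic_derivative_closed:
    "a \<in> arcs G \<Longrightarrow> cyclic_derivative G a W \<in> carrier (completed_path_algebra G)"
begin

abbreviation "P \<equiv> completed_path_algebra G"
abbreviation "I \<equiv> jacobian_ideal G W"
abbreviation "cls \<equiv> jacobian_class G W"

lemma derivatives_closed: "(\<lambda>a. cyclic_derivative G a W) ` arcs G \<subseteq> carrier P"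
  using cyclic_derivative_closed by auto

lemma ideal_I: "ideal I P"
  unfolding jacobian_ideal_def by (rule ideal_closed_ideal[OF derivatives_closed])

sublocale P: ring P
  by (rule ring_cpa)

sublocale I: ideal I P
  by (rule ideal_I)

sublocale J: ring J
  unfolding jacobian_algebra_def by (rule I.quotient_is_ring)

lemma derivative_in_I: "a \<in> arcs G \<Longrightarrow> cyclic_derivative G a W \<in> I"
  unfolding jacobian_ideal_def using subset_closed_ideal[OF derivatives_closed] by auto

lemma cls_hom: "cls \<in> Ring.ring_hom P J"
proof -
  have "cls = (+>\<^bsub>P\<^esub>) I" by (simp add: jacobian_class_def fun_eq_iff)
  then show ?thesis unfolding jacobian_algebra_def using I.rcos_ring_hom by simp
qed

lemma cls_eq_iff:
  assumes "x \<in> carrier P" "y \<in> carrier P"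
  shows "cls x = cls y \<longleftrightarrow> (\<lambda>w. x w - y w) \<in> I"
  using P.quotient_eq_iff_same_a_r_cos[OF ideal_I assms] assms
  by (simp add: jacobian_class_def minus_cpa)

lemma J_carrierE:
  assumes "X \<in> carrier J"
  obtains x where "x \<in> carrier P" "X = cls x"
  using assms by (auto simp: jacobian_algebra_def FactRing_def A_RCOSETS_def' jacobian_class_def)

lemma path_elem_closed [simp]: "w \<in> paths G \<Longrightarrow> path_elem w \<in> carrier P"
  by (auto simp: carrier_cpa path_elem_def)

lemma scale_closed: "x \<in> carrier P \<Longrightarrow> (\<lambda>w. c * x w) \<in> carrier P"
  by (simp add: carrier_cpa)

text \<open>If all long paths lie in the ideal, an element is a finite combination of short paths
  modulo \<open>I\<close>. A property stable under sums then needs to be checked only on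
  \<open>I\<close> and on scaled paths, which is how statements about modules are reduced to
  paths.\<close>

lemma cpa_induct:
  assumes nilp: "\<And>w. w \<in> paths G \<Longrightarrow> length (snd w) \<ge> N \<Longrightarrow> path_elem w \<in> I"
    and x: "x \<in> carrier P"
    and I: "\<And>x. x \<in> I \<Longrightarrow> Q x"
    and add: "\<And>x y. x \<in> carrier P \<Longrightarrow> y \<in> carrier P \<Longrightarrow> Q x \<Longrightarrow> Q y \<Longrightarrow> Q (\<lambda>w. x w + y w)"
    and path: "\<And>c w. w \<in> paths G \<Longrightarrow> Q (\<lambda>v. c * path_elem w v)"
  shows "Q x"
proof -
  let ?F = "{(u, p). (u, p) \<in> paths G \<and> length p < N}"
  let ?y = "\<lambda>v. \<Sum>w\<in>?F. x w * path_elem w v" and ?z = "\<lambda>(u, p). if length p < N then 0 else x (u, p)"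
  have sum: "(\<lambda>v. \<Sum>w\<in>F. x w * path_elem w v) \<in> carrier P \<and> Q (\<lambda>v. \<Sum>w\<in>F. x w * path_elem w v)"
    if "finite F" "F \<subseteq> paths G" for F
    using that
  proof (induction F rule: finite_induct)
    case empty
    show ?case using I[OF additive_subgroup.zero_closed[OF I.is_additive_subgroup]]
      by (simp add: zero_cpa carrier_cpa)
  next
    case (insert w F)
    then have "Q (\<lambda>v. x w * path_elem w v)" "(\<lambda>v. x w * path_elem w v) \<in> carrier P"
      by (auto intro: path scale_closed)
    with insert show ?case
      using add[of "\<lambda>v. x w * path_elem w v" "\<lambda>v. \<Sum>w\<in>F. x w * path_elem w v"]
        P.a_closed[of "\<lambda>v. x w * path_elem w v" "\<lambda>v. \<Sum>w\<in>F. x w * path_elem w v"]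
      by (simp add: add_cpa)
  qed
  \<comment> \<open>The tail from length \<open>N\<close> on may have infinite support; it lies in
    \<open>I\<close> because \<open>I\<close> is closed.\<close>
  have z: "?z \<in> I"
    unfolding jacobian_ideal_def
  proof (rule closed_idealI_paths[OF derivatives_closed])
    show "?z \<in> carrier P" using x by (auto simp: carrier_cpa)
    fix w assume "w \<in> paths G" "?z w \<noteq> 0"
    then show "path_elem w \<in> closed_ideal G ((\<lambda>a. cyclic_derivative G a W) ` arcs G)"
      using nilp[of w] unfolding jacobian_ideal_def by (auto split: if_splits prod.splits)
  qed
  have "x = (\<lambda>w. ?y w + ?z w)"
  proof
    fix w
    have "?y w = (\<Sum>w'\<in>?F. if w' = w then x w else 0)"
      by (intro sum.cong) (auto simp: path_elem_def)
    also have "\<dots> = (if w \<in> ?F then x w else 0)"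
      using finite_short_paths[of N] by (subst sum.delta) auto
    finally show "x w = ?y w + ?z w"
      using x by (cases w) (auto simp: carrier_cpa)
  qed
  moreover have "Q (\<lambda>w. ?y w + ?z w)"
    using sum[OF finite_short_paths[of N]] I[OF z] z by (intro add) auto
  ultimately show ?thesis by simp
qed

text \<open>Two lifts of an element of the Jacobian algebra may differ, so the module is defined
  with a choice of lifts.\<close>

definition lift_module :: "nat \<Rightarrow> ((('v, 'e) path \<Rightarrow> complex) \<Rightarrow> complex mat) \<Rightarrow> ('v, 'e) jmod" where
  "lift_module d \<Psi> = \<lparr> mdim = d, act = (\<lambda>X. \<Psi> (SOME x. x \<in> carrier P \<and> cls x = X)) \<rparr>"

lemma mdim_lift_module [simp]: "mdim (lift_module d \<Psi>) = d"
  by (simp add: lift_module_def)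

text \<open>A representation \<open>\<Psi>\<close> that kills the cyclic derivatives kills the ideal
  they generate. Since it depends only on coefficients at paths shorter than \<open>k\<close>, it
  also kills the closure, so every choice of lifts gives the same matrices.\<close>

lemma
  assumes hom: "\<Psi> \<in> Ring.ring_hom P (ring_mat TYPE(complex) d ())"
    and scale: "\<And>c. \<Psi> (\<lambda>w. c * \<one>\<^bsub>P\<^esub> w) = c \<cdot>\<^sub>m 1\<^sub>m d"
    and deriv: "\<And>a. a \<in> arcs G \<Longrightarrow> \<Psi> (cyclic_derivative G a W) = 0\<^sub>m d d"
    and cont: "\<And>x y. x \<in> carrier P \<Longrightarrow> y \<in> carrier P \<Longrightarrow>
      (\<And>u p. length p < k \<Longrightarrow> x (u, p) = y (u, p)) \<Longrightarrow> \<Psi> x = \<Psi> y"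
  shows is_module_lift_module: "is_module (lift_module d \<Psi>)"
    and act_lift_module: "x \<in> carrier P \<Longrightarrow> act (lift_module d \<Psi>) (cls x) = \<Psi> x"
proof -
  let ?M = "ring_mat TYPE(complex) d ()"
  have M: "ring ?M" by (rule ring_mat)
  have h: "ring_hom_ring P ?M \<Psi>"
    by (rule ring_hom_ringI2[OF ring_cpa ring_mat hom])
  note closed = ring_hom_closed[OF hom]
  have kerI: "\<Psi> x = 0\<^sub>m d d" if "x \<in> I" for x
  proof -
    have "genideal P ((\<lambda>a. cyclic_derivative G a W) ` arcs G) \<subseteq> a_kernel P ?M \<Psi>"
      using deriv cyclic_derivative_closed
      by (intro P.genideal_minimal ring_hom_ring.kernel_is_ideal[OF h])
         (auto simp: a_kernel_def' ring_mat_simps)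
    moreover have "x \<in> closed_ideal G ((\<lambda>a. cyclic_derivative G a W) ` arcs G)"
      using that by (simp add: jacobian_ideal_def)
    from closed_idealE[OF this, of k] obtain y where
        y: "y \<in> genideal P ((\<lambda>a. cyclic_derivative G a W) ` arcs G)"
          "\<And>u p. length p < k \<Longrightarrow> x (u, p) = y (u, p)"
      by metis
    ultimately have "y \<in> carrier P" "\<Psi> y = 0\<^sub>m d d"
      by (auto simp: a_kernel_def' ring_mat_simps)
    then show ?thesis
      using cont[of x y] y(2) I.Icarr[OF that] by simp
  qed
  show act: "act (lift_module d \<Psi>) (cls x) = \<Psi> x" if x: "x \<in> carrier P" for x
  proof -
    let ?y = "SOME y. y \<in> carrier P \<and> cls y = cls x"
    have y: "?y \<in> carrier P \<and> cls ?y = cls x"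
      by (rule someI[of _ x]) (simp add: x)
    then have "?y \<ominus>\<^bsub>P\<^esub> x \<in> I"
      using cls_eq_iff[of ?y x] x y by (simp add: minus_cpa)
    have d: "?y \<ominus>\<^bsub>P\<^esub> x \<in> carrier P" using x y by simp
    have "?y = (?y \<ominus>\<^bsub>P\<^esub> x) \<oplus>\<^bsub>P\<^esub> x"
      using x y by (simp add: minus_cpa add_cpa)
    then have "\<Psi> ?y = \<Psi> (?y \<ominus>\<^bsub>P\<^esub> x) \<oplus>\<^bsub>?M\<^esub> \<Psi> x"
      using ring_hom_add[OF hom d x] by simp
    then have "\<Psi> ?y = \<Psi> x"
      using kerI[OF \<open>?y \<ominus>\<^bsub>P\<^esub> x \<in> I\<close>] closed[OF x] by (simp add: ring_mat_simps)
    then show ?thesis by (simp add: lift_module_def)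
  qed
  show "is_module (lift_module d \<Psi>)"
    unfolding is_module_def mdim_lift_module
  proof (intro conjI allI ring_hom_memI)
    fix X assume "X \<in> carrier J"
    then obtain x where x: "x \<in> carrier P" "X = cls x" by (rule J_carrierE)
    then show "act (lift_module d \<Psi>) X \<in> carrier ?M" using closed by (simp add: act)
    fix Y assume "Y \<in> carrier J"
    then obtain y where y: "y \<in> carrier P" "Y = cls y" by (rule J_carrierE)
    show "act (lift_module d \<Psi>) (X \<otimes>\<^bsub>J\<^esub> Y) =
        act (lift_module d \<Psi>) X \<otimes>\<^bsub>?M\<^esub> act (lift_module d \<Psi>) Y"
      using x y ring_hom_mult[OF cls_hom x(1) y(1), symmetric]
        ring_hom_mult[OF hom x(1) y(1)] by (simp add: act)
    show "act (lift_module d \<Psi>) (X \<oplus>\<^bsub>J\<^esub> Y) =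
        act (lift_module d \<Psi>) X \<oplus>\<^bsub>?M\<^esub> act (lift_module d \<Psi>) Y"
      using x y ring_hom_add[OF cls_hom x(1) y(1), symmetric]
        ring_hom_add[OF hom x(1) y(1)] by (simp add: act)
  next
    show "act (lift_module d \<Psi>) \<one>\<^bsub>J\<^esub> = \<one>\<^bsub>?M\<^esub>"
      using ring_hom_one[OF cls_hom, symmetric] ring_hom_one[OF hom] by (simp add: act)
  next
    fix c
    have "(\<lambda>w. c * \<one>\<^bsub>P\<^esub> w) \<in> carrier P" by (rule scale_closed) simp
    then show "act (lift_module d \<Psi>) (cls (\<lambda>w. c * \<one>\<^bsub>P\<^esub> w)) = c \<cdot>\<^sub>m 1\<^sub>m d"
      by (simp add: act scale)
  qed
qed

context
  fixes M
  assumes M: "is_module M"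
begin

lemma act_hom: "(\<lambda>x. act M (cls x)) \<in> Ring.ring_hom P (ring_mat TYPE(complex) (mdim M) ())"
proof -
  have "act M \<in> Ring.ring_hom J (ring_mat TYPE(complex) (mdim M) ())"
    using M by (simp add: is_module_def)
  from ring_hom_trans[OF cls_hom this] show ?thesis by (simp add: comp_def)
qed

lemma act_carrier: "x \<in> carrier P \<Longrightarrow> act M (cls x) \<in> carrier_mat (mdim M) (mdim M)"
  using ring_hom_closed[OF act_hom] by (simp add: ring_mat_simps)

lemma act_mult: "x \<in> carrier P \<Longrightarrow> y \<in> carrier P \<Longrightarrow>
    act M (cls (x \<otimes>\<^bsub>P\<^esub> y)) = act M (cls x) * act M (cls y)"
  using ring_hom_mult[OF act_hom] by (simp add: ring_mat_simps)

lemma act_add: "x \<in> carrier P \<Longrightarrow> y \<in> carrier P \<Longrightarrow>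
    act M (cls (\<lambda>w. x w + y w)) = act M (cls x) + act M (cls y)"
  using ring_hom_add[OF act_hom] by (simp add: ring_mat_simps add_cpa)

lemma act_scale:
  assumes "x \<in> carrier P"
  shows "act M (cls (\<lambda>w. c * x w)) = c \<cdot>\<^sub>m act M (cls x)"
proof -
  have "act M (cls (\<lambda>w. c * x w)) = act M (cls (\<lambda>w. c * \<one>\<^bsub>P\<^esub> w)) * act M (cls x)"
    using assms by (subst act_mult[symmetric]) (auto simp: scale_cpa intro: scale_closed)
  also have "\<dots> = c \<cdot>\<^sub>m act M (cls x)"
    using M act_carrier[OF assms] mult_smult_assoc_mat[OF one_carrier_mat act_carrier[OF assms]]
    by (simp add: is_module_def)
  finally show ?thesis .
qed

lemma act_I:
  assumes "x \<in> I"
  shows "act M (cls x) = 0\<^sub>m (mdim M) (mdim M)"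
proof -
  \<comment> \<open>\<open>x\<close> and \<open>0 * x\<close> differ by an element of
    \<open>I\<close>, and the scalar \<open>0\<close> acts as the zero matrix.\<close>
  have "cls x = cls (\<lambda>w. 0 * x w)"
    using assms I.Icarr[OF assms] by (subst cls_eq_iff) (auto simp: carrier_cpa)
  moreover have "0 \<cdot>\<^sub>m A = 0\<^sub>m (mdim M) (mdim M)" if "A \<in> carrier_mat (mdim M) (mdim M)" for A :: "complex mat"
    using that by auto
  ultimately show ?thesis
    using act_scale[OF I.Icarr[OF assms], of 0] act_carrier[OF I.Icarr[OF assms]] by simp
qed

end

lemma Hom_iff:
  "f \<in> Hom M N \<longleftrightarrow> f \<in> carrier_mat (mdim N) (mdim M) \<and>
     (\<forall>x \<in> carrier P. f * act M (cls x) = act N (cls x) * f)"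
proof -
  have "(\<forall>X \<in> carrier J. Q X) \<longleftrightarrow> (\<forall>x \<in> carrier P. Q (cls x))" for Q
    using J_carrierE ring_hom_closed[OF cls_hom] by metis
  then show ?thesis unfolding Hom_def by simp
qed

lemma is_submodule_iff:
  "is_submodule M N \<longleftrightarrow> VectorSpace.subspace class_ring N (module_vec TYPE(complex) (mdim M)) \<and>
     (\<forall>x \<in> carrier P. \<forall>v \<in> N. act M (cls x) *\<^sub>v v \<in> N)"
proof -
  have "(\<forall>X \<in> carrier J. Q X) \<longleftrightarrow> (\<forall>x \<in> carrier P. Q (cls x))" for Q
    using J_carrierE ring_hom_closed[OF cls_hom] by metis
  then show ?thesis unfolding is_submodule_def by simp
qed

lemma HomI_paths:
  assumes nilp: "\<And>w. w \<in> paths G \<Longrightarrow> length (snd w) \<ge> N \<Longrightarrow> path_elem w \<in> I"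
    and M: "is_module M" and M': "is_module M'" and f: "f \<in> carrier_mat (mdim M') (mdim M)"
    and path: "\<And>w. w \<in> paths G \<Longrightarrow>
      f * act M (cls (path_elem w)) = act M' (cls (path_elem w)) * f"
  shows "f \<in> Hom M M'"
  unfolding Hom_iff
proof (intro conjI ballI f)
  fix x assume x: "x \<in> carrier P"
  show "f * act M (cls x) = act M' (cls x) * f"
  proof (rule cpa_induct[where N = N and Q = "\<lambda>x. f * act M (cls x) = act M' (cls x) * f"])
    fix x assume "x \<in> I"
    then show "f * act M (cls x) = act M' (cls x) * f"
      using f by (simp add: act_I[OF M] act_I[OF M'])
  next
    fix x y assume "x \<in> carrier P" "y \<in> carrier P" "f * act M (cls x) = act M' (cls x) * f"
      "f * act M (cls y) = act M' (cls y) * f"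
    then show "f * act M (cls (\<lambda>w. x w + y w)) = act M' (cls (\<lambda>w. x w + y w)) * f"
      using mult_add_distrib_mat[OF f act_carrier[OF M, of x] act_carrier[OF M, of y]]
        add_mult_distrib_mat[OF act_carrier[OF M', of x] act_carrier[OF M', of y] f]
      by (simp add: act_add[OF M] act_add[OF M'])
  next
    fix c w assume w: "w \<in> paths G"
    then show "f * act M (cls (\<lambda>v. c * path_elem w v)) = act M' (cls (\<lambda>v. c * path_elem w v)) * f"
      using path[OF w] mult_smult_distrib[OF f act_carrier[OF M, of "path_elem w"]]
        mult_smult_assoc_mat[OF act_carrier[OF M', of "path_elem w"] f]
      by (simp add: act_scale[OF M] act_scale[OF M'])
  qed (use nilp x in auto)
qed

end

text \<open>With \<open>h\<close> the conjugate transpose, the Gram matrix \<open>h * f\<close> is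
  invertible: if it kills \<open>v\<close>, then \<open>f *\<^sub>v v\<close> has norm zero and
  \<open>v\<close> is zero by injectivity. The inverse times \<open>h\<close> is a left inverse of
  \<open>f\<close>. It serves to extend linear functionals along monomorphisms.\<close>

lemma inj_mat_left_inverse:
  assumes f: "(f :: complex mat) \<in> carrier_mat r c"
    and inj: "inj_on (\<lambda>v. f *\<^sub>v v) (carrier_vec c)"
  obtains g where "g \<in> carrier_mat c r" "g * f = 1\<^sub>m c"
proof -
  define h where "h = mat c r (\<lambda>(i, j). cnj (f $$ (j, i)))"
  let ?k = "h * f"
  have h: "h \<in> carrier_mat c r" by (simp add: h_def)
  have k: "?k \<in> carrier_mat c c" using h f by simp
  have "det ?k \<noteq> 0"
  proof
    assume "det ?k = 0"
    then obtain v where v: "v \<in> carrier_vec c" "v \<noteq> 0\<^sub>v c" "?k *\<^sub>v v = 0\<^sub>v c"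
      using det_0_iff_vec_prod_zero[OF k] by auto
    define w where "w = f *\<^sub>v v"
    have w: "w \<in> carrier_vec r" using f v(1) by (simp add: w_def)
    have hw: "h *\<^sub>v w = 0\<^sub>v c"
      using v(3) assoc_mult_mat_vec[OF h f v(1)] by (simp add: w_def)
    have wj: "w $ j = (\<Sum>i<c. f $$ (j, i) * v $ i)" if "j < r" for j
      using that f v(1) by (simp add: w_def scalar_prod_def lessThan_atLeast0)
    have "w \<bullet>c w = (\<Sum>j<r. w $ j * cnj (w $ j))"
      using w by (simp add: scalar_prod_def lessThan_atLeast0)
    also have "\<dots> = (\<Sum>j<r. w $ j * cnj (\<Sum>i<c. f $$ (j, i) * v $ i))"
      by (intro sum.cong) (simp_all add: wj)
    also have "\<dots> = (\<Sum>j<r. \<Sum>i<c. cnj (v $ i) * (cnj (f $$ (j, i)) * w $ j))"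
      by (simp add: sum_distrib_left sum_distrib_right algebra_simps)
    also have "\<dots> = (\<Sum>i<c. cnj (v $ i) * (\<Sum>j<r. cnj (f $$ (j, i)) * w $ j))"
      by (subst sum.swap) (simp add: sum_distrib_left)
    also have "\<dots> = (\<Sum>i<c. cnj (v $ i) * (h *\<^sub>v w) $ i)"
      using w by (intro sum.cong) (auto simp: h_def scalar_prod_def lessThan_atLeast0)
    also have "\<dots> = 0" using hw by simp
    finally have "w = 0\<^sub>v r"
      using conjugate_square_eq_0_vec[OF w] by simp
    then have "f *\<^sub>v v = f *\<^sub>v 0\<^sub>v c" using f by (auto simp: w_def)
    then show False using inj v by (auto dest: inj_onD)
  qed
  then obtain B where "B \<in> carrier_mat c c" "B * ?k = 1\<^sub>m c"
    using det_non_zero_imp_unit[OF k, of "()"] by (auto simp: Units_def ring_mat_simps)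
  then show ?thesis using h f by (intro that[of "B * h"]) (auto simp: assoc_mult_mat[of _ c c _ r _ c])
qed

section \<open>Alternating products\<close>

context Group.monoid
begin

text \<open>Arrows of kind \<open>A\<close>, \<open>B\<close> go from odd to even vertices and
  arrows of kind \<open>L\<close>, \<open>R\<close> from even to odd ones, so a path is a word
  alternating between two kinds of letters. When the list whose turn it is runs out, the rest of the
  other one is dropped; the length hypotheses below guard against this.\<close>

function alt :: "'a list \<Rightarrow> 'a list \<Rightarrow> 'a" where
  "alt [] ys = \<one>"
| "alt (x # xs) ys = x \<otimes> alt ys xs"
  by pat_completeness auto
termination by (relation "measure (\<lambda>(xs, ys). length xs + length ys)") auto

lemma alt_closed [simp]: "set xs \<subseteq> carrier G \<Longrightarrow> set ys \<subseteq> carrier G \<Longrightarrow> alt xs ys \<in> carrier G"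
  by (induction xs ys rule: alt.induct) auto

lemma alt_snoc1:
  "set xs \<subseteq> carrier G \<Longrightarrow> set ys \<subseteq> carrier G \<Longrightarrow> x \<in> carrier G \<Longrightarrow> length xs = length ys \<Longrightarrow>
    alt (xs @ [x]) ys = alt xs ys \<otimes> x"
  and alt_snoc2:
  "set xs \<subseteq> carrier G \<Longrightarrow> set ys \<subseteq> carrier G \<Longrightarrow> x \<in> carrier G \<Longrightarrow> length xs = Suc (length ys) \<Longrightarrow>
    alt xs (ys @ [x]) = alt xs ys \<otimes> x"
proof (induction xs ys rule: alt.induct)
  case (2 z xs ys)
  {
    case 1
    with 2 show ?case by (cases ys) (auto simp: m_assoc)
  next
    case 2
    with "2.IH" show ?case by (auto simp: m_assoc)
  }
qed auto

text \<open>The relation exchanges two neighbours from \<open>X\<close> across one letter of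
  \<open>Y\<close>, so \<open>z\<close> travels to the front past the letters of \<open>us\<close>
  one at a time. The length bound provides the letters of \<open>ys\<close> in between.\<close>

lemma alt_move_front:
  assumes rel: "\<And>x x' y. x \<in> X \<Longrightarrow> x' \<in> X \<Longrightarrow> y \<in> Y \<Longrightarrow> x \<otimes> y \<otimes> x' = x' \<otimes> y \<otimes> x"
    and carr: "X \<subseteq> carrier G" "Y \<subseteq> carrier G"
  shows "set us \<subseteq> X \<Longrightarrow> z \<in> X \<Longrightarrow> set vs \<subseteq> X \<Longrightarrow> set ys \<subseteq> Y \<Longrightarrow>
    length us + length vs \<le> length ys \<Longrightarrow> alt (us @ z # vs) ys = alt (z # us @ vs) ys"
proof (induction us arbitrary: ys)
  case (Cons u us)
  then obtain y ys' where ys: "ys = y # ys'" by (cases ys) auto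
  have c: "u \<in> carrier G" "y \<in> carrier G" "z \<in> carrier G" "set us \<subseteq> carrier G" "set vs \<subseteq> carrier G"
    "set ys' \<subseteq> carrier G"
    using Cons.prems carr ys by auto
  have IH: "alt (us @ z # vs) ys' = alt (z # us @ vs) ys'"
    using Cons.prems ys by (intro Cons.IH) auto
  have "alt ((u # us) @ z # vs) ys = u \<otimes> y \<otimes> z \<otimes> alt ys' (us @ vs)"
    using c by (simp add: ys IH m_assoc)
  also have "u \<otimes> y \<otimes> z = z \<otimes> y \<otimes> u"
    using Cons.prems ys by (intro rel) auto
  finally show ?case using c by (simp add: ys m_assoc)
qed simp

text \<open>Moving the wanted first letter to the front, again and again, reaches every
  rearrangement: the product sees only the multiset of the letters of one kind.\<close>

lemma alt_cong_mset1:
  assumes rel: "\<And>x x' y. x \<in> X \<Longrightarrow> x' \<in> X \<Longrightarrow> y \<in> Y \<Longrightarrow> x \<otimes> y \<otimes> x' = x' \<otimes> y \<otimes> x"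
    and carr: "X \<subseteq> carrier G" "Y \<subseteq> carrier G"
  shows "set xs \<subseteq> X \<Longrightarrow> set ys \<subseteq> Y \<Longrightarrow> mset xs = mset xs' \<Longrightarrow> length xs \<le> Suc (length ys) \<Longrightarrow>
    alt xs ys = alt xs' ys"
proof (induction xs arbitrary: xs' ys)
  case (Cons x xs)
  have "x \<in> set xs'" using Cons.prems(3) by (metis list.set_intros(1) mset_eq_setD)
  then obtain us vs where xs': "xs' = us @ x # vs" by (meson split_list)
  then have m: "mset xs = mset (us @ vs)" using Cons.prems(3) by simp
  then have s: "set us \<subseteq> X" "set vs \<subseteq> X" "length us + length vs = length xs"
    using Cons.prems(1) mset_eq_setD[OF m] mset_eq_length[OF m] by auto
  have "alt xs' ys = alt (x # us @ vs) ys"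
    unfolding xs' by (rule alt_move_front[OF rel carr]) (use Cons.prems s in auto)
  also have "\<dots> = alt (x # xs) ys"
  proof (cases ys)
    case Nil
    then have "us @ vs = []" "xs = []" using Cons.prems s by auto
    then show ?thesis by simp
  next
    case (Cons y ys')
    then have "alt xs ys' = alt (us @ vs) ys'"
      using Cons.prems m by (intro Cons.IH) auto
    then show ?thesis using Cons by simp
  qed
  finally show ?case by simp
qed simp

lemma alt_cong_mset2:
  assumes rel: "\<And>x x' y. x \<in> X \<Longrightarrow> x' \<in> X \<Longrightarrow> y \<in> Y \<Longrightarrow> x \<otimes> y \<otimes> x' = x' \<otimes> y \<otimes> x"
    and carr: "X \<subseteq> carrier G" "Y \<subseteq> carrier G"
    and "set xs \<subseteq> X" "set ys \<subseteq> Y" "mset xs = mset xs'" "length xs \<le> length ys"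
  shows "alt ys xs = alt ys xs'"
proof (cases ys)
  case (Cons y ys')
  have "alt xs ys' = alt xs' ys'"
    by (rule alt_cong_mset1[OF rel carr]) (use assms Cons in auto)
  then show ?thesis using Cons by simp
qed simp

end

section \<open>Relations in the Jacobian algebra\<close>

text \<open>Contributions to the quadruple that counts the letters r, l, a, b, in this order. The
  index is forgotten because it can be recovered from the end vertex of the path and the letters
  traversed afterwards.\<close>

fun letter :: "toda_arrow \<Rightarrow> nat \<times> nat \<times> nat \<times> nat" where
  "letter (R i) = (1, 0, 0, 0)"
| "letter (L i) = (0, 1, 0, 0)"
| "letter (A i) = (0, 0, 1, 0)"
| "letter (B i) = (0, 0, 0, 1)"

definition content :: "toda_arrow list \<Rightarrow> nat \<times> nat \<times> nat \<times> nat" where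
  "content p = sum_list (map letter p)"

lemma content_Nil [simp]: "content [] = 0"
  and content_Cons [simp]: "content (e # p) = letter e + content p"
  and content_append: "content (p @ q) = content p + content q"
  by (simp_all add: content_def)

lemma toda_quiver_simps [simp]:
  "verts (toda_quiver n) = {1..2 * n}"
  "tail (toda_quiver n) = toda_tail"
  "head (toda_quiver n) = toda_head"
  "arcs (toda_quiver n) = A ` {1..n} \<union> B ` {1..n} \<union> L ` {2..n} \<union> R ` {1..<n}"
  by (simp_all add: toda_quiver_def)

section \<open>Cyclic derivatives of the potential\<close>

lemma sum_path_elem:
  assumes "finite F" "inj_on g F"
  shows "(\<Sum>i\<in>F. path_elem (g i) w) = (if w \<in> g ` F then 1 else 0)"
proof (cases "w \<in> g ` F")
  case True
  then obtain j where j: "j \<in> F" "w = g j" by auto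
  then have "(\<Sum>i\<in>F. path_elem (g i) w) = (\<Sum>i\<in>F. if i = j then 1 else 0)"
    using assms(2) by (intro sum.cong) (auto simp: path_elem_def inj_on_eq_iff)
  then show ?thesis using assms(1) j True by simp
next
  case False
  then show ?thesis by (auto simp: path_elem_def intro!: sum.neutral)
qed

text \<open>All cycles of the potential are written with their arrow of kind \<open>R\<close> first,
  so the first letter already decides whether a coefficient can be nonzero.\<close>

lemma toda_potential_R:
  "toda_potential n (w, [R j, x, y, z]) = (if 1 \<le> j \<and> j < n \<and> w = 2 * j then
     (if x = B (j + 1) \<and> y = L (j + 1) \<and> z = A j then 1 else 0)
     - (if x = A (j + 1) \<and> y = L (j + 1) \<and> z = B j then 1 else 0) else 0)"
  unfolding toda_potential_def sum_subtractf
  by (subst (1 2) sum_path_elem) (auto simp: inj_on_def)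

lemma toda_potential_not_R:
  assumes "\<And>j. c \<noteq> R j"
  shows "toda_potential n (w, c # p) = 0"
  unfolding toda_potential_def sum_subtractf
  by (subst (1 2) sum_path_elem) (use assms in \<open>auto simp: inj_on_def\<close>)

lemma toda_potential_length:
  assumes "length p \<noteq> 4"
  shows "toda_potential n (w, p) = 0"
  unfolding toda_potential_def sum_subtractf
  by (subst (1 2) sum_path_elem) (use assms in \<open>auto simp: inj_on_def\<close>)

lemmas toda_potential_simps = toda_potential_R toda_potential_not_R[of "A i" for i]
  toda_potential_not_R[of "B i" for i] toda_potential_not_R[of "L i" for i]

text \<open>The four summands are the rotations of one cycle through \<open>a\<close>. Length three
  is the only relevant one, as the potential is homogeneous of degree four.\<close>

lemma toda_cyclic_derivative_3:
  "cyclic_derivative (toda_quiver n) a (toda_potential n) (u, [x, y, z]) = (if u = toda_head a then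
     toda_potential n (u, [x, y, z, a]) + toda_potential n (toda_head x, [y, z, a, x])
     + toda_potential n (toda_head y, [z, a, x, y]) + toda_potential n (toda_head z, [a, x, y, z]) else 0)"
  by (simp add: cyclic_derivative_def numeral_3_eq_3 lessThan_Suc atMost_Suc)

lemma toda_cyclic_derivative_length:
  assumes "length p \<noteq> 3"
  shows "cyclic_derivative (toda_quiver n) a (toda_potential n) (u, p) = 0"
  using assms by (auto simp: cyclic_derivative_def toda_potential_length intro!: sum.neutral)

lemma cyclic_derivative_cases:
  assumes "length (snd w) \<noteq> 3 \<Longrightarrow> f w = 0"
    and "\<And>u x y z. w = (u, [x, y, z]) \<Longrightarrow>
      cyclic_derivative (toda_quiver n) a (toda_potential n) (u, [x, y, z]) = f (u, [x, y, z])"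
  shows "cyclic_derivative (toda_quiver n) a (toda_potential n) w = f w"
proof (cases "length (snd w) = 3")
  case True
  then obtain u x y z where "w = (u, [x, y, z])"
    by (cases w) (auto simp: numeral_3_eq_3 length_Suc_conv)
  then show ?thesis using assms(2) by simp
next
  case False
  then show ?thesis using assms(1) toda_cyclic_derivative_length by (cases w) auto
qed

text \<open>Inside the quiver this identifies two paths. At \<open>i = 1\<close> or
  \<open>i = n\<close> a term is missing, and a remaining single path vanishes in the Jacobian
  algebra.\<close>

lemma cyclic_derivative_A:
  assumes "1 \<le> i" "i \<le> n"
  shows "cyclic_derivative (toda_quiver n) (A i) (toda_potential n) w =
    (if i < n then path_elem (2 * i, [R i, B (i + 1), L (i + 1)]) w else 0) -
    (if 2 \<le> i then path_elem (2 * i, [L i, B (i - 1), R (i - 1)]) w else 0)"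
proof (rule cyclic_derivative_cases)
  fix u x y z
  show "cyclic_derivative (toda_quiver n) (A i) (toda_potential n) (u, [x, y, z]) =
    (if i < n then path_elem (2 * i, [R i, B (i + 1), L (i + 1)]) (u, [x, y, z]) else 0) -
    (if 2 \<le> i then path_elem (2 * i, [L i, B (i - 1), R (i - 1)]) (u, [x, y, z]) else 0)"
    unfolding toda_cyclic_derivative_3 path_elem_def using assms
    by (cases x; cases y; cases z) (auto simp: toda_potential_simps)
qed (auto simp: path_elem_def)

lemma cyclic_derivative_B:
  assumes "1 \<le> i" "i \<le> n"
  shows "cyclic_derivative (toda_quiver n) (B i) (toda_potential n) w =
    (if 2 \<le> i then path_elem (2 * i, [L i, A (i - 1), R (i - 1)]) w else 0) -
    (if i < n then path_elem (2 * i, [R i, A (i + 1), L (i + 1)]) w else 0)"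
proof (rule cyclic_derivative_cases)
  fix u x y z
  show "cyclic_derivative (toda_quiver n) (B i) (toda_potential n) (u, [x, y, z]) =
    (if 2 \<le> i then path_elem (2 * i, [L i, A (i - 1), R (i - 1)]) (u, [x, y, z]) else 0) -
    (if i < n then path_elem (2 * i, [R i, A (i + 1), L (i + 1)]) (u, [x, y, z]) else 0)"
    unfolding toda_cyclic_derivative_3 path_elem_def using assms
    by (cases x; cases y; cases z) (auto simp: toda_potential_simps)
qed (auto simp: path_elem_def)

lemma cyclic_derivative_R:
  assumes "1 \<le> i" "i < n"
  shows "cyclic_derivative (toda_quiver n) (R i) (toda_potential n) w =
    path_elem (2 * i + 1, [B (i + 1), L (i + 1), A i]) w -
    path_elem (2 * i + 1, [A (i + 1), L (i + 1), B i]) w"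
proof (rule cyclic_derivative_cases)
  fix u x y z
  show "cyclic_derivative (toda_quiver n) (R i) (toda_potential n) (u, [x, y, z]) =
    path_elem (2 * i + 1, [B (i + 1), L (i + 1), A i]) (u, [x, y, z]) -
    path_elem (2 * i + 1, [A (i + 1), L (i + 1), B i]) (u, [x, y, z])"
    unfolding toda_cyclic_derivative_3 path_elem_def using assms
    by (cases x; cases y; cases z) (auto simp: toda_potential_simps)
qed (auto simp: path_elem_def)

lemma cyclic_derivative_L:
  assumes "2 \<le> i" "i \<le> n"
  shows "cyclic_derivative (toda_quiver n) (L i) (toda_potential n) w =
    path_elem (2 * i - 3, [A (i - 1), R (i - 1), B i]) w -
    path_elem (2 * i - 3, [B (i - 1), R (i - 1), A i]) w"
proof (rule cyclic_derivative_cases)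
  fix u x y z
  show "cyclic_derivative (toda_quiver n) (L i) (toda_potential n) (u, [x, y, z]) =
    path_elem (2 * i - 3, [A (i - 1), R (i - 1), B i]) (u, [x, y, z]) -
    path_elem (2 * i - 3, [B (i - 1), R (i - 1), A i]) (u, [x, y, z])"
    unfolding toda_cyclic_derivative_3 path_elem_def using assms
    by (cases x; cases y; cases z) (auto simp: toda_potential_simps)
qed (auto simp: path_elem_def)

lemma fin_digraph_toda: "fin_digraph (toda_quiver n)"
  by unfold_locales auto

section \<open>Relations between sums of arrows of one kind\<close>

text \<open>Summing all arrows of a kind removes the indices: a product of such sums collects the
  composable words, and the relations become four identities between words of three letters. A
  single arrow is recovered with the idempotent at its tail.\<close>

definition arrow_sum :: "toda_arrow set \<Rightarrow> (nat, toda_arrow) path \<Rightarrow> complex" where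
  "arrow_sum S = (\<lambda>(u, p). if \<exists>e\<in>S. u = toda_tail e \<and> p = [e] then 1 else 0)"

lemma arrow_sum_apply: "arrow_sum S (u, p) = (if \<exists>e\<in>S. u = toda_tail e \<and> p = [e] then 1 else 0)"
  by (simp add: arrow_sum_def)

lemma mult_arrow_sum:
  "(x \<otimes>\<^bsub>completed_path_algebra (toda_quiver n)\<^esub> arrow_sum S) (u, p) =
     (case p of [] \<Rightarrow> 0 | e # q \<Rightarrow> if e \<in> S \<and> u = toda_tail e then x (toda_head e, q) else 0)"
proof (cases p)
  case Nil
  then show ?thesis by (simp add: mult_cpa_Nil arrow_sum_def)
next
  case (Cons e q)
  have "(x \<otimes>\<^bsub>completed_path_algebra (toda_quiver n)\<^esub> (\<lambda>(v, q). arrow_sum S (u, e # q))) (toda_head e, q)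
    = (\<Sum>i\<le>length q. if i = 0 then (if e \<in> S \<and> u = toda_tail e then x (toda_head e, q) else 0) else 0)"
    unfolding mult_cpa by (intro sum.cong) (auto simp: arrow_sum_def)
  then show ?thesis using Cons by (simp add: mult_cpa_Cons arrow_sum_def)
qed

text \<open>Zero at numbers that are not vertices, so that idempotents move through words without
  range conditions, and a word that would leave the quiver vanishes.\<close>

definition vertex_elem :: "nat \<Rightarrow> nat \<Rightarrow> (nat, toda_arrow) path \<Rightarrow> complex" where
  "vertex_elem n j = (if j \<in> {1..2 * n} then path_elem (j, []) else (\<lambda>_. 0))"

lemma mult_vertex_elem:
  "(x \<otimes>\<^bsub>completed_path_algebra (toda_quiver n)\<^esub> vertex_elem n j) (u, p) =
     (if u = j \<and> j \<in> {1..2 * n} then x (u, p) else 0)"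
proof -
  have "(x \<otimes>\<^bsub>completed_path_algebra (toda_quiver n)\<^esub> vertex_elem n j) (u, p) =
    (\<Sum>i\<le>length p. if i = 0 then (if u = j \<and> j \<in> {1..2 * n} then x (u, p) else 0) else 0)"
    unfolding mult_cpa by (intro sum.cong) (auto simp: vertex_elem_def path_elem_def)
  then show ?thesis by simp
qed

lemma vertex_elem_mult:
  "(vertex_elem n j \<otimes>\<^bsub>completed_path_algebra (toda_quiver n)\<^esub> x) (u, p) =
     (if path_end (toda_quiver n) (u, p) = j \<and> j \<in> {1..2 * n} then x (u, p) else 0)"
proof -
  have "(vertex_elem n j \<otimes>\<^bsub>completed_path_algebra (toda_quiver n)\<^esub> x) (u, p) =
    (\<Sum>i\<le>length p. if i = length p then (if path_end (toda_quiver n) (u, p) = j \<and> j \<in> {1..2 * n} then x (u, p) else 0) else 0)"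
    unfolding mult_cpa by (intro sum.cong) (auto simp: vertex_elem_def path_elem_def)
  then show ?thesis by simp
qed

locale toda_algebra =
  fixes n :: nat
begin

abbreviation "Q \<equiv> toda_quiver n"

sublocale jacobian_quiver "toda_quiver n" "toda_potential n"
proof -
  interpret fin_digraph "toda_quiver n" by (rule fin_digraph_toda)
  show "jacobian_quiver (toda_quiver n) (toda_potential n)"
  proof
    fix a assume a: "a \<in> arcs (toda_quiver n)"
    show "cyclic_derivative (toda_quiver n) a (toda_potential n) \<in> carrier (completed_path_algebra (toda_quiver n))"
    proof (cases a)
      case (A i)
      with a have "1 \<le> i" "i \<le> n" by auto
      then show ?thesis unfolding A carrier_cpa
        by (auto simp: cyclic_derivative_A path_elem_def image_iff)
    next
      case (B i)
      with a have "1 \<le> i" "i \<le> n" by auto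
      then show ?thesis unfolding B carrier_cpa
        by (auto simp: cyclic_derivative_B path_elem_def image_iff)
    next
      case (L i)
      with a have "2 \<le> i" "i \<le> n" by auto
      then show ?thesis unfolding L carrier_cpa
        by (auto simp: cyclic_derivative_L path_elem_def image_iff)
    next
      case (R i)
      with a have "1 \<le> i" "i < n" by auto
      then show ?thesis unfolding R carrier_cpa
        by (auto simp: cyclic_derivative_R path_elem_def image_iff)
    qed
  qed
qed

abbreviation "Jac \<equiv> jacobian_algebra (toda_quiver n) (toda_potential n)"
abbreviation "sA \<equiv> A ` {1..n}"
abbreviation "sB \<equiv> B ` {1..n}"
abbreviation "sL \<equiv> L ` {2..n}"
abbreviation "sR \<equiv> R ` {1..<n}"

lemma arrow_sum_closed: "S \<subseteq> arcs Q \<Longrightarrow> arrow_sum S \<in> carrier P"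
  unfolding carrier_cpa arrow_sum_def by (auto dest!: subsetD)

lemma arrow_sums_closed [simp]:
  "arrow_sum sA \<in> carrier P" "arrow_sum sB \<in> carrier P" "arrow_sum sL \<in> carrier P" "arrow_sum sR \<in> carrier P"
  by (intro arrow_sum_closed; auto)+

lemma triple_product:
  "(arrow_sum S1 \<otimes>\<^bsub>P\<^esub> arrow_sum S2 \<otimes>\<^bsub>P\<^esub> arrow_sum S3) (u, p) =
    (if \<exists>e3\<in>S3. \<exists>e2\<in>S2. \<exists>e1\<in>S1. p = [e3, e2, e1] \<and> u = toda_tail e3 \<and>
       toda_tail e2 = toda_head e3 \<and> toda_tail e1 = toda_head e2 then 1 else 0)"
  by (auto simp: mult_arrow_sum arrow_sum_apply split: list.splits)

text \<open>In each use \<open>F\<close> consists of all arrows of one kind: up to the sign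
  \<open>s\<close>, the sum of their derivatives is the difference of the two words.\<close>

lemma relation_in_J:
  assumes F: "finite F" "F \<subseteq> arcs Q"
    and S: "S1 \<subseteq> arcs Q" "S2 \<subseteq> arcs Q" "S3 \<subseteq> arcs Q"
    and eq: "\<And>u p. (arrow_sum S1 \<otimes>\<^bsub>P\<^esub> arrow_sum S2 \<otimes>\<^bsub>P\<^esub> arrow_sum S3) (u, p) -
      (arrow_sum S3 \<otimes>\<^bsub>P\<^esub> arrow_sum S2 \<otimes>\<^bsub>P\<^esub> arrow_sum S1) (u, p) =
      (\<Sum>a\<in>F. s * cyclic_derivative Q a (toda_potential n) (u, p))"
  shows "cls (arrow_sum S1) \<otimes>\<^bsub>Jac\<^esub> cls (arrow_sum S2) \<otimes>\<^bsub>Jac\<^esub> cls (arrow_sum S3) =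
    cls (arrow_sum S3) \<otimes>\<^bsub>Jac\<^esub> cls (arrow_sum S2) \<otimes>\<^bsub>Jac\<^esub> cls (arrow_sum S1)"
proof -
  have c: "arrow_sum S1 \<in> carrier P" "arrow_sum S2 \<in> carrier P" "arrow_sum S3 \<in> carrier P"
    using S by (auto intro!: arrow_sum_closed)
  have "(\<lambda>w. \<Sum>a\<in>F. s * cyclic_derivative Q a (toda_potential n) w) \<in> I"
    using F by (intro ideal_cpa_sum ideal_I derivative_in_I) auto
  then have "(\<lambda>w. (arrow_sum S1 \<otimes>\<^bsub>P\<^esub> arrow_sum S2 \<otimes>\<^bsub>P\<^esub> arrow_sum S3) w -
      (arrow_sum S3 \<otimes>\<^bsub>P\<^esub> arrow_sum S2 \<otimes>\<^bsub>P\<^esub> arrow_sum S1) w) \<in> I"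
    by (rule back_subst[where P = "\<lambda>x. x \<in> I"]) (use eq in auto)
  then have "cls (arrow_sum S1 \<otimes>\<^bsub>P\<^esub> arrow_sum S2 \<otimes>\<^bsub>P\<^esub> arrow_sum S3) =
      cls (arrow_sum S3 \<otimes>\<^bsub>P\<^esub> arrow_sum S2 \<otimes>\<^bsub>P\<^esub> arrow_sum S1)"
    using c by (subst cls_eq_iff) simp_all
  then show ?thesis
    using c by (simp add: ring_hom_mult[OF cls_hom])
qed

lemma triple_product_sum:
  assumes "inj_on g {1..<n}"
    and "\<And>u p. (\<exists>e3\<in>S3. \<exists>e2\<in>S2. \<exists>e1\<in>S1. p = [e3, e2, e1] \<and> u = toda_tail e3 \<and>
       toda_tail e2 = toda_head e3 \<and> toda_tail e1 = toda_head e2) \<longleftrightarrow> (\<exists>i\<in>{1..<n}. (u, p) = g i)"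
  shows "(arrow_sum S1 \<otimes>\<^bsub>P\<^esub> arrow_sum S2 \<otimes>\<^bsub>P\<^esub> arrow_sum S3) w = (\<Sum>i\<in>{1..<n}. path_elem (g i) w)"
  using assms by (cases w) (simp only: triple_product sum_path_elem finite_atLeastLessThan image_iff)

lemma product_BRA: "(arrow_sum sB \<otimes>\<^bsub>P\<^esub> arrow_sum sR \<otimes>\<^bsub>P\<^esub> arrow_sum sA) w =
    (\<Sum>i\<in>{1..<n}. path_elem (2 * i - 1, [A i, R i, B (i + 1)]) w)"
  by (rule triple_product_sum) (auto simp: inj_on_def)

lemma product_ARB: "(arrow_sum sA \<otimes>\<^bsub>P\<^esub> arrow_sum sR \<otimes>\<^bsub>P\<^esub> arrow_sum sB) w =
    (\<Sum>i\<in>{1..<n}. path_elem (2 * i - 1, [B i, R i, A (i + 1)]) w)"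
  by (rule triple_product_sum) (auto simp: inj_on_def)

lemma product_ALB: "(arrow_sum sA \<otimes>\<^bsub>P\<^esub> arrow_sum sL \<otimes>\<^bsub>P\<^esub> arrow_sum sB) w =
    (\<Sum>i\<in>{1..<n}. path_elem (2 * i + 1, [B (i + 1), L (i + 1), A i]) w)"
proof (rule triple_product_sum)
  fix u p
  show "(\<exists>e3\<in>sB. \<exists>e2\<in>sL. \<exists>e1\<in>sA. p = [e3, e2, e1] \<and> u = toda_tail e3 \<and>
       toda_tail e2 = toda_head e3 \<and> toda_tail e1 = toda_head e2) \<longleftrightarrow>
     (\<exists>i\<in>{1..<n}. (u, p) = (2 * i + 1, [B (i + 1), L (i + 1), A i]))" (is "?l \<longleftrightarrow> ?r")
  proof
    assume ?l
    then obtain i j k where "p = [B i, L j, A k]" "u = 2 * i - 1" "2 * j = 2 * i" "2 * k - 1 = 2 * j - 3"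
      "1 \<le> i" "i \<le> n" "2 \<le> j" "1 \<le> k" by auto
    then show ?r by (intro bexI[of _ k]) auto
  qed auto
qed (auto simp: inj_on_def)

lemma product_BLA: "(arrow_sum sB \<otimes>\<^bsub>P\<^esub> arrow_sum sL \<otimes>\<^bsub>P\<^esub> arrow_sum sA) w =
    (\<Sum>i\<in>{1..<n}. path_elem (2 * i + 1, [A (i + 1), L (i + 1), B i]) w)"
proof (rule triple_product_sum)
  fix u p
  show "(\<exists>e3\<in>sA. \<exists>e2\<in>sL. \<exists>e1\<in>sB. p = [e3, e2, e1] \<and> u = toda_tail e3 \<and>
       toda_tail e2 = toda_head e3 \<and> toda_tail e1 = toda_head e2) \<longleftrightarrow>
     (\<exists>i\<in>{1..<n}. (u, p) = (2 * i + 1, [A (i + 1), L (i + 1), B i]))" (is "?l \<longleftrightarrow> ?r")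
  proof
    assume ?l
    then obtain i j k where "p = [A i, L j, B k]" "u = 2 * i - 1" "2 * j = 2 * i" "2 * k - 1 = 2 * j - 3"
      "1 \<le> i" "i \<le> n" "2 \<le> j" "1 \<le> k" by auto
    then show ?r by (intro bexI[of _ k]) auto
  qed auto
qed (auto simp: inj_on_def)

lemma product_LKR:
  assumes "K = A \<or> K = B"
  shows "(arrow_sum sL \<otimes>\<^bsub>P\<^esub> arrow_sum (K ` {1..n}) \<otimes>\<^bsub>P\<^esub> arrow_sum sR) w =
    (\<Sum>i\<in>{1..<n}. path_elem (2 * i, [R i, K (i + 1), L (i + 1)]) w)"
proof (rule triple_product_sum)
  fix u p
  show "(\<exists>e3\<in>sR. \<exists>e2\<in>K ` {1..n}. \<exists>e1\<in>sL. p = [e3, e2, e1] \<and> u = toda_tail e3 \<and>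
       toda_tail e2 = toda_head e3 \<and> toda_tail e1 = toda_head e2) \<longleftrightarrow>
     (\<exists>i\<in>{1..<n}. (u, p) = (2 * i, [R i, K (i + 1), L (i + 1)]))" (is "?l \<longleftrightarrow> ?r")
  proof
    assume ?l
    then obtain i j k where "p = [R i, K j, L k]" "u = 2 * i" "2 * j - 1 = 2 * i + 1" "2 * k = 2 * j"
      "1 \<le> i" "i < n" "1 \<le> j" using assms by auto
    moreover from this have "j = Suc i" by linarith
    ultimately show ?r by (intro bexI[of _ i]) auto
  qed (use assms in auto)
qed (auto simp: inj_on_def)

lemma product_RKL:
  assumes "K = A \<or> K = B"
  shows "(arrow_sum sR \<otimes>\<^bsub>P\<^esub> arrow_sum (K ` {1..n}) \<otimes>\<^bsub>P\<^esub> arrow_sum sL) w =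
    (\<Sum>i\<in>{1..<n}. path_elem (2 * (i + 1), [L (i + 1), K i, R i]) w)"
proof (rule triple_product_sum)
  fix u p
  show "(\<exists>e3\<in>sL. \<exists>e2\<in>K ` {1..n}. \<exists>e1\<in>sR. p = [e3, e2, e1] \<and> u = toda_tail e3 \<and>
       toda_tail e2 = toda_head e3 \<and> toda_tail e1 = toda_head e2) \<longleftrightarrow>
     (\<exists>i\<in>{1..<n}. (u, p) = (2 * (i + 1), [L (i + 1), K i, R i]))" (is "?l \<longleftrightarrow> ?r")
  proof
    assume ?l
    then obtain i j k where "p = [L i, K j, R k]" "u = 2 * i" "2 * j - 1 = 2 * i - 3" "2 * k = 2 * j"
      "2 \<le> i" "i \<le> n" "1 \<le> j" using assms by auto
    then show ?r by (intro bexI[of _ j]) auto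
  qed (use assms in auto)
qed (auto simp: inj_on_def)

text \<open>The derivatives in the arrows of kind \<open>L\<close> exchange a and b across r. The
  arrows are indexed as \<open>L (Suc i)\<close> so that the derivatives and the words run over the
  same range.\<close>

lemma relation_BRA:
  "cls (arrow_sum sB) \<otimes>\<^bsub>Jac\<^esub> cls (arrow_sum sR) \<otimes>\<^bsub>Jac\<^esub> cls (arrow_sum sA) =
   cls (arrow_sum sA) \<otimes>\<^bsub>Jac\<^esub> cls (arrow_sum sR) \<otimes>\<^bsub>Jac\<^esub> cls (arrow_sum sB)"
proof (rule relation_in_J[where F = "(\<lambda>i. L (Suc i)) ` {1..<n}" and s = 1])
  show "(arrow_sum sB \<otimes>\<^bsub>P\<^esub> arrow_sum sR \<otimes>\<^bsub>P\<^esub> arrow_sum sA) (u, p) -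
      (arrow_sum sA \<otimes>\<^bsub>P\<^esub> arrow_sum sR \<otimes>\<^bsub>P\<^esub> arrow_sum sB) (u, p) =
      (\<Sum>a\<in>(\<lambda>i. L (Suc i)) ` {1..<n}. 1 * cyclic_derivative Q a (toda_potential n) (u, p))" for u p
    unfolding product_BRA product_ARB
    by (subst sum.reindex) (auto simp: inj_on_def cyclic_derivative_L sum_subtractf[symmetric]
        simp del: toda_quiver_simps intro!: sum.cong)
qed auto

lemma relation_ALB:
  "cls (arrow_sum sA) \<otimes>\<^bsub>Jac\<^esub> cls (arrow_sum sL) \<otimes>\<^bsub>Jac\<^esub> cls (arrow_sum sB) =
   cls (arrow_sum sB) \<otimes>\<^bsub>Jac\<^esub> cls (arrow_sum sL) \<otimes>\<^bsub>Jac\<^esub> cls (arrow_sum sA)"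
proof (rule relation_in_J[where F = sR and s = 1])
  show "(arrow_sum sA \<otimes>\<^bsub>P\<^esub> arrow_sum sL \<otimes>\<^bsub>P\<^esub> arrow_sum sB) (u, p) -
      (arrow_sum sB \<otimes>\<^bsub>P\<^esub> arrow_sum sL \<otimes>\<^bsub>P\<^esub> arrow_sum sA) (u, p) =
      (\<Sum>a\<in>sR. 1 * cyclic_derivative Q a (toda_potential n) (u, p))" for u p
    unfolding product_ALB product_BLA
    by (subst sum.reindex) (auto simp: inj_on_def cyclic_derivative_R sum_subtractf[symmetric]
        simp del: toda_quiver_simps intro!: sum.cong)
qed auto

text \<open>The terms missing at the two ends make both sums run over \<open>{1..<n}\<close>, after
  a shift of the index in the second one.\<close>

lemma sum_boundary:
  fixes f g :: "nat \<Rightarrow> complex"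
  shows "(\<Sum>i\<in>{1..n}. (if i < n then f i else 0) - (if 2 \<le> i then g i else 0)) =
    (\<Sum>i\<in>{1..<n}. f i) - (\<Sum>i\<in>{1..<n}. g (i + 1))"
proof -
  have "(\<Sum>i\<in>{1..n}. if i < n then f i else 0) = (\<Sum>i\<in>{1..<n}. f i)"
    by (rule sum.mono_neutral_cong_right) auto
  moreover have "(\<Sum>i\<in>{1..n}. if 2 \<le> i then g i else 0) = (\<Sum>i\<in>{Suc 1..<Suc n}. g i)"
    by (rule sum.mono_neutral_cong_right) auto
  ultimately show ?thesis by (simp add: sum_subtractf sum.shift_bounds_Suc_ivl del: sum.op_ivl_Suc)
qed

text \<open>Here the arrows of kind \<open>A\<close> are used. At an outer column only one of the
  two words is composable, in accordance with the single term of the derivative there, so the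
  relation has no exceptions.\<close>

lemma relation_LBR:
  "cls (arrow_sum sL) \<otimes>\<^bsub>Jac\<^esub> cls (arrow_sum sB) \<otimes>\<^bsub>Jac\<^esub> cls (arrow_sum sR) =
   cls (arrow_sum sR) \<otimes>\<^bsub>Jac\<^esub> cls (arrow_sum sB) \<otimes>\<^bsub>Jac\<^esub> cls (arrow_sum sL)"
proof (rule relation_in_J[where F = sA and s = 1])
  fix u p
  have "(\<Sum>a\<in>sA. 1 * cyclic_derivative Q a (toda_potential n) (u, p)) =
    (\<Sum>i\<in>{1..n}. (if i < n then path_elem (2 * i, [R i, B (i + 1), L (i + 1)]) (u, p) else 0) -
       (if 2 \<le> i then path_elem (2 * i, [L i, B (i - 1), R (i - 1)]) (u, p) else 0))"
    by (subst sum.reindex) (auto simp: inj_on_def cyclic_derivative_A simp del: toda_quiver_simps intro!: sum.cong)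
  then show "(arrow_sum sL \<otimes>\<^bsub>P\<^esub> arrow_sum sB \<otimes>\<^bsub>P\<^esub> arrow_sum sR) (u, p) -
      (arrow_sum sR \<otimes>\<^bsub>P\<^esub> arrow_sum sB \<otimes>\<^bsub>P\<^esub> arrow_sum sL) (u, p) =
      (\<Sum>a\<in>sA. 1 * cyclic_derivative Q a (toda_potential n) (u, p))"
    by (simp only: sum_boundary product_LKR[of B] product_RKL[of B] diff_add_inverse2 simp_thms)
qed auto

lemma relation_LAR:
  "cls (arrow_sum sL) \<otimes>\<^bsub>Jac\<^esub> cls (arrow_sum sA) \<otimes>\<^bsub>Jac\<^esub> cls (arrow_sum sR) =
   cls (arrow_sum sR) \<otimes>\<^bsub>Jac\<^esub> cls (arrow_sum sA) \<otimes>\<^bsub>Jac\<^esub> cls (arrow_sum sL)"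
\<comment> \<open>The derivatives in the arrows of kind \<open>B\<close> carry the opposite
  sign.\<close>
proof (rule relation_in_J[where F = sB and s = "-1"])
  fix u p
  have "(\<Sum>a\<in>sB. - 1 * cyclic_derivative Q a (toda_potential n) (u, p)) =
    (\<Sum>i\<in>{1..n}. (if i < n then path_elem (2 * i, [R i, A (i + 1), L (i + 1)]) (u, p) else 0) -
       (if 2 \<le> i then path_elem (2 * i, [L i, A (i - 1), R (i - 1)]) (u, p) else 0))"
    by (subst sum.reindex) (auto simp: inj_on_def cyclic_derivative_B simp del: toda_quiver_simps intro!: sum.cong)
  then show "(arrow_sum sL \<otimes>\<^bsub>P\<^esub> arrow_sum sA \<otimes>\<^bsub>P\<^esub> arrow_sum sR) (u, p) -
      (arrow_sum sR \<otimes>\<^bsub>P\<^esub> arrow_sum sA \<otimes>\<^bsub>P\<^esub> arrow_sum sL) (u, p) =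
      (\<Sum>a\<in>sB. - 1 * cyclic_derivative Q a (toda_potential n) (u, p))"
    by (simp only: sum_boundary product_LKR[of A] product_RKL[of A] diff_add_inverse2 simp_thms)
qed auto

definition "eJ j = cls (vertex_elem n j)"
definition "aJ = cls (arrow_sum sA)"
definition "bJ = cls (arrow_sum sB)"
definition "lJ = cls (arrow_sum sL)"
definition "rJ = cls (arrow_sum sR)"

lemma vertex_elem_closed [simp]: "vertex_elem n j \<in> carrier P"
  by (auto simp: vertex_elem_def carrier_cpa path_elem_def)

lemma cls_closed [simp]: "x \<in> carrier P \<Longrightarrow> cls x \<in> carrier Jac"
  by (rule ring_hom_closed[OF cls_hom])

lemma cls_zero: "cls (\<lambda>_. 0) = \<zero>\<^bsub>Jac\<^esub>"
  using ring_hom_zero[OF cls_hom P.ring_axioms J.ring_axioms] by (simp add: zero_cpa)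

lemma eJ_not_vertex: "j \<notin> {1..2 * n} \<Longrightarrow> eJ j = \<zero>\<^bsub>Jac\<^esub>"
  unfolding eJ_def vertex_elem_def by (auto simp: cls_zero)

lemma cls_mult: "x \<in> carrier P \<Longrightarrow> y \<in> carrier P \<Longrightarrow> cls x \<otimes>\<^bsub>Jac\<^esub> cls y = cls (x \<otimes>\<^bsub>P\<^esub> y)"
  using ring_hom_mult[OF cls_hom] by simp

lemma vertex_shift:
  assumes "S \<subseteq> arcs Q" "\<And>e. e \<in> S \<Longrightarrow> toda_head e = j \<longleftrightarrow> toda_tail e = k"
  shows "eJ j \<otimes>\<^bsub>Jac\<^esub> cls (arrow_sum S) = cls (arrow_sum S) \<otimes>\<^bsub>Jac\<^esub> eJ k"
proof -
  have v: "toda_tail e \<in> {1..2 * n} \<and> toda_head e \<in> {1..2 * n}" if "e \<in> S" for e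
  proof -
    have "e \<in> arcs Q" using assms(1) that by blast
    from tail_in_verts[OF this] head_in_verts[OF this] show ?thesis by simp
  qed
  have "(vertex_elem n j \<otimes>\<^bsub>P\<^esub> arrow_sum S) w = (arrow_sum S \<otimes>\<^bsub>P\<^esub> vertex_elem n k) w" for w
  proof (cases w)
    case (Pair u p)
    show ?thesis
    proof (cases "\<exists>e\<in>S. u = toda_tail e \<and> p = [e]")
      case True
      then obtain e where "e \<in> S" "u = toda_tail e" "p = [e]" by blast
      then show ?thesis
        using assms(2)[of e] v[of e] by (auto simp: Pair vertex_elem_mult mult_vertex_elem)
    next
      case False
      then have "arrow_sum S (u, p) = 0" by (simp only: arrow_sum_apply if_False)
      then show ?thesis by (auto simp: Pair vertex_elem_mult mult_vertex_elem)
    qed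
  qed
  then have "vertex_elem n j \<otimes>\<^bsub>P\<^esub> arrow_sum S = arrow_sum S \<otimes>\<^bsub>P\<^esub> vertex_elem n k"
    by blast
  then show ?thesis
    using assms(1) by (simp add: eJ_def cls_mult arrow_sum_closed)
qed

text \<open>Valid for every \<open>i\<close>: if one of the indices is not a vertex, both sides are
  zero.\<close>

lemma eJ_aJ: "eJ (2 * i) \<otimes>\<^bsub>Jac\<^esub> aJ = aJ \<otimes>\<^bsub>Jac\<^esub> eJ (2 * i - 1)"
  and eJ_bJ: "eJ (2 * i) \<otimes>\<^bsub>Jac\<^esub> bJ = bJ \<otimes>\<^bsub>Jac\<^esub> eJ (2 * i - 1)"
  and eJ_rJ: "eJ (2 * i + 1) \<otimes>\<^bsub>Jac\<^esub> rJ = rJ \<otimes>\<^bsub>Jac\<^esub> eJ (2 * i)"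
  and eJ_lJ: "eJ (2 * i + 1) \<otimes>\<^bsub>Jac\<^esub> lJ = lJ \<otimes>\<^bsub>Jac\<^esub> eJ (2 * (i + 2))"
  unfolding aJ_def bJ_def rJ_def lJ_def by (rule vertex_shift; auto)+

section \<open>Normal forms of paths\<close>

definition Klist where "Klist s t = replicate s aJ @ replicate t bJ"
definition Slist where "Slist p q = replicate p rJ @ replicate q lJ"

lemma letters_closed [simp]: "aJ \<in> carrier Jac" "bJ \<in> carrier Jac" "lJ \<in> carrier Jac" "rJ \<in> carrier Jac" "eJ j \<in> carrier Jac"
  unfolding aJ_def bJ_def rJ_def lJ_def eJ_def
  by (intro cls_closed arrow_sums_closed vertex_elem_closed)+

lemma set_Klist: "set (Klist s t) \<subseteq> {aJ, bJ}" and set_Slist: "set (Slist p q) \<subseteq> {lJ, rJ}"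
  by (auto simp: Klist_def Slist_def)

lemma KSlist_closed [simp]: "set (Klist s t) \<subseteq> carrier Jac" "set (Slist p q) \<subseteq> carrier Jac"
  using set_Klist[of s t] set_Slist[of p q] by (auto intro: letters_closed)

lemma length_KSlist [simp]: "length (Klist s t) = s + t" "length (Slist p q) = p + q"
  by (simp_all add: Klist_def Slist_def)

lemma relK: "x \<in> {aJ, bJ} \<Longrightarrow> x' \<in> {aJ, bJ} \<Longrightarrow> y \<in> {lJ, rJ} \<Longrightarrow>
    x \<otimes>\<^bsub>Jac\<^esub> y \<otimes>\<^bsub>Jac\<^esub> x' = x' \<otimes>\<^bsub>Jac\<^esub> y \<otimes>\<^bsub>Jac\<^esub> x"
  using relation_BRA relation_ALB unfolding aJ_def bJ_def rJ_def lJ_def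
  by (elim insertE emptyE) (simp_all only:)

lemma relS: "x \<in> {lJ, rJ} \<Longrightarrow> x' \<in> {lJ, rJ} \<Longrightarrow> y \<in> {aJ, bJ} \<Longrightarrow>
    x \<otimes>\<^bsub>Jac\<^esub> y \<otimes>\<^bsub>Jac\<^esub> x' = x' \<otimes>\<^bsub>Jac\<^esub> y \<otimes>\<^bsub>Jac\<^esub> x"
  using relation_LBR relation_LAR unfolding aJ_def bJ_def rJ_def lJ_def
  by (elim insertE emptyE) (simp_all only:)

lemma alt_congK1: "set xs \<subseteq> {aJ, bJ} \<Longrightarrow> set ys \<subseteq> {lJ, rJ} \<Longrightarrow> mset xs = mset xs' \<Longrightarrow> length xs \<le> Suc (length ys) \<Longrightarrow>
    J.alt xs ys = J.alt xs' ys"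
proof (rule J.alt_cong_mset1[where X = "{aJ, bJ}" and Y = "{lJ, rJ}"])
  show "x \<otimes>\<^bsub>Jac\<^esub> y \<otimes>\<^bsub>Jac\<^esub> x' = x' \<otimes>\<^bsub>Jac\<^esub> y \<otimes>\<^bsub>Jac\<^esub> x" if "x \<in> {aJ, bJ}" "x' \<in> {aJ, bJ}" "y \<in> {lJ, rJ}" for x x' y
    using that by (rule relK)
qed simp_all

lemma alt_congK2: "set xs \<subseteq> {aJ, bJ} \<Longrightarrow> set ys \<subseteq> {lJ, rJ} \<Longrightarrow> mset xs = mset xs' \<Longrightarrow> length xs \<le> length ys \<Longrightarrow>
    J.alt ys xs = J.alt ys xs'"
proof (rule J.alt_cong_mset2[where X = "{aJ, bJ}" and Y = "{lJ, rJ}"])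
  show "x \<otimes>\<^bsub>Jac\<^esub> y \<otimes>\<^bsub>Jac\<^esub> x' = x' \<otimes>\<^bsub>Jac\<^esub> y \<otimes>\<^bsub>Jac\<^esub> x" if "x \<in> {aJ, bJ}" "x' \<in> {aJ, bJ}" "y \<in> {lJ, rJ}" for x x' y
    using that by (rule relK)
qed simp_all

lemma alt_congS1: "set xs \<subseteq> {lJ, rJ} \<Longrightarrow> set ys \<subseteq> {aJ, bJ} \<Longrightarrow> mset xs = mset xs' \<Longrightarrow> length xs \<le> Suc (length ys) \<Longrightarrow>
    J.alt xs ys = J.alt xs' ys"
proof (rule J.alt_cong_mset1[where X = "{lJ, rJ}" and Y = "{aJ, bJ}"])
  show "x \<otimes>\<^bsub>Jac\<^esub> y \<otimes>\<^bsub>Jac\<^esub> x' = x' \<otimes>\<^bsub>Jac\<^esub> y \<otimes>\<^bsub>Jac\<^esub> x" if "x \<in> {lJ, rJ}" "x' \<in> {lJ, rJ}" "y \<in> {aJ, bJ}" for x x' y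
    using that by (rule relS)
qed simp_all

lemma alt_congS2: "set xs \<subseteq> {lJ, rJ} \<Longrightarrow> set ys \<subseteq> {aJ, bJ} \<Longrightarrow> mset xs = mset xs' \<Longrightarrow> length xs \<le> length ys \<Longrightarrow>
    J.alt ys xs = J.alt ys xs'"
proof (rule J.alt_cong_mset2[where X = "{lJ, rJ}" and Y = "{aJ, bJ}"])
  show "x \<otimes>\<^bsub>Jac\<^esub> y \<otimes>\<^bsub>Jac\<^esub> x' = x' \<otimes>\<^bsub>Jac\<^esub> y \<otimes>\<^bsub>Jac\<^esub> x" if "x \<in> {lJ, rJ}" "x' \<in> {lJ, rJ}" "y \<in> {aJ, bJ}" for x x' y
    using that by (rule relS)
qed simp_all

text \<open>The product of letters in the order in which they occur at the target \<open>v\<close> of a walk with the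
  given content.\<close>

fun normal_form :: "nat \<Rightarrow> nat \<times> nat \<times> nat \<times> nat \<Rightarrow> ((nat, toda_arrow) path \<Rightarrow> complex) set" where
  "normal_form v (p, q, s, t) = eJ v \<otimes>\<^bsub>Jac\<^esub>
     (if even v then J.alt (Klist s t) (Slist p q) else J.alt (Slist p q) (Klist s t))"

lemma normal_form_closed [simp]: "normal_form v w \<in> carrier Jac"
  by (cases w) simp

text \<open>A word at an even \<open>v\<close> starts with a or b, at an odd \<open>v\<close> with l
  or r. The parity hypothesis thus says that the word ends where a letter a or b is due; the
  appended letter is then moved to its sorted place.\<close>

lemma normal_form_mult_K:
  assumes "s + t + v mod 2 = p + q" "x \<in> {aJ, bJ}" "mset (Klist s t @ [x]) = mset (Klist s' t')"
  shows "normal_form v (p, q, s, t) \<otimes>\<^bsub>Jac\<^esub> x = normal_form v (p, q, s', t')"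
proof -
  have x: "x \<in> carrier Jac" and X: "set (Klist s t @ [x]) \<subseteq> {aJ, bJ}"
    using assms(2) set_Klist[of s t] by (auto intro: letters_closed)
  show ?thesis
  proof (cases "even v")
    case True
    then have "s + t = p + q" using assms(1) by presburger
    then show ?thesis
      using True x alt_congK1[OF X set_Slist[of p q] assms(3)]
      by (simp add: J.m_assoc J.alt_snoc1[symmetric])
  next
    case False
    then have "p + q = Suc (s + t)" using assms(1) by presburger
    then show ?thesis
      using False x alt_congK2[OF X set_Slist[of p q] assms(3)]
      by (simp add: J.m_assoc J.alt_snoc2[symmetric])
  qed
qed

lemma normal_form_mult_S:
  assumes "s + t + v mod 2 = p + q + 1" "x \<in> {lJ, rJ}" "mset (Slist p q @ [x]) = mset (Slist p' q')"
  shows "normal_form v (p, q, s, t) \<otimes>\<^bsub>Jac\<^esub> x = normal_form v (p', q', s, t)"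
proof -
  have x: "x \<in> carrier Jac" and X: "set (Slist p q @ [x]) \<subseteq> {lJ, rJ}"
    using assms(2) set_Slist[of p q] by (auto intro: letters_closed)
  show ?thesis
  proof (cases "even v")
    case True
    then have "s + t = Suc (p + q)" using assms(1) by presburger
    then show ?thesis
      using True x alt_congS2[OF X set_Klist[of s t] assms(3)]
      by (simp add: J.m_assoc J.alt_snoc2[symmetric])
  next
    case False
    then have "s + t = p + q" using assms(1) by presburger
    then show ?thesis
      using False x alt_congS1[OF X set_Klist[of s t] assms(3)]
      by (simp add: J.m_assoc J.alt_snoc1[symmetric])
  qed
qed

text \<open>A letter a or b followed by r carries the idempotent from the vertex
  \<open>2 * i\<close> to \<open>2 * (i - 1)\<close>. After \<open>i\<close> rounds it stands at
  \<open>0\<close>, which is not a vertex. The length bound keeps the word from being cut off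
  earlier.\<close>

lemma eJ_alt_r:
  "set K \<subseteq> {aJ, bJ} \<Longrightarrow> set S \<subseteq> {lJ, rJ} \<Longrightarrow> i + length S \<le> length K \<Longrightarrow>
    eJ (2 * i) \<otimes>\<^bsub>Jac\<^esub> J.alt K (replicate i rJ @ S) = \<zero>\<^bsub>Jac\<^esub>"
proof (induction i arbitrary: K)
  case 0
  have "set K \<subseteq> carrier Jac" "set S \<subseteq> carrier Jac"
    using 0 by (auto intro: letters_closed)
  then show ?case using eJ_not_vertex[of 0] by simp
next
  case (Suc i)
  then obtain k K' where K: "K = k # K'" by (cases K) auto
  have S: "set (replicate i rJ @ S) \<subseteq> {lJ, rJ}" using Suc.prems by auto
  have c: "set K' \<subseteq> carrier Jac" "set (replicate i rJ @ S) \<subseteq> carrier Jac" "k \<in> carrier Jac"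
  proof -
    show "set K' \<subseteq> carrier Jac" by (rule order_trans[of _ "{aJ, bJ}"]) (use Suc.prems K in auto)
    show "set (replicate i rJ @ S) \<subseteq> carrier Jac" by (rule order_trans[OF S]) simp
    have "k = aJ \<or> k = bJ" using Suc.prems(1) K by auto
    then show "k \<in> carrier Jac" by (elim disjE) simp_all
  qed
  have e: "eJ (2 * Suc i) \<otimes>\<^bsub>Jac\<^esub> k = k \<otimes>\<^bsub>Jac\<^esub> eJ (2 * i + 1)"
    using Suc.prems(1) K eJ_aJ[of "Suc i"] eJ_bJ[of "Suc i"] by auto
  have "eJ (2 * Suc i) \<otimes>\<^bsub>Jac\<^esub> J.alt K (replicate (Suc i) rJ @ S) =
    (eJ (2 * Suc i) \<otimes>\<^bsub>Jac\<^esub> k) \<otimes>\<^bsub>Jac\<^esub> (rJ \<otimes>\<^bsub>Jac\<^esub> J.alt K' (replicate i rJ @ S))"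
    using c by (simp add: K J.m_assoc)
  also have "\<dots> = k \<otimes>\<^bsub>Jac\<^esub> ((eJ (2 * i + 1) \<otimes>\<^bsub>Jac\<^esub> rJ) \<otimes>\<^bsub>Jac\<^esub> J.alt K' (replicate i rJ @ S))"
    unfolding e using c by (simp add: J.m_assoc)
  also have "\<dots> = k \<otimes>\<^bsub>Jac\<^esub> (rJ \<otimes>\<^bsub>Jac\<^esub> (eJ (2 * i) \<otimes>\<^bsub>Jac\<^esub> J.alt K' (replicate i rJ @ S)))"
    unfolding eJ_rJ using c by (simp add: J.m_assoc)
  also have "eJ (2 * i) \<otimes>\<^bsub>Jac\<^esub> J.alt K' (replicate i rJ @ S) = \<zero>\<^bsub>Jac\<^esub>"
    using Suc.prems K by (intro Suc.IH) auto
  finally show ?case using c by simp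
qed

text \<open>With l in place of r each round leads one column up, and \<open>j\<close> rounds lead
  from column \<open>i\<close> to \<open>n + 1\<close>, beyond the last vertex.\<close>

lemma eJ_alt_l:
  "set K \<subseteq> {aJ, bJ} \<Longrightarrow> set S \<subseteq> {lJ, rJ} \<Longrightarrow> j + length S \<le> length K \<Longrightarrow> i + j = n + 1 \<Longrightarrow>
    eJ (2 * i) \<otimes>\<^bsub>Jac\<^esub> J.alt K (replicate j lJ @ S) = \<zero>\<^bsub>Jac\<^esub>"
proof (induction j arbitrary: K i)
  case 0
  have "set K \<subseteq> carrier Jac" "set S \<subseteq> carrier Jac"
    using 0 by (auto intro: letters_closed)
  then show ?case using eJ_not_vertex[of "2 * i"] 0 by simp
next
  case (Suc j)
  then obtain k K' where K: "K = k # K'" by (cases K) auto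
  have S: "set (replicate j lJ @ S) \<subseteq> {lJ, rJ}" using Suc.prems by auto
  have c: "set K' \<subseteq> carrier Jac" "set (replicate j lJ @ S) \<subseteq> carrier Jac" "k \<in> carrier Jac"
  proof -
    show "set K' \<subseteq> carrier Jac" by (rule order_trans[of _ "{aJ, bJ}"]) (use Suc.prems K in auto)
    show "set (replicate j lJ @ S) \<subseteq> carrier Jac" by (rule order_trans[OF S]) simp
    have "k = aJ \<or> k = bJ" using Suc.prems(1) K by auto
    then show "k \<in> carrier Jac" by (elim disjE) simp_all
  qed
  show ?case
  proof (cases i)
    case 0
    then show ?thesis using eJ_not_vertex[of 0] c K by (simp add: J.m_assoc)
  next
    case (Suc i')
    have e: "eJ (2 * i) \<otimes>\<^bsub>Jac\<^esub> k = k \<otimes>\<^bsub>Jac\<^esub> eJ (2 * i' + 1)"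
      using Suc.prems(1) K eJ_aJ[of i] eJ_bJ[of i] Suc by auto
    have l: "eJ (2 * i' + 1) \<otimes>\<^bsub>Jac\<^esub> lJ = lJ \<otimes>\<^bsub>Jac\<^esub> eJ (2 * (i + 1))"
      using eJ_lJ[of i'] unfolding Suc by (simp only: add_2_eq_Suc' Suc_eq_plus1)
    have "eJ (2 * i) \<otimes>\<^bsub>Jac\<^esub> J.alt K (replicate (Suc j) lJ @ S) =
      (eJ (2 * i) \<otimes>\<^bsub>Jac\<^esub> k) \<otimes>\<^bsub>Jac\<^esub> (lJ \<otimes>\<^bsub>Jac\<^esub> J.alt K' (replicate j lJ @ S))"
      using c by (simp add: K J.m_assoc)
    also have "\<dots> = k \<otimes>\<^bsub>Jac\<^esub> ((eJ (2 * i' + 1) \<otimes>\<^bsub>Jac\<^esub> lJ) \<otimes>\<^bsub>Jac\<^esub> J.alt K' (replicate j lJ @ S))"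
      unfolding e using c by (simp add: J.m_assoc)
    also have "\<dots> = k \<otimes>\<^bsub>Jac\<^esub> (lJ \<otimes>\<^bsub>Jac\<^esub> (eJ (2 * (i + 1)) \<otimes>\<^bsub>Jac\<^esub> J.alt K' (replicate j lJ @ S)))"
      unfolding l using c by (simp add: J.m_assoc)
    also have "eJ (2 * (i + 1)) \<otimes>\<^bsub>Jac\<^esub> J.alt K' (replicate j lJ @ S) = \<zero>\<^bsub>Jac\<^esub>"
      using Suc.prems K by (intro Suc.IH) auto
    finally show ?thesis using c by simp
  qed
qed

text \<open>The letters r, or the letters l, can be sorted in front of the others of their kind. If
  \<open>v\<close> lies in column \<open>m\<close>, then \<open>m\<close> letters r, or
  \<open>n + 1 - m\<close> letters l, push the idempotent out of the quiver.\<close>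

lemma normal_form_zero:
  assumes l: "s + t + v mod 2 = p + q \<or> s + t + v mod 2 = p + q + 1"
    and large: "p \<ge> (v + 1) div 2 \<or> q + (v + 1) div 2 > n"
  shows "normal_form v (p, q, s, t) = \<zero>\<^bsub>Jac\<^esub>"
proof -
  define m where "m = (v + 1) div 2"
  have lm: "p \<ge> m \<or> n < q + m" using large by (simp add: m_def)
  let ?S = "if p \<ge> m then replicate m rJ @ Slist (p - m) q else replicate (n + 1 - m) lJ @ Slist p (q - (n + 1 - m))"
  have ms: "mset (Slist p q) = mset ?S"
  proof (cases "p \<ge> m")
    case True
    then show ?thesis
      by (simp add: Slist_def replicate_add[symmetric] flip: append_assoc)
  next
    case False
    then have "q = n + 1 - m + (q - (n + 1 - m))" using lm by simp
    then have "replicate q lJ = replicate (n + 1 - m) lJ @ replicate (q - (n + 1 - m)) lJ"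
      using replicate_add[of "n + 1 - m" "q - (n + 1 - m)" lJ] by (simp only:)
    then show ?thesis using False by (simp add: Slist_def)
  qed
  have zero: "v > 2 * n \<Longrightarrow> eJ v = \<zero>\<^bsub>Jac\<^esub>" by (rule eJ_not_vertex) auto
  show ?thesis
  proof (cases "v \<le> 2 * n")
    case False
    then show ?thesis using zero by simp
  next
    case True
    then have m: "m \<le> n" by (auto simp: m_def)
    show ?thesis
    proof (cases "even v")
      case True
      then have v: "v = 2 * m" by (auto simp: m_def elim!: evenE)
      have "J.alt (Klist s t) (Slist p q) = J.alt (Klist s t) ?S"
        using l ms True by (intro alt_congS2) (auto simp: set_Slist set_Klist)
      moreover have "eJ (2 * m) \<otimes>\<^bsub>Jac\<^esub> J.alt (Klist s t) ?S = \<zero>\<^bsub>Jac\<^esub>"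
      proof (cases "p \<ge> m")
        case True
        then show ?thesis
          using eJ_alt_r[OF set_Klist[of s t] set_Slist[of "p - m" q], of m] l v by auto
      next
        case False
        then show ?thesis
          using eJ_alt_l[OF set_Klist[of s t] set_Slist[of p "q - (n + 1 - m)"], of "n + 1 - m" m] l lm v m by auto
      qed
      ultimately show ?thesis using v by simp
    next
      case False
      then have v: "v = 2 * (m - 1) + 1" "m \<ge> 1" by (auto simp: m_def elim!: oddE)
      have vm: "v mod 2 = 1" using False by presburger
      have "J.alt (Slist p q) (Klist s t) = J.alt ?S (Klist s t)"
        using l ms vm by (intro alt_congS1) (auto simp: set_Slist set_Klist)
      moreover have "eJ v \<otimes>\<^bsub>Jac\<^esub> J.alt ?S (Klist s t) = \<zero>\<^bsub>Jac\<^esub>"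
      proof (cases "p \<ge> m")
        case True
        \<comment> \<open>For odd \<open>v\<close> the leading r is split off; it moves the
          idempotent to the even vertex \<open>2 * (m - 1)\<close>, where \<open>eJ_alt_r\<close>
          applies.\<close>
        define S' where "S' = replicate (m - 1) rJ @ Slist (p - m) q"
        have S: "?S = rJ # S'" using True v(2) by (cases m) (auto simp: S'_def)
        have c: "set S' \<subseteq> carrier Jac" by (auto simp: S'_def Slist_def)
        have z: "eJ (2 * (m - 1)) \<otimes>\<^bsub>Jac\<^esub> J.alt (Klist s t) S' = \<zero>\<^bsub>Jac\<^esub>"
          unfolding S'_def using l v True vm by (intro eJ_alt_r set_Slist set_Klist) auto
        have "eJ v \<otimes>\<^bsub>Jac\<^esub> J.alt ?S (Klist s t) = (eJ v \<otimes>\<^bsub>Jac\<^esub> rJ) \<otimes>\<^bsub>Jac\<^esub> J.alt (Klist s t) S'"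
          unfolding S using c by (simp add: J.m_assoc)
        also have "\<dots> = rJ \<otimes>\<^bsub>Jac\<^esub> (eJ (2 * (m - 1)) \<otimes>\<^bsub>Jac\<^esub> J.alt (Klist s t) S')"
          unfolding v(1) eJ_rJ using c by (simp add: J.m_assoc)
        finally show ?thesis using z by simp
      next
        case F: False
        define S' where "S' = replicate (n - m) lJ @ Slist p (q - (n + 1 - m))"
        have "n + 1 - m = Suc (n - m)" using m by simp
        then have S: "?S = lJ # S'" using F by (auto simp: S'_def)
        have c: "set S' \<subseteq> carrier Jac" by (auto simp: S'_def Slist_def)
        have z: "eJ (2 * (m + 1)) \<otimes>\<^bsub>Jac\<^esub> J.alt (Klist s t) S' = \<zero>\<^bsub>Jac\<^esub>"
          unfolding S'_def using l v F m lm vm by (intro eJ_alt_l set_Slist set_Klist) auto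
        have "m - 1 + 2 = m + 1" using v(2) by simp
        then have l: "eJ v \<otimes>\<^bsub>Jac\<^esub> lJ = lJ \<otimes>\<^bsub>Jac\<^esub> eJ (2 * (m + 1))"
          unfolding v(1) eJ_lJ by (simp only:)
        have "eJ v \<otimes>\<^bsub>Jac\<^esub> J.alt ?S (Klist s t) = (eJ v \<otimes>\<^bsub>Jac\<^esub> lJ) \<otimes>\<^bsub>Jac\<^esub> J.alt (Klist s t) S'"
          unfolding S using c by (simp add: J.m_assoc)
        also have "\<dots> = lJ \<otimes>\<^bsub>Jac\<^esub> (eJ (2 * (m + 1)) \<otimes>\<^bsub>Jac\<^esub> J.alt (Klist s t) S')"
          unfolding l using c by (simp add: J.m_assoc)
        finally show ?thesis using z by simp
      qed
      ultimately show ?thesis using False by simp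
    qed
  qed
qed

text \<open>The idempotent at the tail cuts a single arrow out of the sum of its kind, since no
  other arrow of that kind starts there.\<close>

lemma cls_path_Cons:
  assumes "(u, e # p) \<in> paths Q"
  shows "cls (path_elem (u, e # p)) =
    cls (path_elem (toda_head e, p)) \<otimes>\<^bsub>Jac\<^esub> (case e of A i \<Rightarrow> aJ | B i \<Rightarrow> bJ | L i \<Rightarrow> lJ | R i \<Rightarrow> rJ) \<otimes>\<^bsub>Jac\<^esub> eJ u"
proof -
  define S where "S = (case e of A i \<Rightarrow> sA | B i \<Rightarrow> sB | L i \<Rightarrow> sL | R i \<Rightarrow> sR)"
  have e: "e \<in> arcs Q" "u = toda_tail e" "(toda_head e, p) \<in> paths Q"
    using assms by (simp_all only: path_Cons_iff toda_quiver_simps)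
  have S: "S \<subseteq> arcs Q" "e \<in> S"
    using e(1) unfolding S_def by (cases e; auto)+
  have inj: "e' = e" if "e' \<in> S" "toda_tail e' = toda_tail e" for e'
    using that S(2) unfolding S_def by (cases e; cases e'; auto)
  have u: "u \<in> {1..2 * n}" using e tail_in_verts[OF e(1)] by simp
  have "path_elem (u, e # p) w =
      (path_elem (toda_head e, p) \<otimes>\<^bsub>P\<^esub> arrow_sum S \<otimes>\<^bsub>P\<^esub> vertex_elem n u) w" for w
    using S inj u by (cases w) (auto simp: mult_vertex_elem mult_arrow_sum path_elem_def e(2) split: list.splits)
  then have "path_elem (u, e # p) = path_elem (toda_head e, p) \<otimes>\<^bsub>P\<^esub> arrow_sum S \<otimes>\<^bsub>P\<^esub> vertex_elem n u"
    by blast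
  moreover have "cls (arrow_sum S) = (case e of A i \<Rightarrow> aJ | B i \<Rightarrow> bJ | L i \<Rightarrow> lJ | R i \<Rightarrow> rJ)"
    unfolding S_def aJ_def bJ_def lJ_def rJ_def by (cases e) simp_all
  ultimately show ?thesis
    using e(3) S(1) by (simp add: cls_mult[symmetric] eJ_def arrow_sum_closed)
qed

text \<open>Two conservation laws along a walk. The two kinds of letters alternate, so their numbers
  differ by what the parities of the ends prescribe; and a, b, r raise the vertex by 1 while l
  lowers it by 3. Hence the end and the content determine the start.\<close>

lemma content_parity:
  assumes "(u, p) \<in> paths Q" "path_end Q (u, p) = v" "content p = (r, l, s, t)"
  shows "s + t + v mod 2 = r + l + u mod 2" "u + r + s + t = v + 3 * l"
proof -
  have "s + t + v mod 2 = r + l + u mod 2 \<and> u + r + s + t = v + 3 * l"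
    using assms
  proof (induction p arbitrary: u r l s t)
    case (Cons e p)
    obtain r' l' s' t' where c: "content p = (r', l', s', t')" by (cases "content p")
    have e: "e \<in> arcs Q" "u = toda_tail e" "(toda_head e, p) \<in> paths Q"
      using Cons.prems(1) by (simp_all only: path_Cons_iff toda_quiver_simps)
    have "s' + t' + v mod 2 = r' + l' + toda_head e mod 2 \<and> toda_head e + r' + s' + t' = v + 3 * l'"
      using Cons.IH[OF e(3) _ c] Cons.prems(2) by simp
    note IH = this
    show ?case
    proof (cases e)
      case (A i)
      have eq: "r = r'" "l = l'" "s = s' + 1" "t = t'"
        using Cons.prems(3) c A by auto
      have "i \<ge> 1" using e(1) A by auto
      then have "u + 1 = toda_head e" "u mod 2 = 1" "toda_head e mod 2 = 0" unfolding e(2) A toda_head.simps toda_tail.simps by presburger+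
      then show ?thesis using IH unfolding eq by linarith
    next
      case (B i)
      have eq: "r = r'" "l = l'" "s = s'" "t = t' + 1"
        using Cons.prems(3) c B by auto
      have "i \<ge> 1" using e(1) B by auto
      then have "u + 1 = toda_head e" "u mod 2 = 1" "toda_head e mod 2 = 0" unfolding e(2) B toda_head.simps toda_tail.simps by presburger+
      then show ?thesis using IH unfolding eq by linarith
    next
      case (L i)
      have eq: "r = r'" "l = l' + 1" "s = s'" "t = t'"
        using Cons.prems(3) c L by auto
      have "i \<ge> 1" "i \<ge> 2" using e(1) L by auto
      then have "u = toda_head e + 3" "u mod 2 = 0" "toda_head e mod 2 = 1" unfolding e(2) L toda_head.simps toda_tail.simps by presburger+
      then show ?thesis using IH unfolding eq by simp
    next
      case (R i)
      have eq: "r = r' + 1" "l = l'" "s = s'" "t = t'"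
        using Cons.prems(3) c R by auto
      have "i \<ge> 1" using e(1) R by auto
      then have "u + 1 = toda_head e" "u mod 2 = 0" "toda_head e mod 2 = 1" unfolding e(2) R toda_head.simps toda_tail.simps by presburger+
      then show ?thesis using IH unfolding eq by linarith
    qed
  qed (auto simp: zero_prod_def)
  then show "s + t + v mod 2 = r + l + u mod 2" "u + r + s + t = v + 3 * l" by auto
qed

lemma eJ_idem: "eJ u \<otimes>\<^bsub>Jac\<^esub> eJ u = eJ u"
proof -
  have "vertex_elem n u (v, p) = (if v = u \<and> p = [] \<and> u \<in> {1..2 * n} then 1 else 0)" for v p
    by (simp add: vertex_elem_def path_elem_def)
  then have "(vertex_elem n u \<otimes>\<^bsub>P\<^esub> vertex_elem n u) w = vertex_elem n u w" for w
    by (cases w) (simp add: mult_vertex_elem)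
  then have "vertex_elem n u \<otimes>\<^bsub>P\<^esub> vertex_elem n u = vertex_elem n u" by blast
  then show ?thesis by (simp add: eJ_def cls_mult)
qed

text \<open>A letter traversed earlier stands further right in the product. Prepending an arrow to
  the list therefore multiplies the normal form of the rest on the right, and its parity hypothesis
  comes from \<open>content_parity\<close>.\<close>

lemma cls_path_elem:
  assumes "(u, p) \<in> paths Q" "path_end Q (u, p) = v"
  shows "cls (path_elem (u, p)) = normal_form v (content p) \<otimes>\<^bsub>Jac\<^esub> eJ u"
  using assms
proof (induction p arbitrary: u)
  case Nil
  then have u: "u = v" "u \<in> {1..2 * n}" by auto
  have "eJ u = cls (path_elem (u, []))" using u by (simp add: eJ_def vertex_elem_def)
  moreover have "normal_form v (content []) = eJ v"
    by (simp add: zero_prod_def Klist_def Slist_def)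
  ultimately show ?case using u eJ_idem[of u] by simp
next
  case (Cons e p)
  obtain r l s t where c: "content p = (r, l, s, t)" by (cases "content p")
  have e: "e \<in> arcs Q" "u = toda_tail e" "(toda_head e, p) \<in> paths Q"
    using Cons.prems(1) by (simp_all only: path_Cons_iff toda_quiver_simps)
  have IH: "cls (path_elem (toda_head e, p)) = normal_form v (r, l, s, t) \<otimes>\<^bsub>Jac\<^esub> eJ (toda_head e)"
    using Cons.IH[OF e(3)] Cons.prems(2) c by simp
  note par = content_parity(1)[OF e(3) _ c, of v]
  define x where "x = (case e of A i \<Rightarrow> aJ | B i \<Rightarrow> bJ | L i \<Rightarrow> lJ | R i \<Rightarrow> rJ)"
  have x: "x \<in> carrier Jac" by (cases e) (simp_all add: x_def)
  have "eJ (toda_head e) \<otimes>\<^bsub>Jac\<^esub> x \<otimes>\<^bsub>Jac\<^esub> eJ u = x \<otimes>\<^bsub>Jac\<^esub> eJ u"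
  proof -
    have "eJ (toda_head e) \<otimes>\<^bsub>Jac\<^esub> x = x \<otimes>\<^bsub>Jac\<^esub> eJ u"
    proof (cases e)
      case (A i)
      then show ?thesis using eJ_aJ[of i] by (simp add: x_def e(2))
    next
      case (B i)
      then show ?thesis using eJ_bJ[of i] by (simp add: x_def e(2))
    next
      case (R i)
      then show ?thesis using eJ_rJ[of i] by (simp add: x_def e(2))
    next
      case (L i)
      then have "2 \<le> i" using e(1) by auto
      then have "2 * (i - 2) + 1 = 2 * i - 3" "i - 2 + 2 = i" by auto
      then show ?thesis using eJ_lJ[of "i - 2"] L by (simp add: x_def e(2))
    qed
    then show ?thesis using x eJ_idem[of u] by (simp add: J.m_assoc)
  qed
  then have "cls (path_elem (u, e # p)) = normal_form v (r, l, s, t) \<otimes>\<^bsub>Jac\<^esub> x \<otimes>\<^bsub>Jac\<^esub> eJ u"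
    using cls_path_Cons[OF Cons.prems(1)] x unfolding IH x_def[symmetric]
    by (simp add: J.m_assoc del: normal_form.simps)
  also have "normal_form v (r, l, s, t) \<otimes>\<^bsub>Jac\<^esub> x = normal_form v (content (e # p))"
  proof (cases e)
    case (A i)
    then have "s + t + v mod 2 = r + l" using par Cons.prems(2) by simp
    then show ?thesis using A c unfolding x_def
      by (simp add: normal_form_mult_K[of s t v r l aJ "Suc s" t] Klist_def del: normal_form.simps)
  next
    case (B i)
    then have "s + t + v mod 2 = r + l" using par Cons.prems(2) by simp
    then show ?thesis using B c unfolding x_def
      by (simp add: normal_form_mult_K[of s t v r l bJ s "Suc t"] Klist_def del: normal_form.simps)
  next
    case (R i)
    then have "s + t + v mod 2 = r + l + 1" using par Cons.prems(2) by simp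
    then show ?thesis using R c unfolding x_def
      by (simp add: normal_form_mult_S[of s t v r l rJ "Suc r" l] Slist_def del: normal_form.simps)
  next
    case (L i)
    then have "2 \<le> i" using e(1) by auto
    then have "(2 * i - 3) mod 2 = 1" by presburger
    then have "s + t + v mod 2 = r + l + 1" using par Cons.prems(2) L by simp
    then show ?thesis using L c unfolding x_def
      by (simp add: normal_form_mult_S[of s t v r l lJ r "Suc l"] Slist_def del: normal_form.simps)
  qed
  finally show ?case .
qed

lemma cls_path_elem_eq:
  assumes "(u, p) \<in> paths Q" "(u', p') \<in> paths Q" "path_end Q (u, p) = path_end Q (u', p')"
    and "content p = content p'"
  shows "cls (path_elem (u, p)) = cls (path_elem (u', p'))"
proof -
  obtain r l s t where c: "content p = (r, l, s, t)" by (cases "content p")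
  have "u = u'"
    using content_parity(2)[OF assms(1) refl c] content_parity(2)[OF assms(2) assms(3)[symmetric], of r l s t] c assms(4)
    by simp
  then show ?thesis
    using cls_path_elem[OF assms(1) refl] cls_path_elem[OF assms(2) refl] assms(3,4) by simp
qed

lemma cls_path_elem_zero:
  assumes "(u, p) \<in> paths Q" "path_end Q (u, p) = v" "content p = (r, l, s, t)"
    and "r \<ge> (v + 1) div 2 \<or> l + (v + 1) div 2 > n"
  shows "cls (path_elem (u, p)) = \<zero>\<^bsub>Jac\<^esub>"
proof -
  have "u mod 2 = 0 \<or> u mod 2 = 1" by auto
  then have "normal_form v (r, l, s, t) = \<zero>\<^bsub>Jac\<^esub>"
    using content_parity(1)[OF assms(1-3)] by (intro normal_form_zero assms(4)) linarith
  then show ?thesis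
    using cls_path_elem[OF assms(1,2)] assms(3) by simp
qed

lemma length_content: "content p = (r, l, s, t) \<Longrightarrow> length p = r + l + s + t"
proof (induction p arbitrary: r l s t)
  case (Cons e p)
  obtain r' l' s' t' where "content p = (r', l', s', t')" by (cases "content p")
  with Cons show ?case by (cases e) auto
qed (simp add: zero_prod_def)

text \<open>A path to column \<open>c\<close> that survives has fewer than \<open>c\<close> letters
  r and at most \<open>n - c\<close> letters l, so fewer than \<open>n\<close> of both together, and
  by alternation at most \<open>n\<close> letters a and b. The constant \<open>4 * n + 2\<close> is
  a generous bound for the total.\<close>

lemma long_paths_in_I:
  assumes "w \<in> paths Q" "length (snd w) \<ge> 4 * n + 2"
  shows "path_elem w \<in> I"
proof -
  obtain u p where w: "w = (u, p)" by (cases w)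
  define v where "v = path_end Q (u, p)"
  obtain r l s t where c: "content p = (r, l, s, t)" by (cases "content p")
  have up: "(u, p) \<in> paths Q" using assms w by simp
  have v: "v \<in> {1..2 * n}" using path_end_in_verts[OF up] by (simp add: v_def)
  have "r + l + s + t \<ge> 4 * n + 2" using length_content[OF c] assms w by simp
  moreover have "s + t \<le> r + l + 1"
    using content_parity(1)[OF up v_def[symmetric] c] mod_less_divisor[of 2 u] by linarith
  ultimately have "r \<ge> (v + 1) div 2 \<or> l + (v + 1) div 2 > n" using v by linarith
  then have "cls (path_elem (u, p)) = cls (\<lambda>_. 0)"
    using cls_path_elem_zero[OF up v_def[symmetric] c] cls_zero by simp
  then show ?thesis
    using up w by (subst (asm) cls_eq_iff) (auto simp: carrier_cpa path_elem_def)
qed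

end

section \<open>Matrices indexed by finite sets\<close>

text \<open>The injective modules have finite sets of monomials as bases, while matrices are indexed
  by numbers. An arbitrary enumeration mediates, and \<open>matI\<close> and \<open>vecI\<close>
  allow to calculate with the monomials themselves.\<close>

definition enum :: "'a set \<Rightarrow> 'a list" where
  "enum S = (SOME xs. set xs = S \<and> distinct xs)"

definition pos :: "'a set \<Rightarrow> 'a \<Rightarrow> nat" where
  "pos S x = (THE i. i < card S \<and> enum S ! i = x)"

definition matI :: "'a set \<Rightarrow> 'b set \<Rightarrow> ('a \<Rightarrow> 'b \<Rightarrow> complex) \<Rightarrow> complex mat" where
  "matI X Y F = mat (card X) (card Y) (\<lambda>(i, j). F (enum X ! i) (enum Y ! j))"

definition vecI :: "'a set \<Rightarrow> ('a \<Rightarrow> complex) \<Rightarrow> complex vec" where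
  "vecI S \<phi> = vec (card S) (\<lambda>i. \<phi> (enum S ! i))"

lemma enum:
  assumes "finite S"
  shows "set (enum S) = S" "distinct (enum S)" "length (enum S) = card S"
proof -
  have "set (enum S) = S \<and> distinct (enum S)"
    unfolding enum_def using finite_distinct_list[OF assms] by (rule someI_ex)
  then show "set (enum S) = S" "distinct (enum S)" "length (enum S) = card S"
    using distinct_card by fastforce+
qed

lemma enum_in: "finite S \<Longrightarrow> i < card S \<Longrightarrow> enum S ! i \<in> S"
  using enum[of S] nth_mem[of i "enum S"] by simp

lemma pos:
  assumes "finite S" "x \<in> S"
  shows "pos S x < card S" "enum S ! pos S x = x"
proof -
  obtain i where i: "i < card S" "enum S ! i = x"
    using assms enum[of S] by (metis in_set_conv_nth)
  have "pos S x < card S \<and> enum S ! pos S x = x"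
    unfolding pos_def
    by (rule theI[of _ i]) (use i enum[OF assms(1)] in \<open>auto simp: nth_eq_iff_index_eq\<close>)
  then show "pos S x < card S" "enum S ! pos S x = x" by auto
qed

lemma pos_enum: "finite S \<Longrightarrow> i < card S \<Longrightarrow> pos S (enum S ! i) = i"
  using pos[of S "enum S ! i"] enum_in[of S i] enum[of S] by (simp add: nth_eq_iff_index_eq)

lemma bij_betw_enum: "finite S \<Longrightarrow> bij_betw (\<lambda>i. enum S ! i) {..<card S} S"
  by (rule bij_betwI[where g = "pos S"]) (auto simp: enum_in pos pos_enum)

lemma sum_enum: "finite S \<Longrightarrow> (\<Sum>i<card S. f (enum S ! i)) = sum f S"
  by (rule sum.reindex_bij_betw[OF bij_betw_enum])

lemma matI_carrier [simp]: "matI X Y F \<in> carrier_mat (card X) (card Y)"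
  and dim_matI [simp]: "dim_row (matI X Y F) = card X" "dim_col (matI X Y F) = card Y"
  by (simp_all add: matI_def)

lemma vecI_carrier [simp]: "vecI S \<phi> \<in> carrier_vec (card S)"
  and dim_vecI [simp]: "dim_vec (vecI S \<phi>) = card S"
  by (simp_all add: vecI_def)

lemma vecI_pos: "finite S \<Longrightarrow> x \<in> S \<Longrightarrow> vecI S \<phi> $ pos S x = \<phi> x"
  by (simp add: vecI_def pos)

lemma matI_pos: "finite X \<Longrightarrow> finite Y \<Longrightarrow> r \<in> X \<Longrightarrow> c \<in> Y \<Longrightarrow> matI X Y F $$ (pos X r, pos Y c) = F r c"
  by (simp add: matI_def pos)

lemma vecI_surj: "finite S \<Longrightarrow> x \<in> carrier_vec (card S) \<Longrightarrow> vecI S (\<lambda>a. x $ pos S a) = x"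
  by (auto simp: vecI_def pos_enum)

lemma matI_surj: "finite X \<Longrightarrow> finite Y \<Longrightarrow> M \<in> carrier_mat (card X) (card Y) \<Longrightarrow>
    matI X Y (\<lambda>r c. M $$ (pos X r, pos Y c)) = M"
  by (auto simp: matI_def pos_enum)

lemma matI_cong: "finite X \<Longrightarrow> finite Y \<Longrightarrow> (\<And>r c. r \<in> X \<Longrightarrow> c \<in> Y \<Longrightarrow> F r c = G r c) \<Longrightarrow>
    matI X Y F = matI X Y G"
  by (auto simp: matI_def enum_in)

lemma vecI_cong: "finite S \<Longrightarrow> (\<And>x. x \<in> S \<Longrightarrow> \<phi> x = \<psi> x) \<Longrightarrow> vecI S \<phi> = vecI S \<psi>"
  by (auto simp: vecI_def enum_in)

lemma vecI_eq_iff: "finite S \<Longrightarrow> vecI S \<phi> = vecI S \<psi> \<longleftrightarrow> (\<forall>x\<in>S. \<phi> x = \<psi> x)"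
  using vecI_cong[of S \<phi> \<psi>] vecI_pos[of S _ \<phi>] vecI_pos[of S _ \<psi>] by auto

lemma matI_mult:
  assumes "finite Y"
  shows "matI X Y F * matI Y Z G = matI X Z (\<lambda>r d. \<Sum>c\<in>Y. F r c * G c d)"
  by (rule eq_matI) (auto simp: matI_def scalar_prod_def lessThan_atLeast0[symmetric] sum_enum[OF assms, symmetric])

lemma matI_mult_vecI:
  assumes "finite Y"
  shows "matI X Y F *\<^sub>v vecI Y \<phi> = vecI X (\<lambda>r. \<Sum>c\<in>Y. F r c * \<phi> c)"
  by (rule eq_vecI) (auto simp: matI_def vecI_def scalar_prod_def lessThan_atLeast0[symmetric] sum_enum[OF assms, symmetric])

lemma matI_one: "finite S \<Longrightarrow> matI S S (\<lambda>a b. if a = b then 1 else 0) = 1\<^sub>m (card S)"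
  by (rule eq_matI) (auto simp: matI_def enum nth_eq_iff_index_eq)

lemma matI_add: "matI X Y F + matI X Y G = matI X Y (\<lambda>r c. F r c + G r c)"
  by (rule eq_matI) (auto simp: matI_def)

lemma matI_smult: "a \<cdot>\<^sub>m matI X Y F = matI X Y (\<lambda>r c. a * F r c)"
  by (rule eq_matI) (auto simp: matI_def)

lemma matI_zero: "matI X Y (\<lambda>_ _. 0) = 0\<^sub>m (card X) (card Y)"
  by (rule eq_matI) (auto simp: matI_def)

section \<open>Injective envelopes\<close>

lemma path_elem_mult:
  fixes G :: "('v, 'e) pre_digraph"
  shows "path_elem (b, q) \<otimes>\<^bsub>completed_path_algebra G\<^esub> path_elem (a, p) =
    (if path_end G (a, p) = b then path_elem (a, p @ q) else (\<lambda>_. 0))"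
proof
  fix w :: "('v, 'e) path"
  obtain u r where w: "w = (u, r)" by (cases w)
  have "(path_elem (b, q) \<otimes>\<^bsub>completed_path_algebra G\<^esub> path_elem (a, p)) (u, r) =
    (\<Sum>i\<le>length r. if i = length p then (if path_end G (a, p) = b \<and> u = a \<and> r = p @ q then 1 else 0) else 0)"
    unfolding mult_cpa
  proof (intro sum.cong refl)
    fix i assume "i \<in> {..length r}"
    then have "take i r = p \<and> drop i r = q \<longleftrightarrow> i = length p \<and> r = p @ q"
      by (metis append_eq_conv_conj append_take_drop_id atMost_iff length_take min.absorb2)
    then consider "i = length p" "r = p @ q" | "take i r \<noteq> p \<or> drop i r \<noteq> q" "\<not> (i = length p \<and> r = p @ q)"
      by blast
    then show "path_elem (b, q) (path_end G (u, take i r), drop i r) * path_elem (a, p) (u, take i r) =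
        (if i = length p then (if path_end G (a, p) = b \<and> u = a \<and> r = p @ q then 1 else 0) else 0)"
    proof cases
      case 1
      then show ?thesis by (auto simp: path_elem_def)
    next
      case 2
      then show ?thesis by (simp add: path_elem_def) blast
    qed
  qed
  also have "\<dots> = (if path_end G (a, p) = b \<and> u = a \<and> r = p @ q then 1 else 0)"
    by auto
  finally show "(path_elem (b, q) \<otimes>\<^bsub>completed_path_algebra G\<^esub> path_elem (a, p)) w =
    (if path_end G (a, p) = b then path_elem (a, p @ q) else (\<lambda>_. 0)) w"
    by (auto simp: w path_elem_def)
qed

context toda_algebra
begin

section \<open>The dual of the right module e_v J\<close>

text \<open>The quadruples that \<open>normal_form_zero\<close> does not kill. The two alternatives
  in the last clause are the parities of the start: even for the first, odd for the second.\<close>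

definition basis :: "nat \<Rightarrow> (nat \<times> nat \<times> nat \<times> nat) set" where
  "basis v = {(p, q, s, t). p < (v + 1) div 2 \<and> q + (v + 1) div 2 \<le> n \<and>
     (s + t + v mod 2 = p + q \<or> s + t + v mod 2 = p + q + 1)}"

text \<open>The start of a path to \<open>v\<close> with the given content, by the second law of
  \<open>content_parity\<close>. On \<open>basis v\<close> the subtraction is not truncated.\<close>

fun source :: "nat \<Rightarrow> nat \<times> nat \<times> nat \<times> nat \<Rightarrow> nat" where
  "source v (p, q, s, t) = v + 3 * q - (p + s + t)"

lemma source:
  assumes "(p, q, s, t) \<in> basis v"
  shows "source v (p, q, s, t) + p + s + t = v + 3 * q"
    and "s + t + v mod 2 = p + q + source v (p, q, s, t) mod 2"
    and "source v (p, q, s, t) \<in> {1..2 * n}"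
proof -
  have b: "p < (v + 1) div 2" "q + (v + 1) div 2 \<le> n"
    "s + t + v mod 2 = p + q \<or> s + t + v mod 2 = p + q + 1"
    using assms by (auto simp: basis_def)
  have m: "2 * ((v + 1) div 2) = v + v mod 2" by presburger
  have le: "p + s + t < v + 3 * q" using b m by linarith
  then show *: "source v (p, q, s, t) + p + s + t = v + 3 * q" by simp
  show "s + t + v mod 2 = p + q + source v (p, q, s, t) mod 2"
    using b(3)
  proof
    assume e: "s + t + v mod 2 = p + q"
    then have "source v (p, q, s, t) + 2 * p = 2 * ((v + 1) div 2) + 2 * q" using * m by linarith
    then have "source v (p, q, s, t) mod 2 = 0" by presburger
    with e show ?thesis by linarith
  next
    assume e: "s + t + v mod 2 = p + q + 1"
    then have "source v (p, q, s, t) + 2 * p + 1 = 2 * ((v + 1) div 2) + 2 * q" using * m by linarith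
    then have "source v (p, q, s, t) mod 2 = 1" by presburger
    with e show ?thesis by linarith
  qed
  have "source v (p, q, s, t) \<ge> 1" using le by simp
  moreover have "source v (p, q, s, t) \<le> 2 * n" using b m * by linarith
  ultimately show "source v (p, q, s, t) \<in> {1..2 * n}" by simp
qed

lemma source_eqI:
  assumes "(p, q, s, t) \<in> basis v" "u + p + s + t = v + 3 * q"
  shows "source v (p, q, s, t) = u"
  using source(1)[OF assms(1)] assms(2) by linarith

lemma basis_bounds: "(p, q, s, t) \<in> basis v \<Longrightarrow> p < n \<and> q < n \<and> s < 2 * n + 1 \<and> t < 2 * n + 1 \<and> p + q < n"
  by (auto simp: basis_def)

lemma finite_basis [simp]: "finite (basis v)"
proof (rule finite_subset)
  show "basis v \<subseteq> {..<n} \<times> {..<n} \<times> {..<2 * n + 1} \<times> {..<2 * n + 1}"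
    using basis_bounds by fastforce
qed auto

lemma zero_in_basis: "v \<in> {1..2 * n} \<Longrightarrow> 0 \<in> basis v"
  by (auto simp: basis_def zero_prod_def)

lemma source_zero: "source v 0 = v"
  by (simp add: zero_prod_def)

lemma source_extend:
  assumes w: "w \<in> basis v" and \<pi>: "(a, p) \<in> paths Q" "path_end Q (a, p) = source v w"
    and b: "w + content p \<in> basis v"
  shows "source v (w + content p) = a"
proof -
  obtain p1 q1 s1 t1 where w1: "w = (p1, q1, s1, t1)" by (cases w)
  obtain p2 q2 s2 t2 where c: "content p = (p2, q2, s2, t2)" by (cases "content p")
  show ?thesis
    using source_eqI[of "p1 + p2" "q1 + q2" "s1 + s2" "t1 + t2" v a] b w1 c
      source(1)[of p1 q1 s1 t1 v] w content_parity(2)[OF \<pi> c]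
    by (simp del: source.simps)
qed

text \<open>Alternation is automatic when a composable path is appended, so only the bounds on r and
  l remain to be tested.\<close>

lemma basis_extend:
  assumes w: "w \<in> basis v" and \<pi>: "(a, p) \<in> paths Q" "path_end Q (a, p) = source v w"
    and wc: "w + content p = (p', q', s', t')"
  shows "w + content p \<in> basis v \<longleftrightarrow> p' < (v + 1) div 2 \<and> q' + (v + 1) div 2 \<le> n"
proof -
  obtain p1 q1 s1 t1 where w1: "w = (p1, q1, s1, t1)" by (cases w)
  obtain p2 q2 s2 t2 where c: "content p = (p2, q2, s2, t2)" by (cases "content p")
  have "s1 + t1 + v mod 2 = p1 + q1 + source v w mod 2" using source(2) w w1 by auto
  moreover have "s2 + t2 + source v w mod 2 = p2 + q2 + a mod 2" by (rule content_parity(1)[OF \<pi> c])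
  ultimately have "s' + t' + v mod 2 = p' + q' + a mod 2" using wc w1 c by simp
  moreover have "a mod 2 = 0 \<or> a mod 2 = 1" by auto
  ultimately show ?thesis unfolding wc basis_def by auto
qed

text \<open>The paths whose product with the monomial \<open>w\<close> of e_v J is the monomial
  \<open>u\<close>. On the dual they send the basis vector of \<open>u\<close> to that of
  \<open>w\<close>, and so contribute to the entry at \<open>(w, u)\<close>.\<close>

definition walks :: "nat \<Rightarrow> nat \<times> nat \<times> nat \<times> nat \<Rightarrow> nat \<times> nat \<times> nat \<times> nat \<Rightarrow> (nat, toda_arrow) path set" where
  "walks v w u = {\<pi>. \<pi> \<in> paths Q \<and> path_end Q \<pi> = source v w \<and> w + content (snd \<pi>) = u}"

lemma walks_short:
  assumes "u \<in> basis v" "(a, p) \<in> walks v w u"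
  shows "length p < 4 * n + 2"
proof -
  obtain p1 q1 s1 t1 where w1: "w = (p1, q1, s1, t1)" by (cases w)
  obtain p2 q2 s2 t2 where c: "content p = (p2, q2, s2, t2)" by (cases "content p")
  have "(p1 + p2, q1 + q2, s1 + s2, t1 + t2) \<in> basis v"
    using assms w1 c by (auto simp: walks_def)
  then have "p2 + q2 < n" "s2 + t2 \<le> p1 + p2 + q1 + q2 + 1" "p1 + p2 + q1 + q2 < n" by (auto simp: basis_def)
  then show ?thesis using length_content[OF c] by simp
qed

lemma finite_walks: "u \<in> basis v \<Longrightarrow> finite (walks v w u)"
proof (rule finite_subset[OF _ finite_short_paths[of "4 * n + 2"]])
  assume u: "u \<in> basis v"
  show "walks v w u \<subseteq> {(u, p). (u, p) \<in> paths Q \<and> length p < 4 * n + 2}"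
  proof safe
    fix a p assume ap: "(a, p) \<in> walks v w u"
    show "length p < 4 * n + 2" by (rule walks_short[OF u ap])
    show "(a, p) \<in> paths Q" using ap by (simp add: walks_def)
  qed
qed

lemma walks_source:
  "w \<in> basis v \<Longrightarrow> u \<in> basis v \<Longrightarrow> (a, p) \<in> walks v w u \<Longrightarrow> a = source v u"
  using source_extend[of w v a p] by (auto simp: walks_def)

text \<open>The left action on the dual of the right module \<open>e\<^sub>v J\<close>, in the dual of its monomial basis.\<close>

definition inj_entry :: "nat \<Rightarrow> ((nat, toda_arrow) path \<Rightarrow> complex) \<Rightarrow>
    nat \<times> nat \<times> nat \<times> nat \<Rightarrow> nat \<times> nat \<times> nat \<times> nat \<Rightarrow> complex" where
  "inj_entry v x w u = (\<Sum>\<pi>\<in>walks v w u. x \<pi>)"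

lemma inj_entry_path_elem:
  "u \<in> basis v \<Longrightarrow> inj_entry v (path_elem \<pi>) w u = (if \<pi> \<in> walks v w u then 1 else 0)"
  unfolding inj_entry_def path_elem_def by (simp add: finite_walks)

lemma inj_entry_one:
  assumes "w \<in> basis v" "u \<in> basis v"
  shows "inj_entry v \<one>\<^bsub>P\<^esub> w u = (if w = u then 1 else 0)"
proof -
  have "source v w \<in> {1..2 * n}" using source(3) assms(1) by (cases w) auto
  then have "inj_entry v \<one>\<^bsub>P\<^esub> w u = (\<Sum>\<pi>\<in>walks v w u. if \<pi> = (source v w, []) then 1 else 0)"
    unfolding inj_entry_def by (intro sum.cong) (auto simp: one_cpa walks_def split: if_splits)
  also have "\<dots> = (if w = u then 1 else 0)"
    using \<open>source v w \<in> {1..2 * n}\<close> assms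
    by (subst sum.delta[OF finite_walks[OF assms(2)]]) (auto simp: walks_def)
  finally show ?thesis .
qed

text \<open>Cutting a walk from \<open>w\<close> to \<open>u\<close> at a position \<open>i\<close>
  amounts to naming the intermediate monomial together with the two pieces, so the sum over all cuts
  is a matrix product.\<close>

lemma inj_entry_mult:
  assumes w: "w \<in> basis v" and u: "u \<in> basis v"
  shows "inj_entry v (x \<otimes>\<^bsub>P\<^esub> y) w u = (\<Sum>w'\<in>basis v. inj_entry v x w w' * inj_entry v y w' u)"
proof -
  have "inj_entry v (x \<otimes>\<^bsub>P\<^esub> y) w u =
    (\<Sum>(a, p)\<in>walks v w u. \<Sum>i\<le>length p. x (path_end Q (a, take i p), drop i p) * y (a, take i p))"
    unfolding inj_entry_def by (intro sum.cong) (auto simp: mult_cpa)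
  also have "\<dots> = (\<Sum>((a, p), i)\<in>Sigma (walks v w u) (\<lambda>\<pi>. {..length (snd \<pi>)}).
      x (path_end Q (a, take i p), drop i p) * y (a, take i p))"
    by (subst sum.Sigma[symmetric]) (auto simp: finite_walks u intro!: sum.cong)
  also have "\<dots> = (\<Sum>(w', \<pi>2, \<pi>1)\<in>Sigma (basis v) (\<lambda>w'. walks v w w' \<times> walks v w' u). x \<pi>2 * y \<pi>1)"
  proof (rule sum.reindex_bij_witness[where
        i = "\<lambda>(w', (b, p2), (a, p1)). ((a, p1 @ p2), length p1)" and
        j = "\<lambda>((a, p), i). (w + content (drop i p), (path_end Q (a, take i p), drop i p), (a, take i p))"])
    fix z assume "z \<in> Sigma (walks v w u) (\<lambda>\<pi>. {..length (snd \<pi>)})"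
    then obtain a p i where z: "z = ((a, p), i)" "i \<le> length p" and ap: "(a, p) \<in> walks v w u"
      by (cases z) auto
    define p1 p2 where "p1 = take i p" and "p2 = drop i p"
    then have p: "p = p1 @ p2" "length p1 = i" using z by auto
    have paths: "(a, p1) \<in> paths Q" "(path_end Q (a, p1), p2) \<in> paths Q"
      and e: "path_end Q (path_end Q (a, p1), p2) = source v w"
      and c: "w + content p1 + content p2 = u"
      using ap by (auto simp: walks_def p path_append_iff path_end_append content_append add_ac)
    obtain p' q' s' t' where w': "w + content p2 = (p', q', s', t')" by (cases "w + content p2")
    \<comment> \<open>The intermediate monomial divides \<open>u\<close>, so it inherits the upper
      bounds on r and l.\<close>
    have "(p', q', s', t') + content p1 \<in> basis v" using u c w' by (metis add.assoc add.commute)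
    then have "w + content p2 \<in> basis v"
      by (subst basis_extend[OF w paths(2) e w']) (cases "content p1", auto simp: basis_def)
    then show "(\<lambda>((a, p), i). (w + content (drop i p), (path_end Q (a, take i p), drop i p), (a, take i p))) z
        \<in> Sigma (basis v) (\<lambda>w'. walks v w w' \<times> walks v w' u)"
      using paths e c source_extend[OF w paths(2) e] by (simp add: z p walks_def add_ac)
  next
    fix z assume "z \<in> Sigma (basis v) (\<lambda>w'. walks v w w' \<times> walks v w' u)"
    then obtain w' b p2 a p1 where z: "z = (w', (b, p2), (a, p1))" and
        *: "w' \<in> basis v" "(b, p2) \<in> walks v w w'" "(a, p1) \<in> walks v w' u"
      by (cases z) auto
    have b: "b = path_end Q (a, p1)"
      using walks_source[OF w *(1,2)] *(3) by (simp add: walks_def)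
    show "(\<lambda>((a, p), i). (w + content (drop i p), (path_end Q (a, take i p), drop i p), (a, take i p)))
        ((\<lambda>(w', (b, p2), (a, p1)). ((a, p1 @ p2), length p1)) z) = z"
      using *(2) b by (simp add: z walks_def)
    show "(\<lambda>(w', (b, p2), (a, p1)). ((a, p1 @ p2), length p1)) z \<in>
        Sigma (walks v w u) (\<lambda>\<pi>. {..length (snd \<pi>)})"
      using * b by (auto simp: z walks_def path_append_iff path_end_append content_append add_ac)
  qed auto
  also have "\<dots> = (\<Sum>w'\<in>basis v. inj_entry v x w w' * inj_entry v y w' u)"
    unfolding inj_entry_def
    by (subst sum.Sigma[symmetric]) (auto simp: finite_walks u sum_product sum.cartesian_product intro!: sum.cong)
  finally show ?thesis .
qed

lemma inj_entry_diff:
  assumes u: "u \<in> basis v" and "\<pi>1 \<in> walks v w u \<longleftrightarrow> \<pi>2 \<in> walks v w u"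
  shows "inj_entry v (\<lambda>z. path_elem \<pi>1 z - path_elem \<pi>2 z) w u = 0"
  using assms inj_entry_path_elem[OF u, of \<pi>1 w] inj_entry_path_elem[OF u, of \<pi>2 w]
  by (simp add: inj_entry_def sum_subtractf split: if_splits)

lemma even_source:
  assumes "(p, q, s, t) \<in> basis v" "source v (p, q, s, t) = 2 * i"
  shows "i + p = (v + 1) div 2 + q"
proof -
  have "s + t + v mod 2 = p + q" "2 * i + p + s + t = v + 3 * q"
    using source(1,2)[OF assms(1)] assms(2) by auto
  moreover have "2 * ((v + 1) div 2) = v + v mod 2" by presburger
  ultimately show ?thesis by linarith
qed

text \<open>The single path left in a derivative at an outer column contains both r and l. A
  monomial that starts in column \<open>1\<close> and contains an l needs too many r, and one that
  starts in column \<open>n\<close> and contains an r needs too many l, to belong to the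
  basis.\<close>

lemma not_walk_boundary:
  assumes "w \<in> basis v" "u \<in> basis v" "i = n \<or> i = 1" "content p = (1, 1, s, t)"
  shows "(2 * i, p) \<notin> walks v w u"
proof
  assume *: "(2 * i, p) \<in> walks v w u"
  obtain p1 q1 s1 t1 where u: "u = (p1, q1, s1, t1)" by (cases u)
  have "w + (1, 1, s, t) = u" using * assms(4) by (auto simp: walks_def)
  then have pq: "p1 \<ge> 1" "q1 \<ge> 1" using u by (cases w; auto)+
  have "i + p1 = (v + 1) div 2 + q1"
    using even_source[of p1 q1 s1 t1 v i] walks_source[OF assms(1,2) *] assms(2) u by simp
  moreover have "p1 < (v + 1) div 2" "q1 + (v + 1) div 2 \<le> n" using assms(2) u by (auto simp: basis_def)
  ultimately show False using pq assms(3) by auto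
qed

text \<open>Inside the quiver a derivative is a difference of two paths with the same ends and the
  same content, which count equally. At the outer columns \<open>not_walk_boundary\<close> disposes
  of what is left.\<close>

lemma inj_entry_derivative:
  assumes w: "w \<in> basis v" and u: "u \<in> basis v" and a: "a \<in> arcs Q"
  shows "inj_entry v (cyclic_derivative Q a (toda_potential n)) w u = 0"
proof -
  have swap: "(b, p) \<in> walks v w u \<longleftrightarrow> (b, p') \<in> walks v w u"
    if "(b, p) \<in> paths Q" "(b, p') \<in> paths Q" "path_end Q (b, p) = path_end Q (b, p')" "content p = content p'" for b p p'
    using that by (simp add: walks_def)
  have boundary: "inj_entry v (\<lambda>z. (if X then path_elem (2 * i, p) z else 0) - (if Y then path_elem (2 * i, p') z else 0)) w u = 0"
    if "X \<Longrightarrow> Y \<Longrightarrow> (2 * i, p) \<in> walks v w u \<longleftrightarrow> (2 * i, p') \<in> walks v w u" "content p = (1, 1, s, t)" "content p' = (1, 1, s, t)"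
      "\<not> X \<or> \<not> Y \<Longrightarrow> i = n \<or> i = 1" for X Y i p p' s t
  proof (cases "X \<and> Y")
    case True
    then show ?thesis using that(1) by (simp add: inj_entry_diff[OF u])
  next
    case False
    then have "(2 * i, p) \<notin> walks v w u" "(2 * i, p') \<notin> walks v w u"
      using not_walk_boundary[OF w u] that(2-4) by blast+
    then show ?thesis
      using inj_entry_path_elem[OF u, of "(2 * i, p)" w] inj_entry_path_elem[OF u, of "(2 * i, p')" w] False
      by (cases X; cases Y) (auto simp: inj_entry_def sum_negf)
  qed
  show ?thesis
  proof (cases a)
    case (A i)
    with a have i: "1 \<le> i" "i \<le> n" by auto
    show ?thesis unfolding A cyclic_derivative_A[OF i, abs_def]
      using i by (intro boundary[of _ _ _ _ _ 0 1] swap) (auto simp: image_iff)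
  next
    case (B i)
    with a have i: "1 \<le> i" "i \<le> n" by auto
    \<comment> \<open>Up to sign this derivative is that in \<open>A i\<close> with the letters a
      and b exchanged, so \<open>boundary\<close> applies again.\<close>
    have "inj_entry v (cyclic_derivative Q a (toda_potential n)) w u =
      - inj_entry v (\<lambda>w. (if i < n then path_elem (2 * i, [R i, A (i + 1), L (i + 1)]) w else 0) -
          (if 2 \<le> i then path_elem (2 * i, [L i, A (i - 1), R (i - 1)]) w else 0)) w u"
      unfolding B cyclic_derivative_B[OF i, abs_def] inj_entry_def sum_negf[symmetric] by simp
    also have "\<dots> = 0"
      unfolding neg_equal_0_iff_equal
      using i by (intro boundary[of _ _ _ _ _ 1 0] swap) (auto simp: image_iff)
    finally show ?thesis .
  next
    case (L i)
    with a have i: "2 \<le> i" "i \<le> n" by auto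
    show ?thesis unfolding L cyclic_derivative_L[OF i, abs_def]
      using i by (intro inj_entry_diff[OF u] swap) (auto simp: image_iff)
  next
    case (R i)
    with a have i: "1 \<le> i" "i < n" by auto
    show ?thesis unfolding R cyclic_derivative_R[OF i, abs_def]
      using i by (intro inj_entry_diff[OF u] swap) (auto simp: image_iff)
  qed
qed

definition inj_mat :: "nat \<Rightarrow> ((nat, toda_arrow) path \<Rightarrow> complex) \<Rightarrow> complex mat" where
  "inj_mat v x = matI (basis v) (basis v) (inj_entry v x)"

definition inj_module :: "nat \<Rightarrow> (nat, toda_arrow) jmod" where
  "inj_module v = lift_module (card (basis v)) (inj_mat v)"

lemma mdim_inj_module [simp]: "mdim (inj_module v) = card (basis v)"
  by (simp add: inj_module_def)

lemma is_module_inj_module: "toda.is_module n (inj_module v)"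
  and act_inj_module: "x \<in> carrier P \<Longrightarrow> act (inj_module v) (cls x) = inj_mat v x"
proof -
  have hom: "inj_mat v \<in> Ring.ring_hom P (ring_mat TYPE(complex) (card (basis v)) ())"
  proof (rule ring_hom_memI)
    fix x y
    show "inj_mat v (x \<otimes>\<^bsub>P\<^esub> y) = inj_mat v x \<otimes>\<^bsub>ring_mat TYPE(complex) (card (basis v)) ()\<^esub> inj_mat v y"
      unfolding ring_mat_simps inj_mat_def matI_mult[OF finite_basis]
      by (intro matI_cong finite_basis inj_entry_mult)
    show "inj_mat v (x \<oplus>\<^bsub>P\<^esub> y) = inj_mat v x \<oplus>\<^bsub>ring_mat TYPE(complex) (card (basis v)) ()\<^esub> inj_mat v y"
      by (simp add: ring_mat_simps inj_mat_def matI_add inj_entry_def[abs_def] add_cpa sum.distrib)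
  next
    show "inj_mat v \<one>\<^bsub>P\<^esub> = \<one>\<^bsub>ring_mat TYPE(complex) (card (basis v)) ()\<^esub>"
      unfolding ring_mat_simps inj_mat_def matI_one[OF finite_basis, symmetric]
      by (intro matI_cong finite_basis inj_entry_one)
  qed (simp add: ring_mat_simps inj_mat_def)
  have scale: "inj_mat v (\<lambda>w. c * \<one>\<^bsub>P\<^esub> w) = c \<cdot>\<^sub>m 1\<^sub>m (card (basis v))" for c
  proof -
    have "inj_mat v (\<lambda>w. c * \<one>\<^bsub>P\<^esub> w) = c \<cdot>\<^sub>m inj_mat v \<one>\<^bsub>P\<^esub>"
      by (simp add: inj_mat_def matI_smult inj_entry_def[abs_def] sum_distrib_left)
    also have "inj_mat v \<one>\<^bsub>P\<^esub> = 1\<^sub>m (card (basis v))"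
      unfolding inj_mat_def matI_one[OF finite_basis, symmetric]
      by (intro matI_cong finite_basis inj_entry_one)
    finally show ?thesis .
  qed
  have deriv: "inj_mat v (cyclic_derivative Q a (toda_potential n)) = 0\<^sub>m (card (basis v)) (card (basis v))"
    if "a \<in> arcs Q" for a
    unfolding inj_mat_def matI_zero[symmetric] by (intro matI_cong finite_basis inj_entry_derivative that)
  have cont: "inj_mat v x = inj_mat v y" if "\<And>u p. length p < 4 * n + 2 \<Longrightarrow> x (u, p) = y (u, p)" for x y
    unfolding inj_mat_def
  proof (intro matI_cong finite_basis)
    fix w u assume "u \<in> basis v"
    then show "inj_entry v x w u = inj_entry v y w u"
      unfolding inj_entry_def
    proof (intro sum.cong refl)
      fix \<pi> assume "\<pi> \<in> walks v w u"
      then show "x \<pi> = y \<pi>"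
        using walks_short[OF \<open>u \<in> basis v\<close>, of "fst \<pi>" "snd \<pi>" w] that[of "snd \<pi>" "fst \<pi>"] by simp
    qed
  qed
  show "toda.is_module n (inj_module v)"
    unfolding inj_module_def by (rule is_module_lift_module[OF hom scale deriv cont])
  show "x \<in> carrier P \<Longrightarrow> act (inj_module v) (cls x) = inj_mat v x"
    unfolding inj_module_def by (rule act_lift_module[OF hom scale deriv cont])
qed

section \<open>Simple modules\<close>

definition simple_module :: "nat \<Rightarrow> (nat, toda_arrow) jmod" where
  "simple_module v = lift_module 1 (\<lambda>x. mat 1 1 (\<lambda>_. x (v, [])))"

lemma
  assumes v: "v \<in> {1..2 * n}"
  shows is_module_simple_module: "toda.is_module n (simple_module v)"
    and act_simple_module: "x \<in> carrier P \<Longrightarrow> act (simple_module v) (cls x) = mat 1 1 (\<lambda>_. x (v, []))"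
proof -
  let ?\<Psi> = "\<lambda>x :: (nat, toda_arrow) path \<Rightarrow> complex. mat 1 1 (\<lambda>_. x (v, []))"
  have hom: "?\<Psi> \<in> Ring.ring_hom P (ring_mat TYPE(complex) 1 ())"
  proof (rule ring_hom_memI)
    fix x y
    show "?\<Psi> (x \<otimes>\<^bsub>P\<^esub> y) = ?\<Psi> x \<otimes>\<^bsub>ring_mat TYPE(complex) 1 ()\<^esub> ?\<Psi> y"
      by (rule eq_matI) (auto simp: ring_mat_simps mult_cpa_Nil scalar_prod_def)
    show "?\<Psi> (x \<oplus>\<^bsub>P\<^esub> y) = ?\<Psi> x \<oplus>\<^bsub>ring_mat TYPE(complex) 1 ()\<^esub> ?\<Psi> y"
      by (rule eq_matI) (auto simp: ring_mat_simps add_cpa)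
  next
    show "?\<Psi> \<one>\<^bsub>P\<^esub> = \<one>\<^bsub>ring_mat TYPE(complex) 1 ()\<^esub>"
      using v by (intro eq_matI) (auto simp: ring_mat_simps one_cpa)
  qed (simp add: ring_mat_simps)
  have scale: "?\<Psi> (\<lambda>w. c * \<one>\<^bsub>P\<^esub> w) = c \<cdot>\<^sub>m 1\<^sub>m 1" for c
    using v by (intro eq_matI) (auto simp: one_cpa)
  have deriv: "?\<Psi> (cyclic_derivative Q a (toda_potential n)) = 0\<^sub>m 1 1" for a
    by (intro eq_matI) (auto simp: toda_cyclic_derivative_length)
  have cont: "?\<Psi> x = ?\<Psi> y" if "\<And>u p. length p < 1 \<Longrightarrow> x (u, p) = y (u, p)"
    for x y :: "(nat, toda_arrow) path \<Rightarrow> complex"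
    using that by simp
  show "toda.is_module n (simple_module v)"
    unfolding simple_module_def by (rule is_module_lift_module[where \<Psi> = ?\<Psi> and k = 1 and d = 1])
      (rule hom, rule scale, rule deriv, rule cont, blast, (assumption)?)
  show "x \<in> carrier P \<Longrightarrow> act (simple_module v) (cls x) = ?\<Psi> x"
    unfolding simple_module_def by (rule act_lift_module[where \<Psi> = ?\<Psi> and k = 1 and d = 1])
      (rule hom, rule scale, rule deriv, rule cont, blast, (assumption)?)
qed

lemma is_simple_at_simple_module:
  assumes v: "v \<in> {1..2 * n}"
  shows "toda.is_simple_at n v (simple_module v)"
  unfolding toda.is_simple_at_def
proof (intro conjI ballI)
  show "act (simple_module v) (cls (path_elem (v, []))) = 1\<^sub>m 1"
    using v by (subst act_simple_module[OF v path_elem_closed]) (auto simp: path_elem_def)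
  fix a assume a: "a \<in> arcs Q"
  have "(tail Q a, [a]) \<in> paths Q"
    using a head_in_verts[OF a] by simp
  then show "act (simple_module v) (cls (path_elem (tail Q a, [a]))) = 0\<^sub>m 1 1"
    by (subst act_simple_module[OF v path_elem_closed]) (auto simp: path_elem_def)
qed (use is_module_simple_module[OF v] in \<open>simp_all add: simple_module_def\<close>)

end

lemma add_tuple_eq_0: "w + u = 0 \<longleftrightarrow> w = 0 \<and> u = 0" for w u :: "nat \<times> nat \<times> nat \<times> nat"
  by (cases w; cases u) (auto simp: zero_prod_def)

lemma content_eq_0: "content p = 0 \<longleftrightarrow> p = []"
proof (cases p)
  case (Cons e q)
  have "letter e \<noteq> 0" by (cases e) (auto simp: zero_prod_def)
  then show ?thesis using Cons by (simp add: add_tuple_eq_0)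
qed simp

context toda_algebra
begin

section \<open>Monomials as classes of walks\<close>

text \<open>A nonzero monomial loses the letter traversed first: a or b if it starts at an odd
  vertex, l or r otherwise. The alternation law shows that such a letter is present, and the arrow
  exists because the next vertex lies in the quiver.\<close>

lemma basis_step:
  assumes w: "w \<in> basis v" "w \<noteq> 0"
  obtains w' e where "w' \<in> basis v" "e \<in> arcs Q" "toda_head e = source v w'" "w' + letter e = w"
proof -
  obtain p q s t where pq: "w = (p, q, s, t)" by (cases w)
  note b = w(1)[unfolded pq] and src = source[OF w(1)[unfolded pq]]
  have bd: "p < (v + 1) div 2" "q + (v + 1) div 2 \<le> n"
    using b by (auto simp: basis_def)
  define u where "u = source v (p, q, s, t)"
  note src = src[folded u_def]
  show ?thesis
  proof (cases "odd u")
    case True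
    then have u2: "u mod 2 = 1" by presburger
    define i where "i = (u + 1) div 2"
    have i: "u + 1 = 2 * i" "1 \<le> i" "i \<le> n" using True src(3) by (auto simp: i_def elim!: oddE)
    have "s + t \<noteq> 0"
    proof
      assume "s + t = 0"
      then have "p + q + 1 = v mod 2" using src(2) u2 by linarith
      moreover have "v mod 2 < 2" by simp
      ultimately have "p = 0" "q = 0" by auto
      with \<open>s + t = 0\<close> w(2) pq show False by (simp add: zero_prod_def)
    qed
    then consider s' where "s = Suc s'" | t' where "t = Suc t'" by (cases s; cases t) auto
    then show ?thesis
    proof cases
      case 1
      have b': "(p, q, s', t) \<in> basis v" using bd src(2) u2 1 by (auto simp: basis_def)
      have "source v (p, q, s', t) = 2 * i"
        by (rule source_eqI[OF b']) (use src(1) 1 i in linarith)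
      then show ?thesis using i pq 1 b' by (intro that[of "(p, q, s', t)" "A i"]) auto
    next
      case 2
      have b': "(p, q, s, t') \<in> basis v" using bd src(2) u2 2 by (auto simp: basis_def)
      have "source v (p, q, s, t') = 2 * i"
        by (rule source_eqI[OF b']) (use src(1) 2 i in linarith)
      then show ?thesis using i pq 2 b' by (intro that[of "(p, q, s, t')" "B i"]) auto
    qed
  next
    case False
    then have u2: "u mod 2 = 0" by presburger
    define i where "i = u div 2"
    have i: "u = 2 * i" "1 \<le> i" "i \<le> n" using False src(3) by (auto simp: i_def elim!: evenE)
    have "p + q \<noteq> 0"
    proof
      assume "p + q = 0"
      then have "s + t = 0" using src(2) u2 by linarith
      with \<open>p + q = 0\<close> w(2) pq show False by (simp add: zero_prod_def)
    qed
    then consider p' where "p = Suc p'" | q' where "q = Suc q'" by (cases p; cases q) auto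
    then show ?thesis
    proof cases
      case 1
      have b': "(p', q, s, t) \<in> basis v" using bd src(2) u2 1 by (auto simp: basis_def)
      have e: "source v (p', q, s, t) = 2 * i + 1"
        by (rule source_eqI[OF b']) (use src(1) 1 i in linarith)
      then have "i < n" using source(3)[OF b'] by auto
      then show ?thesis using i pq 1 b' e by (intro that[of "(p', q, s, t)" "R i"]) auto
    next
      case 2
      have b': "(p, q', s, t) \<in> basis v" using bd src(2) u2 2 by (auto simp: basis_def)
      have e: "source v (p, q', s, t) + 3 = 2 * i"
        using source(1)[OF b'] src(1) 2 i by linarith
      then have "2 \<le> i" using source(3)[OF b'] by auto
      then show ?thesis using i pq 2 b' e by (intro that[of "(p, q', s, t)" "L i"]) auto
    qed
  qed
qed

lemma walk_exists:
  assumes v: "v \<in> {1..2 * n}"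
  shows "w \<in> basis v \<Longrightarrow> \<exists>\<pi>. \<pi> \<in> paths Q \<and> path_end Q \<pi> = v \<and> content (snd \<pi>) = w"
proof (induction "case w of (p, q, s, t) \<Rightarrow> p + q + s + t" arbitrary: w rule: less_induct)
  case less
  show ?case
  proof (cases "w = 0")
    case True
    then show ?thesis using v by (intro exI[of _ "(v, [])"]) auto
  next
    case False
    then obtain w' e where e: "w' \<in> basis v" "e \<in> arcs Q" "toda_head e = source v w'" "w' + letter e = w"
      using basis_step[OF less.prems] by blast
    have "(case w' of (p, q, s, t) \<Rightarrow> p + q + s + t) < (case w of (p, q, s, t) \<Rightarrow> p + q + s + t)"
      unfolding e(4)[symmetric] by (cases w'; cases e) auto
    from less.hyps[OF this e(1)] obtain a p where p: "(a, p) \<in> paths Q" "path_end Q (a, p) = v" "content p = w'"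
      by auto
    have "source v (0 + content p) = a"
      by (rule source_extend) (use p e(1) v zero_in_basis source_zero in simp_all)
    then have "a = toda_head e" using e(3) p(3) by simp
    then show ?thesis
      using p e(2,4) by (intro exI[of _ "(toda_tail e, e # p)"]) (auto simp: add.commute simp del: toda_quiver_simps(4))
  qed
qed

definition walk :: "nat \<Rightarrow> nat \<times> nat \<times> nat \<times> nat \<Rightarrow> (nat, toda_arrow) path" where
  "walk v w = (SOME \<pi>. \<pi> \<in> paths Q \<and> path_end Q \<pi> = v \<and> content (snd \<pi>) = w)"

lemma walk:
  assumes "v \<in> {1..2 * n}" "w \<in> basis v"
  shows "walk v w \<in> paths Q" "path_end Q (walk v w) = v" "content (snd (walk v w)) = w"
    and "fst (walk v w) = source v w"
proof -
  show *: "walk v w \<in> paths Q" "path_end Q (walk v w) = v" "content (snd (walk v w)) = w"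
    using someI_ex[OF walk_exists[OF assms]] by (auto simp: walk_def)
  show "fst (walk v w) = source v w"
    using source_extend[of 0 v "fst (walk v w)" "snd (walk v w)"] * zero_in_basis[OF assms(1)] assms(2)
    by (simp add: source_zero)
qed

text \<open>A product of a monomial with a path is again a monomial of the basis or zero. This is
  the rule built into \<open>inj_entry\<close>, so the maps constructed below from functionals
  commute with the action.\<close>

lemma cls_walk_mult:
  assumes v: "v \<in> {1..2 * n}" and w: "w \<in> basis v" and \<pi>: "\<pi> \<in> paths Q"
  shows "cls (path_elem (walk v w) \<otimes>\<^bsub>P\<^esub> path_elem \<pi>) =
    (if path_end Q \<pi> = source v w \<and> w + content (snd \<pi>) \<in> basis v
     then cls (path_elem (walk v (w + content (snd \<pi>)))) else cls (\<lambda>_. 0))"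
proof -
  obtain a p where ap: "\<pi> = (a, p)" by (cases \<pi>)
  obtain b q where bq: "walk v w = (b, q)" by (cases "walk v w")
  note wk = walk[OF v w, unfolded bq, simplified]
  show ?thesis
  proof (cases "path_end Q \<pi> = source v w")
    case False
    then show ?thesis using wk(4) by (simp add: ap bq path_elem_mult)
  next
    case True
    have pq: "(a, p @ q) \<in> paths Q" "path_end Q (a, p @ q) = v" "content (p @ q) = w + content p"
      using wk \<pi> True by (auto simp: ap path_append_iff path_end_append content_append add.commute)
    have prod: "path_elem (walk v w) \<otimes>\<^bsub>P\<^esub> path_elem \<pi> = path_elem (a, p @ q)"
      using True wk(4) by (simp add: ap bq path_elem_mult)
    show ?thesis
    proof (cases "w + content p \<in> basis v")
      case b: True
      obtain b' q' where bq': "walk v (w + content p) = (b', q')" by (cases "walk v (w + content p)")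
      note wk' = walk[OF v b, unfolded bq', simplified]
      have "cls (path_elem (a, p @ q)) = cls (path_elem (b', q'))"
        by (rule cls_path_elem_eq) (use pq wk' in auto)
      then show ?thesis using True b by (simp add: prod[unfolded ap] ap bq')
    next
      case b: False
      obtain p' q' s' t' where c: "w + content p = (p', q', s', t')" by (cases "w + content p")
      have "p' \<ge> (v + 1) div 2 \<or> q' + (v + 1) div 2 > n"
        using b basis_extend[OF w \<pi>[unfolded ap] True[unfolded ap] c] by linarith
      then have "cls (path_elem (a, p @ q)) = \<zero>\<^bsub>Jac\<^esub>"
        using pq c by (intro cls_path_elem_zero[OF pq(1,2)]) auto
      then show ?thesis using b by (simp add: prod[unfolded ap] ap cls_zero)
    qed
  qed
qed

text \<open>\<open>walk v w\<close> moves the coordinate \<open>w\<close> to the coordinate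
  \<open>0\<close>. The functional at \<open>0\<close> and the action together thus recover all
  coordinates.\<close>

lemma inj_entry_walk:
  assumes "v \<in> {1..2 * n}" "w \<in> basis v" "u \<in> basis v"
  shows "inj_entry v (path_elem (walk v w)) 0 u = (if u = w then 1 else 0)"
  using assms by (simp add: inj_entry_path_elem walks_def walk source_zero)

section \<open>Injectivity and essentiality\<close>

text \<open>A homomorphism into the dual of e_v J is determined by its composite with the functional
  at the monomial \<open>0\<close>. For \<open>h\<close> this composite extends to a functional
  \<open>\<rho>\<close> on \<open>N\<close> by means of a linear left inverse of \<open>f\<close>;
  conversely \<open>\<rho>\<close> yields the homomorphism whose coordinate \<open>w\<close> is
  \<open>\<rho>\<close> after the action of \<open>walk v w\<close>.\<close>

lemma is_injective_inj_module:
  assumes v: "v \<in> {1..2 * n}"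
  shows "toda.is_injective n (inj_module v)"
  unfolding toda.is_injective_def
proof (intro conjI allI impI is_module_inj_module, elim conjE)
  fix M N f h
  assume M: "toda.is_module n M" and N: "toda.is_module n N" and f: "toda.is_mono n M N f"
    and h: "h \<in> toda.Hom n M (inj_module v)"
  let ?B = "basis v" and ?c = "\<lambda>w. path_elem (walk v w)"
  have fH: "f \<in> toda.Hom n M N" and inj: "inj_on (\<lambda>x. f *\<^sub>v x) (carrier_vec (mdim M))"
    using f by (simp_all add: toda.is_mono_def)
  have fc: "f \<in> carrier_mat (mdim N) (mdim M)" and hc: "h \<in> carrier_mat (card ?B) (mdim M)"
    using fH h by (simp_all add: Hom_iff)
  obtain g where g: "g \<in> carrier_mat (mdim M) (mdim N)" "g * f = 1\<^sub>m (mdim M)"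
    using inj_mat_left_inverse[OF fc inj] by blast
  have wc: "?c w \<in> carrier P" if "w \<in> ?B" for w using walk(1)[OF v that] by simp
  note aN = act_carrier[OF N] and aM = act_carrier[OF M]
  have z: "0 \<in> ?B" by (rule zero_in_basis[OF v])
  \<comment> \<open>The row vector \<open>e\<close> reads off the coordinate at the monomial
    \<open>0\<close>.\<close>
  define e where "e = mat 1 (card ?B) (\<lambda>(_, j). if j = pos ?B 0 then 1 else (0 :: complex))"
  define \<rho> where "\<rho> = e * h * g"
  have e: "e \<in> carrier_mat 1 (card ?B)" by (simp add: e_def)
  have \<rho>: "\<rho> \<in> carrier_mat 1 (mdim N)" using e hc g by (simp add: \<rho>_def)
  have e_mult: "(e * X) $$ (0, j) = X $$ (pos ?B 0, j)" if "X \<in> carrier_mat (card ?B) k" "j < k" for X j k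
  proof -
    have "(e * X) $$ (0, j) = (\<Sum>i<card ?B. (if i = pos ?B 0 then 1 else 0) * X $$ (i, j))"
      using that by (auto simp: e_def scalar_prod_def lessThan_atLeast0 intro!: sum.cong)
    then show ?thesis using pos(1)[OF finite_basis z] by (simp add: if_distrib[of "\<lambda>x. x * _"] sum.delta cong: if_cong)
  qed
  define X where "X w = \<rho> * act N (cls (?c w))" for w
  have X: "X w \<in> carrier_mat 1 (mdim N)" if "w \<in> ?B" for w
    using \<rho> aN[OF wc[OF that]] by (simp add: X_def)
  define h' where "h' = mat (card ?B) (mdim N) (\<lambda>(i, j). X (enum ?B ! i) $$ (0, j))"
  have h'c: "h' \<in> carrier_mat (card ?B) (mdim N)" by (simp add: h'_def)
  have row: "(h' * Y) $$ (i, j) = (X (enum ?B ! i) * Y) $$ (0, j)"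
    if "Y \<in> carrier_mat (mdim N) k" "i < card ?B" "j < k" for Y i j k
    using that X[OF enum_in[OF finite_basis that(2)]]
    by (auto simp: h'_def scalar_prod_def intro!: sum.cong)
  have "h' \<in> toda.Hom n N (inj_module v)"
  proof (rule HomI_paths[OF long_paths_in_I N is_module_inj_module])
    fix \<pi> assume \<pi>: "\<pi> \<in> paths Q"
    have pc: "path_elem \<pi> \<in> carrier P" using \<pi> by simp
    have im: "inj_mat v (path_elem \<pi>) \<in> carrier_mat (card ?B) (card ?B)" by (simp add: inj_mat_def)
    show "h' * act N (cls (path_elem \<pi>)) = act (inj_module v) (cls (path_elem \<pi>)) * h'"
      unfolding act_inj_module[OF pc]
    proof (rule eq_matI)
      fix i j assume "i < dim_row (inj_mat v (path_elem \<pi>) * h')" "j < dim_col (inj_mat v (path_elem \<pi>) * h')"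
      then have i: "i < card ?B" and j: "j < mdim N" using im h'c by auto
      define w where "w = enum ?B ! i"
      have w: "w \<in> ?B" using enum_in[OF finite_basis i] by (simp add: w_def)
      have "(h' * act N (cls (path_elem \<pi>))) $$ (i, j) = (\<rho> * act N (cls (?c w)) * act N (cls (path_elem \<pi>))) $$ (0, j)"
        using row[OF aN[OF pc] i j] by (simp add: X_def w_def)
      also have "\<rho> * act N (cls (?c w)) * act N (cls (path_elem \<pi>)) = \<rho> * act N (cls (?c w \<otimes>\<^bsub>P\<^esub> path_elem \<pi>))"
        unfolding act_mult[OF N wc[OF w] pc] by (rule assoc_mult_mat[OF \<rho> aN[OF wc[OF w]] aN[OF pc]])
      also have "\<dots> $$ (0, j) = (if path_end Q \<pi> = source v w \<and> w + content (snd \<pi>) \<in> ?B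
          then X (w + content (snd \<pi>)) $$ (0, j) else 0)"
        unfolding cls_walk_mult[OF v w \<pi>] X_def
        using act_I[OF N additive_subgroup.zero_closed[OF I.is_additive_subgroup]] \<rho> j by (auto simp: zero_cpa)
      also have "\<dots> = (\<Sum>u\<in>?B. if path_end Q \<pi> = source v w \<and> w + content (snd \<pi>) = u then X u $$ (0, j) else 0)"
        by (cases "path_end Q \<pi> = source v w") simp_all
      also have "\<dots> = (\<Sum>u\<in>?B. inj_entry v (path_elem \<pi>) w u * X u $$ (0, j))"
        using \<pi> by (intro sum.cong refl) (simp add: inj_entry_path_elem walks_def)
      also have "\<dots> = (\<Sum>k<card ?B. inj_entry v (path_elem \<pi>) w (enum ?B ! k) * X (enum ?B ! k) $$ (0, j))"
        by (rule sum_enum[OF finite_basis, symmetric])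
      also have "\<dots> = (inj_mat v (path_elem \<pi>) * h') $$ (i, j)"
        using i j by (simp add: inj_mat_def matI_def h'_def scalar_prod_def w_def lessThan_atLeast0)
      finally show "(h' * act N (cls (path_elem \<pi>))) $$ (i, j) = (inj_mat v (path_elem \<pi>) * h') $$ (i, j)" .
    qed (use h'c im aN[OF pc] in auto)
  qed (use h'c in auto)
  moreover have "h' * f = h"
  proof (rule eq_matI)
    fix i j assume "i < dim_row h" "j < dim_col h"
    then have i: "i < card ?B" and j: "j < mdim M" using hc by auto
    define w where "w = enum ?B ! i"
    have w: "w \<in> ?B" using enum_in[OF finite_basis i] by (simp add: w_def)
    note aw = aN[OF wc[OF w]] aM[OF wc[OF w]]
    have "(h' * f) $$ (i, j) = (\<rho> * act N (cls (?c w)) * f) $$ (0, j)"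
      using row[OF fc i j] by (simp add: X_def w_def)
    also have "\<rho> * act N (cls (?c w)) * f = \<rho> * (f * act M (cls (?c w)))"
      using fH wc[OF w] assoc_mult_mat[OF \<rho> aw(1) fc] by (simp add: Hom_iff)
    also have "\<dots> = \<rho> * f * act M (cls (?c w))"
      by (rule assoc_mult_mat[OF \<rho> fc aw(2), symmetric])
    also have "\<rho> * f = e * h"
      unfolding \<rho>_def using assoc_mult_mat[OF mult_carrier_mat[OF e hc] g(1) fc] g(2)
        right_mult_one_mat[OF mult_carrier_mat[OF e hc]]
      by simp
    also have "e * h * act M (cls (?c w)) = e * (inj_mat v (?c w) * h)"
      using h wc[OF w] assoc_mult_mat[OF e hc aw(2)] by (simp add: Hom_iff act_inj_module)
    also have "\<dots> $$ (0, j) = (inj_mat v (?c w) * h) $$ (pos ?B 0, j)"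
      by (rule e_mult[of _ "mdim M"]) (use hc j in \<open>auto simp: inj_mat_def\<close>)
    also have "\<dots> = (\<Sum>k<card ?B. inj_entry v (?c w) 0 (enum ?B ! k) * h $$ (k, j))"
      using hc j pos[OF finite_basis z] by (simp add: inj_mat_def matI_def scalar_prod_def lessThan_atLeast0)
    also have "\<dots> = (\<Sum>k<card ?B. if k = i then h $$ (k, j) else 0)"
      using i enum[OF finite_basis[of v]]
      by (intro sum.cong refl)
        (simp add: inj_entry_walk[OF v w, unfolded w_def] enum_in w_def nth_eq_iff_index_eq)
    also have "\<dots> = h $$ (i, j)" using i by simp
    finally show "(h' * f) $$ (i, j) = h $$ (i, j)" .
  qed (use h'c hc fc in auto)
  ultimately show "\<exists>h'\<in>toda.Hom n N (inj_module v). h' * f = h" by blast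
qed

text \<open>The action of \<open>walk v w\<close> carries the value at \<open>u + w\<close> to
  \<open>u\<close>. If the support contains no multiple of \<open>w\<close> other than
  \<open>w\<close>, just the value at \<open>w\<close> survives, and it lands in the socle.\<close>

lemma act_walk_top:
  assumes v: "v \<in> {1..2 * n}" and w: "w \<in> basis v"
    and \<phi>: "\<And>u. u \<in> basis v \<Longrightarrow> \<phi> u \<noteq> 0 \<Longrightarrow> u \<noteq> w \<Longrightarrow> \<not> (\<exists>u'. u = u' + w)"
  shows "inj_mat v (path_elem (walk v w)) *\<^sub>v vecI (basis v) \<phi> =
    vecI (basis v) (\<lambda>u. if u = 0 then \<phi> w else 0)"
  unfolding inj_mat_def matI_mult_vecI[OF finite_basis]
proof (intro vecI_cong finite_basis)
  fix u assume u: "u \<in> basis v"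
  have "(\<Sum>u'\<in>basis v. inj_entry v (path_elem (walk v w)) u u' * \<phi> u') =
    (\<Sum>u'\<in>basis v. if u' = w then (if u = 0 then \<phi> w else 0) else 0)"
  proof (intro sum.cong refl)
    fix u' assume u': "u' \<in> basis v"
    show "inj_entry v (path_elem (walk v w)) u u' * \<phi> u' = (if u' = w then (if u = 0 then \<phi> w else 0) else 0)"
    proof (cases "walk v w \<in> walks v u u'")
      case True
      then have "u' = u + w" using walk[OF v w] by (simp add: walks_def)
      have "u = 0 \<or> \<phi> u' = 0"
      proof (rule ccontr)
        assume "\<not> (u = 0 \<or> \<phi> u' = 0)"
        moreover from this have "u' \<noteq> w" using \<open>u' = u + w\<close> by (cases u; cases w) (auto simp: zero_prod_def)
        ultimately show False using \<phi>[OF u'] \<open>u' = u + w\<close> by blast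
      qed
      moreover have "u' = w \<longleftrightarrow> u = 0"
        using \<open>u' = u + w\<close> by (cases u; cases w) (auto simp: zero_prod_def)
      ultimately show ?thesis using True u' by (auto simp: inj_entry_path_elem)
    next
      case False
      then show ?thesis using walk[OF v w] u' by (auto simp: inj_entry_path_elem walks_def source_zero)
    qed
  qed
  also have "\<dots> = (if u = 0 then \<phi> w else 0)" using w by simp
  finally show "(\<Sum>u'\<in>basis v. inj_entry v (path_elem (walk v w)) u u' * \<phi> u') = (if u = 0 then \<phi> w else 0)" .
qed

text \<open>The simple module is the line at the monomial \<open>0\<close>. Every nonzero submodule
  meets it: a monomial of maximal degree in the support of a vector has no proper multiple there, so
  \<open>act_walk_top\<close> gives a nonzero vector on the line.\<close>

lemma is_injective_envelope_inj_module:
  assumes v: "v \<in> {1..2 * n}"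
  shows "toda.is_injective_envelope n (simple_module v) (inj_module v)"
  unfolding toda.is_injective_envelope_def
proof (intro conjI is_injective_inj_module v)
  let ?B = "basis v"
  have z: "0 \<in> ?B" by (rule zero_in_basis[OF v])
  define f where "f = mat (card ?B) 1 (\<lambda>(i, _). if i = pos ?B 0 then 1 else (0 :: complex))"
  have fc: "f \<in> carrier_mat (card ?B) 1" by (simp add: f_def)
  have fv: "f *\<^sub>v x = vecI ?B (\<lambda>u. if u = 0 then x $ 0 else 0)" if "x \<in> carrier_vec 1" for x
  proof (rule eq_vecI)
    fix i assume "i < dim_vec (vecI ?B (\<lambda>u. if u = 0 then x $ 0 else 0))"
    then have i: "i < card ?B" by simp
    have "i = pos ?B 0 \<longleftrightarrow> enum ?B ! i = 0"
      using pos[OF finite_basis z] pos_enum[OF finite_basis i] by metis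
    then show "(f *\<^sub>v x) $ i = vecI ?B (\<lambda>u. if u = 0 then x $ 0 else 0) $ i"
      using i that by (simp add: f_def vecI_def scalar_prod_def)
  qed (simp add: f_def)
  have mono: "toda.is_mono n (simple_module v) (inj_module v) f"
    unfolding toda.is_mono_def
  proof
    show "f \<in> toda.Hom n (simple_module v) (inj_module v)"
      unfolding Hom_iff
    proof (intro conjI ballI)
      show "f \<in> carrier_mat (mdim (inj_module v)) (mdim (simple_module v))"
        using fc by (simp add: simple_module_def)
      fix x assume x: "x \<in> carrier P"
      have im: "inj_mat v x \<in> carrier_mat (card ?B) (card ?B)" by (simp add: inj_mat_def)
      show "f * act (simple_module v) (cls x) = act (inj_module v) (cls x) * f"
        unfolding act_simple_module[OF v x] act_inj_module[OF x]
      proof (rule eq_matI)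
        fix i j assume "i < dim_row (inj_mat v x * f)" "j < dim_col (inj_mat v x * f)"
        then have i: "i < card ?B" and j: "j = 0" using im by (auto simp: f_def)
        define w where "w = enum ?B ! i"
        have w: "w \<in> ?B" using enum_in[OF finite_basis i] by (simp add: w_def)
        have iw: "i = pos ?B 0 \<longleftrightarrow> w = 0"
          using pos[OF finite_basis z] pos_enum[OF finite_basis i] unfolding w_def by metis
        have "walks v w 0 = (if w = 0 then {(v, [])} else {})"
          using v content_eq_0 add_tuple_eq_0 by (auto simp: walks_def source_zero)
        then have "inj_entry v x w 0 = (if w = 0 then x (v, []) else 0)"
          by (simp add: inj_entry_def)
        moreover have "(inj_mat v x * f) $$ (i, 0) = (\<Sum>k<card ?B. inj_mat v x $$ (i, k) * (if k = pos ?B 0 then 1 else 0))"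
          using i im by (auto simp: f_def scalar_prod_def lessThan_atLeast0 intro!: sum.cong)
        moreover have "\<dots> = inj_mat v x $$ (i, pos ?B 0)"
          using pos(1)[OF finite_basis z] by (simp add: if_distrib sum.delta cong: if_cong)
        moreover have "\<dots> = inj_entry v x w 0"
          using i pos[OF finite_basis z] by (simp add: inj_mat_def matI_def w_def)
        ultimately show "(f * mat 1 1 (\<lambda>_. x (v, []))) $$ (i, j) = (inj_mat v x * f) $$ (i, j)"
          using i iw by (simp add: f_def scalar_prod_def j)
      qed (use im in \<open>auto simp: f_def\<close>)
    qed
    show "inj_on ((*\<^sub>v) f) (carrier_vec (mdim (simple_module v)))"
    proof (rule inj_onI)
      fix x y assume xy: "x \<in> carrier_vec (mdim (simple_module v))" "y \<in> carrier_vec (mdim (simple_module v))"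
        "f *\<^sub>v x = f *\<^sub>v y"
      then have c: "x \<in> carrier_vec 1" "y \<in> carrier_vec 1" by (simp_all add: simple_module_def)
      then have "x $ 0 = y $ 0"
        using xy(3) z unfolding fv[OF c(1)] fv[OF c(2)] vecI_eq_iff[OF finite_basis] by auto
      then show "x = y" using c by (intro eq_vecI) auto
    qed
  qed
  show "\<exists>f. toda.is_mono n (simple_module v) (inj_module v) f \<and>
      (\<forall>N. toda.is_submodule n (inj_module v) N \<and> N \<noteq> {0\<^sub>v (mdim (inj_module v))} \<longrightarrow>
         N \<inter> (*\<^sub>v) f ` carrier_vec (mdim (simple_module v)) \<noteq> {0\<^sub>v (mdim (inj_module v))})"
  proof (intro exI[of _ f] conjI mono allI impI, elim conjE)
    fix N assume N: "toda.is_submodule n (inj_module v) N" "N \<noteq> {0\<^sub>v (mdim (inj_module v))}"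
    have sub: "VectorSpace.subspace class_ring N (module_vec TYPE(complex) (card ?B))"
      and act: "\<And>x y. x \<in> carrier P \<Longrightarrow> y \<in> N \<Longrightarrow> inj_mat v x *\<^sub>v y \<in> N"
      using N(1) act_inj_module unfolding is_submodule_iff by auto
    interpret VS: vec_space "TYPE(complex)" "card ?B" .
    have subm: "submodule class_ring N VS.V" using sub by (simp add: VectorSpace.subspace_def)
    have "N \<subseteq> carrier_vec (card ?B)" "0\<^sub>v (card ?B) \<in> N"
      using submodule.subset[OF subm] submodule.zero_closed[OF subm] by (auto simp: module_vec_simps)
    then obtain y where y: "y \<in> N" "y \<noteq> 0\<^sub>v (card ?B)" "y \<in> carrier_vec (card ?B)"
      using N(2) by auto
    define \<phi> where "\<phi> u = y $ pos ?B u" for u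
    have y\<phi>: "y = vecI ?B \<phi>" unfolding \<phi>_def using vecI_surj[OF finite_basis y(3)] by simp
    let ?S = "{u \<in> ?B. \<phi> u \<noteq> 0}" and ?d = "\<lambda>(p, q, s, t). p + q + s + (t :: nat)"
    have "vecI ?B (\<lambda>_. 0) = 0\<^sub>v (card ?B)" by (auto simp: vecI_def)
    then have "?S \<noteq> {}" using y(2) vecI_eq_iff[OF finite_basis, of v \<phi> "\<lambda>_. 0"] by (auto simp: y\<phi>)
    have fin: "finite ?S" by simp
    have "Max (?d ` ?S) \<in> ?d ` ?S" using \<open>?S \<noteq> {}\<close> fin by (intro Max_in) auto
    then obtain w where w: "w \<in> ?S" "Max (?d ` ?S) = ?d w" by (elim imageE)
    have wmax: "?d u \<le> ?d w" if "u \<in> ?S" for u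
      unfolding w(2)[symmetric] by (rule Max_ge) (use fin that in \<open>auto intro!: imageI\<close>)
    have top: "\<not> (\<exists>u'. u = u' + w)" if "u \<in> ?B" "\<phi> u \<noteq> 0" "u \<noteq> w" for u
    proof
      assume "\<exists>u'. u = u' + w"
      then obtain u' where u': "u = u' + w" by blast
      have "?d u = ?d u' + ?d w" unfolding u' by (cases u'; cases w) auto
      then have "?d u' = 0" using wmax[of u] that by simp
      then have "u' = 0" by (cases u') (auto simp: zero_prod_def)
      then show False using u' that by simp
    qed
    have wB: "w \<in> ?B" "\<phi> w \<noteq> 0" using w(1) by auto
    let ?y = "vecI ?B (\<lambda>u. if u = 0 then \<phi> w else 0)"
    have "?y \<in> N"
      using act[of "path_elem (walk v w)" y] y(1) walk(1)[OF v wB(1)] act_walk_top[OF v wB(1) top]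
      by (simp add: y\<phi>)
    moreover have "?y \<in> (*\<^sub>v) f ` carrier_vec (mdim (simple_module v))"
    proof (rule image_eqI)
      have "vec 1 (\<lambda>_. \<phi> w) $ 0 = \<phi> w" by simp
      with fv[of "vec 1 (\<lambda>_. \<phi> w)"] show "?y = f *\<^sub>v vec 1 (\<lambda>_. \<phi> w)" by (simp only: vec_carrier)
    qed (simp add: simple_module_def)
    moreover have "?y \<noteq> 0\<^sub>v (card ?B)"
    proof
      assume "?y = 0\<^sub>v (card ?B)"
      then have "?y $ pos ?B 0 = 0" using pos[OF finite_basis z] by simp
      then show False using vecI_pos[OF finite_basis z] wB(2) by simp
    qed
    ultimately show "N \<inter> (*\<^sub>v) f ` carrier_vec (mdim (simple_module v)) \<noteq> {0\<^sub>v (mdim (inj_module v))}"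
      by auto
  qed
qed

end

section \<open>The kernel of a generic homomorphism\<close>

context toda_algebra
begin

text \<open>Extension by zero: a shift that leaves the basis then contributes nothing, and no case
  distinction is needed in the equations of the kernel.\<close>

definition ext :: "nat \<Rightarrow> (nat \<times> nat \<times> nat \<times> nat \<Rightarrow> complex) \<Rightarrow> nat \<times> nat \<times> nat \<times> nat \<Rightarrow> complex" where
  "ext v \<phi> u = (if u \<in> basis v then \<phi> u else 0)"

lemma inj_mat_path:
  assumes "\<pi> \<in> paths Q"
  shows "inj_mat v (path_elem \<pi>) *\<^sub>v vecI (basis v) \<phi> =
    vecI (basis v) (\<lambda>w. if source v w = path_end Q \<pi> then ext v \<phi> (w + content (snd \<pi>)) else 0)"
  unfolding inj_mat_def matI_mult_vecI[OF finite_basis]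
proof (intro vecI_cong finite_basis)
  fix w assume w: "w \<in> basis v"
  have "(\<Sum>u\<in>basis v. inj_entry v (path_elem \<pi>) w u * \<phi> u) =
    (\<Sum>u\<in>basis v. if w + content (snd \<pi>) = u then (if source v w = path_end Q \<pi> then \<phi> u else 0) else 0)"
    using assms by (intro sum.cong refl) (auto simp: inj_entry_path_elem walks_def)
  then show "(\<Sum>u\<in>basis v. inj_entry v (path_elem \<pi>) w u * \<phi> u) =
      (if source v w = path_end Q \<pi> then ext v \<phi> (w + content (snd \<pi>)) else 0)"
    by (simp add: ext_def)
qed

end

text \<open>A homomorphism into I_(2m-1) is determined by its row at the monomial \<open>0\<close>,
  an element of e_(2m) J e_(2m-1). The assumption \<open>generic\<close> is that its coefficient at
  a_m does not vanish.\<close>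

locale toda_kernel = toda_algebra n for n :: nat +
  fixes m :: nat and f :: "complex mat"
  assumes m: "1 \<le> m" "m \<le> n"
    and f: "f \<in> toda.Hom n (inj_module (2 * m)) (inj_module (2 * m - 1))"
    and generic: "f $$ (pos (basis (2 * m - 1)) 0, pos (basis (2 * m)) (0, 0, 1, 0)) \<noteq> 0"
begin

declare One_nat_def [simp del]

abbreviation "B1 \<equiv> basis (2 * m - 1)"
abbreviation "B2 \<equiv> basis (2 * m)"

definition coef :: "nat \<times> nat \<times> nat \<times> nat \<Rightarrow> complex" where
  "coef u = f $$ (pos B1 0, pos B2 u)"

definition C :: "(nat \<times> nat \<times> nat \<times> nat) set" where
  "C = {u \<in> B2. source (2 * m) u = 2 * m - 1}"

text \<open>Elements of the kernel, as functions on all quadruples that vanish off the basis.\<close>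

definition sols :: "(nat \<times> nat \<times> nat \<times> nat \<Rightarrow> complex) set" where
  "sols = {\<phi>. (\<forall>u. u \<notin> B2 \<longrightarrow> \<phi> u = 0) \<and> (\<forall>w\<in>B1. (\<Sum>u\<in>C. coef u * \<phi> (u + w)) = 0)}"

lemma B2_iff: "(p, q, s, t) \<in> B2 \<longleftrightarrow> p < m \<and> q + m \<le> n \<and> (s + t = p + q \<or> s + t = p + q + 1)"
  by (simp add: basis_def)

lemma B1_iff: "(p, q, s, t) \<in> B1 \<longleftrightarrow> p < m \<and> q + m \<le> n \<and> (s + t + 1 = p + q \<or> s + t = p + q)"
proof -
  have "(2 * m - 1 + 1) div 2 = m" "(2 * m - 1) mod 2 = 1" using m(1) by presburger+
  then show ?thesis by (auto simp: basis_def)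
qed

lemma B1_Suc: "(p, q, s, t) \<in> B1 \<longleftrightarrow> (p, q, Suc s, t) \<in> B2"
  by (auto simp: B1_iff B2_iff)

lemma v1: "2 * m - 1 \<in> {1..2 * n}"
  using m by auto

text \<open>These are the monomials of e_(2m) J e_(2m-1). Both ends lie in column \<open>m\<close>,
  so r and l occur equally often.\<close>

lemma C_iff: "(p, q, s, t) \<in> C \<longleftrightarrow> p = q \<and> s + t = 2 * p + 1 \<and> p < m \<and> p + m \<le> n"
proof
  assume *: "(p, q, s, t) \<in> C"
  then have b: "(p, q, s, t) \<in> B2" and s: "source (2 * m) (p, q, s, t) = 2 * m - 1" by (auto simp: C_def)
  have "(2 * m - 1) mod 2 = 1" using m(1) by presburger
  then have "s + t = p + q + 1" "2 * m - 1 + p + s + t = 2 * m + 3 * q"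
    using source(1,2)[OF b] s by simp_all
  then show "p = q \<and> s + t = 2 * p + 1 \<and> p < m \<and> p + m \<le> n"
    using b[unfolded B2_iff] m(1) by auto
next
  assume *: "p = q \<and> s + t = 2 * p + 1 \<and> p < m \<and> p + m \<le> n"
  then have "(p, q, s, t) \<in> B2" by (auto simp: B2_iff)
  moreover have "source (2 * m) (p, q, s, t) = 2 * m - 1"
    by (rule source_eqI[OF \<open>(p, q, s, t) \<in> B2\<close>]) (use * m in auto)
  ultimately show "(p, q, s, t) \<in> C" by (simp add: C_def)
qed

lemma finite_C: "finite C" by (simp add: C_def)

lemma lead_in_C: "(0, 0, 1, 0) \<in> C"
  using m by (simp add: C_iff)

lemma fc: "f \<in> carrier_mat (card B1) (card B2)"
  using f by (simp add: Hom_iff)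

text \<open>Row \<open>w\<close> of \<open>f\<close> is row \<open>0\<close> shifted by
  \<open>w\<close>: \<open>f\<close> commutes with \<open>walk (2 * m - 1) w\<close>, which moves
  the coordinate \<open>w\<close> to the coordinate \<open>0\<close>.\<close>

lemma f_entry:
  assumes w: "w \<in> B1"
  shows "(f *\<^sub>v vecI B2 \<phi>) $ pos B1 w = (\<Sum>u\<in>C. coef u * ext (2 * m) \<phi> (u + w))"
proof -
  let ?\<pi> = "path_elem (walk (2 * m - 1) w)"
  note wk = walk[OF v1 w]
  have \<pi>: "?\<pi> \<in> carrier P" using wk(1) by simp
  have z: "0 \<in> B1" by (rule zero_in_basis[OF v1])
  define y where "y = f *\<^sub>v vecI B2 \<phi>"
  have y: "y \<in> carrier_vec (card B1)" using fc by (simp add: y_def)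
  have im: "inj_mat v x \<in> carrier_mat (card (basis v)) (card (basis v))" for v x by (simp add: inj_mat_def)
  have "inj_mat (2 * m - 1) ?\<pi> *\<^sub>v y = f *\<^sub>v (inj_mat (2 * m) ?\<pi> *\<^sub>v vecI B2 \<phi>)"
  proof -
    have "f * inj_mat (2 * m) ?\<pi> = inj_mat (2 * m - 1) ?\<pi> * f"
      using f \<pi> unfolding Hom_iff by (simp add: act_inj_module)
    then show ?thesis
      unfolding y_def using assoc_mult_mat_vec[OF im fc vecI_carrier] assoc_mult_mat_vec[OF fc im vecI_carrier]
      by metis
  qed
  moreover have "(inj_mat (2 * m - 1) ?\<pi> *\<^sub>v y) $ pos B1 0 = y $ pos B1 w"
  proof -
    have "inj_mat (2 * m - 1) ?\<pi> *\<^sub>v vecI B1 (\<lambda>u. y $ pos B1 u) = vecI B1 (\<lambda>w'. if source (2 * m - 1) w' = 2 * m - 1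
        then ext (2 * m - 1) (\<lambda>u. y $ pos B1 u) (w' + w) else 0)"
      unfolding inj_mat_path[OF wk(1)] wk(2,3) ..
    then show ?thesis
      unfolding vecI_surj[OF finite_basis y] using z w by (simp add: vecI_pos source_zero ext_def)
  qed
  moreover have "(f *\<^sub>v (inj_mat (2 * m) ?\<pi> *\<^sub>v vecI B2 \<phi>)) $ pos B1 0 = (\<Sum>u\<in>C. coef u * ext (2 * m) \<phi> (u + w))"
  proof -
    let ?\<psi> = "\<lambda>w'. if source (2 * m) w' = 2 * m - 1 then ext (2 * m) \<phi> (w' + w) else 0"
    have "f *\<^sub>v vecI B2 ?\<psi> = vecI B1 (\<lambda>r. \<Sum>u\<in>B2. f $$ (pos B1 r, pos B2 u) * ?\<psi> u)"
      using matI_mult_vecI[OF finite_basis, of B1 "2 * m" "\<lambda>r u. f $$ (pos B1 r, pos B2 u)" ?\<psi>]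
      unfolding matI_surj[OF finite_basis finite_basis fc] .
    then have "(f *\<^sub>v vecI B2 ?\<psi>) $ pos B1 0 = (\<Sum>u\<in>B2. coef u * ?\<psi> u)"
      using z by (simp only: vecI_pos[OF finite_basis] coef_def)
    also have "\<dots> = (\<Sum>u\<in>C. coef u * ext (2 * m) \<phi> (u + w))"
      unfolding C_def by (rule sum.mono_neutral_cong_right) auto
    finally show ?thesis unfolding inj_mat_path[OF wk(1)] wk(2,3) .
  qed
  ultimately show ?thesis by (simp add: y_def)
qed

lemma vecI_in_kernel: "vecI B2 \<phi> \<in> mat_kernel f \<longleftrightarrow> ext (2 * m) \<phi> \<in> sols"
proof -
  have "vecI B2 \<phi> \<in> mat_kernel f \<longleftrightarrow> f *\<^sub>v vecI B2 \<phi> = 0\<^sub>v (card B1)"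
    using mat_kernel[OF fc] by auto
  also have "\<dots> \<longleftrightarrow> (\<forall>w\<in>B1. (f *\<^sub>v vecI B2 \<phi>) $ pos B1 w = 0)"
  proof
    assume *: "\<forall>w\<in>B1. (f *\<^sub>v vecI B2 \<phi>) $ pos B1 w = 0"
    show "f *\<^sub>v vecI B2 \<phi> = 0\<^sub>v (card B1)"
    proof (rule eq_vecI)
      fix i assume "i < dim_vec (0\<^sub>v (card B1))"
      then have i: "i < card B1" by simp
      show "(f *\<^sub>v vecI B2 \<phi>) $ i = 0\<^sub>v (card B1) $ i"
        using *[rule_format, OF enum_in[OF finite_basis i]] i by (simp add: pos_enum)
    qed (use fc in simp)
  qed (auto simp: pos)
  also have "\<dots> \<longleftrightarrow> ext (2 * m) \<phi> \<in> sols"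
    by (auto simp: f_entry sols_def ext_def)
  finally show ?thesis .
qed

lemma ext_sols: "\<phi> \<in> sols \<Longrightarrow> ext (2 * m) \<phi> = \<phi>"
  by (auto simp: sols_def ext_def)

definition C' where "C' = C - {(0, 0, 1, 0)}"

lemma C_sum: "(\<Sum>u\<in>C. coef u * g u) = coef (0, 0, 1, 0) * g (0, 0, 1, 0) + (\<Sum>u\<in>C'. coef u * g u)"
  unfolding C'_def using finite_C lead_in_C by (rule sum.remove)

lemma lead_nonzero: "coef (0, 0, 1, 0) \<noteq> 0"
  using generic by (simp add: coef_def)

text \<open>The triangularity behind the recursion: apart from a_m, a monomial of \<open>C\<close>
  has \<open>k > 0\<close> letters r or is b_m, which contains no a.\<close>

lemma C'_cases:
  assumes "u \<in> C'"
  obtains k s t where "u = (k, k, s, t)" "s + t = 2 * k + 1" "k = 0 \<longrightarrow> s = 0"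
proof -
  obtain p q s t where u: "u = (p, q, s, t)" by (cases u)
  then have "p = q" "s + t = 2 * p + 1" "u \<noteq> (0, 0, 1, 0)" using assms by (auto simp: C'_def C_iff)
  then show ?thesis using u by (intro that[of p s t]) auto
qed

text \<open>The condition at \<open>w\<close> determines the value at \<open>w + (0, 0, 1, 0)\<close> from values at quadruples that
  have a larger first component or the same first component and fewer letters \<open>A\<close>.\<close>

lemma sols_lead:
  assumes "\<phi> \<in> sols" "(p, q, Suc s, t) \<in> B2"
  shows "\<phi> (p, q, Suc s, t) = - (\<Sum>u\<in>C'. coef u * \<phi> (u + (p, q, s, t))) / coef (0, 0, 1, 0)"
proof -
  have "(p, q, s, t) \<in> B1" using assms(2) by (simp add: B1_Suc)
  then have "(\<Sum>u\<in>C. coef u * \<phi> (u + (p, q, s, t))) = 0" using assms(1) by (auto simp: sols_def)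
  then show ?thesis using lead_nonzero by (simp add: C_sum field_simps add_eq_0_iff Suc_eq_plus1_left)
qed

text \<open>Iterating \<open>sols_lead\<close> removes all letters a: each step adds letters r, so
  that \<open>m - p\<close> drops, or turns an a into a b. Besides such replacements it adds only
  cycles with one r, one l and two letters a or b; \<open>j\<close> counts these cycles. The
  coefficients are uniform in \<open>\<phi>\<close>.\<close>

lemma expansion_aux:
  "\<forall>q t. \<exists>\<gamma>. \<forall>\<phi>\<in>sols. \<phi> (p, q, s, t) = (\<Sum>j<n. \<gamma> j * \<phi> (p + j, q + j, 0, t + s + 2 * j))"
proof (induction "(m - p, s)" arbitrary: p s rule: wf_induct_rule[OF wf_lex_prod[OF wf_less_than wf_less_than]])
  case (1 p s)
  show ?case
  proof (intro allI)
    fix q t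
    consider "(p, q, s, t) \<notin> B2" | "s = 0" | s' where "(p, q, s, t) \<in> B2" "s = Suc s'" by (cases s) auto
    then show "\<exists>\<gamma>. \<forall>\<phi>\<in>sols. \<phi> (p, q, s, t) = (\<Sum>j<n. \<gamma> j * \<phi> (p + j, q + j, 0, t + s + 2 * j))"
    proof cases
      case 1
      then show ?thesis by (intro exI[of _ "\<lambda>_. 0"]) (auto simp: sols_def)
    next
      case 2
      have "0 < n" using m by simp
      then show ?thesis using 2
        by (intro exI[of _ "\<lambda>j. if j = 0 then 1 else 0"]) (simp add: if_distrib[of "\<lambda>x. x * _"] sum.delta cong: if_cong)
    next
      case 3
      have IH: "\<exists>\<gamma>. \<forall>\<phi>\<in>sols. \<phi> (u + (p, q, s', t)) = (\<Sum>j<n. \<gamma> j * \<phi> (p + j, q + j, 0, t + s + 2 * j))"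
        if uC: "u \<in> C'" for u
      proof -
        obtain k s1 t1 where u: "u = (k, k, s1, t1)" "s1 + t1 = 2 * k + 1" "k = 0 \<longrightarrow> s1 = 0"
          using uC by (rule C'_cases)
        have p: "p < m" using 3 by (simp add: B2_iff)
        then have "((m - (k + p), s1 + s'), (m - p, s)) \<in> less_than <*lex*> less_than"
          using u 3 by (cases "k = 0") auto
        from 1[OF this] obtain \<gamma> where \<gamma>: "\<forall>\<phi>\<in>sols. \<phi> (k + p, k + q, s1 + s', t1 + t) =
            (\<Sum>j<n. \<gamma> j * \<phi> (k + p + j, k + q + j, 0, t1 + t + (s1 + s') + 2 * j))"
          by blast
        have "\<phi> (u + (p, q, s', t)) = (\<Sum>j<n. (if k \<le> j then \<gamma> (j - k) else 0) * \<phi> (p + j, q + j, 0, t + s + 2 * j))"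
          if \<phi>: "\<phi> \<in> sols" for \<phi>
        proof -
          let ?g = "\<lambda>j. \<gamma> j * \<phi> (p + (j + k), q + (j + k), 0, t + s + 2 * (j + k))"
          \<comment> \<open>After the shift by \<open>k\<close> the sum can again be taken over
            \<open>j < n\<close>, as monomials with \<open>n\<close> or more letters r lie outside
            the basis.\<close>
          have big: "\<phi> (p + j, q + j, 0, t + s + 2 * j) = 0" if "j \<ge> n" for j
            using \<phi> that m by (auto simp: sols_def B2_iff)
          have "\<phi> (u + (p, q, s', t)) = (\<Sum>j<n. ?g j)"
            unfolding u(1) add_Pair \<gamma>[rule_format, OF \<phi>]
          proof (intro sum.cong refl)
            fix j
            have "t1 + t + (s1 + s') + 2 * j = t + s + 2 * (j + k)" using u(2) 3 by simp
            then show "\<gamma> j * \<phi> (k + p + j, k + q + j, 0, t1 + t + (s1 + s') + 2 * j) = ?g j"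
              by (simp only: ac_simps)
          qed
          also have "\<dots> = (\<Sum>j\<in>{k..<n + k}. \<gamma> (j - k) * \<phi> (p + j, q + j, 0, t + s + 2 * j))"
            using sum.shift_bounds_nat_ivl[of "\<lambda>j. \<gamma> (j - k) * \<phi> (p + j, q + j, 0, t + s + 2 * j)" 0 k n]
            by (simp add: lessThan_atLeast0 ac_simps)
          also have "\<dots> = (\<Sum>j\<in>{..<n + k}. (if k \<le> j then \<gamma> (j - k) else 0) * \<phi> (p + j, q + j, 0, t + s + 2 * j))"
            by (rule sum.mono_neutral_cong_left) auto
          also have "\<dots> = (\<Sum>j<n. (if k \<le> j then \<gamma> (j - k) else 0) * \<phi> (p + j, q + j, 0, t + s + 2 * j))"
            by (rule sum.mono_neutral_cong_right) (auto simp: big)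
          finally show ?thesis .
        qed
        then show ?thesis by (intro exI[of _ "\<lambda>j. if k \<le> j then \<gamma> (j - k) else 0"] ballI)
      qed
      then have "\<forall>u\<in>C'. \<exists>\<gamma>. \<forall>\<phi>\<in>sols. \<phi> (u + (p, q, s', t)) = (\<Sum>j<n. \<gamma> j * \<phi> (p + j, q + j, 0, t + s + 2 * j))"
        by (rule ballI)
      from bchoice[OF this] obtain \<gamma> where \<gamma>: "\<forall>u\<in>C'. \<forall>\<phi>\<in>sols. \<phi> (u + (p, q, s', t)) =
          (\<Sum>j<n. \<gamma> u j * \<phi> (p + j, q + j, 0, t + s + 2 * j))"
        by (elim exE)
      have scale: "- (\<Sum>j<n. a j * b j) / c = (\<Sum>j<n. - a j / c * b j)" for a b :: "nat \<Rightarrow> complex" and c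
        by (simp add: sum_divide_distrib sum_negf[symmetric])
      have "\<phi> (p, q, s, t) = (\<Sum>j<n. (- (\<Sum>u\<in>C'. coef u * \<gamma> u j) / coef (0, 0, 1, 0)) * \<phi> (p + j, q + j, 0, t + s + 2 * j))"
        if \<phi>: "\<phi> \<in> sols" for \<phi>
      proof -
        have "\<phi> (p, q, s, t) = - (\<Sum>u\<in>C'. coef u * \<phi> (u + (p, q, s', t))) / coef (0, 0, 1, 0)"
          unfolding 3(2) by (rule sols_lead[OF \<phi>]) (use 3 in simp)
        also have "(\<Sum>u\<in>C'. coef u * \<phi> (u + (p, q, s', t))) =
            (\<Sum>u\<in>C'. \<Sum>j<n. coef u * \<gamma> u j * \<phi> (p + j, q + j, 0, t + s + 2 * j))"
          by (intro sum.cong refl) (simp add: \<gamma>[rule_format, OF _ \<phi>] sum_distrib_left mult.assoc)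
        also have "\<dots> = (\<Sum>j<n. (\<Sum>u\<in>C'. coef u * \<gamma> u j) * \<phi> (p + j, q + j, 0, t + s + 2 * j))"
          by (subst sum.swap) (simp add: sum_distrib_right)
        finally show ?thesis unfolding scale .
      qed
      then show ?thesis by (intro exI[of _ "\<lambda>j. - (\<Sum>u\<in>C'. coef u * \<gamma> u j) / coef (0, 0, 1, 0)"] ballI)
    qed
  qed
qed

lemma expansion:
  obtains \<gamma> where "\<And>\<phi>. \<phi> \<in> sols \<Longrightarrow> \<phi> (p, q, s, t) = (\<Sum>j<n. \<gamma> j * \<phi> (p + j, q + j, 0, t + s + 2 * j))"
proof -
  obtain \<gamma> where "\<forall>\<phi>\<in>sols. \<phi> (p, q, s, t) = (\<Sum>j<n. \<gamma> j * \<phi> (p + j, q + j, 0, t + s + 2 * j))"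
    using expansion_aux[of p s, THEN spec, of q, THEN spec, of t] by (elim exE)
  then have "\<And>\<phi>. \<phi> \<in> sols \<Longrightarrow> \<phi> (p, q, s, t) = (\<Sum>j<n. \<gamma> j * \<phi> (p + j, q + j, 0, t + s + 2 * j))"
    by blast
  then show ?thesis by (rule that)
qed

text \<open>The recursion of \<open>sols_lead\<close> read as a definition: values at the monomials
  without a are prescribed by \<open>\<xi>\<close> and the others computed. So these values are not
  only separating but also free coordinates on the kernel.\<close>

function solve :: "(nat \<times> nat \<times> nat \<times> nat \<Rightarrow> complex) \<Rightarrow> nat \<times> nat \<times> nat \<times> nat \<Rightarrow> complex" where
  "solve \<xi> (p, q, s, t) = (if (p, q, s, t) \<notin> B2 then 0 else if s = 0 then \<xi> (p, q, s, t)
     else - (\<Sum>u\<in>C'. coef u * solve \<xi> (u + (p, q, s - 1, t))) / coef (0, 0, 1, 0))"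
  by pat_completeness auto
termination
proof (relation "inv_image (less_than <*lex*> less_than) (\<lambda>(\<xi>, (p, q, s, t)). (m - p, s))")
  fix \<xi> :: "nat \<times> nat \<times> nat \<times> nat \<Rightarrow> complex" and p q s t u
  assume "\<not> (p, q, s, t) \<notin> B2" "s \<noteq> 0" "u \<in> C'"
  then show "((\<xi>, u + (p, q, s - 1, t)), (\<xi>, (p, q, s, t))) \<in> inv_image (less_than <*lex*> less_than) (\<lambda>(\<xi>, (p, q, s, t)). (m - p, s))"
    by (elim C'_cases) (auto simp: B2_iff)
qed auto

declare solve.simps [simp del]

lemma solve_in_sols: "solve \<xi> \<in> sols"
  unfolding sols_def
proof (intro CollectI conjI allI impI ballI)
  fix u assume "u \<notin> B2"
  then show "solve \<xi> u = 0" by (cases u) (simp add: solve.simps)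
next
  fix w assume w: "w \<in> B1"
  obtain p q s t where pq: "w = (p, q, s, t)" by (cases w)
  have "solve \<xi> (p, q, Suc s, t) = - (\<Sum>u\<in>C'. coef u * solve \<xi> (u + w)) / coef (0, 0, 1, 0)"
    using w pq by (subst solve.simps) (simp add: B1_Suc)
  then show "(\<Sum>u\<in>C. coef u * solve \<xi> (u + w)) = 0"
    using lead_nonzero by (simp add: C_sum pq Suc_eq_plus1_left)
qed

lemma solve_T: "(p, q, 0, t) \<in> B2 \<Longrightarrow> solve \<xi> (p, q, 0, t) = \<xi> (p, q, 0, t)"
  by (simp add: solve.simps)

end

section \<open>Submodules of the kernel\<close>

lemma subspace_vec_iff:
  "VectorSpace.subspace class_ring N (module_vec TYPE(complex) d) \<longleftrightarrow> N \<subseteq> carrier_vec d \<and> 0\<^sub>v d \<in> N \<and>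
    (\<forall>v\<in>N. \<forall>w\<in>N. v + w \<in> N) \<and> (\<forall>c. \<forall>v\<in>N. c \<cdot>\<^sub>v v \<in> N)"
proof -
  interpret vec_space "TYPE(complex)" d .
  show ?thesis
    unfolding VectorSpace.subspace_def submodule_def
    using vectorspace_axioms module_axioms by (auto simp: module_vec_simps class_ring_simps)
qed

lemma dim_image_frame:
  assumes F: "F \<in> carrier_mat d k" and inj: "inj_on (\<lambda>v. F *\<^sub>v v) (carrier_vec k)"
  shows "vectorspace.dim class_ring
    ((module_vec TYPE(complex) d)\<lparr>carrier := (\<lambda>v. F *\<^sub>v v) ` carrier_vec k\<rparr>) = k"
proof -
  let ?N = "(\<lambda>v. F *\<^sub>v v) ` carrier_vec k"
  interpret V: vec_space "TYPE(complex)" k .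
  interpret W: vec_space "TYPE(complex)" d .
  have "VectorSpace.subspace class_ring ?N (module_vec TYPE(complex) d)"
    unfolding subspace_vec_iff
  proof (intro conjI ballI allI)
    have "0\<^sub>v d = F *\<^sub>v 0\<^sub>v k" using F by auto
    then show "0\<^sub>v d \<in> ?N" by (rule image_eqI) simp
  next
    fix v w assume "v \<in> ?N" "w \<in> ?N"
    then obtain x y where "x \<in> carrier_vec k" "y \<in> carrier_vec k" "v = F *\<^sub>v x" "w = F *\<^sub>v y" by auto
    then show "v + w \<in> ?N"
      using mult_add_distrib_mat_vec[OF F, of x y] by (intro image_eqI[of _ _ "x + y"]) auto
  next
    fix c v assume "v \<in> ?N"
    then obtain x where "x \<in> carrier_vec k" "v = F *\<^sub>v x" by auto
    then show "c \<cdot>\<^sub>v v \<in> ?N"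
      using mult_mat_vec[OF F, of x c] by (intro image_eqI[of _ _ "c \<cdot>\<^sub>v x"]) auto
  qed (use F in auto)
  then have vs: "vectorspace class_ring (W.vs ?N)"
    by (rule W.subspace_is_vs)
  have "linear_map class_ring V.V (W.vs ?N) (\<lambda>v. F *\<^sub>v v)"
  proof (intro linear_map.intro mod_hom.intro mod_hom_axioms.intro)
    show "vectorspace class_ring V.V" by unfold_locales
    show "module class_ring V.V" by unfold_locales
    show "vectorspace class_ring (W.vs ?N)" by (rule vs)
    then show "module class_ring (W.vs ?N)" by (simp add: vectorspace_def)
    show "(\<lambda>v. F *\<^sub>v v) \<in> module_hom class_ring V.V (W.vs ?N)"
      using mult_add_distrib_mat_vec[OF F] mult_mat_vec[OF F]
      by (auto simp: module_hom_def module_vec_simps class_ring_simps)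
  qed
  from linear_map.dim_eq[OF this V.fin_dim] show ?thesis
    using inj by (simp add: module_vec_simps V.dim_is_n)
qed

context toda_kernel
begin

text \<open>The part at the vertex \<open>y\<close> of an element of the kernel is determined by its values at the
  quadruples \<open>tau y j\<close>.\<close>

definition tau :: "nat \<Rightarrow> nat \<Rightarrow> nat \<times> nat \<times> nat \<times> nat" where
  "tau y j = (let i = (y + 1) div 2 in (j + (m - i), j + (i - m), 0, 2 * j + (m - i) + (i - m) + y mod 2))"

text \<open>A walk from column \<open>i\<close> to column \<open>m\<close> needs
  \<open>m - i\<close> letters r or \<open>i - m\<close> letters l, one of which truncates to zero,
  with letters b in between. Each unit of \<open>j\<close> inserts a cycle with letters b, r, b,
  l.\<close>

lemma tau_even: "tau (2 * i) j = (j + (m - i), j + (i - m), 0, 2 * j + (m - i) + (i - m))"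
  and tau_odd: "1 \<le> i \<Longrightarrow> tau (2 * i - 1) j = (j + (m - i), j + (i - m), 0, 2 * j + (m - i) + (i - m) + 1)"
proof -
  show "tau (2 * i) j = (j + (m - i), j + (i - m), 0, 2 * j + (m - i) + (i - m))"
    by (simp add: tau_def)
  assume "1 \<le> i"
  then have "(2 * i - 1 + 1) div 2 = i" "(2 * i - 1) mod 2 = 1" by presburger+
  then show "tau (2 * i - 1) j = (j + (m - i), j + (i - m), 0, 2 * j + (m - i) + (i - m) + 1)"
    by (simp add: tau_def Let_def)
qed

lemma tau_iff: "tau y j \<in> B2 \<longleftrightarrow> j + (m - (y + 1) div 2) < m \<and> j + ((y + 1) div 2 - m) + m \<le> n"
  by (auto simp: tau_def Let_def B2_iff)

lemma tau_add: "tau y j + (k, k, 0, 2 * k) = tau y (j + k)"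
  by (simp add: tau_def Let_def)

lemma tau_large: "n \<le> j \<Longrightarrow> tau y j \<notin> B2"
  using m by (auto simp: tau_iff)

lemma tau_mono: "tau y j \<in> B2 \<Longrightarrow> k \<le> j \<Longrightarrow> tau y k \<in> B2"
  by (auto simp: tau_iff)

lemma source_tau:
  assumes "tau y j \<in> B2"
  shows "source (2 * m) (tau y j) = y"
proof -
  define i where "i = (y + 1) div 2"
  have i: "2 * i = y + y mod 2" unfolding i_def by presburger
  have t: "tau y j = (j + (m - i), j + (i - m), 0, 2 * j + (m - i) + (i - m) + y mod 2)"
    by (simp add: tau_def Let_def i_def)
  have "y + (j + (m - i)) + 0 + (2 * j + (m - i) + (i - m) + y mod 2) = 2 * m + 3 * (j + (i - m))"
    using i by (cases "i \<le> m") auto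
  with assms show ?thesis unfolding t by (intro source_eqI)
qed

lemma tau_in_B2_source: "tau y j \<in> B2 \<Longrightarrow> y \<in> {1..2 * n}"
  using source_tau[of y j] source(3) by (cases "tau y j") metis

lemma sols_zero: "\<phi> \<in> sols \<Longrightarrow> u \<notin> B2 \<Longrightarrow> \<phi> u = 0"
  unfolding sols_def by blast

text \<open>The columns fix the difference of \<open>p\<close> and \<open>q\<close>, so
  \<open>min p q\<close> is the number of cycles that the monomial already contains. The expansion
  starts at this level and involves only higher ones.\<close>

lemma expansion_tau:
  assumes w: "(p, q, s, t) \<in> B2"
  obtains \<gamma> where "\<And>\<phi>. \<phi> \<in> sols \<Longrightarrow>
    \<phi> (p, q, s, t) = (\<Sum>j<n. \<gamma> j * \<phi> (tau (source (2 * m) (p, q, s, t)) (min p q + j)))"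
proof -
  define y where "y = source (2 * m) (p, q, s, t)"
  define i where "i = (y + 1) div 2"
  have i: "2 * i = y + y mod 2" unfolding i_def by presburger
  have y: "y + p + s + t = 2 * m + 3 * q" "s + t = p + q + y mod 2"
    using source(1,2)[OF w] by (simp_all only: y_def mod_mult_self1_is_0)
  then have ip: "i + p = m + q" using i by linarith
  have "tau y (min p q + j) = (p + j, q + j, 0, t + s + 2 * j)" for j
  proof -
    have "min p q + (m - i) = p" "min p q + (i - m) = q" "2 * min p q + (m - i) + (i - m) = p + q"
      using ip by (auto simp: min_def)
    then show ?thesis unfolding tau_def Let_def i_def[symmetric] using y(2) by auto
  qed
  note tau_eq = this
  show ?thesis
  proof (rule expansion[of p q s t])
    fix \<gamma> assume \<gamma>: "\<And>\<phi>. \<phi> \<in> sols \<Longrightarrow> \<phi> (p, q, s, t) = (\<Sum>j<n. \<gamma> j * \<phi> (p + j, q + j, 0, t + s + 2 * j))"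
    show thesis
    proof (rule that)
      fix \<phi> assume "\<phi> \<in> sols"
      then show "\<phi> (p, q, s, t) = (\<Sum>j<n. \<gamma> j * \<phi> (tau (source (2 * m) (p, q, s, t)) (min p q + j)))"
        unfolding y_def[symmetric] tau_eq by (rule \<gamma>)
    qed
  qed
qed

lemma sols_unique:
  assumes "\<phi> \<in> sols" "w \<in> B2" "\<And>j. \<phi> (tau (source (2 * m) w) j) = 0"
  shows "\<phi> w = 0"
proof -
  obtain p q s t where w: "w = (p, q, s, t)" by (cases w)
  obtain \<gamma> where "\<And>\<phi>. \<phi> \<in> sols \<Longrightarrow> \<phi> (p, q, s, t) = (\<Sum>j<n. \<gamma> j * \<phi> (tau (source (2 * m) (p, q, s, t)) (min p q + j)))"
    using expansion_tau[of p q s t] assms(2) w by blast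
  from this[OF assms(1)] show ?thesis using assms(3) by (simp add: w)
qed

lemma sols_add: "\<phi> \<in> sols \<Longrightarrow> \<psi> \<in> sols \<Longrightarrow> (\<lambda>u. \<phi> u + \<psi> u) \<in> sols"
  by (auto simp: sols_def distrib_left sum.distrib)

lemma sols_scale: "\<phi> \<in> sols \<Longrightarrow> (\<lambda>u. c * \<phi> u) \<in> sols"
  by (auto simp: sols_def mult.left_commute[of _ c] sum_distrib_left[symmetric])

lemma sols_sum: "finite F \<Longrightarrow> (\<And>i. i \<in> F \<Longrightarrow> g i \<in> sols) \<Longrightarrow> (\<lambda>u. \<Sum>i\<in>F. g i u) \<in> sols"
  by (induction F rule: finite_induct) (auto simp: sols_add, simp add: sols_def)

definition path_act :: "(nat, toda_arrow) path \<Rightarrow> (nat \<times> nat \<times> nat \<times> nat \<Rightarrow> complex) \<Rightarrow>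
    nat \<times> nat \<times> nat \<times> nat \<Rightarrow> complex" where
  "path_act \<pi> \<phi> w = (if w \<in> B2 \<and> source (2 * m) w = path_end Q \<pi> then \<phi> (w + content (snd \<pi>)) else 0)"

lemma vecI_path_act:
  assumes "\<phi> \<in> sols" "\<pi> \<in> paths Q"
  shows "inj_mat (2 * m) (path_elem \<pi>) *\<^sub>v vecI B2 \<phi> = vecI B2 (path_act \<pi> \<phi>)"
  unfolding inj_mat_path[OF assms(2)] ext_sols[OF assms(1)]
  by (intro vecI_cong finite_basis) (simp add: path_act_def)

lemma kernel_act:
  assumes x: "x \<in> carrier P" and v: "v \<in> mat_kernel f"
  shows "inj_mat (2 * m) x *\<^sub>v v \<in> mat_kernel f"
proof -
  have im: "inj_mat y x \<in> carrier_mat (card (basis y)) (card (basis y))" for y by (simp add: inj_mat_def)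
  have vc: "v \<in> carrier_vec (card B2)" and fv: "f *\<^sub>v v = 0\<^sub>v (card B1)" using v mat_kernel[OF fc] by auto
  have "f * inj_mat (2 * m) x = inj_mat (2 * m - 1) x * f"
    using f x unfolding Hom_iff by (simp add: act_inj_module)
  then have "f *\<^sub>v (inj_mat (2 * m) x *\<^sub>v v) = inj_mat (2 * m - 1) x *\<^sub>v (f *\<^sub>v v)"
    using assoc_mult_mat_vec[OF fc im vc] assoc_mult_mat_vec[OF im fc vc] by metis
  then have "f *\<^sub>v (inj_mat (2 * m) x *\<^sub>v v) = 0\<^sub>v (card B1)"
    using fv im[of "2 * m - 1"] by auto
  then show ?thesis using mat_kernel[OF fc] im[of "2 * m"] vc by auto
qed

lemma path_act_sols:
  assumes "\<phi> \<in> sols" "\<pi> \<in> paths Q"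
  shows "path_act \<pi> \<phi> \<in> sols"
proof -
  have "vecI B2 \<phi> \<in> mat_kernel f" using assms(1) by (simp add: vecI_in_kernel ext_sols)
  from kernel_act[OF _ this, of "path_elem \<pi>"] have "vecI B2 (path_act \<pi> \<phi>) \<in> mat_kernel f"
    using assms by (simp add: vecI_path_act)
  moreover have "ext (2 * m) (path_act \<pi> \<phi>) = path_act \<pi> \<phi>" by (auto simp: ext_def path_act_def)
  ultimately show ?thesis by (simp add: vecI_in_kernel)
qed

text \<open>At each vertex this is a member of the chain of invariant subspaces of a nilpotent
  Jordan block.\<close>

definition lev :: "(nat \<Rightarrow> nat) \<Rightarrow> (nat \<times> nat \<times> nat \<times> nat \<Rightarrow> complex) set" where
  "lev e = {\<phi> \<in> sols. \<forall>y\<in>{1..2 * n}. \<forall>j\<ge>e y. \<phi> (tau y j) = 0}"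

text \<open>Compatibility of the chains with the arrows. An arrow towards column \<open>m\<close>
  keeps the level and one away from it lowers the level by one, whence the alternatives
  \<open>0\<close> and \<open>1\<close>. The last clause bounds \<open>e y\<close> by the dimension
  of the kernel at \<open>y\<close>.\<close>

definition good :: "(nat \<Rightarrow> nat) \<Rightarrow> bool" where
  "good e \<longleftrightarrow> (\<forall>i\<in>{1..n}. e (2 * i - 1) \<le> e (2 * i)) \<and>
     (\<forall>i\<in>{1..<n}. e (2 * i) \<le> e (2 * i + 1) + (if i < m then 0 else 1)) \<and>
     (\<forall>i\<in>{2..n}. e (2 * i) \<le> e (2 * i - 3) + (if m < i then 0 else 1)) \<and>
     (\<forall>y\<in>{1..2 * n}. \<forall>j<e y. tau y j \<in> B2)"

lemma tau_B: "1 \<le> i \<Longrightarrow> tau (2 * i) j + (0, 0, 0, 1) = tau (2 * i - 1) j"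
  by (simp add: tau_even tau_odd)

text \<open>For \<open>i < m\<close> the letter r lies on the direct way to column \<open>m\<close>.
  Otherwise it has to be undone by an l, which makes one more cycle.\<close>

lemma tau_R: "1 \<le> i \<Longrightarrow> tau (2 * i + 1) j + (1, 0, 0, 0) = tau (2 * i) (if i < m then j else j + 1)"
proof -
  assume "1 \<le> i"
  have e: "2 * (i + 1) - 1 = 2 * i + 1" by simp
  have "tau (2 * i + 1) j = (j + (m - (i + 1)), j + (i + 1 - m), 0, 2 * j + (m - (i + 1)) + (i + 1 - m) + 1)"
    using tau_odd[of "i + 1" j] unfolding e by simp
  then show ?thesis unfolding \<open>tau (2 * i + 1) j = _\<close> by (auto simp: tau_even)
qed

lemma tau_L: "2 \<le> i \<Longrightarrow> tau (2 * i - 3) j + (0, 1, 0, 0) = tau (2 * i) (if m < i then j else j + 1)"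
proof -
  assume "2 \<le> i"
  then have "2 * (i - 1) - 1 = 2 * i - 3" "1 \<le> i - 1" by auto
  then show ?thesis using tau_odd[of "i - 1" j] \<open>2 \<le> i\<close> by (auto simp: tau_even)
qed

lemma lev_arrow:
  assumes e: "good e" and \<phi>: "\<phi> \<in> lev e" and a: "a \<in> arcs Q"
  shows "path_act (toda_tail a, [a]) \<phi> \<in> lev e"
  unfolding lev_def
proof (intro CollectI conjI ballI allI impI)
  have "(tail Q a, [a]) \<in> paths Q" using a head_in_verts[OF a] by simp
  then have p: "(toda_tail a, [a]) \<in> paths Q" by simp
  have \<phi>s: "\<phi> \<in> sols" and \<phi>0: "\<And>y j. y \<in> {1..2 * n} \<Longrightarrow> e y \<le> j \<Longrightarrow> \<phi> (tau y j) = 0"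
    using \<phi> by (auto simp: lev_def)
  show "path_act (toda_tail a, [a]) \<phi> \<in> sols" by (rule path_act_sols[OF \<phi>s p])
  fix y j assume y: "y \<in> {1..2 * n}" and j: "e y \<le> j"
  have "\<phi> (tau y j + letter a) = 0" if b: "tau y j \<in> B2" and y': "y = toda_head a"
  proof (cases a)
    case (B i)
    then have i: "1 \<le> i" "i \<le> n" using a by auto
    then have "e (2 * i - 1) \<le> j" using e j y' B by (auto simp: good_def intro: order_trans)
    moreover have "2 * i - 1 \<in> {1..2 * n}" using i by auto
    ultimately have "\<phi> (tau (2 * i - 1) j) = 0" by (intro \<phi>0)
    then show ?thesis using B y' i by (simp add: tau_B)
  next
    case (A i)
    then have i: "1 \<le> i" "i \<le> n" using a by auto
    then have ej: "e (2 * i - 1) \<le> j" using e j y' A by (auto simp: good_def intro: order_trans)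
    \<comment> \<open>A letter a leads off the coordinates \<open>tau\<close>. The value there
      expands in the coordinates at \<open>2 * i - 1\<close> of level at least \<open>j\<close>, and
      all of these vanish.\<close>
    define p q t where "p = j + (m - i)" "q = j + (i - m)" "t = 2 * j + (m - i) + (i - m)"
    have pq: "tau y j + letter a = (p, q, 1, t)" using A y' by (simp add: tau_even p_q_t_def)
    show ?thesis
    proof (cases "(p, q, 1, t) \<in> B2")
      case True
      have s: "source (2 * m) (p, q, 1, t) = 2 * i - 1"
        by (rule source_eqI[OF True]) (use i in \<open>auto simp: p_q_t_def\<close>)
      have "min p q = j" by (auto simp: p_q_t_def)
      moreover obtain \<gamma> where \<gamma>: "\<And>\<phi>. \<phi> \<in> sols \<Longrightarrow> \<phi> (p, q, 1, t) = (\<Sum>k<n. \<gamma> k * \<phi> (tau (2 * i - 1) (min p q + k)))"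
        using expansion_tau[OF True] unfolding s by blast
      moreover have "\<phi> (tau (2 * i - 1) (j + k)) = 0" for k
        by (rule \<phi>0) (use i ej in auto)
      ultimately show ?thesis using \<gamma>[OF \<phi>s] by (simp add: pq)
    qed (simp add: pq sols_zero[OF \<phi>s])
  next
    case (R i)
    then have i: "1 \<le> i" "i < n" using a by auto
    then have "e (2 * i) \<le> e (2 * i + 1) + (if i < m then 0 else 1)" using e by (auto simp: good_def)
    then have "e (2 * i) \<le> (if i < m then j else j + 1)"
      using j y' R by (auto split: if_splits)
    moreover have "2 * i \<in> {1..2 * n}" using i by auto
    ultimately have "\<phi> (tau (2 * i) (if i < m then j else j + 1)) = 0" by (intro \<phi>0)
    moreover have "tau y j + letter a = tau (2 * i) (if i < m then j else j + 1)"
      using tau_R[OF i(1), of j] unfolding y' R letter.simps toda_head.simps .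
    ultimately show ?thesis by (simp only:)
  next
    case (L i)
    then have i: "2 \<le> i" "i \<le> n" using a by auto
    then have "e (2 * i) \<le> e (2 * i - 3) + (if m < i then 0 else 1)" using e by (auto simp: good_def)
    then have "e (2 * i) \<le> (if m < i then j else j + 1)"
      using j y' L by (auto split: if_splits)
    moreover have "2 * i \<in> {1..2 * n}" using i by auto
    ultimately have "\<phi> (tau (2 * i) (if m < i then j else j + 1)) = 0" by (intro \<phi>0)
    moreover have "tau y j + letter a = tau (2 * i) (if m < i then j else j + 1)"
      using tau_L[OF i(1), of j] unfolding y' L letter.simps toda_head.simps .
    ultimately show ?thesis by (simp only:)
  qed
  note zero = this
  show "path_act (toda_tail a, [a]) \<phi> (tau y j) = 0"
  proof (cases "tau y j \<in> B2 \<and> y = toda_head a")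
    case True
    have "content (snd (toda_tail a, [a])) = letter a" by simp
    then show ?thesis using zero True unfolding path_act_def by (simp only: if_split) simp
  next
    case False
    then have "\<not> (tau y j \<in> B2 \<and> source (2 * m) (tau y j) = path_end Q (toda_tail a, [a]))"
      using source_tau[of y j] by auto
    then show ?thesis unfolding path_act_def by (simp only: if_False)
  qed
qed

lemma lev_vertex:
  assumes \<phi>: "\<phi> \<in> lev e" and u: "u \<in> {1..2 * n}"
  shows "path_act (u, []) \<phi> \<in> lev e"
  using path_act_sols[of \<phi> "(u, [])"] \<phi> u by (auto simp: lev_def path_act_def)

definition sub :: "(nat \<Rightarrow> nat) \<Rightarrow> complex vec set" where
  "sub e = vecI B2 ` lev e"

lemma vecI_add: "vecI X \<phi> + vecI X \<psi> = vecI X (\<lambda>u. \<phi> u + \<psi> u)"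
  and vecI_smult: "c \<cdot>\<^sub>v vecI X \<phi> = vecI X (\<lambda>u. c * \<phi> u)"
  and vecI_zero: "vecI X (\<lambda>_. 0) = 0\<^sub>v (card X)"
  by (auto simp: vecI_def)

lemma vecI_sols_inj: "\<phi> \<in> sols \<Longrightarrow> \<psi> \<in> sols \<Longrightarrow> vecI B2 \<phi> = vecI B2 \<psi> \<Longrightarrow> \<phi> = \<psi>"
  by (metis ext vecI_eq_iff[OF finite_basis] sols_zero)

lemma zero_sols: "(\<lambda>_. 0) \<in> sols" by (simp add: sols_def)

lemma sub_kernel: "sub e \<subseteq> mat_kernel f"
  by (auto simp: sub_def lev_def vecI_in_kernel ext_sols)

lemma sub_subspace: "VectorSpace.subspace class_ring (sub e) (module_vec TYPE(complex) (card B2))"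
  unfolding subspace_vec_iff sub_def
proof (intro conjI ballI allI)
  show "0\<^sub>v (card B2) \<in> vecI B2 ` lev e"
    using vecI_zero[of B2] zero_sols by (intro image_eqI[of _ _ "\<lambda>_. 0"]) (auto simp: lev_def)
qed (auto simp: lev_def vecI_add vecI_smult intro!: imageI sols_add sols_scale)

lemma is_submodule_sub:
  assumes e: "good e"
  shows "toda.is_submodule n (inj_module (2 * m)) (sub e)"
  unfolding is_submodule_iff mdim_inj_module
proof (intro conjI sub_subspace ballI)
  note S = sub_subspace[of e, unfolded subspace_vec_iff]
  have im: "inj_mat (2 * m) x \<in> carrier_mat (card B2) (card B2)" for x by (simp add: inj_mat_def)
  note M = is_module_inj_module[of "2 * m"]
  have path: "act (inj_module (2 * m)) (cls (path_elem (u, p))) *\<^sub>v v \<in> sub e"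
    if "(u, p) \<in> paths Q" "v \<in> sub e" for u p v
    using that
  proof (induction p arbitrary: u v)
    case Nil
    then have "u \<in> {1..2 * n}" by simp
    with Nil show ?case
      by (auto simp: act_inj_module sub_def vecI_path_act lev_def intro!: imageI lev_vertex[unfolded lev_def, simplified])
  next
    case (Cons a p)
    have a: "a \<in> arcs Q" "u = toda_tail a" "(toda_head a, p) \<in> paths Q"
      using Cons.prems(1) by (simp_all only: path_Cons_iff toda_quiver_simps)
    have "(tail Q a, [a]) \<in> paths Q" using a(1) head_in_verts[OF a(1)] by simp
    then have p1: "(toda_tail a, [a]) \<in> paths Q" by simp
    have "path_elem (u, a # p) = path_elem (toda_head a, p) \<otimes>\<^bsub>P\<^esub> path_elem (toda_tail a, [a])"
      by (simp add: path_elem_mult a(2))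
    then have "act (inj_module (2 * m)) (cls (path_elem (u, a # p))) *\<^sub>v v =
      act (inj_module (2 * m)) (cls (path_elem (toda_head a, p))) *\<^sub>v
        (act (inj_module (2 * m)) (cls (path_elem (toda_tail a, [a]))) *\<^sub>v v)"
      using act_carrier[OF M path_elem_closed[OF a(3)]] act_carrier[OF M path_elem_closed[OF p1]] S Cons.prems(2)
        act_mult[OF M path_elem_closed[OF a(3)] path_elem_closed[OF p1]]
      by (auto intro!: assoc_mult_mat_vec simp del: act_inj_module)
    moreover have "act (inj_module (2 * m)) (cls (path_elem (toda_tail a, [a]))) *\<^sub>v v \<in> sub e"
    proof -
      obtain \<phi> where \<phi>: "v = vecI B2 \<phi>" "\<phi> \<in> lev e" using Cons.prems(2) by (auto simp: sub_def)
      then have "\<phi> \<in> sols" by (simp add: lev_def)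
      then show ?thesis
        using lev_arrow[OF e \<phi>(2) a(1)] p1 by (simp add: act_inj_module[OF path_elem_closed[OF p1]] \<phi>(1) vecI_path_act sub_def)
    qed
    ultimately show ?case using Cons.IH[OF a(3)] by simp
  qed
  fix x v assume x: "x \<in> carrier P" and v: "v \<in> sub e"
  show "act (inj_module (2 * m)) (cls x) *\<^sub>v v \<in> sub e"
  proof (rule cpa_induct[where N = "4 * n + 2" and Q = "\<lambda>x. act (inj_module (2 * m)) (cls x) *\<^sub>v v \<in> sub e"])
    have vc: "v \<in> carrier_vec (card B2)" using v S by auto
    show "act (inj_module (2 * m)) (cls x) *\<^sub>v v \<in> sub e" if "x \<in> I" for x
    proof -
      have "0\<^sub>m (card B2) (card B2) *\<^sub>v v = 0\<^sub>v (card B2)" using vc by (intro eq_vecI) auto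
      then show ?thesis using act_I[OF M that] S by simp
    qed
    show "act (inj_module (2 * m)) (cls (\<lambda>w. x w + y w)) *\<^sub>v v \<in> sub e"
      if "x \<in> carrier P" "y \<in> carrier P" "act (inj_module (2 * m)) (cls x) *\<^sub>v v \<in> sub e"
        "act (inj_module (2 * m)) (cls y) *\<^sub>v v \<in> sub e" for x y
      using that S add_mult_distrib_mat_vec[OF act_carrier[OF M that(1)] act_carrier[OF M that(2)], of v] vc
      by (simp add: act_add[OF M])
    show "act (inj_module (2 * m)) (cls (\<lambda>z. c * path_elem w z)) *\<^sub>v v \<in> sub e" if "w \<in> paths Q" for c w
    proof -
      have "act (inj_module (2 * m)) (cls (path_elem w)) *\<^sub>v v \<in> sub e"
        using path[of "fst w" "snd w" v] that v by simp
      moreover have "(c \<cdot>\<^sub>m X) *\<^sub>v v = c \<cdot>\<^sub>v (X *\<^sub>v v)" if "X \<in> carrier_mat (card B2) (card B2)" for X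
        using that vc by (intro eq_vecI) (auto simp: scalar_prod_def sum_distrib_left mult.assoc)
      ultimately show ?thesis
        using S act_carrier[OF M path_elem_closed[OF that]] by (simp add: act_scale[OF M path_elem_closed[OF that]])
    qed
  qed (use x long_paths_in_I in auto)
qed

lemma kernel_vecE:
  assumes "v \<in> mat_kernel f"
  obtains \<phi> where "\<phi> \<in> sols" "v = vecI B2 \<phi>"
proof -
  define \<phi> where "\<phi> = ext (2 * m) (\<lambda>u. v $ pos B2 u)"
  have "v \<in> carrier_vec (card B2)" using assms mat_kernel[OF fc] by auto
  then have v: "v = vecI B2 (\<lambda>u. v $ pos B2 u)" by (simp add: vecI_surj)
  then have "\<phi> \<in> sols" using assms vecI_in_kernel unfolding \<phi>_def by metis
  moreover have "vecI B2 (\<lambda>u. v $ pos B2 u) = vecI B2 \<phi>"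
    by (intro vecI_cong finite_basis) (simp add: \<phi>_def ext_def)
  ultimately show ?thesis using v by (intro that) auto
qed

lemma shift_walk:
  assumes y: "y \<in> {1..2 * n}" and k: "tau y k \<in> B2"
  obtains \<pi> where "\<pi> \<in> paths Q" "path_end Q \<pi> = y" "content (snd \<pi>) = (k, k, 0, 2 * k)"
proof -
  have "(k, k, 0, 2 * k) \<in> basis y"
    using k[unfolded tau_iff] y m by (auto simp: basis_def)
  then show ?thesis using walk[OF y] that by blast
qed

text \<open>A closed walk with \<open>k\<close> cycles acts on the coordinates at \<open>y\<close>
  as the \<open>k\<close>-th power of the nilpotent shift.\<close>

lemma path_act_shift:
  assumes "\<phi> \<in> sols" "path_end Q \<pi> = y" "content (snd \<pi>) = (k, k, 0, 2 * k)"
  shows "path_act \<pi> \<phi> (tau y j) = \<phi> (tau y (j + k))"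
proof (cases "tau y j \<in> B2")
  case True
  then show ?thesis using assms(2,3) source_tau[OF True] by (simp add: path_act_def tau_add)
next
  case False
  then have "tau y (j + k) \<notin> B2" using tau_mono[of y "j + k" j] by auto
  then show ?thesis using False sols_zero[OF assms(1)] by (simp add: path_act_def)
qed

text \<open>A submodule is the sum of its parts at the vertices, and each part, being invariant
  under the shift, is determined by the highest level occurring in it. \<open>e y\<close> is one
  more than this level, or zero if the part at \<open>y\<close> is.\<close>

lemma submodule_levels:
  assumes N: "toda.is_submodule n (inj_module (2 * m)) N" and K: "N \<subseteq> mat_kernel f"
  obtains e where "good e" "N = sub e"
proof -
  define Nf where "Nf = {\<phi> \<in> sols. vecI B2 \<phi> \<in> N}"
  have N': "VectorSpace.subspace class_ring N (module_vec TYPE(complex) (card B2))"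
      "\<And>x v. x \<in> carrier P \<Longrightarrow> v \<in> N \<Longrightarrow> act (inj_module (2 * m)) (cls x) *\<^sub>v v \<in> N"
    using N unfolding is_submodule_iff mdim_inj_module by blast+
  note S = N'(1)[unfolded subspace_vec_iff]
  have N_eq: "N = vecI B2 ` Nf"
  proof
    show "N \<subseteq> vecI B2 ` Nf"
    proof
      fix v assume v: "v \<in> N"
      then obtain \<phi> where "\<phi> \<in> sols" "v = vecI B2 \<phi>" using K by (blast elim: kernel_vecE)
      then show "v \<in> vecI B2 ` Nf" using v by (auto simp: Nf_def)
    qed
  qed (auto simp: Nf_def)
  have Nf_sols: "\<phi> \<in> Nf \<Longrightarrow> \<phi> \<in> sols" for \<phi> by (simp add: Nf_def)
  have Nf_zero: "(\<lambda>_. 0) \<in> Nf" using S vecI_zero[of B2] zero_sols by (simp add: Nf_def)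
  have Nf_add: "(\<lambda>u. \<phi> u + \<psi> u) \<in> Nf" if "\<phi> \<in> Nf" "\<psi> \<in> Nf" for \<phi> \<psi>
    using that S by (auto simp: Nf_def sols_add vecI_add[symmetric])
  have Nf_scale: "(\<lambda>u. c * \<phi> u) \<in> Nf" if "\<phi> \<in> Nf" for c \<phi>
    using that S by (auto simp: Nf_def sols_scale vecI_smult[symmetric])
  have Nf_act: "path_act \<pi> \<phi> \<in> Nf" if "\<phi> \<in> Nf" "\<pi> \<in> paths Q" for \<pi> \<phi>
    using N'(2)[OF path_elem_closed[OF that(2)], of "vecI B2 \<phi>"] that
    by (simp add: Nf_def path_act_sols act_inj_module[OF path_elem_closed[OF that(2)]] vecI_path_act)
  have Nf_sum: "(\<lambda>u. \<Sum>i\<in>F. g i u) \<in> Nf" if "finite F" "\<And>i. i \<in> F \<Longrightarrow> g i \<in> Nf" for F and g :: "nat \<Rightarrow> _"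
    using that by (induction F rule: finite_induct) (auto simp: Nf_zero Nf_add)
  define e where "e y = (LEAST k. \<forall>\<phi>\<in>Nf. \<forall>j\<ge>k. \<phi> (tau y j) = 0)" for y
  have e: "\<forall>\<phi>\<in>Nf. \<forall>j\<ge>e y. \<phi> (tau y j) = 0" for y
    unfolding e_def by (rule LeastI[of _ n]) (use tau_large sols_zero Nf_sols in blast)
  have top: "\<exists>\<phi>\<in>Nf. \<phi> (tau y l) \<noteq> 0" if l: "e y = Suc l" for y l
  proof (rule ccontr)
    assume *: "\<not> (\<exists>\<phi>\<in>Nf. \<phi> (tau y l) \<noteq> 0)"
    have "\<forall>\<phi>\<in>Nf. \<forall>j\<ge>l. \<phi> (tau y j) = 0"
    proof (intro ballI allI impI)
      fix \<phi> j assume "\<phi> \<in> Nf" "l \<le> j"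
      then show "\<phi> (tau y j) = 0" using * e[of y] l by (cases "j = l") auto
    qed
    then have "e y \<le> l" unfolding e_def by (rule Least_le)
    then show False using l by simp
  qed
  \<comment> \<open>Elimination from low to high levels: an element of \<open>N\<close> with a
    nonzero coordinate at the top level is shifted down by a closed walk until its leading
    coordinate stands at level \<open>l\<close>, and a multiple of it is subtracted.\<close>
  have single: "\<forall>\<phi>\<in>sols. (\<forall>w\<in>B2. source (2 * m) w \<noteq> y \<longrightarrow> \<phi> w = 0) \<longrightarrow> (\<forall>j\<ge>l. \<phi> (tau y j) = 0) \<longrightarrow> \<phi> \<in> Nf"
    if y: "y \<in> {1..2 * n}" and "l \<le> e y" for y l
    using that(2)
  proof (induction l)
    case 0
    show ?case
    proof (intro ballI impI)
      fix \<phi> assume \<phi>: "\<phi> \<in> sols" "\<forall>w\<in>B2. source (2 * m) w \<noteq> y \<longrightarrow> \<phi> w = 0" "\<forall>j\<ge>0. \<phi> (tau y j) = 0"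
      have "\<phi> w = 0" for w
      proof (cases "w \<in> B2 \<and> source (2 * m) w = y")
        case True
        then show ?thesis using sols_unique[OF \<phi>(1), of w] \<phi>(3) by auto
      next
        case False
        then show ?thesis using \<phi>(2) sols_zero[OF \<phi>(1), of w] by blast
      qed
      then have "\<phi> = (\<lambda>_. 0)" by blast
      then show "\<phi> \<in> Nf" using Nf_zero by simp
    qed
  next
    case (Suc l)
    \<comment> \<open>The distance of level \<open>l\<close> from the top level
      \<open>e y - 1\<close>.\<close>
    define k where "k = e y - 1 - l"
    have ey: "e y = Suc (l + k)" using Suc.prems by (simp add: k_def)
    from top[OF this] obtain \<phi>0 where \<phi>0: "\<phi>0 \<in> Nf" "\<phi>0 (tau y (l + k)) \<noteq> 0" by blast
    then have "tau y (l + k) \<in> B2" using sols_zero Nf_sols by blast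
    then have "tau y k \<in> B2" by (rule tau_mono) simp
    then obtain \<pi> where \<pi>: "\<pi> \<in> paths Q" "path_end Q \<pi> = y" "content (snd \<pi>) = (k, k, 0, 2 * k)"
      using shift_walk[OF y] by blast
    define z where "z = path_act \<pi> \<phi>0"
    have z: "z \<in> Nf" using Nf_act[OF \<phi>0(1) \<pi>(1)] by (simp add: z_def)
    have z_tau: "z (tau y j) = \<phi>0 (tau y (j + k))" for j
      unfolding z_def by (rule path_act_shift[OF Nf_sols[OF \<phi>0(1)] \<pi>(2,3)])
    have z_supp: "z w = 0" if "source (2 * m) w \<noteq> y" for w using that \<pi>(2) by (simp add: z_def path_act_def)
    show ?case
    proof (intro ballI impI)
      fix \<phi> assume \<phi>: "\<phi> \<in> sols" "\<forall>w\<in>B2. source (2 * m) w \<noteq> y \<longrightarrow> \<phi> w = 0" "\<forall>j\<ge>Suc l. \<phi> (tau y j) = 0"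
      define c where "c = \<phi> (tau y l) / z (tau y l)"
      define \<psi> where "\<psi> u = \<phi> u + (- c) * z u" for u
      have "\<psi> \<in> sols" unfolding \<psi>_def by (intro sols_add sols_scale \<phi>(1) Nf_sols z)
      moreover have "\<forall>w\<in>B2. source (2 * m) w \<noteq> y \<longrightarrow> \<psi> w = 0"
        using \<phi>(2) z_supp by (simp add: \<psi>_def)
      moreover have "\<psi> (tau y j) = 0" if "l \<le> j" for j
      proof (cases "j = l")
        case True
        then show ?thesis using \<phi>0(2) by (simp add: \<psi>_def c_def z_tau)
      next
        case False
        then have "e y \<le> j + k" using that ey by simp
        then have "z (tau y j) = 0" using e[of y] \<phi>0(1) by (simp add: z_tau)
        then show ?thesis using \<phi>(3) False that by (simp add: \<psi>_def)
      qed
      ultimately have "\<psi> \<in> Nf" using Suc by simp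
      then have "(\<lambda>u. \<psi> u + c * z u) \<in> Nf" by (intro Nf_add Nf_scale z)
      then show "\<phi> \<in> Nf" by (simp add: \<psi>_def)
    qed
  qed
  have "Nf = lev e"
  proof
    show "Nf \<subseteq> lev e" using e Nf_sols by (auto simp: lev_def)
    show "lev e \<subseteq> Nf"
    proof
      fix \<phi> assume \<phi>: "\<phi> \<in> lev e"
      have "path_act (y, []) \<phi> \<in> Nf" if y: "y \<in> {1..2 * n}" for y
      proof -
        have "path_act (y, []) \<phi> \<in> lev e" by (rule lev_vertex[OF \<phi> y])
        then show ?thesis
          using single[OF y order_refl] y by (auto simp: lev_def path_act_def)
      qed
      \<comment> \<open>The vertex idempotents sum to the identity, so the parts at the vertices add
        up to \<open>\<phi>\<close>.\<close>
      then have "(\<lambda>w. \<Sum>y\<in>{1..2 * n}. path_act (y, []) \<phi> w) \<in> Nf" by (intro Nf_sum) auto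
      moreover have "(\<lambda>w. \<Sum>y\<in>{1..2 * n}. path_act (y, []) \<phi> w) = \<phi>"
      proof
        fix w
        have "\<phi> \<in> sols" using \<phi> by (simp add: lev_def)
        show "(\<Sum>y\<in>{1..2 * n}. path_act (y, []) \<phi> w) = \<phi> w"
        proof (cases "w \<in> B2")
          case True
          obtain p q s' t where "w = (p, q, s', t)" by (cases w)
          then have s: "source (2 * m) w \<in> {1..2 * n}" using True source(3)[of p q s' t "2 * m"] by (simp only:)
          have "(\<Sum>y\<in>{1..2 * n}. path_act (y, []) \<phi> w) = (\<Sum>y\<in>{1..2 * n}. if y = source (2 * m) w then \<phi> w else 0)"
            using True by (intro sum.cong) (auto simp: path_act_def)
          also have "\<dots> = \<phi> w" using s by (subst sum.delta) simp_all
          finally show ?thesis .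
        qed (simp add: path_act_def sols_zero[OF \<open>\<phi> \<in> sols\<close>])
      qed
      ultimately show "\<phi> \<in> Nf" by simp
    qed
  qed
  have below: "l < e y" if "\<phi> \<in> Nf" "\<phi> (tau y l) \<noteq> 0" for \<phi> y l
    using e[of y] that by (meson not_le)
  \<comment> \<open>Applied to an element with nonzero top coordinate at its tail, the arrow yields
    a nonzero coordinate \<open>l'\<close> at its head, which bounds \<open>e\<close> there from
    below.\<close>
  have arrow: "l' < e (toda_head a)"
    if a: "a \<in> arcs Q" and l: "e (toda_tail a) = Suc l" and t: "tau (toda_head a) l' + letter a = tau (toda_tail a) l"
      and b: "tau (toda_tail a) l \<in> B2 \<Longrightarrow> tau (toda_head a) l' \<in> B2" for a l l'
  proof -
    obtain \<phi> where \<phi>: "\<phi> \<in> Nf" "\<phi> (tau (toda_tail a) l) \<noteq> 0" using top[OF l] by blast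
    then have "tau (toda_tail a) l \<in> B2" using sols_zero Nf_sols by blast
    then have b': "tau (toda_head a) l' \<in> B2" by (rule b)
    have "(tail Q a, [a]) \<in> paths Q" using a head_in_verts[OF a] by simp
    then have "path_act (toda_tail a, [a]) \<phi> \<in> Nf" using Nf_act[OF \<phi>(1)] by simp
    moreover have "path_act (toda_tail a, [a]) \<phi> (tau (toda_head a) l') = \<phi> (tau (toda_tail a) l)"
      using b' source_tau[OF b'] t by (simp add: path_act_def)
    ultimately show ?thesis using below \<phi>(2) by simp
  qed
  have "good e"
    unfolding good_def
  proof (intro conjI ballI allI impI)
    fix i assume i: "i \<in> {1..n}"
    show "e (2 * i - 1) \<le> e (2 * i)"
    proof (cases "e (2 * i - 1)")
      case (Suc l)
      have "l < e (toda_head (B i))"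
        by (rule arrow) (use i Suc tau_B[of i l] in \<open>auto simp: tau_iff\<close>)
      then show ?thesis using Suc by simp
    qed simp
  next
    fix i assume i: "i \<in> {1..<n}"
    show "e (2 * i) \<le> e (2 * i + 1) + (if i < m then 0 else 1)"
    proof (cases "e (2 * i)")
      case (Suc l)
      show ?thesis
      proof (cases "i < m")
        case True
        have "l < e (toda_head (R i))"
          by (rule arrow) (use i Suc tau_R[of i l] True in \<open>auto simp: tau_iff\<close>)
        then show ?thesis using Suc True by simp
      next
        case False
        \<comment> \<open>An arrow away from column \<open>m\<close> loses one level, so level
          \<open>l = 0\<close> imposes no condition at its head.\<close>
        show ?thesis
        proof (cases l)
          case (Suc l')
          have "l' < e (toda_head (R i))"
            by (rule arrow) (use i \<open>e (2 * i) = Suc l\<close> Suc tau_R[of i l'] False in \<open>auto simp: tau_iff\<close>)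
          then show ?thesis using \<open>e (2 * i) = Suc l\<close> Suc False by simp
        qed (use \<open>e (2 * i) = Suc l\<close> False in simp)
      qed
    qed simp
  next
    fix i assume i: "i \<in> {2..n}"
    then have i3: "(2 * i - 3 + 1) div 2 = i - 1" by auto
    show "e (2 * i) \<le> e (2 * i - 3) + (if m < i then 0 else 1)"
    proof (cases "e (2 * i)")
      case (Suc l)
      show ?thesis
      proof (cases "m < i")
        case True
        have "l < e (toda_head (L i))"
          by (rule arrow) (use i i3 Suc tau_L[of i l] True in \<open>auto simp: tau_iff\<close>)
        then show ?thesis using Suc True by simp
      next
        case False
        show ?thesis
        proof (cases l)
          case (Suc l')
          have "l' < e (toda_head (L i))"
            by (rule arrow) (use i i3 \<open>e (2 * i) = Suc l\<close> Suc tau_L[of i l'] False in \<open>auto simp: tau_iff\<close>)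
          then show ?thesis using \<open>e (2 * i) = Suc l\<close> Suc False by simp
        qed (use \<open>e (2 * i) = Suc l\<close> False in simp)
      qed
    qed simp
  next
    fix y j assume "y \<in> {1..2 * n}" "j < e y"
    then obtain l where l: "e y = Suc l" "j \<le> l" by (cases "e y") auto
    then have "tau y l \<in> B2" using top[OF l(1)] sols_zero Nf_sols by blast
    then show "tau y j \<in> B2" using l(2) by (rule tau_mono)
  qed
  moreover have "N = sub e" unfolding sub_def \<open>Nf = lev e\<close>[symmetric] by (rule N_eq)
  ultimately show ?thesis by (rule that)
qed

end

section \<open>The quiver Grassmannians\<close>

lemma topspace_quotient_topology: "topspace (quotient_topology X q) = q ` topspace X"
proof -
  have "istopology (\<lambda>U. U \<subseteq> q ` topspace X \<and> openin X {x \<in> topspace X. q x \<in> U})"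
    unfolding istopology_def
  proof (intro conjI allI impI)
    fix S T assume S: "S \<subseteq> q ` topspace X \<and> openin X {x \<in> topspace X. q x \<in> S}"
      and T: "T \<subseteq> q ` topspace X \<and> openin X {x \<in> topspace X. q x \<in> T}"
    have "{x \<in> topspace X. q x \<in> S \<inter> T} = {x \<in> topspace X. q x \<in> S} \<inter> {x \<in> topspace X. q x \<in> T}" by auto
    then show "openin X {x \<in> topspace X. q x \<in> S \<inter> T}" using S T by (simp only: openin_Int)
    show "S \<inter> T \<subseteq> q ` topspace X" using S by auto
  next
    fix K assume K: "\<forall>S\<in>K. S \<subseteq> q ` topspace X \<and> openin X {x \<in> topspace X. q x \<in> S}"
    have "{x \<in> topspace X. q x \<in> \<Union>K} = (\<Union>S\<in>K. {x \<in> topspace X. q x \<in> S})" by auto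
    then show "openin X {x \<in> topspace X. q x \<in> \<Union>K}" using K by (auto intro: openin_Union)
    show "\<Union>K \<subseteq> q ` topspace X" using K by auto
  qed
  then have "openin (quotient_topology X q) U \<longleftrightarrow> U \<subseteq> q ` topspace X \<and> openin X {x \<in> topspace X. q x \<in> U}" for U
    by (simp add: quotient_topology_def topology_inverse')
  moreover have "{x \<in> topspace X. q x \<in> q ` topspace X} = topspace X" by auto
  ultimately have "openin (quotient_topology X q) (q ` topspace X)"
    "\<And>U. openin (quotient_topology X q) U \<Longrightarrow> U \<subseteq> q ` topspace X" by auto
  then show ?thesis by (intro antisym) (auto simp: topspace_def)
qed

lemma topspace_grassmannian:
  "topspace (grassmannian k d) = (\<lambda>F. (\<lambda>v. F *\<^sub>v v) ` carrier_vec k) ` frames k d"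
proof -
  have "topspace (frame_topology k d) = frames k d"
    by (auto simp: frame_topology_def topspace_pullback_topology)
  then show ?thesis by (simp add: grassmannian_def topspace_quotient_topology)
qed

text \<open>The only nonempty candidate consists of the unit, which satisfies a relation with
  exponent 1.\<close>

lemma abelian_rank_trivial:
  assumes "trivial_group G"
  shows "abelian_rank G = 0"
proof -
  interpret group G using assms by (simp add: trivial_group_def)
  have one: "carrier G = {\<one>\<^bsub>G\<^esub>}" using assms by (simp add: trivial_group_def)
  have "B = {}" if B: "int_independent G B" for B
  proof (rule ccontr)
    assume "B \<noteq> {}"
    then have B1: "B = {\<one>\<^bsub>G\<^esub>}" using B one by (auto simp: int_independent_def)
    interpret comm_group G
      by (rule group_comm_groupI) (simp add: one)
    have "finprod G (\<lambda>b. b [^]\<^bsub>G\<^esub> (1 :: int)) B = \<one>\<^bsub>G\<^esub>"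
      unfolding B1 by simp
    moreover have "\<forall>c :: _ \<Rightarrow> int. finprod G (\<lambda>b. b [^]\<^bsub>G\<^esub> c b) B = \<one>\<^bsub>G\<^esub> \<longrightarrow> (\<forall>b\<in>B. c b = 0)"
      using B unfolding int_independent_def by (elim conjE)
    ultimately have "\<forall>b\<in>B. (1 :: int) = 0" by (elim allE[of _ "\<lambda>_. 1"]) (rule mp)
    then show False using B1 by simp
  qed
  moreover have "int_independent G {}" by (simp add: int_independent_def)
  ultimately have "int_independent G B \<longleftrightarrow> B = {}" for B by blast
  then have "{card B | B. int_independent G B} = {0}" by simp
  then show ?thesis by (simp add: abelian_rank_def)
qed

text \<open>Two elements of an infinite cyclic group satisfy a relation whose exponents are, up to
  sign, each other's images in the integers. So independent sets have at most one element, and a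
  generator gives one.\<close>

lemma abelian_rank_integers:
  assumes G: "comm_group G" and iso: "G \<cong> integer_group"
  shows "abelian_rank G = 1"
proof -
  interpret comm_group G by (rule G)
  obtain h where h: "h \<in> iso G integer_group" using iso by (auto simp: is_iso_def)
  then have hom: "h \<in> hom G integer_group" and bij: "bij_betw h (carrier G) UNIV"
    by (auto simp: iso_def)
  interpret h: group_hom G integer_group h
    by (intro group_hom.intro group_hom_axioms.intro hom group_integer_group) unfold_locales
  have pow: "h (x [^]\<^bsub>G\<^esub> c) = c * h x" if "x \<in> carrier G" for x and c :: int
    using h.hom_int_pow[OF that] by simp
  have inj: "x = y" if "x \<in> carrier G" "y \<in> carrier G" "h x = h y" for x y
    using bij that by (auto simp: bij_betw_def dest: inj_onD)
  have h1: "h \<one>\<^bsub>G\<^esub> = 0" using h.hom_one by simp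
  have le: "card B \<le> 1" if B: "int_independent G B" for B
  proof (rule ccontr)
    assume "\<not> card B \<le> 1"
    then have "Suc (Suc 0) \<le> card B" by simp
    then obtain b1 b2 B' where b: "B = insert b1 (insert b2 B')" "b1 \<noteq> b2" "b1 \<notin> B'" "b2 \<notin> B'"
      by (auto simp: card_le_Suc_iff)
    have fin: "finite B'" and c: "b1 \<in> carrier G" "b2 \<in> carrier G" "B' \<subseteq> carrier G"
      using B b by (auto simp: int_independent_def)
    define d where "d = (\<lambda>x. if x = b1 then h b2 else if x = b2 then - h b1 else 0)"
    have "finprod G (\<lambda>x. x [^]\<^bsub>G\<^esub> d x) B' = \<one>\<^bsub>G\<^esub>"
      using b by (intro finprod_one_eqI) (auto simp: d_def)
    then have "finprod G (\<lambda>x. x [^]\<^bsub>G\<^esub> d x) B = b1 [^]\<^bsub>G\<^esub> h b2 \<otimes>\<^bsub>G\<^esub> b2 [^]\<^bsub>G\<^esub> (- h b1)"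
      unfolding b(1) using b fin c by (subst finprod_insert; auto simp: Pi_def d_def subset_iff)+
    also have "\<dots> = \<one>\<^bsub>G\<^esub>"
      using c by (intro inj) (auto simp: h1 pow)
    finally have "\<forall>x\<in>B. d x = 0" using B by (auto simp: int_independent_def)
    then have "h b1 = h b2" using b by (auto simp: d_def split: if_splits)
    then show False using inj c b(2) by blast
  qed
  obtain g where g: "g \<in> carrier G" "h g = 1" using bij by (metis UNIV_I bij_betw_iff_bijections)
  have "int_independent G {g}"
    unfolding int_independent_def
  proof (intro conjI allI impI)
    fix c :: "_ \<Rightarrow> int" assume "finprod G (\<lambda>b. b [^]\<^bsub>G\<^esub> c b) {g} = \<one>\<^bsub>G\<^esub>"
    then have "g [^]\<^bsub>G\<^esub> c g = \<one>\<^bsub>G\<^esub>" using g by simp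
    then have "h (g [^]\<^bsub>G\<^esub> c g) = 0" using h1 by simp
    then show "\<forall>b\<in>{g}. c b = 0" using g by (simp add: pow)
  qed (use g in auto)
  then have "1 \<in> {card B | B. int_independent G B}" by (intro CollectI exI[of _ "{g}"]) simp
  then show ?thesis
    unfolding abelian_rank_def using le by (intro cSup_eq_maximum) auto
qed

text \<open>A point has homology \<open>integer_group\<close> in degree zero and trivial homology in
  the other degrees.\<close>

lemma euler_characteristic_point:
  assumes X: "topspace X = {a}"
  shows "euler_characteristic X = 1"
proof -
  have r: "abelian_rank (homology_group (int p) X) = (if p = 0 then 1 else 0)" for p
    using abelian_rank_trivial[OF homology_dimension_axiom[OF X, of "int p"]]
      abelian_rank_integers[OF abelian_homology_group homology_coefficients[OF X]] by auto
  have "{p. abelian_rank (homology_group (int p) X) \<noteq> 0} = {0}" unfolding r by auto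
  then show ?thesis unfolding euler_characteristic_def using r[of 0] by simp
qed

context toda_kernel
begin

text \<open>The basis of the kernel dual to the coordinates \<open>tau\<close>.\<close>

definition kap :: "nat \<times> nat \<Rightarrow> nat \<times> nat \<times> nat \<times> nat \<Rightarrow> complex" where
  "kap = (\<lambda>(y, j). solve (\<lambda>w. if w = tau y j then 1 else 0))"

definition frame :: "(nat \<times> nat) set \<Rightarrow> complex mat" where
  "frame X = matI B2 X (\<lambda>u i. kap i u)"

lemma kap_sols: "kap i \<in> sols"
  by (cases i) (simp add: kap_def solve_in_sols)

lemma kap_tau:
  assumes "tau y j \<in> B2"
  shows "kap i (tau y j) = (if i = (y, j) then 1 else 0)"
proof -
  obtain y' j' where i: "i = (y', j')" by (cases i)
  obtain p q t where t: "tau y j = (p, q, 0, t)" by (auto simp: tau_def Let_def)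
  have "kap i (tau y j) = (if tau y j = tau y' j' then 1 else 0)"
    using solve_T[of p q t] assms by (simp add: i kap_def t)
  moreover have "tau y j = tau y' j' \<longleftrightarrow> y = y' \<and> j = j'"
  proof
    assume e: "tau y j = tau y' j'"
    then have "y = y'" using source_tau[of y j] source_tau[of y' j'] assms by simp
    then show "y = y' \<and> j = j'" using e by (simp add: tau_def Let_def)
  qed simp
  ultimately show ?thesis by (auto simp: i)
qed

context
  fixes X
  assumes X: "finite X" "\<And>y j. (y, j) \<in> X \<Longrightarrow> tau y j \<in> B2"
begin

lemma comb_sols: "(\<lambda>u. \<Sum>i\<in>X. kap i u * \<psi> i) \<in> sols"
proof -
  have "(\<lambda>u. \<psi> i * kap i u) \<in> sols" for i by (intro sols_scale kap_sols)
  then have "(\<lambda>u. \<Sum>i\<in>X. \<psi> i * kap i u) \<in> sols" by (intro sols_sum X(1)) auto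
  then show ?thesis by (simp add: mult.commute)
qed

lemma comb_tau:
  assumes "tau y j \<in> B2"
  shows "(\<Sum>i\<in>X. kap i (tau y j) * \<psi> i) = (if (y, j) \<in> X then \<psi> (y, j) else 0)"
proof -
  have "(\<Sum>i\<in>X. kap i (tau y j) * \<psi> i) = (\<Sum>i\<in>X. if i = (y, j) then \<psi> (y, j) else 0)"
    by (intro sum.cong) (auto simp: kap_tau[OF assms])
  then show ?thesis using X(1) by simp
qed

lemma frame_mult: "frame X *\<^sub>v vecI X \<psi> = vecI B2 (\<lambda>u. \<Sum>i\<in>X. kap i u * \<psi> i)"
  unfolding frame_def by (rule matI_mult_vecI[OF X(1)])

lemma frame_in_frames: "frame X \<in> frames (card X) (card B2)"
  unfolding frames_def
proof (intro CollectI conjI inj_onI)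
  show "frame X \<in> carrier_mat (card B2) (card X)" by (simp add: frame_def)
  fix v w assume v: "v \<in> carrier_vec (card X)" and w: "w \<in> carrier_vec (card X)"
    and eq: "frame X *\<^sub>v v = frame X *\<^sub>v w"
  define \<phi> \<psi> where "\<phi> i = v $ pos X i" and "\<psi> i = w $ pos X i" for i
  have vw: "v = vecI X \<phi>" "w = vecI X \<psi>" by (simp_all add: \<phi>_def[abs_def] \<psi>_def[abs_def] vecI_surj[OF X(1)] v w)
  have "(\<lambda>u. \<Sum>i\<in>X. kap i u * \<phi> i) = (\<lambda>u. \<Sum>i\<in>X. kap i u * \<psi> i)"
    by (rule vecI_sols_inj[OF comb_sols comb_sols]) (use eq in \<open>simp add: vw frame_mult\<close>)
  from fun_cong[OF this] have "\<phi> (y, j) = \<psi> (y, j)" if "(y, j) \<in> X" for y j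
    using comb_tau[OF X(2)[OF that], of \<phi>] comb_tau[OF X(2)[OF that], of \<psi>] that by simp
  then show "v = w" unfolding vw by (intro vecI_cong X(1)) auto
qed

text \<open>Subtracting from \<open>\<phi>\<close> the combination of the \<open>kap\<close> with
  the coordinates of \<open>\<phi>\<close> leaves a solution without coordinates, which is zero by
  \<open>sols_unique\<close>.\<close>

lemma frame_image: "(\<lambda>v. frame X *\<^sub>v v) ` carrier_vec (card X) =
    vecI B2 ` {\<phi> \<in> sols. \<forall>y j. (y, j) \<notin> X \<longrightarrow> \<phi> (tau y j) = 0}" (is "?l = vecI B2 ` ?r")
proof (intro equalityI subsetI)
  fix x assume "x \<in> ?l"
  then obtain v where v: "v \<in> carrier_vec (card X)" "x = frame X *\<^sub>v v" by auto
  then have x: "x = vecI B2 (\<lambda>u. \<Sum>i\<in>X. kap i u * v $ pos X i)"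
    using frame_mult[of "\<lambda>i. v $ pos X i"] vecI_surj[OF X(1) v(1)] by simp
  have "(\<Sum>i\<in>X. kap i (tau y j) * v $ pos X i) = 0" if "(y, j) \<notin> X" for y j
  proof (cases "tau y j \<in> B2")
    case True
    then show ?thesis using comb_tau[OF True] that by simp
  next
    case False
    then show ?thesis using sols_zero[OF kap_sols False] by simp
  qed
  then show "x \<in> vecI B2 ` ?r" unfolding x using comb_sols by (intro imageI CollectI) auto
next
  fix x assume "x \<in> vecI B2 ` ?r"
  then obtain \<phi> where \<phi>: "\<phi> \<in> sols" "\<And>y j. (y, j) \<notin> X \<Longrightarrow> \<phi> (tau y j) = 0" "x = vecI B2 \<phi>" by auto
  define \<psi> where "\<psi> = (\<lambda>(y, j). \<phi> (tau y j))"
  define d where "d u = \<phi> u + (- 1) * (\<Sum>i\<in>X. kap i u * \<psi> i)" for u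
  have ds: "d \<in> sols" unfolding d_def by (intro sols_add sols_scale comb_sols \<phi>(1))
  have "d (tau y j) = 0" for y j
  proof (cases "tau y j \<in> B2")
    case True
    then show ?thesis using comb_tau[OF True, of \<psi>] \<phi>(2) by (auto simp: d_def \<psi>_def)
  next
    case False
    then show ?thesis by (rule sols_zero[OF ds])
  qed
  then have "d w = 0" for w
    using sols_unique[OF ds, of w] sols_zero[OF ds, of w] by blast
  then have "\<phi> = (\<lambda>u. \<Sum>i\<in>X. kap i u * \<psi> i)" by (simp add: d_def fun_eq_iff)
  then have "x = frame X *\<^sub>v vecI X \<psi>" unfolding \<phi>(3) frame_mult by simp
  then show "x \<in> ?l" by (rule image_eqI) simp
qed

end

definition cells :: "(nat \<Rightarrow> nat) \<Rightarrow> (nat \<times> nat) set" where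
  "cells e = Sigma {1..2 * n} (\<lambda>y. {..<e y})"

lemma cells_B2: "good e \<Longrightarrow> (y, j) \<in> cells e \<Longrightarrow> tau y j \<in> B2"
  by (auto simp: cells_def good_def)

lemma sub_frame:
  assumes e: "good e"
  shows "sub e = (\<lambda>v. frame (cells e) *\<^sub>v v) ` carrier_vec (card (cells e))"
    and "frame (cells e) \<in> frames (card (cells e)) (card B2)"
proof -
  have fin: "finite (cells e)" by (simp add: cells_def)
  have "lev e = {\<phi> \<in> sols. \<forall>y j. (y, j) \<notin> cells e \<longrightarrow> \<phi> (tau y j) = 0}"
  proof -
    have "\<phi> (tau y j) = 0" if "\<phi> \<in> sols" "y \<notin> {1..2 * n}" for \<phi> y j
      using tau_in_B2_source[of y j] sols_zero[OF that(1)] that(2) by blast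
    then show ?thesis unfolding lev_def cells_def by (auto simp: not_less; metis)
  qed
  then show "sub e = (\<lambda>v. frame (cells e) *\<^sub>v v) ` carrier_vec (card (cells e))"
    unfolding sub_def by (simp add: frame_image[OF fin cells_B2[OF e]])
  show "frame (cells e) \<in> frames (card (cells e)) (card B2)"
    by (rule frame_in_frames[OF fin cells_B2[OF e]])
qed

text \<open>The idempotent at \<open>y\<close> restricts a function to the monomials starting at
  \<open>y\<close>; the image of \<open>sub e\<close> is therefore spanned by the dual basis
  elements of the cells at \<open>y\<close>.\<close>

lemma dimension_at_sub:
  assumes e: "good e" and y: "y \<in> {1..2 * n}"
  shows "toda.dimension_at n (inj_module (2 * m)) (sub e) y = e y"
proof -
  let ?X = "{y} \<times> {..<e y}"
  have X: "finite ?X" "\<And>y' j. (y', j) \<in> ?X \<Longrightarrow> tau y' j \<in> B2" using e y by (auto simp: good_def)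
  have p: "(y, []) \<in> paths Q" using y by simp
  have "(\<lambda>x. act (inj_module (2 * m)) (cls (path_elem (y, []))) *\<^sub>v x) ` sub e = vecI B2 ` path_act (y, []) ` lev e"
    unfolding sub_def image_image act_inj_module[OF path_elem_closed[OF p]]
    by (intro image_cong refl) (simp add: lev_def vecI_path_act[OF _ p])
  also have "path_act (y, []) ` lev e = {\<phi> \<in> sols. \<forall>y' j. (y', j) \<notin> ?X \<longrightarrow> \<phi> (tau y' j) = 0}"
  proof (intro equalityI subsetI)
    fix \<psi> assume "\<psi> \<in> path_act (y, []) ` lev e"
    then obtain \<phi> where \<phi>: "\<phi> \<in> lev e" "\<psi> = path_act (y, []) \<phi>" by auto
    have l: "\<psi> \<in> lev e" unfolding \<phi>(2) by (rule lev_vertex[OF \<phi>(1) y])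
    have "\<psi> (tau y' j) = 0" if "(y', j) \<notin> ?X" for y' j
    proof (cases "y' = y")
      case True
      then show ?thesis using that l y by (auto simp: lev_def)
    next
      case False
      then show ?thesis using source_tau[of y' j] by (auto simp: \<phi>(2) path_act_def)
    qed
    then show "\<psi> \<in> {\<phi> \<in> sols. \<forall>y' j. (y', j) \<notin> ?X \<longrightarrow> \<phi> (tau y' j) = 0}"
      using l by (simp add: lev_def)
  next
    fix \<phi> assume "\<phi> \<in> {\<phi> \<in> sols. \<forall>y' j. (y', j) \<notin> ?X \<longrightarrow> \<phi> (tau y' j) = 0}"
    then have \<phi>: "\<phi> \<in> sols" "\<And>y' j. y' \<noteq> y \<or> e y \<le> j \<Longrightarrow> \<phi> (tau y' j) = 0" by auto
    have "\<phi> \<in> lev e"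
      unfolding lev_def
    proof (intro CollectI conjI ballI allI impI \<phi>(1))
      fix y' j assume "e y' \<le> j"
      then show "\<phi> (tau y' j) = 0" by (cases "y' = y") (auto intro: \<phi>(2))
    qed
    moreover have "path_act (y, []) \<phi> = \<phi>"
    proof
      fix w show "path_act (y, []) \<phi> w = \<phi> w"
        using sols_unique[OF \<phi>(1), of w] \<phi>(2) sols_zero[OF \<phi>(1), of w] by (auto simp: path_act_def)
    qed
    ultimately show "\<phi> \<in> path_act (y, []) ` lev e" by (metis image_eqI)
  qed
  finally have im: "(\<lambda>x. act (inj_module (2 * m)) (cls (path_elem (y, []))) *\<^sub>v x) ` sub e =
      (\<lambda>v. frame ?X *\<^sub>v v) ` carrier_vec (card ?X)"
    by (simp only: frame_image[OF X])
  have "frame ?X \<in> frames (card ?X) (card B2)" by (rule frame_in_frames[OF X])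
  then have "vectorspace.dim class_ring ((module_vec TYPE(complex) (card B2))
      \<lparr>carrier := (\<lambda>v. frame ?X *\<^sub>v v) ` carrier_vec (card ?X)\<rparr>) = card ?X"
    by (intro dim_image_frame) (auto simp: frames_def)
  then show ?thesis
    unfolding toda.dimension_at_def im mdim_inj_module by simp
qed

text \<open>Dimension vectors are compared at the vertices, whereas \<open>e\<close> is a function
  on all numbers.\<close>

lemma good_cong: "(\<And>y. y \<in> {1..2 * n} \<Longrightarrow> e y = e' y) \<Longrightarrow> good e \<longleftrightarrow> good e'"
proof -
  assume e: "\<And>y. y \<in> {1..2 * n} \<Longrightarrow> e y = e' y"
  have "e (2 * i - 1) = e' (2 * i - 1)" "e (2 * i) = e' (2 * i)" if "i \<in> {1..n}" for i
    using that by (auto intro!: e)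
  moreover have "e (2 * i + 1) = e' (2 * i + 1)" if "i \<in> {1..<n}" for i using that by (auto intro!: e)
  moreover have "e (2 * i - 3) = e' (2 * i - 3)" if "i \<in> {2..n}" for i using that by (auto intro!: e)
  ultimately show ?thesis unfolding good_def using e by (auto cong: ball_cong)
qed

lemma sub_cong: "(\<And>y. y \<in> {1..2 * n} \<Longrightarrow> e y = e' y) \<Longrightarrow> sub e = sub e'"
  by (simp add: sub_def lev_def)

text \<open>By \<open>submodule_levels\<close> a point is some \<open>sub e'\<close>, and its
  dimension vector forces \<open>e'\<close> to agree with \<open>e\<close> at the vertices.\<close>

lemma topspace_quiver_grassmannian:
  "topspace (toda.quiver_grassmannian n (inj_module (2 * m)) (mat_kernel f) e) = (if good e then {sub e} else {})"
proof -
  have top: "topspace (toda.quiver_grassmannian n (inj_module (2 * m)) (mat_kernel f) e) =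
    topspace (grassmannian (\<Sum>v\<in>{1..2 * n}. e v) (card B2)) \<inter>
    {N. toda.is_submodule n (inj_module (2 * m)) N \<and> N \<subseteq> mat_kernel f \<and>
      (\<forall>v\<in>{1..2 * n}. toda.dimension_at n (inj_module (2 * m)) N v = e v)}"
    by (simp add: toda.quiver_grassmannian_def)
  have "N = sub e \<and> good e"
    if N: "toda.is_submodule n (inj_module (2 * m)) N" "N \<subseteq> mat_kernel f"
      "\<forall>v\<in>{1..2 * n}. toda.dimension_at n (inj_module (2 * m)) N v = e v" for N
  proof -
    obtain e' where e': "good e'" "N = sub e'" using submodule_levels[OF N(1,2)] .
    then have "e' y = e y" if "y \<in> {1..2 * n}" for y
      using N(3) that dimension_at_sub[OF e'(1) that] unfolding e'(2) by simp
    then show ?thesis using e' good_cong[of e' e] sub_cong[of e' e] by simp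
  qed
  moreover have "sub e \<in> topspace (grassmannian (\<Sum>v\<in>{1..2 * n}. e v) (card B2))" if "good e"
  proof -
    have "card (cells e) = (\<Sum>v\<in>{1..2 * n}. e v)" by (simp add: cells_def)
    then show ?thesis using sub_frame[OF that] unfolding topspace_grassmannian by auto
  qed
  ultimately show ?thesis
    unfolding top using is_submodule_sub sub_kernel dimension_at_sub by auto
qed

end

section \<open>Principal minors of the Toda matrix\<close>

definition minor :: "'a :: comm_ring_1 mat \<Rightarrow> nat set \<Rightarrow> 'a mat" where
  "minor M S = mat (card S) (card S) (\<lambda>(a, b). M $$ (pick S a, pick S b))"

lemma submatrix_eq_minor:
  assumes "M \<in> carrier_mat N N" "S \<subseteq> {0..<N}"
  shows "submatrix M S S = minor M S"
proof -
  have "{i. i < N \<and> i \<in> S} = S" using assms(2) by auto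
  then show ?thesis
    using assms(1) unfolding minor_def by (intro eq_matI) (auto simp: submatrix_index dim_submatrix)
qed

lemma pick_in: "finite S \<Longrightarrow> a < card S \<Longrightarrow> pick S a \<in> S"
  by (rule pick_in_set) simp

lemma pick_less: "finite S \<Longrightarrow> a < b \<Longrightarrow> b < card S \<Longrightarrow> pick S a < pick S b"
  by (rule pick_mono) auto

lemma pick_eq_iff: "finite S \<Longrightarrow> a < card S \<Longrightarrow> b < card S \<Longrightarrow> pick S a = pick S b \<longleftrightarrow> a = b"
  using pick_less[of S a b] pick_less[of S b a] by (cases a b rule: linorder_cases) auto

lemma bij_betw_pick:
  assumes "finite S"
  shows "bij_betw (pick S) {..<card S} S"
proof -
  have "inj_on (pick S) {..<card S}" using pick_eq_iff[OF assms] by (auto simp: inj_on_def)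
  moreover from card_image[OF this] have "pick S ` {..<card S} = S"
    using pick_in[OF assms] by (intro card_subset_eq assms) auto
  ultimately show ?thesis by (simp add: bij_betw_def)
qed

lemma minor_carrier [simp]: "minor M S \<in> carrier_mat (card S) (card S)"
  by (simp add: minor_def)

lemma index_mult_mat_sum:
  assumes "M \<in> carrier_mat a N" "M' \<in> carrier_mat N b" "r < a" "c < b"
  shows "(M * M') $$ (r, c) = (\<Sum>u<N. M $$ (r, u) * M' $$ (u, c))"
  using assms by (auto simp: scalar_prod_def lessThan_atLeast0 intro!: sum.cong)

text \<open>The case of the Cauchy-Binet formula in which only the intermediate set \<open>S\<close>
  contributes.\<close>

lemma minor_mult:
  assumes M: "M \<in> carrier_mat N N" "M' \<in> carrier_mat N N" and S: "S \<subseteq> {..<N}"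
    and off: "\<And>r c u. r \<in> S \<Longrightarrow> c \<in> S \<Longrightarrow> u < N \<Longrightarrow> u \<notin> S \<Longrightarrow> M $$ (r, u) * M' $$ (u, c) = 0"
  shows "minor (M * M') S = minor M S * minor M' S"
proof (rule eq_matI)
  have fin: "finite S" using S finite_subset by blast
  fix a b assume "a < dim_row (minor M S * minor M' S)" "b < dim_col (minor M S * minor M' S)"
  then have ab: "a < card S" "b < card S" by (simp_all add: minor_def)
  let ?r = "pick S a" and ?c = "pick S b"
  have rc: "?r \<in> S" "?c \<in> S" using ab pick_in[OF fin] by auto
  then have "?r < N" "?c < N" using S by auto
  then have "(M * M') $$ (?r, ?c) = (\<Sum>u<N. M $$ (?r, u) * M' $$ (u, ?c))"
    by (rule index_mult_mat_sum[OF M])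
  also have "\<dots> = (\<Sum>u\<in>S. M $$ (?r, u) * M' $$ (u, ?c))"
    using S rc off by (intro sum.mono_neutral_right) auto
  also have "\<dots> = (\<Sum>i<card S. M $$ (?r, pick S i) * M' $$ (pick S i, ?c))"
    by (rule sum.reindex_bij_betw[OF bij_betw_pick[OF fin], symmetric])
  also have "\<dots> = (minor M S * minor M' S) $$ (a, b)"
    using ab by (auto simp: minor_def scalar_prod_def lessThan_atLeast0 intro!: sum.cong)
  finally show "minor (M * M') S $$ (a, b) = (minor M S * minor M' S) $$ (a, b)"
    using ab by (simp add: minor_def)
qed (simp_all add: minor_def)

lemma prod_pick: "finite S \<Longrightarrow> (\<Prod>a<card S. f (pick S a)) = prod f S"
  by (rule prod.reindex_bij_betw[OF bij_betw_pick])

lemma det_minor_upper: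
  assumes "finite S" "\<And>r c. r \<in> S \<Longrightarrow> c \<in> S \<Longrightarrow> c < r \<Longrightarrow> M $$ (r, c) = 0"
  shows "det (minor M S) = (\<Prod>r\<in>S. M $$ (r, r))"
proof -
  have "upper_triangular (minor M S)"
    unfolding upper_triangular_def using assms pick_in pick_less by (auto simp: minor_def)
  then have "det (minor M S) = prod_list (diag_mat (minor M S))"
    by (rule det_upper_triangular[OF _ minor_carrier])
  also have "\<dots> = (\<Prod>a<card S. M $$ (pick S a, pick S a))"
    by (simp add: diag_mat_def prod.distinct_set_conv_list[symmetric]
        minor_def lessThan_atLeast0 cong: map_cong)
  finally show ?thesis using prod_pick[OF assms(1)] by simp
qed

lemma det_minor_lower:
  assumes "finite S" "\<And>r c. r \<in> S \<Longrightarrow> c \<in> S \<Longrightarrow> r < c \<Longrightarrow> M $$ (r, c) = 0"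
  shows "det (minor M S) = (\<Prod>r\<in>S. M $$ (r, r))"
proof -
  have "det (minor M S) = prod_list (diag_mat (minor M S))"
    by (rule det_lower_triangular[OF _ minor_carrier])
      (use assms pick_in pick_less in \<open>auto simp: minor_def\<close>)
  also have "\<dots> = (\<Prod>a<card S. M $$ (pick S a, pick S a))"
    by (simp add: diag_mat_def prod.distinct_set_conv_list[symmetric]
        minor_def lessThan_atLeast0 cong: map_cong)
  finally show ?thesis using prod_pick[OF assms(1)] by simp
qed

text \<open>Expanded along column \<open>a\<close>, both determinants are the same diagonal entry
  times the same cofactor. This is what allows row \<open>a\<close> of \<open>X\<close> to differ
  from that of \<open>Y\<close> off the diagonal.\<close>

lemma det_eq_if_column_diagonal:
  fixes X Y :: "'a :: comm_ring_1 mat"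
  assumes X: "X \<in> carrier_mat k k" and Y: "Y \<in> carrier_mat k k" and a: "a < k"
    and rows: "\<And>i j. i < k \<Longrightarrow> j < k \<Longrightarrow> i \<noteq> a \<Longrightarrow> X $$ (i, j) = Y $$ (i, j)"
    and col: "\<And>i. i < k \<Longrightarrow> i \<noteq> a \<Longrightarrow> Y $$ (i, a) = 0" and diag: "X $$ (a, a) = Y $$ (a, a)"
  shows "det X = det Y"
proof -
  have "mat_delete X a a = mat_delete Y a a"
    using X Y a rows by (intro eq_matI) (auto simp: mat_delete_def)
  then have "cofactor X a a = cofactor Y a a" by (simp add: cofactor_def)
  moreover have "det X = (\<Sum>i<k. X $$ (i, a) * cofactor X i a)" "det Y = (\<Sum>i<k. Y $$ (i, a) * cofactor Y i a)"
    using laplace_expansion_column[OF X a] laplace_expansion_column[OF Y a] by auto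
  moreover have "(\<Sum>i<k. X $$ (i, a) * cofactor X i a) = (\<Sum>i\<in>{a}. X $$ (i, a) * cofactor X i a)"
    using a rows col by (intro sum.mono_neutral_right) auto
  moreover have "(\<Sum>i<k. Y $$ (i, a) * cofactor Y i a) = (\<Sum>i\<in>{a}. Y $$ (i, a) * cofactor Y i a)"
    using a col by (intro sum.mono_neutral_right) auto
  ultimately show ?thesis using diag by simp
qed

text \<open>The factor \<open>j\<close> of the Toda matrix without its \<open>E_mat\<close>. The
  entry \<open>z\<close> below the diagonal stems from \<open>F_mat\<close>; it is scaled only by
  the second of the two diagonal matrices.\<close>

definition dFd :: "nat \<Rightarrow> nat \<Rightarrow> laurent \<Rightarrow> laurent \<Rightarrow> laurent mat" where
  "dFd n j y z = mat (n + 1) (n + 1) (\<lambda>(r, c). if r = c then (if r < j then y * z else 1)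
     else if r = j \<and> Suc c = j then z else 0)"

lemma dFd_eq:
  assumes "1 \<le> j" "j \<le> n"
  shows "E_mat n j * d_mat n j y * F_mat n j * d_mat n j z = E_mat n j * dFd n j y z"
proof -
  have c: "E_mat n j \<in> carrier_mat (n + 1) (n + 1)" "d_mat n j y \<in> carrier_mat (n + 1) (n + 1)"
    "F_mat n j \<in> carrier_mat (n + 1) (n + 1)" "d_mat n j z \<in> carrier_mat (n + 1) (n + 1)" for y z
    by (simp_all add: E_mat_def d_mat_def F_mat_def)
  have "d_mat n j y * F_mat n j * d_mat n j z = dFd n j y z"
  proof (rule eq_matI)
    fix r s assume "r < dim_row (dFd n j y z)" "s < dim_col (dFd n j y z)"
    then have rs: "r < n + 1" "s < n + 1" by (simp_all add: dFd_def)
    have 1: "(d_mat n j y * F_mat n j) $$ (r, s) = (if r < j then y else 1) * F_mat n j $$ (r, s)" if "s < n + 1" for s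
    proof -
      have "(d_mat n j y * F_mat n j) $$ (r, s) = (\<Sum>u<n + 1. d_mat n j y $$ (r, u) * F_mat n j $$ (u, s))"
        by (rule index_mult_mat_sum[OF c(2,3) rs(1) that])
      also have "\<dots> = (\<Sum>u<n + 1. if u = r then (if r < j then y else 1) * F_mat n j $$ (u, s) else 0)"
        using rs by (intro sum.cong) (auto simp: d_mat_def)
      finally show ?thesis using rs by (simp del: sum.lessThan_Suc add: less_Suc_eq_le)
    qed
    have "(d_mat n j y * F_mat n j * d_mat n j z) $$ (r, s) =
        (\<Sum>u<n + 1. (d_mat n j y * F_mat n j) $$ (r, u) * d_mat n j z $$ (u, s))"
      by (rule index_mult_mat_sum[OF mult_carrier_mat[OF c(2,3)] c(4) rs])
    also have "\<dots> = (\<Sum>u<n + 1. if u = s then (d_mat n j y * F_mat n j) $$ (r, s) * (if s < j then z else 1) else 0)"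
      using rs by (intro sum.cong) (auto simp: d_mat_def)
    also have "\<dots> = (if r < j then y else 1) * F_mat n j $$ (r, s) * (if s < j then z else 1)"
      using rs by (simp add: 1[OF rs(2)] del: sum.lessThan_Suc index_mult_mat)
    also have "\<dots> = dFd n j y z $$ (r, s)"
      using rs assms by (auto simp: F_mat_def dFd_def)
    finally show "(d_mat n j y * F_mat n j * d_mat n j z) $$ (r, s) = dFd n j y z $$ (r, s)" .
  qed (use c in \<open>auto simp: dFd_def d_mat_def\<close>)
  then show ?thesis
    using assoc_mult_mat[OF mult_carrier_mat[OF c(1,2)] c(3,4)] assoc_mult_mat[OF c(1,2) mult_carrier_mat[OF c(3,4)]]
      assoc_mult_mat[OF c(2,3,4)] by metis
qed

text \<open>Factor \<open>i\<close> has its off-diagonal entries in rows and columns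
  \<open>i - 1\<close> and \<open>i\<close>. The product of the factors after \<open>j\<close>
  therefore has none in a row or column with index below \<open>j\<close>.\<close>

definition diag_below :: "nat \<Rightarrow> nat \<Rightarrow> laurent mat \<Rightarrow> bool" where
  "diag_below n j Y \<longleftrightarrow> (\<forall>r\<le>n. \<forall>c\<le>n. r \<noteq> c \<longrightarrow> r < j \<or> c < j \<longrightarrow> Y $$ (r, c) = 0)"

definition weight :: "nat set \<Rightarrow> nat \<Rightarrow> laurent \<Rightarrow> laurent \<Rightarrow> laurent" where
  "weight S j y z = (let c = card (S \<inter> {..<j}) in
     if j - 1 \<in> S \<and> j \<notin> S then (y * z) ^ (c - 1) * ((y + 1) * z) else (y * z) ^ c)"

lemma E_dFd_mult:
  assumes Y: "Y \<in> carrier_mat (n + 1) (n + 1)" and j: "1 \<le> j" "j \<le> n" and r: "r \<le> n" and c: "c \<le> n"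
  shows "(dFd n j y z * Y) $$ (r, c) = (if r < j then y * z else 1) * Y $$ (r, c) + (if r = j then z * Y $$ (j - 1, c) else 0)"
    and "(E_mat n j * (dFd n j y z * Y)) $$ (r, c) = (dFd n j y z * Y) $$ (r, c) +
      (if r = j - 1 then (dFd n j y z * Y) $$ (j, c) else 0)"
proof -
  have D: "dFd n j y z \<in> carrier_mat (n + 1) (n + 1)" by (simp add: dFd_def)
  have "(dFd n j y z * Y) $$ (r, c) = (\<Sum>u<n + 1. dFd n j y z $$ (r, u) * Y $$ (u, c))"
    using r c by (intro index_mult_mat_sum[OF D Y]) auto
  also have "\<dots> = (\<Sum>u<n + 1. (if u = r then (if r < j then y * z else 1) * Y $$ (r, c) else 0) +
      (if u = j - 1 then (if r = j then z * Y $$ (j - 1, c) else 0) else 0))"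
    using r j by (intro sum.cong) (auto simp: dFd_def)
  also have "\<dots> = (if r < j then y * z else 1) * Y $$ (r, c) + (if r = j then z * Y $$ (j - 1, c) else 0)"
    unfolding sum.distrib using r j by (auto simp: sum.delta simp del: sum.lessThan_Suc)
  finally show "(dFd n j y z * Y) $$ (r, c) = (if r < j then y * z else 1) * Y $$ (r, c) + (if r = j then z * Y $$ (j - 1, c) else 0)" .
  have X: "dFd n j y z * Y \<in> carrier_mat (n + 1) (n + 1)" using D Y by simp
  have "(E_mat n j * (dFd n j y z * Y)) $$ (r, c) = (\<Sum>u<n + 1. E_mat n j $$ (r, u) * (dFd n j y z * Y) $$ (u, c))"
    using r c by (intro index_mult_mat_sum[OF _ X]) (auto simp: E_mat_def)
  also have "\<dots> = (\<Sum>u<n + 1. (if u = r then (dFd n j y z * Y) $$ (r, c) else 0) +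
      (if u = j then (if r = j - 1 then (dFd n j y z * Y) $$ (j, c) else 0) else 0))"
    using r j by (intro sum.cong) (auto simp: E_mat_def simp del: index_mult_mat)
  also have "\<dots> = (dFd n j y z * Y) $$ (r, c) + (if r = j - 1 then (dFd n j y z * Y) $$ (j, c) else 0)"
    unfolding sum.distrib using r j by (auto simp: sum.delta simp del: sum.lessThan_Suc index_mult_mat)
  finally show "(E_mat n j * (dFd n j y z * Y)) $$ (r, c) = (dFd n j y z * Y) $$ (r, c) +
      (if r = j - 1 then (dFd n j y z * Y) $$ (j, c) else 0)" .
qed

lemma diag_below_step:
  assumes "Y \<in> carrier_mat (n + 1) (n + 1)" "1 \<le> j" "j \<le> n" "diag_below n j Y"
  shows "diag_below n (j - 1) (E_mat n j * (dFd n j y z * Y))"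
  unfolding diag_below_def
proof (intro allI impI)
  fix r c assume rc: "r \<le> n" "c \<le> n" "r \<noteq> c" "r < j - 1 \<or> c < j - 1"
  then show "(E_mat n j * (dFd n j y z * Y)) $$ (r, c) = 0"
    using assms E_dFd_mult(2)[OF assms(1-3) rc(1,2)] E_dFd_mult(1)[OF assms(1-3) rc(1,2)]
      E_dFd_mult(1)[OF assms(1-3) assms(3) rc(2)]
    by (auto simp: diag_below_def)
qed

lemma prod_threshold:
  assumes "finite S"
  shows "(\<Prod>r\<in>S. if r < j then a else (1 :: 'a :: comm_monoid_mult)) = a ^ card (S \<inter> {..<j})"
proof -
  have "(\<Prod>r\<in>S. if r < j then a else 1) = (\<Prod>r\<in>S \<inter> {..<j}. a)"
    using assms by (intro prod.mono_neutral_cong_right) auto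
  then show ?thesis by simp
qed

text \<open>By Cauchy--Binet only the intermediate set \<open>S\<close> contributes, unless \<open>j - 1 \<in> S\<close> and \<open>j \<notin> S\<close>: then
  the path through row \<open>j\<close> multiplies the diagonal entry at \<open>j - 1\<close> by \<open>1 + y\<close> instead of \<open>y\<close>.\<close>

lemma minor_step:
  assumes Y: "Y \<in> carrier_mat (n + 1) (n + 1)" and j: "1 \<le> j" "j \<le> n" and d: "diag_below n j Y"
    and S: "S \<subseteq> {..<n + 1}"
  shows "det (minor (E_mat n j * (dFd n j y z * Y)) S) = weight S j y z * det (minor Y S)"
proof -
  have fin: "finite S" using S finite_subset by blast
  have Sn: "r \<in> S \<Longrightarrow> r \<le> n" for r using S by auto
  let ?D = "dFd n j y z"
  have D: "?D \<in> carrier_mat (n + 1) (n + 1)" and E: "E_mat n j \<in> carrier_mat (n + 1) (n + 1)"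
    by (simp_all add: dFd_def E_mat_def)
  have DY: "?D * Y \<in> carrier_mat (n + 1) (n + 1)" using D Y by simp
  show ?thesis
  proof (cases "j - 1 \<in> S \<and> j \<notin> S")
    case False
    \<comment> \<open>The only off-diagonal entry of \<open>?D\<close> leads from row
      \<open>j\<close> to \<open>j - 1\<close>; if \<open>j - 1\<close> is outside \<open>S\<close>,
      row \<open>j - 1\<close> of \<open>Y\<close> vanishes in the columns of
      \<open>S\<close>.\<close>
    have "minor (?D * Y) S = minor ?D S * minor Y S"
    proof (rule minor_mult[OF D Y S])
      fix r c u assume a: "r \<in> S" "c \<in> S" "u < n + 1" "u \<notin> S"
      then have rc: "r \<le> n" "c \<le> n" "r \<noteq> u" "u \<noteq> c" using Sn by auto
      show "?D $$ (r, u) * Y $$ (u, c) = 0"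
      proof (cases "r = j \<and> u = j - 1")
        case True
        then have "Y $$ (u, c) = 0" using d rc j by (auto simp: diag_below_def)
        then show ?thesis by simp
      next
        case False
        then have "?D $$ (r, u) = 0" using rc a(3) j by (auto simp: dFd_def)
        then show ?thesis by simp
      qed
    qed
    moreover have "minor (E_mat n j * (?D * Y)) S = minor (E_mat n j) S * minor (?D * Y) S"
    proof (rule minor_mult[OF E DY S])
      fix r c u assume a: "r \<in> S" "c \<in> S" "u < n + 1" "u \<notin> S"
      then have "r < n + 1" "r \<noteq> u" "\<not> (r = j - 1 \<and> u = j)" using S False by auto
      then have "E_mat n j $$ (r, u) = 0" using a(3) by (simp add: E_mat_def)
      then show "E_mat n j $$ (r, u) * (?D * Y) $$ (u, c) = 0" by simp
    qed
    moreover have "det (minor (E_mat n j) S) = 1"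
      using Sn j by (subst det_minor_upper[OF fin]) (auto simp: E_mat_def less_Suc_eq_le intro!: prod.neutral)
    moreover have "det (minor ?D S) = (y * z) ^ card (S \<inter> {..<j})"
    proof -
      have "det (minor ?D S) = (\<Prod>r\<in>S. ?D $$ (r, r))"
        using Sn by (intro det_minor_lower[OF fin]) (auto simp: dFd_def less_Suc_eq_le)
      also have "\<dots> = (\<Prod>r\<in>S. if r < j then y * z else 1)"
        using Sn by (intro prod.cong) (auto simp: dFd_def less_Suc_eq_le)
      finally show ?thesis by (simp add: prod_threshold[OF fin])
    qed
    ultimately show ?thesis
      using False det_mult[OF minor_carrier mult_carrier_mat[OF minor_carrier minor_carrier], of "E_mat n j" S ?D Y]
        det_mult[OF minor_carrier minor_carrier, of ?D S Y]
      by (auto simp: weight_def Let_def simp del: index_mult_mat)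
  next
    case True
    \<comment> \<open>The diagonal entry at \<open>j - 1\<close> receives \<open>y * z\<close>
      directly and \<open>z\<close> by the detour through row \<open>j\<close>. \<open>D'\<close>
      keeps this entry and drops what the detour adds off the diagonal.\<close>
    define D' where "D' = mat (n + 1) (n + 1) (\<lambda>(r, c). if r = c then
      (if r = j - 1 then (y + 1) * z else if r < j then y * z else 1) else 0)"
    have D': "D' \<in> carrier_mat (n + 1) (n + 1)" by (simp add: D'_def)
    have D'Y: "(D' * Y) $$ (r, c) = (if r = j - 1 then (y + 1) * z else if r < j then y * z else 1) * Y $$ (r, c)"
      if "r \<le> n" "c \<le> n" for r c
    proof -
      have "(D' * Y) $$ (r, c) = (\<Sum>u<n + 1. D' $$ (r, u) * Y $$ (u, c))"
        using that by (intro index_mult_mat_sum[OF D' Y]) auto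
      also have "\<dots> = (\<Sum>u<n + 1. if u = r then (if r = j - 1 then (y + 1) * z else if r < j then y * z else 1) * Y $$ (r, c) else 0)"
        using that by (intro sum.cong) (auto simp: D'_def)
      finally show ?thesis using that by (simp del: sum.lessThan_Suc index_mult_mat add: less_Suc_eq_le)
    qed
    have "j - 1 \<in> pick S ` {..<card S}"
      using bij_betw_pick[OF fin] True by (simp add: bij_betw_def)
    then obtain a where a: "a < card S" "pick S a = j - 1" by force
    have "det (minor (E_mat n j * (?D * Y)) S) = det (minor (D' * Y) S)"
    proof (rule det_eq_if_column_diagonal[OF minor_carrier minor_carrier a(1)])
      fix i k assume ik: "i < card S" "k < card S" "i \<noteq> a"
      let ?r = "pick S i" and ?c = "pick S k"
      have rc: "?r \<in> S" "?c \<in> S" using ik pick_in[OF fin] by auto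
      have "?r \<noteq> j - 1" using ik a pick_eq_iff[OF fin, of i a] by auto
      moreover have "?r \<noteq> j" using rc True by auto
      ultimately show "minor (E_mat n j * (?D * Y)) S $$ (i, k) = minor (D' * Y) S $$ (i, k)"
        using E_dFd_mult[OF Y j, of ?r ?c y z] D'Y[of ?r ?c] rc Sn ik by (simp add: minor_def del: index_mult_mat)
    next
      fix i assume i: "i < card S" "i \<noteq> a"
      have r: "pick S i \<in> S" using i pick_in[OF fin] by auto
      have "pick S i \<noteq> j - 1" using i a pick_eq_iff[OF fin, of i a] by auto
      then have "Y $$ (pick S i, j - 1) = 0" using d r Sn j by (auto simp: diag_below_def)
      then show "minor (D' * Y) S $$ (i, a) = 0"
        using D'Y[of "pick S i" "j - 1"] r Sn j i a by (simp add: minor_def del: index_mult_mat)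
    next
      have "Y $$ (j, j - 1) = 0" using d j by (auto simp: diag_below_def)
      then show "minor (E_mat n j * (?D * Y)) S $$ (a, a) = minor (D' * Y) S $$ (a, a)"
        using E_dFd_mult(1)[OF Y j, of j "j - 1" y z] E_dFd_mult[OF Y j, of "j - 1" "j - 1" y z]
          D'Y[of "j - 1" "j - 1"] j a
        by (simp add: minor_def algebra_simps del: index_mult_mat)
    qed
    also have "minor (D' * Y) S = minor D' S * minor Y S"
      using Sn by (intro minor_mult[OF D' Y S]) (auto simp: D'_def less_Suc_eq_le)
    also have "det \<dots> = (\<Prod>r\<in>S. D' $$ (r, r)) * det (minor Y S)"
      unfolding det_mult[OF minor_carrier minor_carrier]
      using Sn by (subst det_minor_upper[OF fin]) (auto simp: D'_def less_Suc_eq_le)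
    also have "(\<Prod>r\<in>S. D' $$ (r, r)) = D' $$ (j - 1, j - 1) * (\<Prod>r\<in>S - {j - 1}. D' $$ (r, r))"
      using True by (intro prod.remove[OF fin]) auto
    also have "(\<Prod>r\<in>S - {j - 1}. D' $$ (r, r)) = (\<Prod>r\<in>S - {j - 1}. if r < j then y * z else 1)"
      using Sn by (intro prod.cong) (auto simp: D'_def less_Suc_eq_le)
    also have "\<dots> = (y * z) ^ card ((S - {j - 1}) \<inter> {..<j})"
      using fin by (intro prod_threshold) auto
    also have "(S - {j - 1}) \<inter> {..<j} = (S \<inter> {..<j}) - {j - 1}" by auto
    also have "card \<dots> = card (S \<inter> {..<j}) - 1"
      using True j by (intro card_Diff_singleton) auto
    also have "D' $$ (j - 1, j - 1) = (y + 1) * z" using j by (simp add: D'_def)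
    finally show ?thesis using True by (simp add: weight_def Let_def mult.commute del: index_mult_mat)
  qed
qed

lemma minor_toda_matrix:
  assumes S: "S \<subseteq> {..<n + 1}"
  shows "det (minor (toda_matrix n) S) = (\<Prod>j\<in>{1..n}. weight S j (yvar n (2 * j - 1)) (yvar n (2 * j)))"
proof -
  define T where "T j = E_mat n j * d_mat n j (yvar n (2 * j - 1)) * F_mat n j * d_mat n j (yvar n (2 * j))" for j
  define Y where "Y j = foldr (*) (map T [j..<n + 1]) (1\<^sub>m (n + 1))" for j
  have fin: "finite S" using S finite_subset by blast
  \<comment> \<open>Induction downwards in the first factor, since \<open>diag_below\<close>
    describes products of the last factors.\<close>
  have "1 \<le> j \<Longrightarrow> Y j \<in> carrier_mat (n + 1) (n + 1) \<and> diag_below n (j - 1) (Y j) \<and>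
      det (minor (Y j) S) = (\<Prod>i\<in>{j..n}. weight S i (yvar n (2 * i - 1)) (yvar n (2 * i)))" if "j \<le> n + 1" for j
    using that
  proof (induction rule: inc_induct)
    case base
    have "det (minor (1\<^sub>m (n + 1) :: laurent mat) S) = (\<Prod>r\<in>S. (1\<^sub>m (n + 1) :: laurent mat) $$ (r, r))"
      using S by (intro det_minor_upper[OF fin]) auto
    also have "\<dots> = 1" using S by (intro prod.neutral) auto
    finally show ?case by (simp add: Y_def diag_below_def)
  next
    case (step j)
    then have j: "1 \<le> j" "j \<le> n" by auto
    have IH: "Y (Suc j) \<in> carrier_mat (n + 1) (n + 1)" "diag_below n j (Y (Suc j))"
      "det (minor (Y (Suc j)) S) = (\<Prod>i\<in>{Suc j..n}. weight S i (yvar n (2 * i - 1)) (yvar n (2 * i)))"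
      using step.IH by auto
    let ?D = "dFd n j (yvar n (2 * j - 1)) (yvar n (2 * j))"
    have D: "?D \<in> carrier_mat (n + 1) (n + 1)" and E: "E_mat n j \<in> carrier_mat (n + 1) (n + 1)"
      by (simp_all add: dFd_def E_mat_def)
    have "Y j = T j * Y (Suc j)" using j by (simp add: Y_def upt_conv_Cons del: upt_Suc)
    also have "T j = E_mat n j * ?D" unfolding T_def by (rule dFd_eq[OF j])
    also have "E_mat n j * ?D * Y (Suc j) = E_mat n j * (?D * Y (Suc j))" by (rule assoc_mult_mat[OF E D IH(1)])
    finally have Yj: "Y j = E_mat n j * (?D * Y (Suc j))" .
    have "{j..n} = insert j {Suc j..n}" using j by auto
    then show ?case
      unfolding Yj using E D IH diag_below_step[OF IH(1) j IH(2)] minor_step[OF IH(1) j IH(2) S] by simp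
  qed
  from this[of 1] show ?thesis by (simp add: toda_matrix_def Y_def T_def[abs_def])
qed

section \<open>Expanding the Hamiltonians\<close>

text \<open>The conditions of \<open>good\<close> in which membership of the \<open>tau\<close> in
  the basis is written out as bounds on the even entries; the odd entries are bounded through the
  first clause.\<close>

definition admissible :: "nat \<Rightarrow> nat \<Rightarrow> (nat \<Rightarrow> nat) \<Rightarrow> bool" where
  "admissible n m e \<longleftrightarrow>
     (\<forall>i\<in>{1..n}. e (2 * i - 1) \<le> e (2 * i)) \<and>
     (\<forall>i\<in>{1..<n}. e (2 * i) \<le> e (2 * i + 1) + (if i < m then 0 else 1)) \<and>
     (\<forall>i\<in>{2..n}. e (2 * i) \<le> e (2 * i - 3) + (if m < i then 0 else 1)) \<and>
     (\<forall>i\<in>{1..n}. e (2 * i) + (i - m) \<le> i \<and> e (2 * i) + (i - m) + m \<le> n + 1)"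

text \<open>A summand of the trace is given by a set \<open>S\<close> and, for every \<open>j\<close> with \<open>j - 1 \<in> S\<close> and \<open>j \<notin> S\<close>, a
  choice between the terms of \<open>y + 1\<close>. Up to the common shift \<open>i - m\<close> (truncated), the entry of the
  dimension vector at \<open>2 * i\<close> is the number of elements of \<open>S\<close> below \<open>i\<close>, and the choices are the
  differences to the entries at \<open>2 * i - 1\<close>.\<close>

definition counts :: "nat \<Rightarrow> nat \<Rightarrow> (nat \<Rightarrow> nat) \<Rightarrow> nat \<Rightarrow> nat" where
  "counts n m e i = (if i = 0 then 0 else if i \<le> n then e (2 * i) + (i - m) else n + 1 - m)"

definition descents :: "nat set \<Rightarrow> nat \<Rightarrow> nat set" where
  "descents S j = (if j - 1 \<in> S \<and> j \<notin> S then {0, 1} else {0})"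

definition to_dimension :: "nat \<Rightarrow> nat \<Rightarrow> nat set \<times> (nat \<Rightarrow> nat) \<Rightarrow> nat \<Rightarrow> nat" where
  "to_dimension n m = (\<lambda>(S, b). \<lambda>v\<in>{1..2 * n}. let i = (v + 1) div 2 in
     card (S \<inter> {..<i}) - (if even v then 0 else b i) - (i - m))"

text \<open>A set is recovered from its counting function as the set of places where the function
  jumps.\<close>

definition of_dimension :: "nat \<Rightarrow> nat \<Rightarrow> (nat \<Rightarrow> nat) \<Rightarrow> nat set \<times> (nat \<Rightarrow> nat)" where
  "of_dimension n m e = ({i \<in> {..<n + 1}. counts n m e (Suc i) = Suc (counts n m e i)},
     \<lambda>i\<in>{1..n}. e (2 * i) - e (2 * i - 1))"

lemma card_Int_lessThan_Suc: "card (S \<inter> {..<Suc i}) = card (S \<inter> {..<i}) + (if i \<in> S then 1 else 0)"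
proof -
  have "S \<inter> {..<Suc i} = (if i \<in> S then insert i (S \<inter> {..<i}) else S \<inter> {..<i})"
    by (auto simp: less_Suc_eq)
  then show ?thesis by simp
qed

text \<open>The choice \<open>b = 1\<close> stands for the term 1 of \<open>y + 1\<close> and so
  loses one factor \<open>y\<close>.\<close>

lemma weight_eq_sum:
  assumes "1 \<le> j"
  shows "weight S j y z = (\<Sum>b\<in>descents S j. y ^ (card (S \<inter> {..<j}) - b) * z ^ card (S \<inter> {..<j}))"
proof (cases "j - 1 \<in> S \<and> j \<notin> S")
  case True
  then obtain c where "card (S \<inter> {..<j}) = Suc c"
    using card_Int_lessThan_Suc[of S "j - 1"] assms by simp
  then show ?thesis using True
    by (simp add: weight_def descents_def Let_def power_mult_distrib algebra_simps)
next
  case False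
  then show ?thesis
    by (auto simp: weight_def descents_def Let_def power_mult_distrib)
qed

lemma prod_pairs: "(\<Prod>v\<in>{1..2 * n}. f v) = (\<Prod>i\<in>{1..n}. f (2 * i - 1) * f (2 * i :: nat))"
  by (induction n) (simp_all add: mult.assoc)

locale subset_choice =
  fixes n m :: nat and S :: "nat set" and b :: "nat \<Rightarrow> nat"
  assumes m: "1 \<le> m" "m \<le> n" and S: "S \<subseteq> {..<n + 1}" "card S = n + 1 - m"
    and b: "b \<in> (\<Pi>\<^sub>E j\<in>{1..n}. descents S j)"
begin

abbreviation "c i \<equiv> card (S \<inter> {..<i})"

lemma c_top: "c (n + 1) = n + 1 - m"
  using S by (simp add: Int_absorb2)

lemma c_le: "c i \<le> i" "c i \<le> n + 1 - m"
proof -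
  have "card (S \<inter> {..<i}) \<le> card {..<i}" by (intro card_mono) auto
  then show "c i \<le> i" by simp
  have "finite S" using S finite_subset by blast
  then show "c i \<le> n + 1 - m" using S card_mono[of S "S \<inter> {..<i}"] by simp
qed

text \<open>Only \<open>m\<close> of the numbers up to \<open>n\<close> are missing from
  \<open>S\<close>. So the shift \<open>i - m\<close> can be subtracted from the count without
  loss.\<close>

lemma c_ge:
  assumes "i \<le> n + 1"
  shows "i \<le> c i + m"
proof -
  have fin: "finite S" using S finite_subset by blast
  have "card {..<i} = c i + card ({..<i} - S)"
    using card_Int_Diff[of "{..<i}" S] by (simp add: Int_commute)
  moreover have "card ({..<i} - S) \<le> card ({..<n + 1} - S)" using assms by (intro card_mono) auto
  moreover have "card ({..<n + 1} - S) = m" using S m fin by (simp add: card_Diff_subset)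
  ultimately show ?thesis by simp
qed

text \<open>The choice 1 is available only at the end of a run of consecutive elements of
  \<open>S\<close>, where the count has just risen and does not rise next.\<close>

lemma b_cases:
  assumes "i \<in> {1..n}"
  shows "b i = 0 \<or> b i = 1 \<and> c i = Suc (c (i - 1)) \<and> c (Suc i) = c i"
proof -
  have "b i \<in> descents S i" using b assms by auto
  then show ?thesis
    using card_Int_lessThan_Suc[of S i] card_Int_lessThan_Suc[of S "i - 1"] assms
    by (auto simp: descents_def split: if_splits)
qed

lemma c_step: "c i \<le> c (Suc i)" "c (Suc i) \<le> Suc (c i)"
  by (simp_all add: card_Int_lessThan_Suc)

lemma b_le:
  assumes "i \<in> {1..n}"
  shows "b i + (i - m) \<le> c i"
  using b_cases[OF assms] c_ge[of i] c_ge[of "Suc i"] assms by auto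

lemma to_dimension_even: "i \<in> {1..n} \<Longrightarrow> to_dimension n m (S, b) (2 * i) = c i - (i - m)"
  by (simp add: to_dimension_def Let_def)

lemma to_dimension_odd: "i \<in> {1..n} \<Longrightarrow> to_dimension n m (S, b) (2 * i - 1) = c i - b i - (i - m)"
proof -
  assume i: "i \<in> {1..n}"
  then have "odd (2 * i - 1)" "(2 * i - 1 + 1) div 2 = i" "2 * i - 1 \<in> {1..2 * n}" by auto
  then show ?thesis by (simp add: to_dimension_def Let_def)
qed

lemma counts_to_dimension:
  assumes "i \<le> n + 1"
  shows "counts n m (to_dimension n m (S, b)) i = c i"
proof -
  consider "i = 0" | "i \<in> {1..n}" | "i = n + 1" using assms by force
  then show ?thesis
  proof cases
    case 2
    then show ?thesis using to_dimension_even[OF 2] c_ge[of i] by (auto simp: counts_def)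
  next
    case 3
    then show ?thesis using c_top by (simp add: counts_def)
  qed (simp add: counts_def)
qed

lemma of_to_dimension: "of_dimension n m (to_dimension n m (S, b)) = (S, b)"
proof -
  have "{i \<in> {..<n + 1}. counts n m (to_dimension n m (S, b)) (Suc i) = Suc (counts n m (to_dimension n m (S, b)) i)} = S"
    using S(1) by (auto simp: counts_to_dimension card_Int_lessThan_Suc split: if_splits)
  moreover have "(\<lambda>i\<in>{1..n}. to_dimension n m (S, b) (2 * i) - to_dimension n m (S, b) (2 * i - 1)) = b"
  proof (rule extensionalityI[of _ "{1..n}"])
    fix i assume i: "i \<in> {1..n}"
    then show "(\<lambda>i\<in>{1..n}. to_dimension n m (S, b) (2 * i) - to_dimension n m (S, b) (2 * i - 1)) i = b i"
      using b_le[OF i] to_dimension_even[OF i] to_dimension_odd[OF i] by simp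
  qed (use b in \<open>auto simp: PiE_def\<close>)
  ultimately show ?thesis by (simp add: of_dimension_def)
qed

lemma to_dimension_admissible: "admissible n m (to_dimension n m (S, b))"
  unfolding admissible_def
proof (intro conjI ballI)
  fix i assume i: "i \<in> {1..n}"
  show "to_dimension n m (S, b) (2 * i - 1) \<le> to_dimension n m (S, b) (2 * i)"
    using to_dimension_even[OF i] to_dimension_odd[OF i] by simp
  show "to_dimension n m (S, b) (2 * i) + (i - m) \<le> i"
    using to_dimension_even[OF i] c_le(1)[of i] by simp
  show "to_dimension n m (S, b) (2 * i) + (i - m) + m \<le> n + 1"
    using to_dimension_even[OF i] c_le(2)[of i] c_ge[of i] i m by auto
next
  fix i assume "i \<in> {1..<n}"
  then have i: "i \<in> {1..n}" "Suc i \<in> {1..n}" by auto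
  have "2 * Suc i - 1 = 2 * i + 1" by simp
  then have e: "to_dimension n m (S, b) (2 * i + 1) = c (Suc i) - b (Suc i) - (Suc i - m)"
    using to_dimension_odd[OF i(2)] by simp
  \<comment> \<open>A choice 1 at \<open>Suc i\<close> requires that \<open>i\<close> belongs to
    \<open>S\<close>.\<close>
  have "c i + b (Suc i) \<le> c (Suc i)" using b_cases[OF i(2)] c_step(1)[of i] by auto
  then show "to_dimension n m (S, b) (2 * i) \<le> to_dimension n m (S, b) (2 * i + 1) + (if i < m then 0 else 1)"
    unfolding e to_dimension_even[OF i(1)] using b_le[OF i(2)] by (auto split: if_splits)
next
  fix i assume i2: "i \<in> {2..n}"
  then have i: "i \<in> {1..n}" "i - 1 \<in> {1..n}" "Suc (i - 1) = i" by auto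
  have "2 * (i - 1) - 1 = 2 * i - 3" by simp
  then have e: "to_dimension n m (S, b) (2 * i - 3) = c (i - 1) - b (i - 1) - (i - 1 - m)"
    using to_dimension_odd[OF i(2)] by simp
  \<comment> \<open>A choice 1 at \<open>i - 1\<close> excludes \<open>i - 1\<close> from
    \<open>S\<close>, so the count does not rise there.\<close>
  have "c i + b (i - 1) \<le> Suc (c (i - 1))"
    using b_cases[OF i(2)] c_step(2)[of "i - 1"] unfolding i(3) by auto
  then show "to_dimension n m (S, b) (2 * i) \<le> to_dimension n m (S, b) (2 * i - 3) + (if m < i then 0 else 1)"
    unfolding e to_dimension_even[OF i(1)] using b_le[OF i(2)] by (auto split: if_splits)
qed

text \<open>Every exponent contains the shift \<open>j - m\<close>. Pulled out, it gives the first
  product, which is the same for all \<open>S\<close> and \<open>b\<close>.\<close>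

lemma prod_to_dimension:
  fixes y :: "nat \<Rightarrow> 'a :: comm_ring_1"
  shows "(\<Prod>i\<in>{1..n}. (y (2 * i - 1) * y (2 * i)) ^ (i - m)) * (\<Prod>v\<in>{1..2 * n}. y v ^ to_dimension n m (S, b) v)
    = (\<Prod>j\<in>{1..n}. y (2 * j - 1) ^ (c j - b j) * y (2 * j) ^ c j)"
  unfolding prod_pairs prod.distrib[symmetric]
proof (rule prod.cong[OF refl])
  fix j assume j: "j \<in> {1..n}"
  have "c j - b j = (j - m) + (c j - b j - (j - m))" "c j = (j - m) + (c j - (j - m))"
    using b_le[OF j] by auto
  then have "y (2 * j - 1) ^ (c j - b j) * y (2 * j) ^ c j =
      y (2 * j - 1) ^ (j - m) * y (2 * j - 1) ^ (c j - b j - (j - m)) * (y (2 * j) ^ (j - m) * y (2 * j) ^ (c j - (j - m)))"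
    by (metis power_add)
  then show "(y (2 * j - 1) * y (2 * j)) ^ (j - m) * (y (2 * j - 1) ^ to_dimension n m (S, b) (2 * j - 1) *
      y (2 * j) ^ to_dimension n m (S, b) (2 * j)) = y (2 * j - 1) ^ (c j - b j) * y (2 * j) ^ c j"
    unfolding to_dimension_even[OF j] to_dimension_odd[OF j] power_mult_distrib by (simp only: mult_ac)
qed

end

text \<open>The inequalities along the arrows in terms of the counts: \<open>up\<close> comes from
  the arrows r and \<open>down\<close> from the arrows l. Together they allow only steps 0 and 1,
  and a difference between \<open>e (2 * i)\<close> and \<open>e (2 * i - 1)\<close> only where the
  count rises before \<open>i\<close> and stays constant after it.\<close>

lemma admissible_steps:
  assumes a: "admissible n m e" and m: "1 \<le> m" "m \<le> n"
  shows "i \<le> n \<Longrightarrow> counts n m e i \<le> counts n m e (Suc i) \<and> counts n m e (Suc i) \<le> Suc (counts n m e i)"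
    and "i \<in> {1..n} \<Longrightarrow> e (2 * i) \<le> e (2 * i - 1) \<or> e (2 * i) = Suc (e (2 * i - 1)) \<and>
      counts n m e i = Suc (counts n m e (i - 1)) \<and> counts n m e (Suc i) = counts n m e i"
proof -
  have D1: "e (2 * i - 1) \<le> e (2 * i)" if "1 \<le> i" "i \<le> n" for i
    using a that by (auto simp: admissible_def)
  have D2: "e (2 * i) \<le> e (2 * i + 1) + (if i < m then 0 else 1)" if "1 \<le> i" "i < n" for i
    using a that by (auto simp: admissible_def)
  have D3: "e (2 * i + 2) \<le> e (2 * i - 1) + (if m < Suc i then 0 else 1)" if "1 \<le> i" "i < n" for i
  proof -
    have "Suc i \<in> {2..n}" "2 * Suc i - 3 = 2 * i - 1" "2 * Suc i = 2 * i + 2" using that by auto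
    then show ?thesis using a unfolding admissible_def by metis
  qed
  have D4: "e (2 * i) + (i - m) \<le> i" "e (2 * i) + (i - m) + m \<le> n + 1" if "1 \<le> i" "i \<le> n" for i
    using a that by (auto simp: admissible_def)
  have up: "counts n m e i + (e (2 * i + 2) - e (2 * i + 1)) \<le> counts n m e (Suc i)" if "i < n" for i
  proof (cases "i = 0")
    case True
    then show ?thesis using that m by (simp add: counts_def numeral_2_eq_2)
  next
    case False
    then show ?thesis using that D2[of i] D1[of "Suc i"] by (cases "i < m") (auto simp: counts_def)
  qed
  have down: "counts n m e (Suc i) + (e (2 * i) - e (2 * i - 1)) \<le> Suc (counts n m e i)" if "1 \<le> i" "i \<le> n" for i
  proof (cases "i = n")
    case True
    then show ?thesis using that m D1[of i] by (auto simp: counts_def)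
  next
    case False
    then show ?thesis using that D3[of i] D1[of i] by (cases "m < Suc i") (auto simp: counts_def)
  qed
  have bot: "counts n m e (Suc 0) \<le> Suc 0" using D4[of 1] m by (simp add: counts_def)
  have top: "counts n m e n \<le> counts n m e (Suc n)" using D4(2)[of n] m by (auto simp: counts_def)
  show 1: "i \<le> n \<Longrightarrow> counts n m e i \<le> counts n m e (Suc i) \<and> counts n m e (Suc i) \<le> Suc (counts n m e i)" for i
    using up[of i] down[of i] bot top by (cases "i = 0"; cases "i = n") (auto simp: counts_def[of _ _ _ 0])
  assume i: "i \<in> {1..n}"
  have "i - 1 < n" "2 * (i - 1) + 2 = 2 * i" "2 * (i - 1) + 1 = 2 * i - 1" "Suc (i - 1) = i" using i by auto
  then have "counts n m e (i - 1) + (e (2 * i) - e (2 * i - 1)) \<le> counts n m e i"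
    using up[of "i - 1"] by metis
  moreover have "counts n m e i \<le> Suc (counts n m e (i - 1))" using 1[of "i - 1"] i by auto
  moreover have "counts n m e i \<le> counts n m e (Suc i)" using 1[of i] i by auto
  moreover have "counts n m e (Suc i) + (e (2 * i) - e (2 * i - 1)) \<le> Suc (counts n m e i)" using down[of i] i by auto
  ultimately show "e (2 * i) \<le> e (2 * i - 1) \<or> e (2 * i) = Suc (e (2 * i - 1)) \<and>
      counts n m e i = Suc (counts n m e (i - 1)) \<and> counts n m e (Suc i) = counts n m e i"
    by linarith
qed

lemma card_of_dimension:
  assumes a: "admissible n m e" and m: "1 \<le> m" "m \<le> n" and i: "i \<le> n + 1"
  shows "card (fst (of_dimension n m e) \<inter> {..<i}) = counts n m e i"
  using i
proof (induction i)
  case 0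
  then show ?case by (simp add: counts_def)
next
  case (Suc i)
  then show ?case
    using admissible_steps(1)[OF a m, of i] by (auto simp: card_Int_lessThan_Suc of_dimension_def)
qed

lemma of_dimension_choice:
  assumes a: "admissible n m e" and m: "1 \<le> m" "m \<le> n"
  shows "subset_choice n m (fst (of_dimension n m e)) (snd (of_dimension n m e))"
proof
  let ?S = "fst (of_dimension n m e)"
  show S: "?S \<subseteq> {..<n + 1}" by (auto simp: of_dimension_def)
  show "card ?S = n + 1 - m"
    using card_of_dimension[OF a m, of "n + 1"] S by (simp add: Int_absorb2 counts_def)
  show "snd (of_dimension n m e) \<in> (\<Pi>\<^sub>E j\<in>{1..n}. descents ?S j)"
  proof (rule PiE_I)
    fix j assume j: "j \<in> {1..n}"
    have "e (2 * j - 1) \<le> e (2 * j)" using a j by (auto simp: admissible_def)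
    then have "e (2 * j) - e (2 * j - 1) \<in> descents ?S j"
      using admissible_steps(2)[OF a m j] j by (auto simp: descents_def of_dimension_def)
    then show "snd (of_dimension n m e) j \<in> descents ?S j" using j by (simp add: of_dimension_def)
  qed (auto simp: of_dimension_def)
qed (use m in auto)

lemma to_of_dimension:
  assumes a: "admissible n m e" and m: "1 \<le> m" "m \<le> n" and e: "e \<in> {1..2 * n} \<rightarrow>\<^sub>E UNIV"
  shows "to_dimension n m (of_dimension n m e) = e"
proof (rule extensionalityI[of _ "{1..2 * n}"])
  interpret subset_choice n m "fst (of_dimension n m e)" "snd (of_dimension n m e)"
    by (rule of_dimension_choice[OF a m])
  fix v assume v: "v \<in> {1..2 * n}"
  define i where "i = (v + 1) div 2"
  have i: "i \<in> {1..n}" "i \<le> n + 1" and vi: "v = 2 * i \<or> v = 2 * i - 1" using v by (auto simp: i_def)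
  have le: "e (2 * i - 1) \<le> e (2 * i)" using a i by (auto simp: admissible_def)
  have ci: "card (fst (of_dimension n m e) \<inter> {..<i}) = e (2 * i) + (i - m)"
    using card_of_dimension[OF a m i(2)] i(1) by (simp add: counts_def)
  have bi: "snd (of_dimension n m e) i = e (2 * i) - e (2 * i - 1)" using i(1) by (simp add: of_dimension_def)
  show "to_dimension n m (of_dimension n m e) v = e v"
    using vi to_dimension_even[OF i(1)] to_dimension_odd[OF i(1)] le unfolding ci bi prod.collapse by auto
qed (use e in \<open>auto simp: to_dimension_def of_dimension_def PiE_def\<close>)

text \<open>Expanding the products yields one monomial for each set with choices, and
  \<open>to_dimension\<close> maps these pairs bijectively to the admissible dimension
  vectors.\<close>

lemma sum_weights:
  fixes y :: "nat \<Rightarrow> laurent"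
  assumes m: "1 \<le> m" "m \<le> n"
  shows "(\<Sum>S | S \<subseteq> {0..<n + 1} \<and> card S = n + 1 - m. \<Prod>j\<in>{1..n}. weight S j (y (2 * j - 1)) (y (2 * j))) =
    (\<Prod>i\<in>{1..n}. (y (2 * i - 1) * y (2 * i)) ^ (i - m)) *
    (\<Sum>e\<in>{e \<in> {1..2 * n} \<rightarrow>\<^sub>E UNIV. admissible n m e}. \<Prod>v\<in>{1..2 * n}. y v ^ e v)"
proof -
  let ?T = "{S. S \<subseteq> {0..<n + 1} \<and> card S = n + 1 - m}"
  let ?P = "\<lambda>S. \<Pi>\<^sub>E j\<in>{1..n}. descents S j"
  let ?f = "\<lambda>S b. \<Prod>j\<in>{1..n}. y (2 * j - 1) ^ (card (S \<inter> {..<j}) - b j) * y (2 * j) ^ card (S \<inter> {..<j})"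
  have fin: "finite (descents S j)" for S j by (simp add: descents_def)
  have ch: "subset_choice n m S b" if "S \<in> ?T" "b \<in> ?P S" for S b
    using that m by unfold_locales (auto simp: lessThan_atLeast0)
  have "(\<Sum>S\<in>?T. \<Prod>j\<in>{1..n}. weight S j (y (2 * j - 1)) (y (2 * j))) =
      (\<Sum>S\<in>?T. \<Prod>j\<in>{1..n}. \<Sum>b\<in>descents S j. y (2 * j - 1) ^ (card (S \<inter> {..<j}) - b) * y (2 * j) ^ card (S \<inter> {..<j}))"
    by (intro sum.cong prod.cong refl weight_eq_sum) auto
  also have "\<dots> = (\<Sum>S\<in>?T. \<Sum>b\<in>?P S. ?f S b)"
    by (intro sum.cong refl prod_sum_PiE) (auto simp: fin)
  also have "\<dots> = (\<Sum>x\<in>Sigma ?T ?P. ?f (fst x) (snd x))"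
    by (subst sum.Sigma) (auto simp: fin split_def intro!: finite_PiE)
  also have "\<dots> = (\<Sum>e\<in>{e \<in> {1..2 * n} \<rightarrow>\<^sub>E UNIV. admissible n m e}.
      (\<Prod>i\<in>{1..n}. (y (2 * i - 1) * y (2 * i)) ^ (i - m)) * (\<Prod>v\<in>{1..2 * n}. y v ^ e v))"
  proof (rule sum.reindex_bij_witness[where i = "of_dimension n m" and j = "to_dimension n m"])
    fix x assume x: "x \<in> Sigma ?T ?P"
    obtain S b where xe: "x = (S, b)" by force
    interpret subset_choice n m S b using x ch unfolding xe by auto
    show "of_dimension n m (to_dimension n m x) = x" unfolding xe by (rule of_to_dimension)
    show "to_dimension n m x \<in> {e \<in> {1..2 * n} \<rightarrow>\<^sub>E UNIV. admissible n m e}"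
      unfolding xe using to_dimension_admissible by (auto simp: to_dimension_def)
    show "(\<Prod>i\<in>{1..n}. (y (2 * i - 1) * y (2 * i)) ^ (i - m)) * (\<Prod>v\<in>{1..2 * n}. y v ^ to_dimension n m x v) = ?f (fst x) (snd x)"
      unfolding xe using prod_to_dimension[of y] by simp
  next
    fix e assume e: "e \<in> {e \<in> {1..2 * n} \<rightarrow>\<^sub>E UNIV. admissible n m e}"
    then have a: "admissible n m e" by simp
    interpret subset_choice n m "fst (of_dimension n m e)" "snd (of_dimension n m e)"
      by (rule of_dimension_choice[OF a m])
    show "to_dimension n m (of_dimension n m e) = e" using e by (intro to_of_dimension[OF a m]) auto
    have "(fst (of_dimension n m e), snd (of_dimension n m e)) \<in> Sigma ?T ?P"
      by (rule SigmaI) (use S b in \<open>simp_all add: lessThan_atLeast0\<close>)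
    then show "of_dimension n m e \<in> Sigma ?T ?P" unfolding prod.collapse .
  qed
  also have "\<dots> = (\<Prod>i\<in>{1..n}. (y (2 * i - 1) * y (2 * i)) ^ (i - m)) *
      (\<Sum>e\<in>{e \<in> {1..2 * n} \<rightarrow>\<^sub>E UNIV. admissible n m e}. \<Prod>v\<in>{1..2 * n}. y v ^ e v)"
    by (simp only: sum_distrib_left)
  finally show ?thesis .
qed

section \<open>Monomials in the cluster variables\<close>

lemma xpow_add: "xpow j (a + b) = xpow j a * xpow j b"
  by (simp add: xpow_def mult_single single_add)

lemma xpow_0 [simp]: "xpow j 0 = 1"
  by (simp add: xpow_def)

lemma xpow_sum: "finite I \<Longrightarrow> xpow j (\<Sum>i\<in>I. a i) = (\<Prod>i\<in>I. xpow j (a i))"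
  by (induction I rule: finite_induct) (simp_all add: xpow_add)

lemma xpow_mult: "xpow j (int k * a) = xpow j a ^ k"
  by (induction k) (simp_all add: xpow_add algebra_simps)

definition arrows_between :: "nat \<Rightarrow> nat \<Rightarrow> nat \<Rightarrow> toda_arrow set" where
  "arrows_between n u w = {a \<in> arcs (toda_quiver n). toda_tail a = u \<and> toda_head a = w}"

lemma arrows_between_cases:
  assumes i: "1 \<le> i" "i \<le> n" and l: "1 \<le> l" "l \<le> n"
  shows "arrows_between n (2 * i - 1) (2 * l - 1) = {}"
    and "arrows_between n (2 * i) (2 * l) = {}"
    and "arrows_between n (2 * i - 1) (2 * l) = (if i = l then {A i, B i} else {})"
    and "arrows_between n (2 * i) (2 * l - 1) = (if i = l + 1 then {L i} else if l = i + 1 then {R i} else {})"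
proof -
  have arcs: "arcs (toda_quiver n) = A ` {1..n} \<union> B ` {1..n} \<union> L ` {2..n} \<union> R ` {1..<n}"
    by (simp add: toda_quiver_def)
  show "arrows_between n (2 * i - 1) (2 * l - 1) = {}"
    using i l unfolding arrows_between_def arcs by (auto; presburger)
  show "arrows_between n (2 * i) (2 * l) = {}"
    using i l unfolding arrows_between_def arcs by (auto; presburger)
  have "a \<in> arrows_between n (2 * i - 1) (2 * l) \<longleftrightarrow> i = l \<and> (a = A i \<or> a = B i)" for a
    using i l unfolding arrows_between_def arcs by (cases a) (auto; presburger)+
  then show "arrows_between n (2 * i - 1) (2 * l) = (if i = l then {A i, B i} else {})"
    by (simp add: set_eq_iff)
  have "a \<in> arrows_between n (2 * i) (2 * l - 1) \<longleftrightarrow> i = l + 1 \<and> a = L i \<or> l = i + 1 \<and> a = R i" for a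
    using i l unfolding arrows_between_def arcs by (cases a) (auto; presburger)+
  then show "arrows_between n (2 * i) (2 * l - 1) = (if i = l + 1 then {L i} else if l = i + 1 then {R i} else {})"
    by (simp add: set_eq_iff)
qed

text \<open>The sum of rows \<open>2 * i - 1\<close> and \<open>2 * i\<close> of the exchange matrix
  is a row of the Cartan matrix of type A_n at the even columns, and minus that row at the odd
  ones.\<close>

lemma exchange_entry_pair:
  assumes i: "1 \<le> i" "i \<le> n" and l: "1 \<le> l" "l \<le> n"
  shows "exchange_entry n (2 * i - 1) (2 * l) + exchange_entry n (2 * i) (2 * l) =
      (if i = l then 2 else 0) - (if i = l - 1 then 1 else 0) - (if i = l + 1 then 1 else 0)"
    and "exchange_entry n (2 * i - 1) (2 * l - 1) + exchange_entry n (2 * i) (2 * l - 1) =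
      (if i = l - 1 then 1 else 0) + (if i = l + 1 then 1 else 0) - (if i = l then 2 else 0)"
proof -
  have ex: "exchange_entry n u w = int (card (arrows_between n u w)) - int (card (arrows_between n w u))" for u w
    by (simp add: exchange_entry_def arrows_between_def)
  have prev: "i = l - 1 \<longleftrightarrow> l = i + 1" using l by auto
  have c: "i = l \<or> i = l + 1 \<or> l = i + 1 \<or> i \<noteq> l \<and> i \<noteq> l + 1 \<and> l \<noteq> i + 1" by blast
  show "exchange_entry n (2 * i - 1) (2 * l) + exchange_entry n (2 * i) (2 * l) =
      (if i = l then 2 else 0) - (if i = l - 1 then 1 else 0) - (if i = l + 1 then 1 else 0)"
    unfolding ex arrows_between_cases[OF i l] arrows_between_cases[OF l i] prev using c by (elim disjE) simp_all
  show "exchange_entry n (2 * i - 1) (2 * l - 1) + exchange_entry n (2 * i) (2 * l - 1) =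
      (if i = l - 1 then 1 else 0) + (if i = l + 1 then 1 else 0) - (if i = l then 2 else 0)"
    unfolding ex arrows_between_cases[OF i l] arrows_between_cases[OF l i] prev using c by (elim disjE) simp_all
qed

text \<open>The truncated function \<open>i - m\<close> is piecewise linear with a kink at
  \<open>m\<close>, where its second difference is concentrated. Cutting it off at \<open>n\<close>
  leaves the value \<open>n + 1 - m\<close> of the missing neighbour uncompensated.\<close>

lemma sum_truncated_second_difference:
  assumes m: "1 \<le> m" and l: "1 \<le> l" "l \<le> n"
  shows "(\<Sum>i\<in>{1..n}. int (i - m) * ((if i = l then 2 else 0) - (if i = l - 1 then 1 else 0) - (if i = l + 1 then 1 else 0)))
    = (if l = n then int (n + 1 - m) else 0) - (if l = m then 1 else 0)"
proof -
  have "(\<Sum>i\<in>{1..n}. int (i - m) * ((if i = l then 2 else 0) - (if i = l - 1 then 1 else 0) - (if i = l + 1 then 1 else 0)))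
    = (\<Sum>i\<in>{1..n}. if i = l then 2 * int (i - m) else 0) - (\<Sum>i\<in>{1..n}. if i = l - 1 then int (i - m) else 0)
      - (\<Sum>i\<in>{1..n}. if i = l + 1 then int (i - m) else 0)"
    unfolding sum_subtractf[symmetric] by (intro sum.cong) (auto simp: algebra_simps)
  also have "\<dots> = 2 * int (l - m) - (if l - 1 \<in> {1..n} then int (l - 1 - m) else 0)
      - (if l + 1 \<in> {1..n} then int (l + 1 - m) else 0)"
    using l by (simp add: sum.delta)
  also have "\<dots> = (if l = n then int (n + 1 - m) else 0) - (if l = m then 1 else 0)"
    using m l by auto
  finally show ?thesis .
qed

text \<open>By the second difference the common factor of the monomials lives in the columns
  \<open>m\<close> and \<open>n\<close> only. Its part at \<open>n\<close> cancels the prefactor of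
  the Hamiltonian precisely for the exponent \<open>n + 1 - m\<close>, and its part at
  \<open>m\<close> is the monomial prescribed by the vector g.\<close>

lemma prefactor:
  assumes m: "1 \<le> m" "m \<le> n"
  shows "(xpow (2 * n - 1) 1 * xpow (2 * n) (- 1)) ^ (n + 1 - m) *
      (\<Prod>i\<in>{1..n}. (yvar n (2 * i - 1) * yvar n (2 * i)) ^ (i - m)) = xpow (2 * m - 1) 1 * xpow (2 * m) (- 1)"
proof -
  define k where "k = int (n + 1 - m)"
  define s where "s i j = exchange_entry n (2 * i - 1) j + exchange_entry n (2 * i) j" for i j
  \<comment> \<open>\<open>h l d\<close> is the power \<open>d\<close> of x_(2l) / x_(2l-1).\<close>
  define h where "h l d = xpow (2 * l - 1) (- d) * xpow (2 * l) d" for l d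
  have h_add: "h l (a + b) = h l a * h l b" for l a b
    using xpow_add[of "2 * l - 1" "- a" "- b"] xpow_add[of "2 * l" a b] by (simp add: h_def mult_ac)
  have h_0: "h l 0 = 1" for l by (simp add: h_def)
  have h_inv: "h n (- k) = (xpow (2 * n - 1) 1 * xpow (2 * n) (- 1)) ^ (n + 1 - m)"
    using xpow_mult[of "2 * n - 1" "n + 1 - m" 1] xpow_mult[of "2 * n" "n + 1 - m" "- 1"]
    by (simp add: h_def k_def power_mult_distrib)
  have y: "yvar n (2 * i - 1) * yvar n (2 * i) = (\<Prod>j\<in>{1..2 * n}. xpow j (s i j))" for i
    unfolding yvar_def s_def xpow_add prod.distrib ..
  have "(\<Prod>i\<in>{1..n}. (yvar n (2 * i - 1) * yvar n (2 * i)) ^ (i - m)) =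
      (\<Prod>i\<in>{1..n}. \<Prod>j\<in>{1..2 * n}. xpow j (int (i - m) * s i j))"
    by (simp only: y xpow_mult prod_power_distrib)
  also have "\<dots> = (\<Prod>j\<in>{1..2 * n}. xpow j (\<Sum>i\<in>{1..n}. int (i - m) * s i j))"
    by (subst prod.swap) (simp add: xpow_sum)
  also have "\<dots> = (\<Prod>l\<in>{1..n}. xpow (2 * l - 1) (\<Sum>i\<in>{1..n}. int (i - m) * s i (2 * l - 1)) *
      xpow (2 * l) (\<Sum>i\<in>{1..n}. int (i - m) * s i (2 * l)))"
    by (rule prod_pairs)
  also have "\<dots> = (\<Prod>l\<in>{1..n}. h l ((if l = n then k else 0) - (if l = m then 1 else 0)))"
  proof (rule prod.cong[OF refl])
    fix l assume "l \<in> {1..n}"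
    then have l: "1 \<le> l" "l \<le> n" by auto
    have even: "(\<Sum>i\<in>{1..n}. int (i - m) * s i (2 * l)) = (if l = n then k else 0) - (if l = m then 1 else 0)"
      unfolding k_def sum_truncated_second_difference[OF m(1) l, symmetric]
      by (intro sum.cong refl) (use exchange_entry_pair(1)[OF _ _ l] in \<open>simp add: s_def\<close>)
    have "(\<Sum>i\<in>{1..n}. int (i - m) * s i (2 * l - 1)) = - (\<Sum>i\<in>{1..n}. int (i - m) * s i (2 * l))"
      unfolding sum_negf[symmetric]
    proof (rule sum.cong[OF refl])
      fix i assume "i \<in> {1..n}"
      then have "s i (2 * l - 1) = - s i (2 * l)"
        unfolding s_def using exchange_entry_pair[of i n l] l by simp
      then show "int (i - m) * s i (2 * l - 1) = - (int (i - m) * s i (2 * l))" by simp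
    qed
    then show "xpow (2 * l - 1) (\<Sum>i\<in>{1..n}. int (i - m) * s i (2 * l - 1)) * xpow (2 * l) (\<Sum>i\<in>{1..n}. int (i - m) * s i (2 * l))
      = h l ((if l = n then k else 0) - (if l = m then 1 else 0))"
      by (simp only: even h_def)
  qed
  also have "\<dots> = (\<Prod>l\<in>{1..n}. (if l = n then h l k else 1) * (if l = m then h l (- 1) else 1))"
    by (rule prod.cong[OF refl]) (simp add: h_add[of _ k "- 1", simplified] h_0)
  also have "\<dots> = h n k * h m (- 1)"
    unfolding prod.distrib using m by (simp add: prod.delta)
  finally have eq: "(\<Prod>i\<in>{1..n}. (yvar n (2 * i - 1) * yvar n (2 * i)) ^ (i - m)) = h n k * h m (- 1)" .
  have "h n (- k) * h n k = 1" using h_add[of n "- k" k] by (simp add: h_0)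
  then have "h n (- k) * (h n k * h m (- 1)) = h m (- 1)" by (simp add: mult.assoc[symmetric])
  then show ?thesis unfolding eq h_inv[symmetric] by (simp add: h_def)
qed

lemma toda_matrix_carrier: "toda_matrix n \<in> carrier_mat (n + 1) (n + 1)"
proof -
  have "foldr (*) (map T js) (1\<^sub>m (n + 1)) \<in> carrier_mat (n + 1) (n + 1)"
    if "\<And>j. T j \<in> carrier_mat (n + 1) (n + 1)" for T :: "nat \<Rightarrow> laurent mat" and js
    using that by (induction js) (auto intro: mult_carrier_mat)
  then show ?thesis unfolding toda_matrix_def
    by this (auto simp: E_mat_def d_mat_def F_mat_def intro!: mult_carrier_mat[where n = "n + 1"])
qed

lemma toda_hamiltonian_eq:
  assumes m: "1 \<le> m" "m \<le> n"
  shows "toda_hamiltonian n (n + 1 - m) = xpow (2 * m - 1) 1 * xpow (2 * m) (- 1) *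
    (\<Sum>e\<in>{e \<in> {1..2 * n} \<rightarrow>\<^sub>E UNIV. admissible n m e}. \<Prod>v\<in>{1..2 * n}. yvar n v ^ e v)"
proof -
  have "trace_exterior_power (n + 1 - m) (toda_matrix n) =
      (\<Sum>S | S \<subseteq> {0..<n + 1} \<and> card S = n + 1 - m.
        \<Prod>j\<in>{1..n}. weight S j (yvar n (2 * j - 1)) (yvar n (2 * j)))"
    unfolding trace_exterior_power_def exterior_power_entry_def carrier_matD(1)[OF toda_matrix_carrier]
  proof (rule sum.cong[OF refl])
    fix S assume "S \<in> {S. S \<subseteq> {0..<n + 1} \<and> card S = n + 1 - m}"
    then have S: "S \<subseteq> {0..<n + 1}" by simp
    show "det (submatrix (toda_matrix n) S S) = (\<Prod>j\<in>{1..n}. weight S j (yvar n (2 * j - 1)) (yvar n (2 * j)))"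
      unfolding submatrix_eq_minor[OF toda_matrix_carrier S]
      by (rule minor_toda_matrix) (use S in \<open>simp add: lessThan_atLeast0\<close>)
  qed
  then show ?thesis
    unfolding toda_hamiltonian_def sum_weights[OF m] prefactor[OF m, symmetric] by (simp only: mult.assoc)
qed

section \<open>Generic homomorphisms\<close>

lemma openin_zariski_topology:
  "openin (zariski_topology r c V) U \<longleftrightarrow> (\<exists>P\<subseteq>polynomial_functions r c. U = {A \<in> V. \<exists>p\<in>P. p A \<noteq> 0})"
proof -
  let ?O = "\<lambda>U. \<exists>P\<subseteq>polynomial_functions r c. U = {A \<in> V. \<exists>p\<in>P. p A \<noteq> 0}"
  have "istopology ?O"
    unfolding istopology_def
  proof (intro conjI allI impI)
    fix S T assume "?O S" "?O T"
    then obtain P P' where P: "P \<subseteq> polynomial_functions r c" "S = {A \<in> V. \<exists>p\<in>P. p A \<noteq> 0}"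
      "P' \<subseteq> polynomial_functions r c" "T = {A \<in> V. \<exists>p\<in>P'. p A \<noteq> 0}" by blast
    \<comment> \<open>A product of one polynomial from each family is nonzero exactly where both
      factors are.\<close>
    show "?O (S \<inter> T)"
    proof (intro exI[of _ "(\<lambda>(p, q) A. p A * q A) ` (P \<times> P')"] conjI)
      show "(\<lambda>(p, q) A. p A * q A) ` (P \<times> P') \<subseteq> polynomial_functions r c"
        using P(1,3) by (auto intro!: polynomial_functions.mult)
      show "S \<inter> T = {A \<in> V. \<exists>p\<in>(\<lambda>(p, q) A. p A * q A) ` (P \<times> P'). p A \<noteq> 0}"
        unfolding P(2,4) by force
    qed
  next
    fix K assume "\<forall>S\<in>K. ?O S"
    from bchoice[OF this] obtain P
      where P': "\<forall>S\<in>K. P S \<subseteq> polynomial_functions r c \<and> S = {A \<in> V. \<exists>p\<in>P S. p A \<noteq> 0}" ..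
    then have P: "\<And>S. S \<in> K \<Longrightarrow> P S \<subseteq> polynomial_functions r c"
      "\<And>S. S \<in> K \<Longrightarrow> S = {A \<in> V. \<exists>p\<in>P S. p A \<noteq> 0}" by simp_all
    have "\<Union> K = {A \<in> V. \<exists>p\<in>\<Union> (P ` K). p A \<noteq> 0}"
    proof (intro equalityI subsetI)
      fix A assume "A \<in> \<Union> K"
      then obtain S where "S \<in> K" "A \<in> S" by blast
      then have "A \<in> {A \<in> V. \<exists>p\<in>P S. p A \<noteq> 0}" using P(2)[of S] by simp
      then show "A \<in> {A \<in> V. \<exists>p\<in>\<Union> (P ` K). p A \<noteq> 0}" using \<open>S \<in> K\<close> by blast
    next
      fix A assume "A \<in> {A \<in> V. \<exists>p\<in>\<Union> (P ` K). p A \<noteq> 0}"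
      then obtain S where "S \<in> K" "A \<in> {A \<in> V. \<exists>p\<in>P S. p A \<noteq> 0}" by blast
      then have "A \<in> S" using P(2)[of S] by simp
      then show "A \<in> \<Union> K" using \<open>S \<in> K\<close> by blast
    qed
    then show "?O (\<Union> K)" using P(1) by (intro exI[of _ "\<Union> (P ` K)"]) blast
  qed
  then show ?thesis unfolding zariski_topology_def by (simp add: topology_inverse')
qed

lemma topspace_zariski_topology: "topspace (zariski_topology r c V) = V"
proof
  show "topspace (zariski_topology r c V) \<subseteq> V"
    unfolding topspace_def openin_zariski_topology by blast
  have "openin (zariski_topology r c V) V"
    unfolding openin_zariski_topology
    by (intro exI[of _ "{\<lambda>_. 1}"]) (auto intro: polynomial_functions.const)
  then show "V \<subseteq> topspace (zariski_topology r c V)" by (rule openin_subset)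
qed

lemma polynomial_function_on_line:
  assumes "p \<in> polynomial_functions r c" "M \<in> carrier_mat r c" "D \<in> carrier_mat r c"
  shows "\<exists>q. \<forall>t. p (M + t \<cdot>\<^sub>m D) = poly q t"
  using assms(1)
proof induction
  case (const z)
  show ?case by (intro exI[of _ "[:z:]"]) simp
next
  case (coord i j)
  then show ?case using assms(2,3) by (intro exI[of _ "[:M $$ (i, j), D $$ (i, j):]"]) simp
next
  case (add p q)
  then obtain p' q' where "\<forall>t. p (M + t \<cdot>\<^sub>m D) = poly p' t" "\<forall>t. q (M + t \<cdot>\<^sub>m D) = poly q' t" by blast
  then show ?case by (intro exI[of _ "p' + q'"]) simp
next
  case (mult p q)
  then obtain p' q' where "\<forall>t. p (M + t \<cdot>\<^sub>m D) = poly p' t" "\<forall>t. q (M + t \<cdot>\<^sub>m D) = poly q' t" by blast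
  then show ?case by (intro exI[of _ "p' * q'"]) simp
qed

text \<open>On the line through \<open>M\<close> in direction \<open>D\<close> a polynomial that is
  nonzero at \<open>M\<close> and the coordinate at \<open>(i, j)\<close> are both nonzero
  polynomials in the parameter. All but finitely many points of the line thus lie in both open
  sets.\<close>

lemma zariski_dense_coordinate:
  assumes V: "V \<subseteq> carrier_mat r c" and line: "\<And>M t. M \<in> V \<Longrightarrow> M + t \<cdot>\<^sub>m D \<in> V"
    and D: "D \<in> V" and ij: "i < r" "j < c" "D $$ (i, j) \<noteq> 0"
  shows "openin (zariski_topology r c V) {M \<in> V. M $$ (i, j) \<noteq> 0}"
    and "zariski_topology r c V closure_of {M \<in> V. M $$ (i, j) \<noteq> 0} = V"
proof -
  show "openin (zariski_topology r c V) {M \<in> V. M $$ (i, j) \<noteq> 0}"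
    unfolding openin_zariski_topology
    by (intro exI[of _ "{\<lambda>M. M $$ (i, j)}"]) (use ij in \<open>auto intro: polynomial_functions.coord\<close>)
  show "zariski_topology r c V closure_of {M \<in> V. M $$ (i, j) \<noteq> 0} = V"
  proof (rule antisym)
    show "zariski_topology r c V closure_of {M \<in> V. M $$ (i, j) \<noteq> 0} \<subseteq> V"
      using closure_of_subset_topspace[of "zariski_topology r c V"] by (simp add: topspace_zariski_topology)
    show "V \<subseteq> zariski_topology r c V closure_of {M \<in> V. M $$ (i, j) \<noteq> 0}"
      unfolding in_closure_of subset_iff topspace_zariski_topology
    proof (intro allI impI conjI, assumption)
      fix M T assume M: "M \<in> V" and T: "M \<in> T \<and> openin (zariski_topology r c V) T"
      obtain P where P: "P \<subseteq> polynomial_functions r c" "T = {A \<in> V. \<exists>p\<in>P. p A \<noteq> 0}"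
        using T unfolding openin_zariski_topology by blast
      then obtain p where p: "p \<in> P" "p M \<noteq> 0" using T by blast
      have MD: "M \<in> carrier_mat r c" "D \<in> carrier_mat r c" using M D V by auto
      obtain q where q: "\<And>t. p (M + t \<cdot>\<^sub>m D) = poly q t"
        using polynomial_function_on_line[OF _ MD] p(1) P(1) by blast
      have "M + 0 \<cdot>\<^sub>m D = M" using MD by (intro eq_matI) auto
      then have "q \<noteq> 0" using q[of 0] p(2) by auto
      then have "finite {t. poly q t = 0}" by (rule poly_roots_finite)
      then have "finite (insert (- M $$ (i, j) / D $$ (i, j)) {t. poly q t = 0})" by simp
      then obtain t where t: "t \<notin> insert (- M $$ (i, j) / D $$ (i, j)) {t. poly q t = 0}"
        using ex_new_if_finite infinite_UNIV_char_0 by blast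
      have "M $$ (i, j) + t * D $$ (i, j) \<noteq> 0"
        using t ij(3) by (auto simp: field_simps add_eq_0_iff)
      then have "(M + t \<cdot>\<^sub>m D) $$ (i, j) \<noteq> 0" using MD ij by simp
      moreover have "p (M + t \<cdot>\<^sub>m D) \<noteq> 0" using t q by simp
      ultimately show "\<exists>y. y \<in> {M \<in> V. M $$ (i, j) \<noteq> 0} \<and> y \<in> T"
        using line[OF M, of t] p(1) unfolding P(2) by blast
    qed
  qed
qed

lemma dsum_singleton: "toda.dsum [M] = M"
  by (cases M) (simp add: toda.dsum_def diag_block_mat_singleton del: diag_block_mat.simps)

lemma injective_sum_single:
  assumes "v \<in> {1..2 * n}" "\<And>j. nat (h j) = (if j = v then 1 else 0)"
  shows "injective_sum n I h = I v"
proof -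
  define r where "r j = replicate (nat (h j)) (I j)" for j
  have upt: "[1..<2 * n + 1] = [1..<v] @ v # [Suc v..<2 * n + 1]"
    using assms(1) upt_add_eq_append[of 1 v "2 * n + 1 - v"] upt_conv_Cons[of v "2 * n + 1"] by (simp del: upt_Suc)
  have nil: "concat (map r js) = []" if "v \<notin> set js" for js
    using that by (induction js) (auto simp: r_def assms(2))
  have "r v = [I v]" by (simp add: r_def assms(2))
  moreover have "concat (map r [1..<v]) = []" "concat (map r [Suc v..<2 * n + 1]) = []"
    by (rule nil; simp)+
  ultimately have "concat (map r [1..<2 * n + 1]) = [I v]"
    unfolding upt by (simp del: upt_Suc concat_eq_Nil_conv)
  then show ?thesis unfolding injective_sum_def r_def[abs_def] by (simp only: dsum_singleton)
qed

context toda_algebra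
begin

lemma Hom_line:
  assumes M: "toda.is_module n M" "toda.is_module n N" and f: "f \<in> toda.Hom n M N" "g \<in> toda.Hom n M N"
  shows "f + t \<cdot>\<^sub>m g \<in> toda.Hom n M N"
  unfolding Hom_iff
proof (intro conjI ballI)
  have c: "f \<in> carrier_mat (mdim N) (mdim M)" "g \<in> carrier_mat (mdim N) (mdim M)" using f by (auto simp: Hom_iff)
  then show "f + t \<cdot>\<^sub>m g \<in> carrier_mat (mdim N) (mdim M)" by simp
  fix x assume x: "x \<in> carrier P"
  note a = act_carrier[OF M(1) x] act_carrier[OF M(2) x]
  have "f * act M (cls x) = act N (cls x) * f" "g * act M (cls x) = act N (cls x) * g"
    using f x by (auto simp: Hom_iff)
  then show "(f + t \<cdot>\<^sub>m g) * act M (cls x) = act N (cls x) * (f + t \<cdot>\<^sub>m g)"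
    using a c by (simp add: add_mult_distrib_mat[OF c(1) _ a(1)] mult_add_distrib_mat[OF a(2) c(1)]
        mult_smult_assoc_mat[OF c(2) a(1)] mult_smult_distrib[OF a(2) c(2)])
qed

text \<open>The dual of left multiplication by a_m from e_(2m-1) J to e_(2m) J. It witnesses that
  the coefficient at a_m does not vanish identically on the homomorphisms.\<close>

definition lowering :: "nat \<Rightarrow> complex mat" where
  "lowering m = matI (basis (2 * m - 1)) (basis (2 * m)) (\<lambda>w u. if u = w + (0, 0, 1, 0) then 1 else 0)"

lemma basis_shift:
  assumes "1 \<le> m"
  shows "w + (0, 0, 1, 0) \<in> basis (2 * m) \<longleftrightarrow> w \<in> basis (2 * m - 1)"
    and "source (2 * m) (w + (0, 0, 1, 0)) = source (2 * m - 1) w"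
proof -
  obtain p q s t where w: "w = (p, q, s, t)" by (cases w)
  have "(2 * m - 1 + 1) div 2 = m" "(2 * m - 1) mod 2 = 1" using assms by presburger+
  then show "w + (0, 0, 1, 0) \<in> basis (2 * m) \<longleftrightarrow> w \<in> basis (2 * m - 1)"
    unfolding w by (auto simp: basis_def)
  show "source (2 * m) (w + (0, 0, 1, 0)) = source (2 * m - 1) w"
    unfolding w using assms by simp
qed

lemma lowering_Hom:
  assumes m: "1 \<le> m" "m \<le> n"
  shows "lowering m \<in> toda.Hom n (inj_module (2 * m)) (inj_module (2 * m - 1))"
proof (rule HomI_paths[where N = "4 * n + 2"])
  fix \<pi> :: "(nat, toda_arrow) path" assume \<pi>: "\<pi> \<in> paths Q"
  let ?a = "(0, 0, 1, 0) :: nat \<times> nat \<times> nat \<times> nat"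
  have eq: "(\<Sum>c\<in>basis (2 * m). (if c = w + ?a then 1 else 0) * inj_entry (2 * m) (path_elem \<pi>) c u) =
      (\<Sum>c\<in>basis (2 * m - 1). inj_entry (2 * m - 1) (path_elem \<pi>) w c * (if u = c + ?a then 1 else 0))"
    if w: "w \<in> basis (2 * m - 1)" and u: "u \<in> basis (2 * m)" for w u
  proof -
    have wa: "w + ?a \<in> basis (2 * m)" using w basis_shift(1)[OF m(1)] by blast
    have "(\<Sum>c\<in>basis (2 * m). (if c = w + ?a then 1 else 0) * inj_entry (2 * m) (path_elem \<pi>) c u) =
        (\<Sum>c\<in>basis (2 * m). if c = w + ?a then inj_entry (2 * m) (path_elem \<pi>) (w + ?a) u else 0)"
      by (intro sum.cong) auto
    also have "\<dots> = (if \<pi> \<in> walks (2 * m) (w + ?a) u then 1 else 0)"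
      unfolding sum.delta[OF finite_basis] using wa inj_entry_path_elem[OF u] by simp
    also have "\<dots> = (\<Sum>c\<in>basis (2 * m - 1). if c = w + content (snd \<pi>) then
        (if path_end Q \<pi> = source (2 * m - 1) w \<and> u = c + ?a then 1 else 0) else 0)"
    proof -
      have "w + ?a + content (snd \<pi>) = w + content (snd \<pi>) + ?a" by (simp only: ac_simps)
      moreover have "w + content (snd \<pi>) \<in> basis (2 * m - 1)" if "u = w + content (snd \<pi>) + ?a"
        using u basis_shift(1)[OF m(1)] unfolding that by blast
      ultimately show ?thesis
        unfolding sum.delta[OF finite_basis] walks_def basis_shift(2)[OF m(1)] using \<pi> by auto
    qed
    also have "\<dots> = (\<Sum>c\<in>basis (2 * m - 1). inj_entry (2 * m - 1) (path_elem \<pi>) w c * (if u = c + ?a then 1 else 0))"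
      by (intro sum.cong refl) (use \<pi> in \<open>auto simp: inj_entry_path_elem walks_def\<close>)
    finally show ?thesis .
  qed
  have "lowering m * inj_mat (2 * m) (path_elem \<pi>) = inj_mat (2 * m - 1) (path_elem \<pi>) * lowering m"
    unfolding lowering_def inj_mat_def matI_mult[OF finite_basis] by (intro matI_cong finite_basis eq)
  then show "lowering m * act (inj_module (2 * m)) (cls (path_elem \<pi>)) =
      act (inj_module (2 * m - 1)) (cls (path_elem \<pi>)) * lowering m"
    using \<pi> by (simp add: act_inj_module)
qed (auto simp: is_module_inj_module lowering_def intro: long_paths_in_I)

end

context toda_kernel
begin

lemma good_iff_admissible: "good e \<longleftrightarrow> admissible n m e"
proof -
  \<comment> \<open>By \<open>tau_mono\<close> the condition for all \<open>j < k\<close> is that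
    for \<open>k - 1\<close>. Stated in terms of \<open>k\<close>, the resulting bounds are also
    correct for \<open>k = 0\<close>.\<close>
  have bound: "(\<forall>j<k. tau y j \<in> B2) \<longleftrightarrow> k + ((y + 1) div 2 - m) \<le> (y + 1) div 2 \<and> k + ((y + 1) div 2 - m) + m \<le> n + 1"
    if "y \<in> {1..2 * n}" for y k
  proof (cases k)
    case 0
    then show ?thesis using m that by auto
  next
    case (Suc l)
    have "(\<forall>j<k. tau y j \<in> B2) \<longleftrightarrow> tau y l \<in> B2" using tau_mono[of y l] Suc by (auto simp: less_Suc_eq_le)
    then show ?thesis using Suc m that by (auto simp: tau_iff)
  qed
  have "(\<forall>y\<in>{1..2 * n}. \<forall>j<e y. tau y j \<in> B2) \<longleftrightarrow>
      (\<forall>i\<in>{1..n}. e (2 * i) + (i - m) \<le> i \<and> e (2 * i) + (i - m) + m \<le> n + 1)"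
    if D: "\<forall>i\<in>{1..n}. e (2 * i - 1) \<le> e (2 * i)"
  proof
    assume *: "\<forall>y\<in>{1..2 * n}. \<forall>j<e y. tau y j \<in> B2"
    show "\<forall>i\<in>{1..n}. e (2 * i) + (i - m) \<le> i \<and> e (2 * i) + (i - m) + m \<le> n + 1"
    proof
      fix i assume "i \<in> {1..n}"
      then have i: "2 * i \<in> {1..2 * n}" by auto
      show "e (2 * i) + (i - m) \<le> i \<and> e (2 * i) + (i - m) + m \<le> n + 1"
        using bound[OF i, of "e (2 * i)"] bspec[OF * i] by simp
    qed
  next
    assume *: "\<forall>i\<in>{1..n}. e (2 * i) + (i - m) \<le> i \<and> e (2 * i) + (i - m) + m \<le> n + 1"
    show "\<forall>y\<in>{1..2 * n}. \<forall>j<e y. tau y j \<in> B2"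
    proof
      fix y assume y: "y \<in> {1..2 * n}"
      define i where "i = (y + 1) div 2"
      have i: "i \<in> {1..n}" "y = 2 * i \<or> y = 2 * i - 1" using y by (auto simp: i_def)
      have "e y \<le> e (2 * i)" using i D by auto
      then show "\<forall>j<e y. tau y j \<in> B2"
        unfolding bound[OF y] i_def[symmetric] using bspec[OF * i(1)] by linarith
    qed
  qed
  then show ?thesis unfolding good_def admissible_def by blast
qed

text \<open>Each nonempty Grassmannian is a point, so every admissible dimension vector enters with
  coefficient 1.\<close>

lemma cluster_character_generic:
  "cluster_character n g (inj_module (2 * m)) f = (\<Prod>j\<in>{1..2 * n}. xpow j (- g j)) *
    (\<Sum>e\<in>{e \<in> {1..2 * n} \<rightarrow>\<^sub>E UNIV. admissible n m e}. \<Prod>v\<in>{1..2 * n}. yvar n v ^ e v)"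
proof -
  have "euler_characteristic (toda.quiver_grassmannian n (inj_module (2 * m)) (mat_kernel f) e) = 1"
    if "admissible n m e" for e
    by (rule euler_characteristic_point[of _ "sub e"])
      (use that in \<open>simp add: topspace_quiver_grassmannian good_iff_admissible\<close>)
  then show ?thesis
    unfolding cluster_character_def topspace_quiver_grassmannian good_iff_admissible
    by (intro arg_cong2[where f = "(*)"] refl sum.cong) auto
qed

end

theorem mainTheorem2:
  fixes n i :: nat
  assumes "1 \<le> n" and "1 \<le> i" and "i \<le> n"
  shows "toda_hamiltonian n i \<in> generic_basis n"
proof -
  define m where "m = n + 1 - i"
  have m: "1 \<le> m" "m \<le> n" and i: "n + 1 - m = i" using assms by (auto simp: m_def)
  interpret toda_algebra n .
  define g :: "nat \<Rightarrow> int" where "g = (\<lambda>j. if j = 2 * m then 1 else if j = 2 * m - 1 then - 1 else 0)"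
  have v: "2 * m \<in> {1..2 * n}" "2 * m - 1 \<in> {1..2 * n}" "2 * m \<noteq> 2 * m - 1" using m by auto
  let ?M = "inj_module (2 * m)" and ?N = "inj_module (2 * m - 1)"
  have M: "injective_sum n inj_module g = ?M" "injective_sum n inj_module (\<lambda>j. - g j) = ?N"
    using v by (auto intro!: injective_sum_single simp: g_def)
  let ?T = "zariski_topology (mdim ?N) (mdim ?M) (toda.Hom n ?M ?N)"
  let ?r = "pos (basis (2 * m - 1)) 0" and ?c = "pos (basis (2 * m)) (0, 0, 1, 0)"
  let ?U = "{f \<in> toda.Hom n ?M ?N. f $$ (?r, ?c) \<noteq> 0}"
  have b: "0 \<in> basis (2 * m - 1)" "(0, 0, 1, 0) \<in> basis (2 * m)"
    using zero_in_basis[OF v(2)] m by (auto simp: basis_def)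
  \<comment> \<open>The direction of the lines used for the density of \<open>?U\<close>: adding
    multiples of \<open>lowering m\<close> to a homomorphism makes its coefficient at a_m
    nonzero.\<close>
  have "lowering m $$ (?r, ?c) \<noteq> 0"
    unfolding lowering_def matI_pos[OF finite_basis finite_basis b] by (simp add: zero_prod_def)
  moreover have "?r < mdim ?N" "?c < mdim ?M" using b by (simp_all add: pos)
  moreover have "toda.Hom n ?M ?N \<subseteq> carrier_mat (mdim ?N) (mdim ?M)" by (auto simp: toda.Hom_def)
  ultimately have U: "openin ?T ?U" "?T closure_of ?U = toda.Hom n ?M ?N"
    using zariski_dense_coordinate[of "toda.Hom n ?M ?N" "mdim ?N" "mdim ?M" "lowering m" ?r ?c]
      Hom_line[OF is_module_inj_module is_module_inj_module _ lowering_Hom[OF m]] lowering_Hom[OF m]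
    by blast+
  have "cluster_character n g ?M f = toda_hamiltonian n i" if "f \<in> ?U" for f
  proof -
    interpret toda_kernel n m f by unfold_locales (use m that in auto)
    have "(\<Prod>j\<in>{1..2 * n}. xpow j (- g j)) = (\<Prod>l\<in>{1..n}. if l = m then xpow (2 * m - 1) 1 * xpow (2 * m) (- 1) else 1)"
      unfolding prod_pairs
    proof (rule prod.cong[OF refl])
      fix l assume "l \<in> {1..n}"
      then have "2 * l - 1 \<noteq> 2 * m" "2 * l \<noteq> 2 * m - 1" "2 * l - 1 = 2 * m - 1 \<longleftrightarrow> l = m" using m by (auto; presburger)+
      then show "xpow (2 * l - 1) (- g (2 * l - 1)) * xpow (2 * l) (- g (2 * l)) =
          (if l = m then xpow (2 * m - 1) 1 * xpow (2 * m) (- 1) else 1)"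
        using v(3) by (auto simp: g_def)
    qed
    also have "\<dots> = xpow (2 * m - 1) 1 * xpow (2 * m) (- 1)" using m by simp
    finally show ?thesis
      unfolding cluster_character_generic toda_hamiltonian_eq[OF m, unfolded i] by simp
  qed
  then have "is_generic_character n g (toda_hamiltonian n i)"
    unfolding is_generic_character_def
  proof (intro exI[of _ inj_module] conjI ballI)
    fix v assume "v \<in> {1..2 * n}"
    then show "\<exists>S. toda.is_simple_at n v S \<and> toda.is_injective_envelope n S (inj_module v)"
      using is_simple_at_simple_module is_injective_envelope_inj_module by blast
  qed (use U in \<open>auto simp: M Let_def simp del: mdim_inj_module\<close>)
  then show ?thesis unfolding generic_basis_def by blast
qed

end
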